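(* (i) The special affine Fourier transform $\mathcal{F}_A$ is a Gelfand triple automorphism of the Banach Gelfand triple $(S_0(\mathbb{R}),L^2(\mathbb{R}),S_0'(\mathbb{R}))$. (ii) The pointwise multiplication operators $f\mapsto\lambda_Af$, $f\mapsto\rho_Af$ and $f\mapsto\eta_Af$ are Gelfand triple automorphisms of $(S_0(\mathbb{R}),L^2(\mathbb{R}),S_0'(\mathbb{R}))$.
   Context: $A=\{a,b,c,d,p,q\}$ are real parameters with $ad-bc=1$ and $b\neq0$. The special affine Fourier transform is $\mathcal{F}_Af(\omega)=\frac{1}{\sqrt{|b|}}\int_{\mathbb{R}}f(t)e^{\frac{\pi i}{b}(at^2+2pt-2\omega t+2(bq-dp)\omega+d\omega^2)}\,dt$ for $f\in L^1(\mathbb{R})$, extended to a unitary operator on $L^2(\mathbb{R})$. The auxiliary functions are $\lambda_A(t)=e^{\frac{\pi i}{b}at^2}$, $\rho_A(t)=e^{\frac{\pi i}{b}(at^2+2pt)}$, $\eta_A(\omega)=e^{\frac{\pi i}{b}(d\omega^2+2(bq-dp)\omega)}$. $S_0(\mathbb{R})$ (the Feichtinger algebra, $=M^1$) is the space of $f\in S'(\mathbb{R})$ with $\|f\|_{S_0}=\int_{\mathbb{R}}\int_{\mathbb{R}}|V_gf(x,\omega)|\,dx\,d\omega<\infty$, for a fixed nonzero $g\in S(\mathbb{R})$, where $V_gf(x,\omega)=\int_{\mathbb{R}}f(t)\overline{g(t-x)}e^{-2\pi i\omega t}\,dt$ (duality pairing for distributions); different windows give equivalent norms. $S_0'(\mathbb{R})$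 is its dual. A Banach Gelfand triple $(\mathcal{B},\mathcal{H},\mathcal{B}')$ consists of a Banach space $\mathcal{B}$ continuously and densely embedded in a Hilbert space $\mathcal{H}$, which in turn is weak$^\star$-continuously and densely embedded in the dual $\mathcal{B}'$. An operator $T$ is a Gelfand triple isomorphism from $(\mathcal{B}_1,\mathcal{H}_1,\mathcal{B}_1')$ to $(\mathcal{B}_2,\mathcal{H}_2,\mathcal{B}_2')$ if it is an isomorphism $\mathcal{B}_1\to\mathcal{B}_2$, an isomorphism $\mathcal{H}_1\to\mathcal{H}_2$, and extends to a weak$^\star$ isomorphism as well as a norm-to-norm continuous isomorphism $\mathcal{B}_1'\to\mathcal{B}_2'$. An automorphism is an isomorphism of a triple onto itself. *)

theory Defs
  imports "HOL-Analysis.Analysis"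
begin

section \<open>Complex normed spaces with explicit carriers\<close>

record 'a normed_cspace =
  vcarrier :: "'a set"
  vadd :: "'a \<Rightarrow> 'a \<Rightarrow> 'a"
  vzero :: 'a
  vscale :: "complex \<Rightarrow> 'a \<Rightarrow> 'a"
  vnorm :: "'a \<Rightarrow> real"

record 'a inner_cspace = "'a normed_cspace" +
  vinner :: "'a \<Rightarrow> 'a \<Rightarrow> complex"

text \<open>The locale for abstract metric spaces asks for nonnegativity and symmetry on the whole type,
  hence the value off the carrier.\<close>

definition vdist :: "('a, 'm) normed_cspace_scheme \<Rightarrow> 'a \<Rightarrow> 'a \<Rightarrow> real" where
  "vdist X x y = (if x \<in> vcarrier X \<and> y \<in> vcarrier X
     then vnorm X (vadd X x (vscale X (-1) y)) else 0)"

definition complex_normed_space :: "('a, 'm) normed_cspace_scheme \<Rightarrow> bool" where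
  "complex_normed_space X \<longleftrightarrow>
     vzero X \<in> vcarrier X \<and>
     (\<forall>x\<in>vcarrier X. \<forall>y\<in>vcarrier X. vadd X x y \<in> vcarrier X) \<and>
     (\<forall>\<alpha>. \<forall>x\<in>vcarrier X. vscale X \<alpha> x \<in> vcarrier X) \<and>
     (\<forall>x\<in>vcarrier X. \<forall>y\<in>vcarrier X. \<forall>z\<in>vcarrier X.
        vadd X (vadd X x y) z = vadd X x (vadd X y z)) \<and>
     (\<forall>x\<in>vcarrier X. \<forall>y\<in>vcarrier X. vadd X x y = vadd X y x) \<and>
     (\<forall>x\<in>vcarrier X. vadd X (vzero X) x = x) \<and>
     (\<forall>x\<in>vcarrier X. vadd X x (vscale X (-1) x) = vzero X) \<and>
     (\<forall>\<alpha> \<beta>. \<forall>x\<in>vcarrier X. vscale X (\<alpha> * \<beta>) x = vscale X \<alpha> (vscale X \<beta> x)) \<and>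
     (\<forall>x\<in>vcarrier X. vscale X 1 x = x) \<and>
     (\<forall>\<alpha> \<beta>. \<forall>x\<in>vcarrier X.
        vscale X (\<alpha> + \<beta>) x = vadd X (vscale X \<alpha> x) (vscale X \<beta> x)) \<and>
     (\<forall>\<alpha>. \<forall>x\<in>vcarrier X. \<forall>y\<in>vcarrier X.
        vscale X \<alpha> (vadd X x y) = vadd X (vscale X \<alpha> x) (vscale X \<alpha> y)) \<and>
     (\<forall>x\<in>vcarrier X. 0 \<le> vnorm X x \<and> (vnorm X x = 0 \<longleftrightarrow> x = vzero X)) \<and>
     (\<forall>\<alpha>. \<forall>x\<in>vcarrier X. vnorm X (vscale X \<alpha> x) = cmod \<alpha> * vnorm X x) \<and>
     (\<forall>x\<in>vcarrier X. \<forall>y\<in>vcarrier X. vnorm X (vadd X x y) \<le> vnorm X x + vnorm X y)"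

definition norm_topology :: "('a, 'm) normed_cspace_scheme \<Rightarrow> 'a topology" where
  "norm_topology X = Metric_space.mtopology (vcarrier X) (vdist X)"

definition complex_banach_space :: "('a, 'm) normed_cspace_scheme \<Rightarrow> bool" where
  "complex_banach_space X \<longleftrightarrow>
     complex_normed_space X \<and> Metric_space.mcomplete (vcarrier X) (vdist X)"

definition complex_hilbert_space :: "('a, 'm) inner_cspace_scheme \<Rightarrow> bool" where
  "complex_hilbert_space X \<longleftrightarrow>
     complex_banach_space X \<and>
     (\<forall>x\<in>vcarrier X. \<forall>y\<in>vcarrier X. \<forall>z\<in>vcarrier X.
        vinner X (vadd X x y) z = vinner X x z + vinner X y z) \<and>
     (\<forall>\<alpha>. \<forall>x\<in>vcarrier X. \<forall>y\<in>vcarrier X. vinner X (vscale X \<alpha> x) y = \<alpha> * vinner X x y) \<and>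
     (\<forall>x\<in>vcarrier X. \<forall>y\<in>vcarrier X. vinner X y x = cnj (vinner X x y)) \<and>
     (\<forall>x\<in>vcarrier X. vinner X x x = of_real ((vnorm X x)\<^sup>2))"

definition clinear_between ::
  "('a, 'm) normed_cspace_scheme \<Rightarrow> ('b, 'n) normed_cspace_scheme \<Rightarrow> ('a \<Rightarrow> 'b) \<Rightarrow> bool" where
  "clinear_between X Y T \<longleftrightarrow>
     T \<in> vcarrier X \<rightarrow> vcarrier Y \<and>
     (\<forall>x\<in>vcarrier X. \<forall>y\<in>vcarrier X. T (vadd X x y) = vadd Y (T x) (T y)) \<and>
     (\<forall>\<alpha>. \<forall>x\<in>vcarrier X. T (vscale X \<alpha> x) = vscale Y \<alpha> (T x))"

definition norm_isomorphism ::
  "('a, 'm) normed_cspace_scheme \<Rightarrow> ('b, 'n) normed_cspace_scheme \<Rightarrow> ('a \<Rightarrow> 'b) \<Rightarrow> bool" where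
  "norm_isomorphism X Y T \<longleftrightarrow>
     clinear_between X Y T \<and> homeomorphic_map (norm_topology X) (norm_topology Y) T"

definition unitary_operator ::
  "('a, 'm) inner_cspace_scheme \<Rightarrow> ('b, 'n) inner_cspace_scheme \<Rightarrow> ('a \<Rightarrow> 'b) \<Rightarrow> bool" where
  "unitary_operator X Y T \<longleftrightarrow>
     clinear_between X Y T \<and> bij_betw T (vcarrier X) (vcarrier Y) \<and>
     (\<forall>x\<in>vcarrier X. \<forall>y\<in>vcarrier X. vinner Y (T x) (T y) = vinner X x y)"

text \<open>Functionals are total functions in HOL; those in the dual are required to vanish off the
  carrier, so that each functional on the space is represented exactly once.\<close>

definition dual_space :: "('a, 'm) normed_cspace_scheme \<Rightarrow> ('a \<Rightarrow> complex) normed_cspace" where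
  "dual_space X =
     \<lparr> vcarrier = {\<phi>.
         (\<forall>x\<in>vcarrier X. \<forall>y\<in>vcarrier X. \<phi> (vadd X x y) = \<phi> x + \<phi> y) \<and>
         (\<forall>\<alpha>. \<forall>x\<in>vcarrier X. \<phi> (vscale X \<alpha> x) = \<alpha> * \<phi> x) \<and>
         (\<exists>C. \<forall>x\<in>vcarrier X. cmod (\<phi> x) \<le> C * vnorm X x) \<and>
         (\<forall>x. x \<notin> vcarrier X \<longrightarrow> \<phi> x = 0)},
       vadd = (\<lambda>\<phi> \<psi> x. \<phi> x + \<psi> x),
       vzero = (\<lambda>x. 0),
       vscale = (\<lambda>\<alpha> \<phi> x. \<alpha> * \<phi> x),
       vnorm = (\<lambda>\<phi>. SUP x\<in>{x \<in> vcarrier X. vnorm X x \<le> 1}. cmod (\<phi> x)) \<rparr>"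

definition weak_star_topology :: "('a, 'm) normed_cspace_scheme \<Rightarrow> ('a \<Rightarrow> complex) topology" where
  "weak_star_topology X = topology_generated_by
     {{\<phi> \<in> vcarrier (dual_space X). \<phi> x \<in> U} | x U. x \<in> vcarrier X \<and> open U}"


section \<open>Banach Gelfand triples\<close>

text \<open>The third space of a triple is always the dual of the first one.  The two inclusions are part
  of the data, since the elements of the three spaces are of different types.\<close>

record ('b, 'h) gelfand_triple =
  Bspace :: "'b normed_cspace"
  Hspace :: "'h inner_cspace"
  embB :: "'b \<Rightarrow> 'h"
  embH :: "'h \<Rightarrow> 'b \<Rightarrow> complex"

definition banach_gelfand_triple :: "('b, 'h) gelfand_triple \<Rightarrow> bool" where
  "banach_gelfand_triple G \<longleftrightarrow>
     complex_banach_space (Bspace G) \<and>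
     complex_hilbert_space (Hspace G) \<and>
     clinear_between (Bspace G) (Hspace G) (embB G) \<and>
     inj_on (embB G) (vcarrier (Bspace G)) \<and>
     continuous_map (norm_topology (Bspace G)) (norm_topology (Hspace G)) (embB G) \<and>
     norm_topology (Hspace G) closure_of (embB G ` vcarrier (Bspace G)) = vcarrier (Hspace G) \<and>
     clinear_between (Hspace G) (dual_space (Bspace G)) (embH G) \<and>
     inj_on (embH G) (vcarrier (Hspace G)) \<and>
     continuous_map (norm_topology (Hspace G)) (weak_star_topology (Bspace G)) (embH G) \<and>
     weak_star_topology (Bspace G) closure_of (embH G ` vcarrier (Hspace G))
       = vcarrier (dual_space (Bspace G))"

text \<open>The operator \<open>T\<close> acts on the Hilbert space; \<open>T\<^sub>B\<close> is its restriction to the Banach space and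
  \<open>T'\<close> its extension to the dual.\<close>

definition gelfand_triple_isomorphism ::
  "('b1, 'h1) gelfand_triple \<Rightarrow> ('b2, 'h2) gelfand_triple \<Rightarrow> ('h1 \<Rightarrow> 'h2) \<Rightarrow> bool" where
  "gelfand_triple_isomorphism G1 G2 T \<longleftrightarrow>
     banach_gelfand_triple G1 \<and> banach_gelfand_triple G2 \<and>
     (\<exists>T\<^sub>B. norm_isomorphism (Bspace G1) (Bspace G2) T\<^sub>B \<and>
        (\<forall>f\<in>vcarrier (Bspace G1). embB G2 (T\<^sub>B f) = T (embB G1 f))) \<and>
     norm_isomorphism (Hspace G1) (Hspace G2) T \<and>
     (\<exists>T'. norm_isomorphism (dual_space (Bspace G1)) (dual_space (Bspace G2)) T' \<and>
        homeomorphic_map (weak_star_topology (Bspace G1)) (weak_star_topology (Bspace G2)) T' \<and>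
        (\<forall>h\<in>vcarrier (Hspace G1). T' (embH G1 h) = embH G2 (T h)))"

definition gelfand_triple_automorphism :: "('b, 'h) gelfand_triple \<Rightarrow> ('h \<Rightarrow> 'h) \<Rightarrow> bool" where
  "gelfand_triple_automorphism G T \<longleftrightarrow> gelfand_triple_isomorphism G G T"


section \<open>Schwartz functions and tempered distributions on the real line\<close>

definition nth_derivative :: "nat \<Rightarrow> (real \<Rightarrow> complex) \<Rightarrow> real \<Rightarrow> complex" where
  "nth_derivative n f = ((\<lambda>h t. vector_derivative h (at t)) ^^ n) f"

definition schwartz_space :: "(real \<Rightarrow> complex) set" where
  "schwartz_space = {f.
     (\<forall>n t. nth_derivative n f differentiable (at t)) \<and>
     (\<forall>m n. bounded (range (\<lambda>t. t ^ m *\<^sub>R nth_derivative n f t)))}"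

definition schwartz_seminorm :: "nat \<Rightarrow> nat \<Rightarrow> (real \<Rightarrow> complex) \<Rightarrow> real" where
  "schwartz_seminorm m n f = (SUP t. cmod (t ^ m *\<^sub>R nth_derivative n f t))"

text \<open>Continuous linear functionals on the Schwartz space, again vanishing off their domain.  The
  pairing is bilinear: a function \<open>u\<close> acts by \<open>\<phi> \<mapsto> \<integral> u \<phi>\<close>, without conjugation.\<close>

definition tempered_distributions :: "((real \<Rightarrow> complex) \<Rightarrow> complex) set" where
  "tempered_distributions = {f.
     (\<forall>\<phi>\<in>schwartz_space. \<forall>\<psi>\<in>schwartz_space. f (\<lambda>t. \<phi> t + \<psi> t) = f \<phi> + f \<psi>) \<and>
     (\<forall>\<alpha>. \<forall>\<phi>\<in>schwartz_space. f (\<lambda>t. \<alpha> * \<phi> t) = \<alpha> * f \<phi>) \<and>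
     (\<exists>C N. \<forall>\<phi>\<in>schwartz_space. cmod (f \<phi>) \<le> C * (\<Sum>m\<le>N. \<Sum>n\<le>N. schwartz_seminorm m n \<phi>)) \<and>
     (\<forall>\<phi>. \<phi> \<notin> schwartz_space \<longrightarrow> f \<phi> = 0)}"


section \<open>The Feichtinger algebra\<close>

definition stft ::
  "(real \<Rightarrow> complex) \<Rightarrow> ((real \<Rightarrow> complex) \<Rightarrow> complex) \<Rightarrow> real \<Rightarrow> real \<Rightarrow> complex" where
  "stft g f x \<omega> = f (\<lambda>t. cnj (g (t - x)) * cis (- 2 * pi * \<omega> * t))"

definition stft_L1 :: "(real \<Rightarrow> complex) \<Rightarrow> ((real \<Rightarrow> complex) \<Rightarrow> complex) \<Rightarrow> ennreal" where
  "stft_L1 g f = (\<integral>\<^sup>+ x. \<integral>\<^sup>+ \<omega>. ennreal (cmod (stft g f x \<omega>)) \<partial>lborel \<partial>lborel)"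

definition S0_space :: "(real \<Rightarrow> complex) \<Rightarrow> ((real \<Rightarrow> complex) \<Rightarrow> complex) normed_cspace" where
  "S0_space g =
     \<lparr> vcarrier = {f \<in> tempered_distributions. stft_L1 g f < \<infinity>},
       vadd = (\<lambda>f h \<phi>. f \<phi> + h \<phi>),
       vzero = (\<lambda>\<phi>. 0),
       vscale = (\<lambda>\<alpha> f \<phi>. \<alpha> * f \<phi>),
       vnorm = (\<lambda>f. enn2real (stft_L1 g f)) \<rparr>"


section \<open>The space of square-integrable functions modulo null sets\<close>

definition L2_functions :: "(real \<Rightarrow> complex) set" where
  "L2_functions =
     {u \<in> borel_measurable lborel. integrable lborel (\<lambda>t. (cmod (u t))\<^sup>2)}"

definition L2_rel :: "((real \<Rightarrow> complex) \<times> (real \<Rightarrow> complex)) set" where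
  "L2_rel = {(u, v). u \<in> L2_functions \<and> v \<in> L2_functions \<and> (AE t in lborel. u t = v t)}"

definition L2_class :: "(real \<Rightarrow> complex) \<Rightarrow> (real \<Rightarrow> complex) set" where
  "L2_class u = L2_rel `` {u}"

text \<open>An arbitrary representative; nothing below depends on the choice.\<close>

definition L2_rep :: "(real \<Rightarrow> complex) set \<Rightarrow> real \<Rightarrow> complex" where
  "L2_rep U = (SOME u. u \<in> U)"

definition L2_space :: "(real \<Rightarrow> complex) set inner_cspace" where
  "L2_space =
     \<lparr> vcarrier = L2_functions // L2_rel,
       vadd = (\<lambda>U V. L2_class (\<lambda>t. L2_rep U t + L2_rep V t)),
       vzero = L2_class (\<lambda>t. 0),
       vscale = (\<lambda>\<alpha> U. L2_class (\<lambda>t. \<alpha> * L2_rep U t)),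
       vnorm = (\<lambda>U. sqrt (\<integral>t. (cmod (L2_rep U t))\<^sup>2 \<partial>lborel)),
       vinner = (\<lambda>U V. \<integral>t. L2_rep U t * cnj (L2_rep V t) \<partial>lborel) \<rparr>"


section \<open>The triple formed by the Feichtinger algebra, the square-integrable functions and the dual\<close>

definition S0_to_L2 :: "((real \<Rightarrow> complex) \<Rightarrow> complex) \<Rightarrow> (real \<Rightarrow> complex) set" where
  "S0_to_L2 f = (THE U. U \<in> vcarrier L2_space \<and>
     (\<forall>\<phi>\<in>schwartz_space. f \<phi> = (\<integral>t. L2_rep U t * \<phi> t \<partial>lborel)))"

text \<open>As for distributions, a function acts on the Feichtinger algebra by the bilinear pairing, which
  makes the inclusion of the Hilbert space into the dual linear.\<close>

definition L2_to_S0_dual ::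
  "(real \<Rightarrow> complex) \<Rightarrow> (real \<Rightarrow> complex) set \<Rightarrow> ((real \<Rightarrow> complex) \<Rightarrow> complex) \<Rightarrow> complex" where
  "L2_to_S0_dual g U = (\<lambda>f. if f \<in> vcarrier (S0_space g)
     then \<integral>t. L2_rep U t * L2_rep (S0_to_L2 f) t \<partial>lborel else 0)"

definition S0_triple ::
  "(real \<Rightarrow> complex) \<Rightarrow> ((real \<Rightarrow> complex) \<Rightarrow> complex, (real \<Rightarrow> complex) set) gelfand_triple" where
  "S0_triple g =
     \<lparr> Bspace = S0_space g, Hspace = L2_space, embB = S0_to_L2, embH = L2_to_S0_dual g \<rparr>"


section \<open>The special affine Fourier transform and its chirp factors\<close>

text \<open>The parameter \<open>c\<close> enters only through the constraint \<open>a d - b c = 1\<close>.\<close>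

definition saft_integral ::
  "real \<Rightarrow> real \<Rightarrow> real \<Rightarrow> real \<Rightarrow> real \<Rightarrow> (real \<Rightarrow> complex) \<Rightarrow> real \<Rightarrow> complex" where
  "saft_integral a b d p q f \<omega> = of_real (1 / sqrt \<bar>b\<bar>) *
     (\<integral>t. f t * cis (pi / b * (a * t\<^sup>2 + 2 * p * t - 2 * \<omega> * t
                               + 2 * (b * q - d * p) * \<omega> + d * \<omega>\<^sup>2)) \<partial>lborel)"

definition saft ::
  "real \<Rightarrow> real \<Rightarrow> real \<Rightarrow> real \<Rightarrow> real \<Rightarrow> (real \<Rightarrow> complex) set \<Rightarrow> (real \<Rightarrow> complex) set" where
  "saft a b d p q = (THE F. F \<in> extensional (vcarrier L2_space) \<and>
     unitary_operator L2_space L2_space F \<and>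
     (\<forall>u \<in> L2_functions. integrable lborel u \<longrightarrow>
        F (L2_class u) = L2_class (saft_integral a b d p q u)))"

definition lambda_chirp :: "real \<Rightarrow> real \<Rightarrow> real \<Rightarrow> complex" where
  "lambda_chirp a b t = cis (pi / b * (a * t\<^sup>2))"

definition rho_chirp :: "real \<Rightarrow> real \<Rightarrow> real \<Rightarrow> real \<Rightarrow> complex" where
  "rho_chirp a b p t = cis (pi / b * (a * t\<^sup>2 + 2 * p * t))"

definition eta_chirp :: "real \<Rightarrow> real \<Rightarrow> real \<Rightarrow> real \<Rightarrow> real \<Rightarrow> complex" where
  "eta_chirp b d p q \<omega> = cis (pi / b * (d * \<omega>\<^sup>2 + 2 * (b * q - d * p) * \<omega>))"

definition mult_operator ::
  "(real \<Rightarrow> complex) \<Rightarrow> (real \<Rightarrow> complex) set \<Rightarrow> (real \<Rightarrow> complex) set" where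
  "mult_operator m U = L2_class (\<lambda>t. m t * L2_rep U t)"

end

theory Submission
  imports Defs "HOL-Probability.Probability"
begin

text \<open>On \<open>L\<^sup>2\<close> all four operators are compositions of chirp multiplications, a dilation and the Fourier
  transform; in particular the special affine Fourier transform is \<open>\<eta>\<^sub>A \<cdot> D\<^sub>b \<F> (\<rho>\<^sub>A \<cdot>)\<close>.  For the Gaussian
  window each factor acts on the short-time Fourier transform by a linear change of variables in the
  time-frequency plane and by replacing the Gaussian with another Gaussian, so that boundedness on
  \<open>S\<^sub>0\<close> reduces to independence of the window.

  A distribution \<open>f\<close> with integrable transform \<open>V\<^sub>g f\<close> is recovered by integrating the time-frequency
  shifts of a window against \<open>V\<^sub>g f\<close>.  Hence \<open>f\<close> is an element of \<open>L\<^sup>2\<close>, and \<open>V\<^sub>h f\<close> is dominated by a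
  convolution of \<open>|V\<^sub>g f|\<close> with an integrable cross-ambiguity function, which gives the independence.

  With respect to the bilinear pairing each operator has a transpose of the same kind; the extension
  to \<open>S\<^sub>0'\<close> is the dual map of this transpose, and is therefore weak-star continuous.\<close>

section \<open>Bounded linear maps between normed spaces with explicit carriers\<close>

text \<open>An element of \<open>S0_space g\<close> is given only as a tempered distribution, so
  neither Fubini nor the L2 pairing applies to it; the reconstruction formula has to come before
  everything else about the space. It is proved one variable at a time: by inversion the frequency
  integral leaves the pairing of \<open>f\<close> with \<open>\<phi>\<close> times a translate of
  |g|^2, and the integral over the translates leaves the constant, the squared L2 norm of
  \<open>g\<close>. Each interchange is a fundamental theorem of calculus for a scalar function of
  one real variable. Its limits are measured in the weight \<open>1 + t^2\<close>, because
  modulations and translates converge only locally uniformly.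

  Uniqueness is tested on modulated Gaussians: pairing \<open>w\<close> with all of them is the
  Fourier transform of \<open>w\<close> times the Gaussian, and this transform is injective on L1 by
  Levy's uniqueness theorem for characteristic functions. Inversion, density in L2 and the weak
  definition of the Fourier operator rest on this test.

  Weak-star density in the dual is finite-dimensional: a functional on finitely many elements of S_0
  is matched exactly by an element of L2.\<close>

locale cnspace =
  fixes X :: "('a, 'm) normed_cspace_scheme"
  assumes cns: "complex_normed_space X"
begin

lemma
  shows zero_closed [simp]: "vzero X \<in> vcarrier X"
    and add_closed [simp]: "x \<in> vcarrier X \<Longrightarrow> y \<in> vcarrier X \<Longrightarrow> vadd X x y \<in> vcarrier X"
    and scale_closed [simp]: "x \<in> vcarrier X \<Longrightarrow> vscale X \<alpha> x \<in> vcarrier X"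
    and add_assoc: "x \<in> vcarrier X \<Longrightarrow> y \<in> vcarrier X \<Longrightarrow> z \<in> vcarrier X
      \<Longrightarrow> vadd X (vadd X x y) z = vadd X x (vadd X y z)"
    and add_comm: "x \<in> vcarrier X \<Longrightarrow> y \<in> vcarrier X \<Longrightarrow> vadd X x y = vadd X y x"
    and add_zero: "x \<in> vcarrier X \<Longrightarrow> vadd X (vzero X) x = x"
    and add_minus: "x \<in> vcarrier X \<Longrightarrow> vadd X x (vscale X (-1) x) = vzero X"
    and scale_scale: "x \<in> vcarrier X \<Longrightarrow> vscale X (\<alpha> * \<beta>) x = vscale X \<alpha> (vscale X \<beta> x)"
    and scale_one: "x \<in> vcarrier X \<Longrightarrow> vscale X 1 x = x"
    and scale_add: "x \<in> vcarrier X \<Longrightarrow> y \<in> vcarrier X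
      \<Longrightarrow> vscale X \<alpha> (vadd X x y) = vadd X (vscale X \<alpha> x) (vscale X \<alpha> y)"
    and norm_nonneg [simp]: "x \<in> vcarrier X \<Longrightarrow> 0 \<le> vnorm X x"
    and norm_scale: "x \<in> vcarrier X \<Longrightarrow> vnorm X (vscale X \<alpha> x) = cmod \<alpha> * vnorm X x"
    and norm_add: "x \<in> vcarrier X \<Longrightarrow> y \<in> vcarrier X
      \<Longrightarrow> vnorm X (vadd X x y) \<le> vnorm X x + vnorm X y"
  by (insert cns[unfolded complex_normed_space_def], (elim conjE, meson)+)

lemma norm_eq_0: "x \<in> vcarrier X \<Longrightarrow> vnorm X x = 0 \<longleftrightarrow> x = vzero X"
  by (insert cns[unfolded complex_normed_space_def], elim conjE) simp

lemma vscale_minus_minus: "y \<in> vcarrier X \<Longrightarrow> vscale X (-1) (vscale X (-1) y) = y"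
  using scale_scale[of y "-1" "-1"] scale_one by simp

lemma vdist_eq: "x \<in> vcarrier X \<Longrightarrow> y \<in> vcarrier X \<Longrightarrow> vdist X x y = vnorm X (vadd X x (vscale X (-1) y))"
  by (simp add: vdist_def)

lemma Metric_space: "Metric_space (vcarrier X) (vdist X)"
proof
  show "0 \<le> vdist X x y" for x y by (auto simp: vdist_def)
  show "vdist X x y = vdist X y x" for x y
  proof (cases "x \<in> vcarrier X \<and> y \<in> vcarrier X")
    case True
    then have "vadd X x (vscale X (-1) y) = vscale X (-1) (vadd X y (vscale X (-1) x))"
      by (simp add: scale_add vscale_minus_minus add_comm)
    then show ?thesis using True by (simp add: vdist_def norm_scale)
  qed (auto simp: vdist_def)
  show "vdist X x y = 0 \<longleftrightarrow> x = y" if xy: "x \<in> vcarrier X" "y \<in> vcarrier X" for x y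
  proof
    assume "vdist X x y = 0"
    then have "vadd X x (vscale X (-1) y) = vzero X" using xy by (simp add: vdist_def norm_eq_0)
    then have "vadd X (vadd X x (vscale X (-1) y)) y = y" using xy by (simp add: add_zero)
    moreover have "vadd X (vadd X x (vscale X (-1) y)) y = vadd X (vzero X) x"
      using xy by (metis add_assoc add_comm add_minus scale_closed zero_closed)
    ultimately show "x = y" using xy by (simp add: add_zero)
  next
    show "x = y \<Longrightarrow> vdist X x y = 0" using xy by (simp add: vdist_def add_minus norm_eq_0)
  qed
  show "vdist X x z \<le> vdist X x y + vdist X y z"
    if xyz: "x \<in> vcarrier X" "y \<in> vcarrier X" "z \<in> vcarrier X" for x y z
  proof -
    have "vadd X (vadd X x (vscale X (-1) y)) (vadd X y (vscale X (-1) z))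
        = vadd X x (vadd X (vadd X y (vscale X (-1) y)) (vscale X (-1) z))"
      using xyz by (metis add_assoc add_comm add_closed scale_closed)
    also have "\<dots> = vadd X x (vscale X (-1) z)" using xyz by (simp add: add_minus add_zero)
    finally show ?thesis using xyz norm_add[of "vadd X x (vscale X (-1) y)" "vadd X y (vscale X (-1) z)"]
      by (simp add: vdist_eq)
  qed
qed

sublocale M: Metric_space "vcarrier X" "vdist X"
  by (rule Metric_space)

lemma topspace_norm_topology [simp]: "topspace (norm_topology X) = vcarrier X"
  by (simp add: norm_topology_def)

lemma norm_topology_closureI:
  assumes "S \<subseteq> vcarrier X"
    and "\<And>x \<epsilon>. x \<in> vcarrier X \<Longrightarrow> \<epsilon> > 0 \<Longrightarrow> \<exists>y\<in>S. vdist X x y < \<epsilon>"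
  shows "norm_topology X closure_of S = vcarrier X"
  unfolding norm_topology_def M.metric_closure_of using assms by (fastforce simp: M.in_mball)

end

section \<open>Bounded linear maps and bounded automorphisms\<close>

lemma clinear_betweenD: "clinear_between X Y T \<Longrightarrow> x \<in> vcarrier X \<Longrightarrow> T x \<in> vcarrier Y"
  unfolding clinear_between_def by blast

text \<open>Linearity turns the bound on \<open>T\<close> into a Lipschitz bound for the distances
  with the same constant \<open>C\<close>.\<close>

lemma clinear_bounded_continuous:
  assumes "complex_normed_space X" "complex_normed_space Y"
    and T: "clinear_between X Y T" and C: "\<And>x. x \<in> vcarrier X \<Longrightarrow> vnorm Y (T x) \<le> C * vnorm X x"
  shows "continuous_map (norm_topology X) (norm_topology Y) T"
proof -
  interpret X: cnspace X by unfold_locales fact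
  interpret Y: cnspace Y by unfold_locales fact
  have clo: "T x \<in> vcarrier Y" if "x \<in> vcarrier X" for x
    using clinear_betweenD[OF T that] .
  have "vdist Y (T x) (T y) \<le> C * vdist X x y" if xy: "x \<in> vcarrier X" "y \<in> vcarrier X" for x y
  proof -
    have "vadd Y (T x) (vscale Y (-1) (T y)) = T (vadd X x (vscale X (-1) y))"
      using T xy by (simp add: clinear_between_def)
    then show ?thesis using C[of "vadd X x (vscale X (-1) y)"] xy clo by (simp add: vdist_def)
  qed
  then have "Lipschitz_continuous_map (metric (vcarrier X, vdist X)) (metric (vcarrier Y, vdist Y)) T"
    unfolding Lipschitz_continuous_map_def using clo by auto
  from Lipschitz_continuous_imp_continuous_map[OF this] show ?thesis
    by (simp add: norm_topology_def X.M.mtopology_of Y.M.mtopology_of)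
qed

text \<open>The inverse \<open>S\<close> and a common bound for both maps are part of the data, so
  continuity in both directions can be read off.\<close>

definition bounded_automorphism ::
  "('a, 'm) normed_cspace_scheme \<Rightarrow> ('a \<Rightarrow> 'a) \<Rightarrow> ('a \<Rightarrow> 'a) \<Rightarrow> bool" where
  "bounded_automorphism X T S \<longleftrightarrow>
     clinear_between X X T \<and> clinear_between X X S \<and>
     (\<forall>x\<in>vcarrier X. S (T x) = x \<and> T (S x) = x) \<and>
     (\<exists>C. \<forall>x\<in>vcarrier X. vnorm X (T x) \<le> C * vnorm X x \<and> vnorm X (S x) \<le> C * vnorm X x)"

lemma bounded_automorphism_norm_isomorphism:
  assumes X: "complex_normed_space X" and TS: "bounded_automorphism X T S"
  shows "norm_isomorphism X X T"
proof -
  interpret X: cnspace X by unfold_locales fact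
  obtain C where C: "\<And>x. x \<in> vcarrier X \<Longrightarrow> vnorm X (T x) \<le> C * vnorm X x"
    "\<And>x. x \<in> vcarrier X \<Longrightarrow> vnorm X (S x) \<le> C * vnorm X x"
    using TS by (auto simp: bounded_automorphism_def)
  have "homeomorphic_maps (norm_topology X) (norm_topology X) T S"
    unfolding homeomorphic_maps_def using TS
    by (auto simp: bounded_automorphism_def intro!: clinear_bounded_continuous[OF X X] C)
  then show ?thesis
    using TS by (auto simp: norm_isomorphism_def bounded_automorphism_def homeomorphic_map_maps)
qed

section \<open>The dual space and its weak-star topology\<close>

lemma dual_carrier: "\<phi> \<in> vcarrier (dual_space X) \<longleftrightarrow>
   (\<forall>x\<in>vcarrier X. \<forall>y\<in>vcarrier X. \<phi> (vadd X x y) = \<phi> x + \<phi> y) \<and>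
   (\<forall>\<alpha>. \<forall>x\<in>vcarrier X. \<phi> (vscale X \<alpha> x) = \<alpha> * \<phi> x) \<and>
   (\<exists>C. \<forall>x\<in>vcarrier X. cmod (\<phi> x) \<le> C * vnorm X x) \<and>
   (\<forall>x. x \<notin> vcarrier X \<longrightarrow> \<phi> x = 0)"
  by (simp add: dual_space_def)

lemma dual_off: "\<phi> \<in> vcarrier (dual_space X) \<Longrightarrow> x \<notin> vcarrier X \<Longrightarrow> \<phi> x = 0"
  unfolding dual_carrier by blast

lemma dual_simps [simp]:
  "vadd (dual_space X) = (\<lambda>\<phi> \<psi> x. \<phi> x + \<psi> x)"
  "vzero (dual_space X) = (\<lambda>x. 0)"
  "vscale (dual_space X) = (\<lambda>\<alpha> \<phi> x. \<alpha> * \<phi> x)"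
  by (simp_all add: dual_space_def)

context cnspace begin

lemma dual_bdd_above:
  assumes "\<phi> \<in> vcarrier (dual_space X)"
  shows "bdd_above ((\<lambda>x. cmod (\<phi> x)) ` {x \<in> vcarrier X. vnorm X x \<le> 1})"
proof -
  obtain C where C: "\<And>x. x \<in> vcarrier X \<Longrightarrow> cmod (\<phi> x) \<le> C * vnorm X x"
    using assms unfolding dual_carrier by blast
  \<comment> \<open>A negative \<open>C\<close> is possible when all norms in the space are zero,
    hence the absolute value.\<close>
  have "cmod (\<phi> x) \<le> \<bar>C\<bar>" if "x \<in> vcarrier X" "vnorm X x \<le> 1" for x
  proof -
    have "C * vnorm X x \<le> \<bar>C\<bar> * 1"
      using that norm_nonneg by (intro mult_mono) auto
    then show ?thesis using C[OF that(1)] by simp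
  qed
  then show ?thesis by (intro bdd_aboveI) auto
qed

lemma dual_norm_eq: "vnorm (dual_space X) \<phi> = (SUP x\<in>{x \<in> vcarrier X. vnorm X x \<le> 1}. cmod (\<phi> x))"
  by (simp add: dual_space_def)

lemma zero_in_ball: "vzero X \<in> {x \<in> vcarrier X. vnorm X x \<le> 1}"
proof -
  have "vnorm X (vzero X) = 0" using norm_eq_0 zero_closed by blast
  then show ?thesis by simp
qed

lemma dual_norm_leI:
  assumes "\<And>x. x \<in> vcarrier X \<Longrightarrow> vnorm X x \<le> 1 \<Longrightarrow> cmod (\<phi> x) \<le> K"
  shows "vnorm (dual_space X) \<phi> \<le> K"
  unfolding dual_norm_eq using zero_in_ball by (intro cSUP_least) (use assms in blast)+

lemma dual_norm_nonneg:
  assumes "\<phi> \<in> vcarrier (dual_space X)" shows "0 \<le> vnorm (dual_space X) \<phi>"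
  unfolding dual_norm_eq by (rule cSUP_upper2[OF dual_bdd_above[OF assms] zero_in_ball]) auto

text \<open>Rescaling \<open>x\<close> to norm one puts it into the ball of the supremum; at norm
  zero the bound that comes with \<open>\<phi>\<close> forces the value 0.\<close>

lemma dual_norm_bound:
  assumes \<phi>: "\<phi> \<in> vcarrier (dual_space X)" and x: "x \<in> vcarrier X"
  shows "cmod (\<phi> x) \<le> vnorm (dual_space X) \<phi> * vnorm X x"
proof (cases "vnorm X x = 0")
  case True
  obtain C where C: "\<And>x. x \<in> vcarrier X \<Longrightarrow> cmod (\<phi> x) \<le> C * vnorm X x"
    using \<phi> unfolding dual_carrier by blast
  show ?thesis using C[OF x] True by simp
next
  case False
  then have pos: "vnorm X x > 0" using x norm_nonneg[OF x] by linarith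
  let ?y = "vscale X (of_real (1 / vnorm X x)) x"
  have "cmod (\<phi> ?y) \<le> vnorm (dual_space X) \<phi>"
    unfolding dual_norm_eq using pos x
    by (intro cSUP_upper dual_bdd_above[OF \<phi>]) (auto simp: norm_scale norm_divide)
  moreover have "\<phi> ?y = of_real (1 / vnorm X x) * \<phi> x" using \<phi> x unfolding dual_carrier by blast
  then have "cmod (\<phi> ?y) = cmod (\<phi> x) / vnorm X x" using pos by (simp add: norm_mult norm_divide)
  ultimately show ?thesis using pos by (simp only: pos_divide_le_eq)
qed

lemma dual_closed:
  assumes "\<phi> \<in> vcarrier (dual_space X)" "\<psi> \<in> vcarrier (dual_space X)"
  shows "(\<lambda>x. \<phi> x + \<psi> x) \<in> vcarrier (dual_space X)" "(\<lambda>x. \<alpha> * \<phi> x) \<in> vcarrier (dual_space X)"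
    "(\<lambda>x. 0) \<in> vcarrier (dual_space X)"
proof -
  have "cmod (\<phi> x + \<psi> x) \<le> (vnorm (dual_space X) \<phi> + vnorm (dual_space X) \<psi>) * vnorm X x"
    if "x \<in> vcarrier X" for x
    using dual_norm_bound[OF assms(1) that] dual_norm_bound[OF assms(2) that] norm_triangle_ineq[of "\<phi> x" "\<psi> x"]
    by (simp add: ring_distribs)
  then show "(\<lambda>x. \<phi> x + \<psi> x) \<in> vcarrier (dual_space X)"
    using assms unfolding dual_carrier
    by (intro conjI exI[of _ "vnorm (dual_space X) \<phi> + vnorm (dual_space X) \<psi>"]) (auto simp: ring_distribs)
  have "cmod (\<alpha> * \<phi> x) \<le> (cmod \<alpha> * vnorm (dual_space X) \<phi>) * vnorm X x"
    if "x \<in> vcarrier X" for x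
    using mult_left_mono[OF dual_norm_bound[OF assms(1) that], of "cmod \<alpha>"] by (simp add: norm_mult mult.assoc)
  then show "(\<lambda>x. \<alpha> * \<phi> x) \<in> vcarrier (dual_space X)"
    using assms unfolding dual_carrier
    by (intro conjI exI[of _ "cmod \<alpha> * vnorm (dual_space X) \<phi>"]) (auto simp: ring_distribs)
  show "(\<lambda>x. 0) \<in> vcarrier (dual_space X)"
    unfolding dual_carrier by (auto intro!: exI[of _ 0])
qed

lemma complex_normed_space_dual: "complex_normed_space (dual_space X)"
proof -
  have ge0: "vnorm (dual_space X) \<phi> = 0 \<longleftrightarrow> \<phi> = (\<lambda>x. 0)" if "\<phi> \<in> vcarrier (dual_space X)" for \<phi>
  proof
    assume 0: "vnorm (dual_space X) \<phi> = 0"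
    show "\<phi> = (\<lambda>x. 0)"
    proof
      fix x show "\<phi> x = 0"
      proof (cases "x \<in> vcarrier X")
        case True
        then show ?thesis using dual_norm_bound[OF that True] 0 by simp
      next
        case False
        then show ?thesis using dual_off[OF that] by blast
      qed
    qed
  next
    assume "\<phi> = (\<lambda>x. 0)"
    then have "vnorm (dual_space X) \<phi> \<le> 0" by (intro dual_norm_leI) auto
    then show "vnorm (dual_space X) \<phi> = 0" using dual_norm_nonneg[OF that] by simp
  qed
  have bd: "cmod (\<phi> x) \<le> vnorm (dual_space X) \<phi>"
    if "\<phi> \<in> vcarrier (dual_space X)" "x \<in> vcarrier X" "vnorm X x \<le> 1" for \<phi> x
    using dual_norm_bound[OF that(1,2)] mult_left_mono[OF that(3) dual_norm_nonneg[OF that(1)]] by linarith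
  have sc_le: "vnorm (dual_space X) (\<lambda>x. \<alpha> * \<phi> x) \<le> cmod \<alpha> * vnorm (dual_space X) \<phi>"
    if "\<phi> \<in> vcarrier (dual_space X)" for \<phi> \<alpha>
    using bd[OF that] by (intro dual_norm_leI) (auto simp: norm_mult intro!: mult_left_mono)
  have sc: "vnorm (dual_space X) (\<lambda>x. \<alpha> * \<phi> x) = cmod \<alpha> * vnorm (dual_space X) \<phi>"
    if \<phi>: "\<phi> \<in> vcarrier (dual_space X)" for \<phi> \<alpha>
  proof (cases "\<alpha> = 0")
    case True
    then show ?thesis using ge0[OF dual_closed(3)[OF \<phi> \<phi>]] by simp
  next
    case False
    \<comment> \<open>The reverse inequality is \<open>sc_le\<close> for the inverse scalar.\<close>
    have "vnorm (dual_space X) (\<lambda>x. inverse \<alpha> * (\<alpha> * \<phi> x))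
        \<le> cmod (inverse \<alpha>) * vnorm (dual_space X) (\<lambda>x. \<alpha> * \<phi> x)"
      by (rule sc_le[OF dual_closed(2)[OF \<phi> \<phi>]])
    then have "cmod \<alpha> * vnorm (dual_space X) \<phi> \<le> vnorm (dual_space X) (\<lambda>x. \<alpha> * \<phi> x)"
      using False by (simp add: norm_inverse norm_divide field_simps)
    then show ?thesis using sc_le[OF \<phi>, of \<alpha>] by linarith
  qed
  have tri: "vnorm (dual_space X) (\<lambda>x. \<phi> x + \<psi> x) \<le> vnorm (dual_space X) \<phi> + vnorm (dual_space X) \<psi>"
    if "\<phi> \<in> vcarrier (dual_space X)" "\<psi> \<in> vcarrier (dual_space X)" for \<phi> \<psi>
    by (rule dual_norm_leI) (use bd[OF that(1)] bd[OF that(2)] in \<open>force intro: norm_triangle_le add_mono\<close>)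
  have z: "(\<lambda>x. 0) \<in> vcarrier (dual_space X)"
    unfolding dual_carrier by (auto intro!: exI[of _ 0])
  show ?thesis
    unfolding complex_normed_space_def dual_simps
    by (intro conjI ballI allI) (auto simp: dual_closed z ge0 sc tri dual_norm_nonneg algebra_simps)
qed

lemma topspace_weak_star [simp]: "topspace (weak_star_topology X) = vcarrier (dual_space X)"
proof -
  \<comment> \<open>One subbasic set suffices: the condition that the value at
    \<open>vzero X\<close> lies in the whole plane holds for every functional.\<close>
  have "\<phi> \<in> \<Union> {{\<phi> \<in> vcarrier (dual_space X). \<phi> x \<in> U} | x U. x \<in> vcarrier X \<and> open U}"
    if "\<phi> \<in> vcarrier (dual_space X)" for \<phi>
    using that zero_closed
    by (intro UnionI[of "{\<phi> \<in> vcarrier (dual_space X). \<phi> (vzero X) \<in> UNIV}"]) blast+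
  then show ?thesis unfolding weak_star_topology_def topology_generated_by_topspace by blast
qed

text \<open>The weak-star topology is the initial topology of the evaluations; preimages of its
  subbasic sets are preimages under a single evaluation.\<close>

lemma continuous_map_weak_star:
  assumes "f \<in> topspace Z \<rightarrow> vcarrier (dual_space X)"
    and "\<And>x. x \<in> vcarrier X \<Longrightarrow> continuous_map Z euclidean (\<lambda>z. f z x)"
  shows "continuous_map Z (weak_star_topology X) f"
  unfolding weak_star_topology_def
proof (rule continuous_on_generated_topo)
  fix U assume "U \<in> {{\<phi> \<in> vcarrier (dual_space X). \<phi> x \<in> U} | x U. x \<in> vcarrier X \<and> open U}"
  then obtain x V where xV: "x \<in> vcarrier X" "open V" "U = {\<phi> \<in> vcarrier (dual_space X). \<phi> x \<in> V}" by auto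
  have "f -` U \<inter> topspace Z = {z \<in> topspace Z. f z x \<in> V}" using assms(1) xV by auto
  then show "openin Z (f -` U \<inter> topspace Z)"
    using assms(2)[OF xV(1)] xV(2) by (simp add: openin_continuous_map_preimage)
next
  show "f ` topspace Z \<subseteq> \<Union> {{\<phi> \<in> vcarrier (dual_space X). \<phi> x \<in> U} | x U. x \<in> vcarrier X \<and> open U}"
    using assms(1) topspace_weak_star
    unfolding weak_star_topology_def topology_generated_by_topspace by (simp only: image_subset_iff_funcset)
qed

lemma continuous_map_weak_star_eval:
  assumes "x \<in> vcarrier X"
  shows "continuous_map (weak_star_topology X) euclidean (\<lambda>\<phi>. \<phi> x)"
proof -
  have "openin (weak_star_topology X) {\<phi> \<in> vcarrier (dual_space X). \<phi> x \<in> V}" if "open V" for V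
    unfolding weak_star_topology_def using that assms
    by (intro topology_generated_by_Basis) auto
  then show ?thesis by (auto simp: continuous_map)
qed

text \<open>A weak-star open set constrains only finitely many values, so that exact interpolation on finite
  sets suffices for density.\<close>

lemma weak_star_closure_of:
  assumes "D \<subseteq> vcarrier (dual_space X)"
    and "\<And>F \<phi>. finite F \<Longrightarrow> F \<subseteq> vcarrier X \<Longrightarrow> \<phi> \<in> vcarrier (dual_space X) \<Longrightarrow> \<exists>\<psi>\<in>D. \<forall>x\<in>F. \<psi> x = \<phi> x"
  shows "weak_star_topology X closure_of D = vcarrier (dual_space X)"
proof -
  let ?S = "{{\<phi> \<in> vcarrier (dual_space X). \<phi> x \<in> U} | x U. x \<in> vcarrier X \<and> open U}"
  \<comment> \<open>By induction on how \<open>U\<close> is generated: around each of its points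
    \<open>U\<close> contains all functionals that agree with that point on a finite set.\<close>
  have fin: "\<exists>F. finite F \<and> F \<subseteq> vcarrier X \<and> {\<psi> \<in> vcarrier (dual_space X). \<forall>x\<in>F. \<psi> x = \<phi> x} \<subseteq> U"
    if "generate_topology_on ?S U" "\<phi> \<in> U" for U \<phi>
    using that
  proof (induction U rule: generate_topology_on.induct)
    case (Int a b)
    then obtain F G where "finite F" "F \<subseteq> vcarrier X" "{\<psi> \<in> vcarrier (dual_space X). \<forall>x\<in>F. \<psi> x = \<phi> x} \<subseteq> a"
      "finite G" "G \<subseteq> vcarrier X" "{\<psi> \<in> vcarrier (dual_space X). \<forall>x\<in>G. \<psi> x = \<phi> x} \<subseteq> b" by auto
    then show ?case by (intro exI[of _ "F \<union> G"]) auto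
  next
    case (UN K) 
    then obtain k where k: "k \<in> K" "\<phi> \<in> k" by blast
    obtain F where "finite F" "F \<subseteq> vcarrier X" "{\<psi> \<in> vcarrier (dual_space X). \<forall>x\<in>F. \<psi> x = \<phi> x} \<subseteq> k"
      using UN.IH[OF k] by blast
    with k show ?case by (intro exI[of _ F]) auto
  next
    case (Basis s)
    then obtain x V where xV: "x \<in> vcarrier X" "s = {\<phi> \<in> vcarrier (dual_space X). \<phi> x \<in> V}"
      unfolding mem_Collect_eq by (elim exE conjE) (rule that)
    have in_s: "\<psi> \<in> s" if "\<psi> \<in> vcarrier (dual_space X)" "\<psi> x = \<phi> x" for \<psi>
      using xV that Basis.prems by (simp only: mem_Collect_eq)
    show ?case
    proof (intro exI[of _ "{x}"] conjI)
      show "{x} \<subseteq> vcarrier X" using xV(1) by blast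
      show "{\<psi> \<in> vcarrier (dual_space X). \<forall>x\<in>{x}. \<psi> x = \<phi> x} \<subseteq> s" using in_s by blast
    qed simp
  qed (simp_all only: empty_iff)
  have "\<phi> \<in> weak_star_topology X closure_of D" if \<phi>: "\<phi> \<in> vcarrier (dual_space X)" for \<phi>
    unfolding in_closure_of
  proof (intro conjI allI impI)
    show "\<phi> \<in> topspace (weak_star_topology X)" using \<phi> by simp
    fix U assume "\<phi> \<in> U \<and> openin (weak_star_topology X) U"
    then obtain F where F: "finite F" "F \<subseteq> vcarrier X" "{\<psi> \<in> vcarrier (dual_space X). \<forall>x\<in>F. \<psi> x = \<phi> x} \<subseteq> U"
      using fin[of U \<phi>] unfolding weak_star_topology_def openin_topology_generated_by_iff by blast
    show "\<exists>y. y \<in> D \<and> y \<in> U"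
      using assms(2)[OF F(1,2) \<phi>] F(3) assms(1) by blast
  qed
  then show ?thesis using closure_of_subset_topspace[of "weak_star_topology X" D] by auto
qed

text \<open>The value 0 off the carrier is what membership in \<open>dual_space X\<close>
  demands.\<close>

definition transpose_map :: "('a \<Rightarrow> 'a) \<Rightarrow> ('a \<Rightarrow> complex) \<Rightarrow> 'a \<Rightarrow> complex" where
  "transpose_map A \<phi> = (\<lambda>x. if x \<in> vcarrier X then \<phi> (A x) else 0)"

lemma transpose_map_closed:
  assumes A: "clinear_between X X A" and C: "\<And>x. x \<in> vcarrier X \<Longrightarrow> vnorm X (A x) \<le> C * vnorm X x"
    and \<phi>: "\<phi> \<in> vcarrier (dual_space X)"
  shows "transpose_map A \<phi> \<in> vcarrier (dual_space X)"
    and "vnorm (dual_space X) (transpose_map A \<phi>) \<le> \<bar>C\<bar> * vnorm (dual_space X) \<phi>"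
proof -
  have Ac: "A x \<in> vcarrier X" if "x \<in> vcarrier X" for x using clinear_betweenD[OF A that] .
  have bd: "cmod (\<phi> (A x)) \<le> (\<bar>C\<bar> * vnorm (dual_space X) \<phi>) * vnorm X x" if x: "x \<in> vcarrier X" for x
  proof -
    have "vnorm X (A x) \<le> \<bar>C\<bar> * vnorm X x"
      using C[OF x] mult_right_mono[of C "\<bar>C\<bar>" "vnorm X x"] norm_nonneg[OF x] by linarith
    then have "vnorm (dual_space X) \<phi> * vnorm X (A x) \<le> vnorm (dual_space X) \<phi> * (\<bar>C\<bar> * vnorm X x)"
      using dual_norm_nonneg[OF \<phi>] by (rule mult_left_mono)
    then show ?thesis using dual_norm_bound[OF \<phi> Ac[OF x]] by (simp add: mult_ac)
  qed
  show "transpose_map A \<phi> \<in> vcarrier (dual_space X)"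
    using A \<phi> Ac bd unfolding dual_carrier transpose_map_def clinear_between_def by (auto simp del: mult.assoc)
  show "vnorm (dual_space X) (transpose_map A \<phi>) \<le> \<bar>C\<bar> * vnorm (dual_space X) \<phi>"
  proof (rule dual_norm_leI)
    fix x assume x: "x \<in> vcarrier X" "vnorm X x \<le> 1"
    have "(\<bar>C\<bar> * vnorm (dual_space X) \<phi>) * vnorm X x \<le> (\<bar>C\<bar> * vnorm (dual_space X) \<phi>) * 1"
      using x dual_norm_nonneg[OF \<phi>] by (intro mult_left_mono) auto
    then show "cmod (transpose_map A \<phi> x) \<le> \<bar>C\<bar> * vnorm (dual_space X) \<phi>"
      using bd[OF x(1)] x by (simp add: transpose_map_def)
  qed
qed

text \<open>Transposition reverses composition, so the transpose of \<open>B\<close> inverts that of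
  \<open>A\<close>. Weak-star continuity holds because evaluating the transpose of \<open>A\<close>
  at \<open>x\<close> is evaluation at \<open>A x\<close>.\<close>

lemma transpose_map_isomorphism:
  assumes AB: "bounded_automorphism X A B"
  shows "norm_isomorphism (dual_space X) (dual_space X) (transpose_map A)"
    and "homeomorphic_map (weak_star_topology X) (weak_star_topology X) (transpose_map A)"
proof -
  note AB' = AB[unfolded bounded_automorphism_def]
  have lA: "clinear_between X X A" and lB: "clinear_between X X B"
    by (rule conjunct1[OF AB'], rule conjunct1[OF conjunct2[OF AB']])
  have inv: "B (A x) = x \<and> A (B x) = x" if "x \<in> vcarrier X" for x
    using AB' that by (elim conjE) (rule bspec)
  obtain C where C: "\<forall>x\<in>vcarrier X. vnorm X (A x) \<le> C * vnorm X x \<and> vnorm X (B x) \<le> C * vnorm X x"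
    using AB' by (elim conjE exE) (rule that)
  have C1: "vnorm X (A x) \<le> C * vnorm X x" and C2: "vnorm X (B x) \<le> C * vnorm X x" if "x \<in> vcarrier X" for x
    using bspec[OF C that] by (rule conjunct1, rule conjunct2)
  have AC: "\<And>x. x \<in> vcarrier X \<Longrightarrow> A x \<in> vcarrier X" "\<And>x. x \<in> vcarrier X \<Longrightarrow> B x \<in> vcarrier X"
    by (rule clinear_betweenD[OF lA] clinear_betweenD[OF lB], assumption)+
  note cA = transpose_map_closed[OF lA C1] and cB = transpose_map_closed[OF lB C2]
  have lin: "clinear_between (dual_space X) (dual_space X) (transpose_map D)"
    if "\<And>\<phi>. \<phi> \<in> vcarrier (dual_space X) \<Longrightarrow> transpose_map D \<phi> \<in> vcarrier (dual_space X)" for D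
    unfolding clinear_between_def using that by (auto simp: transpose_map_def)
  have iv: "transpose_map B (transpose_map A \<phi>) = \<phi>" "transpose_map A (transpose_map B \<phi>) = \<phi>"
    if "\<phi> \<in> vcarrier (dual_space X)" for \<phi>
  proof -
    have "transpose_map B (transpose_map A \<phi>) x = \<phi> x \<and> transpose_map A (transpose_map B \<phi>) x = \<phi> x" for x
    proof (cases "x \<in> vcarrier X")
      case True
      then show ?thesis using AC[OF True] inv[OF True] by (simp only: transpose_map_def if_True simp_thms)
    next
      case False
      then show ?thesis using dual_off[OF that False] by (simp only: transpose_map_def if_False)
    qed
    note pt = this[THEN conjunct1] this[THEN conjunct2]
    show "transpose_map B (transpose_map A \<phi>) = \<phi>" "transpose_map A (transpose_map B \<phi>) = \<phi>"
      by (rule ext, rule pt)+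
  qed
  have "bounded_automorphism (dual_space X) (transpose_map A) (transpose_map B)"
    unfolding bounded_automorphism_def
    by (intro conjI ballI exI[of _ "\<bar>C\<bar>"] lin cA cB iv)
  then show "norm_isomorphism (dual_space X) (dual_space X) (transpose_map A)"
    by (rule bounded_automorphism_norm_isomorphism[OF complex_normed_space_dual])
  have ct: "continuous_map (weak_star_topology X) (weak_star_topology X) (transpose_map D)"
    if "\<And>\<phi>. \<phi> \<in> vcarrier (dual_space X) \<Longrightarrow> transpose_map D \<phi> \<in> vcarrier (dual_space X)"
      "\<And>x. x \<in> vcarrier X \<Longrightarrow> D x \<in> vcarrier X" for D
    by (rule continuous_map_weak_star)
      (use that in \<open>simp_all add: transpose_map_def continuous_map_weak_star_eval\<close>)
  have "homeomorphic_maps (weak_star_topology X) (weak_star_topology X) (transpose_map A) (transpose_map B)"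
    unfolding homeomorphic_maps_def topspace_weak_star
    by (intro conjI ballI ct cA cB AC iv)
  then show "homeomorphic_map (weak_star_topology X) (weak_star_topology X) (transpose_map A)"
    unfolding homeomorphic_map_maps by (rule exI[where x = "transpose_map B"])
qed

end

text \<open>The last assumption says that the transpose of \<open>A\<close> agrees with
  \<open>T\<close> on the embedded Hilbert space; this transpose is the required extension of
  \<open>T\<close> to the dual.\<close>

lemma gelfand_triple_automorphismI:
  assumes G: "banach_gelfand_triple G"
    and T: "bounded_automorphism (Hspace G) T S"
    and TB: "bounded_automorphism (Bspace G) TB SB"
    and A: "bounded_automorphism (Bspace G) A A'"
    and embB: "\<And>f. f \<in> vcarrier (Bspace G) \<Longrightarrow> embB G (TB f) = T (embB G f)"
    and embH: "\<And>h f. h \<in> vcarrier (Hspace G) \<Longrightarrow> f \<in> vcarrier (Bspace G) \<Longrightarrow> embH G (T h) f = embH G h (A f)"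
  shows "gelfand_triple_automorphism G T"
proof -
  have H: "complex_normed_space (Hspace G)" and B: "complex_normed_space (Bspace G)"
    using G by (auto simp: banach_gelfand_triple_def complex_hilbert_space_def complex_banach_space_def)
  interpret B: cnspace "Bspace G" by unfold_locales fact
  have "B.transpose_map A (embH G h) = embH G (T h)" if h: "h \<in> vcarrier (Hspace G)" for h
  proof -
    have Th: "T h \<in> vcarrier (Hspace G)" 
      by (rule clinear_betweenD[OF T[unfolded bounded_automorphism_def, THEN conjunct1] h])
    have "clinear_between (Hspace G) (dual_space (Bspace G)) (embH G)"
      using G unfolding banach_gelfand_triple_def by (elim conjE)
    from dual_off[OF clinear_betweenD[OF this Th]]
    show ?thesis using embH[OF h] by (intro ext) (simp add: B.transpose_map_def)
  qed
  then have H': "\<forall>h\<in>vcarrier (Hspace G). B.transpose_map A (embH G h) = embH G (T h)" by (rule ballI)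
  show ?thesis
    unfolding gelfand_triple_automorphism_def gelfand_triple_isomorphism_def
    by (intro conjI exI[of _ TB] exI[of _ "B.transpose_map A"] G H' ballI embB
        bounded_automorphism_norm_isomorphism[OF H T] bounded_automorphism_norm_isomorphism[OF B TB]
        B.transpose_map_isomorphism[OF A])
qed

section \<open>Square-integrable functions modulo null sets as a Hilbert space type\<close>

lemma L2_functions_iff: "u \<in> L2_functions \<longleftrightarrow>
    u \<in> borel_measurable borel \<and> integrable lborel (\<lambda>t. (cmod (u t))\<^sup>2)"
  by (simp add: L2_functions_def)

lemma L2_measurable [measurable_dest]: "u \<in> L2_functions \<Longrightarrow> u \<in> borel_measurable borel"
  by (simp add: L2_functions_iff)

lemma L2_mult_integrable:
  assumes "u \<in> L2_functions" "v \<in> L2_functions"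
  shows "integrable lborel (\<lambda>t. u t * v t)"
proof (rule Bochner_Integration.integrable_bound)
  show "integrable lborel (\<lambda>t. (cmod (u t))\<^sup>2 + (cmod (v t))\<^sup>2)"
    using assms by (simp add: L2_functions_iff)
  show "(\<lambda>t. u t * v t) \<in> borel_measurable lborel" using assms by measurable
  show "AE t in lborel. norm (u t * v t) \<le> norm ((cmod (u t))\<^sup>2 + (cmod (v t))\<^sup>2)"
  proof (intro AE_I2)
    fix t
    have "0 \<le> (cmod (u t) - cmod (v t))\<^sup>2" "0 \<le> cmod (u t) * cmod (v t)" by auto
    then have "cmod (u t) * cmod (v t) \<le> (cmod (u t))\<^sup>2 + (cmod (v t))\<^sup>2"
      unfolding power2_diff by linarith
    then show "norm (u t * v t) \<le> norm ((cmod (u t))\<^sup>2 + (cmod (v t))\<^sup>2)" by (simp add: norm_mult)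
  qed
qed

lemma L2_add: assumes "u \<in> L2_functions" "v \<in> L2_functions" shows "(\<lambda>t. u t + v t) \<in> L2_functions"
  unfolding L2_functions_iff
proof
  show "(\<lambda>t. u t + v t) \<in> borel_measurable borel" using assms by measurable
  show "integrable lborel (\<lambda>t. (cmod (u t + v t))\<^sup>2)"
  proof (rule Bochner_Integration.integrable_bound)
    show "integrable lborel (\<lambda>t. 2 * (cmod (u t))\<^sup>2 + 2 * (cmod (v t))\<^sup>2)"
      using assms by (simp add: L2_functions_iff)
    show "(\<lambda>t. (cmod (u t + v t))\<^sup>2) \<in> borel_measurable lborel" using assms by measurable
    show "AE t in lborel. norm ((cmod (u t + v t))\<^sup>2) \<le> norm (2 * (cmod (u t))\<^sup>2 + 2 * (cmod (v t))\<^sup>2)"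
    proof (intro AE_I2)
      fix t
      have "(cmod (u t + v t))\<^sup>2 \<le> (cmod (u t) + cmod (v t))\<^sup>2"
        by (intro power_mono norm_triangle_ineq) auto
      moreover have "0 \<le> (cmod (u t) - cmod (v t))\<^sup>2" by simp
      ultimately show "norm ((cmod (u t + v t))\<^sup>2) \<le> norm (2 * (cmod (u t))\<^sup>2 + 2 * (cmod (v t))\<^sup>2)"
        unfolding power2_sum power2_diff by simp
    qed
  qed
qed

lemma L2_mult_bounded:
  assumes "u \<in> L2_functions" "m \<in> borel_measurable borel" "\<And>t. cmod (m t) \<le> K"
  shows "(\<lambda>t. m t * u t) \<in> L2_functions"
  unfolding L2_functions_iff
proof
  show "(\<lambda>t. m t * u t) \<in> borel_measurable borel" using assms by measurable
  show "integrable lborel (\<lambda>t. (cmod (m t * u t))\<^sup>2)"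
  proof (rule Bochner_Integration.integrable_bound)
    show "integrable lborel (\<lambda>t. K\<^sup>2 * (cmod (u t))\<^sup>2)" using assms by (simp add: L2_functions_iff)
    show "(\<lambda>t. (cmod (m t * u t))\<^sup>2) \<in> borel_measurable lborel" using assms by measurable
    show "AE t in lborel. norm ((cmod (m t * u t))\<^sup>2) \<le> norm (K\<^sup>2 * (cmod (u t))\<^sup>2)"
      using assms(3) by (auto simp: norm_mult power_mult_distrib intro!: mult_right_mono power_mono)
  qed
qed

lemma L2_scale: "u \<in> L2_functions \<Longrightarrow> (\<lambda>t. \<alpha> * u t) \<in> L2_functions"
  by (rule L2_mult_bounded[where K = "cmod \<alpha>"]) auto

lemma L2_zero [simp]: "(\<lambda>t. 0) \<in> L2_functions"
  by (simp add: L2_functions_iff)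

lemma borel_measurable_cnj [measurable (raw)]:
  "f \<in> borel_measurable M \<Longrightarrow> (\<lambda>x. cnj (f x)) \<in> borel_measurable M"
  by (rule borel_measurable_continuous_on[OF continuous_on_cnj[OF continuous_on_id]])

lemma L2_cnj: "u \<in> L2_functions \<Longrightarrow> (\<lambda>t. cnj (u t)) \<in> L2_functions"
  by (auto simp: L2_functions_iff)

lemma L2_diff: "u \<in> L2_functions \<Longrightarrow> v \<in> L2_functions \<Longrightarrow> (\<lambda>t. u t - v t) \<in> L2_functions"
  using L2_add[of u "\<lambda>t. -1 * v t"] L2_scale[of v "-1"] by simp

lemma L2_I1_bounded:
  assumes u: "integrable lborel u" and K: "\<And>t. cmod (u t) \<le> K"
  shows "u \<in> L2_functions"
  unfolding L2_functions_iff
proof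
  show "u \<in> borel_measurable borel" using borel_measurable_integrable[OF u] by simp
  show "integrable lborel (\<lambda>t. (cmod (u t))\<^sup>2)"
  proof (rule Bochner_Integration.integrable_bound)
    show "integrable lborel (\<lambda>t. K * cmod (u t))" using u by simp
    show "(\<lambda>t. (cmod (u t))\<^sup>2) \<in> borel_measurable lborel" using u by measurable
    show "AE t in lborel. norm ((cmod (u t))\<^sup>2) \<le> norm (K * cmod (u t))"
    proof (intro AE_I2)
      fix t
      have "0 \<le> K" using K[of t] norm_ge_zero order_trans by blast
      then show "norm ((cmod (u t))\<^sup>2) \<le> norm (K * cmod (u t))"
        using mult_right_mono[OF K[of t], of "cmod (u t)"] by (simp add: power2_eq_square)
    qed
  qed
qed

lemma equiv_L2_rel: "equiv L2_functions L2_rel"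
proof (rule equivI)
  show "L2_rel \<subseteq> L2_functions \<times> L2_functions" by (auto simp: L2_rel_def)
  show "refl_on L2_functions L2_rel" by (auto simp: refl_on_def L2_rel_def)
  show "sym L2_rel" by (auto simp: sym_def L2_rel_def)
  show "trans L2_rel" by (rule transI) (auto simp: L2_rel_def)
qed

text \<open>As a type, the quotient can be made an instance of \<open>real_inner\<close> and
  \<open>complete_space\<close>, which gives access to the general theory of limits and
  closures.\<close>

typedef l2 = "L2_functions // L2_rel"
  using quotientI[OF L2_zero] by blast

definition cl :: "(real \<Rightarrow> complex) \<Rightarrow> l2" where "cl u = Abs_l2 (L2_class u)"

definition fn :: "l2 \<Rightarrow> real \<Rightarrow> complex" where "fn x = L2_rep (Rep_l2 x)"

lemma Rep_cl: "u \<in> L2_functions \<Longrightarrow> Rep_l2 (cl u) = L2_class u"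
  unfolding cl_def L2_class_def by (rule Abs_l2_inverse) (rule quotientI)

lemma rep_rel:
  assumes "u \<in> L2_functions" shows "(u, L2_rep (L2_class u)) \<in> L2_rel"
proof -
  have "u \<in> L2_class u" unfolding L2_class_def by (rule equiv_class_self[OF equiv_L2_rel assms])
  then have "L2_rep (L2_class u) \<in> L2_class u" unfolding L2_rep_def by (rule someI[of "\<lambda>v. v \<in> L2_class u"])
  then show ?thesis by (simp add: L2_class_def)
qed

lemma fn_cl: "u \<in> L2_functions \<Longrightarrow> AE t in lborel. fn (cl u) t = u t"
  using rep_rel[of u] unfolding fn_def by (auto simp: L2_rel_def Rep_cl)

lemma L2_class_eq_iff:
  "u \<in> L2_functions \<Longrightarrow> v \<in> L2_functions \<Longrightarrow> L2_class u = L2_class v \<longleftrightarrow> (AE t in lborel. u t = v t)"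
  unfolding L2_class_def using eq_equiv_class_iff[OF equiv_L2_rel, of u v] by (simp add: L2_rel_def)

lemma cl_eq_iff: "u \<in> L2_functions \<Longrightarrow> v \<in> L2_functions \<Longrightarrow> cl u = cl v \<longleftrightarrow> (AE t in lborel. u t = v t)"
  unfolding Rep_l2_inject[symmetric] by (simp add: Rep_cl L2_class_eq_iff)

lemma cl_cases: obtains u where "u \<in> L2_functions" "x = cl u"
proof -
  have "Rep_l2 x \<in> L2_functions // L2_rel" by (rule Rep_l2)
  then obtain u where u: "u \<in> L2_functions" "Rep_l2 x = L2_class u"
    unfolding L2_class_def by (rule quotientE)
  then have "Rep_l2 x = Rep_l2 (cl u)" by (simp add: Rep_cl)
  then have "x = cl u" by (simp only: Rep_l2_inject)
  with u show ?thesis using that by blast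
qed

lemma fn_L2 [simp]: "fn x \<in> L2_functions"
proof -
  obtain u where u: "u \<in> L2_functions" "x = cl u" by (rule cl_cases)
  then show ?thesis using rep_rel[OF u(1)] by (simp add: fn_def Rep_cl L2_rel_def)
qed

lemma fn_measurable [measurable]: "fn x \<in> borel_measurable borel"
  by (rule L2_measurable) simp

lemma cl_fn [simp]: "cl (fn x) = x"
proof -
  obtain u where u: "u \<in> L2_functions" "x = cl u" by (rule cl_cases)
  then show ?thesis using fn_cl[OF u(1)] by (simp add: cl_eq_iff)
qed

lemma fn_integrable [simp]: "integrable lborel (\<lambda>t. fn x t * fn y t)"
  "integrable lborel (\<lambda>t. fn x t * cnj (fn y t))" "integrable lborel (\<lambda>t. (cmod (fn x t))\<^sup>2)"
  using L2_mult_integrable[OF fn_L2 fn_L2] L2_mult_integrable[OF fn_L2 L2_cnj[OF fn_L2]] fn_L2[of x]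
  by (auto simp: L2_functions_iff)

text \<open>The pairing is bilinear, as for distributions and in \<open>L2_to_S0_dual\<close>; the
  sesquilinear inner product is \<open>bil x (conjl y)\<close>.\<close>

definition bil :: "l2 \<Rightarrow> l2 \<Rightarrow> complex" where "bil x y = (\<integral>t. fn x t * fn y t \<partial>lborel)"
definition cscale :: "complex \<Rightarrow> l2 \<Rightarrow> l2" where "cscale \<alpha> x = cl (\<lambda>t. \<alpha> * fn x t)"
definition conjl :: "l2 \<Rightarrow> l2" where "conjl x = cl (\<lambda>t. cnj (fn x t))"

instantiation l2 :: "{real_vector, sgn_div_norm, dist_norm, uniformity_dist, open_uniformity}"
begin

definition zero_l2_def: "0 = cl (\<lambda>t. 0)"
definition plus_l2_def: "x + y = cl (\<lambda>t. fn x t + fn y t)"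
definition uminus_l2_def: "- x = cl (\<lambda>t. -1 * fn x t)"
definition minus_l2_def: "x - y = cl (\<lambda>t. fn x t - fn y t)"
definition scaleR_l2_def: "scaleR r x = cl (\<lambda>t. of_real r * fn x t)"
definition norm_l2_def: "norm x = sqrt (\<integral>t. (cmod (fn x t))\<^sup>2 \<partial>lborel)"
definition sgn_l2_def: "sgn x = scaleR (inverse (norm x)) (x :: l2)"
definition dist_l2_def: "dist x y = norm (x - y :: l2)"
definition uniformity_l2_def:
  "(uniformity :: (l2 \<times> l2) filter) = (INF e\<in>{0 <..}. principal {(x, y). dist x y < e})"
definition open_l2_def:
  "open (U :: l2 set) \<longleftrightarrow> (\<forall>x\<in>U. eventually (\<lambda>(x', y). x' = x \<longrightarrow> y \<in> U) uniformity)"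

lemma cl_add': "u \<in> L2_functions \<Longrightarrow> v \<in> L2_functions \<Longrightarrow> cl u + cl v = cl (\<lambda>t. u t + v t)"
  unfolding plus_l2_def using fn_cl[of u] fn_cl[of v] by (subst cl_eq_iff) (auto intro!: L2_add)

lemma cl_scaleR': "u \<in> L2_functions \<Longrightarrow> r *\<^sub>R cl u = cl (\<lambda>t. of_real r * u t)"
  unfolding scaleR_l2_def using fn_cl[of u] by (subst cl_eq_iff) (auto intro!: L2_scale)

lemma cl_uminus': "u \<in> L2_functions \<Longrightarrow> - cl u = cl (\<lambda>t. -1 * u t)"
  unfolding uminus_l2_def using fn_cl[of u] by (subst cl_eq_iff) (auto intro!: L2_scale L2_scale[where \<alpha> = "-1", simplified])

lemma cl_minus': "u \<in> L2_functions \<Longrightarrow> v \<in> L2_functions \<Longrightarrow> cl u - cl v = cl (\<lambda>t. u t - v t)"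
  unfolding minus_l2_def using fn_cl[of u] fn_cl[of v] by (subst cl_eq_iff) (auto intro!: L2_diff)

instance
proof
  fix x y z :: l2 and a b :: real
  obtain u v w where u: "u \<in> L2_functions" "x = cl u" and v: "v \<in> L2_functions" "y = cl v"
    and w: "w \<in> L2_functions" "z = cl w" using cl_cases[of x] cl_cases[of y] cl_cases[of z] by metis
  note r = cl_add' cl_scaleR' cl_uminus' cl_minus' L2_add L2_scale L2_diff u v w
  show "x + y + z = x + (y + z)" by (simp add: r add.assoc)
  show "x + y = y + x" by (simp add: r add.commute)
  show "0 + x = x" by (simp add: zero_l2_def r)
  show "- x + x = 0" by (simp only: zero_l2_def r) simp
  have "(\<lambda>t. - v t) \<in> L2_functions" using L2_scale[OF v(1), of "-1"] by simp
  then show "x - y = x + - y" by (simp add: r)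
  show "a *\<^sub>R (x + y) = a *\<^sub>R x + a *\<^sub>R y" by (simp add: r algebra_simps)
  show "(a + b) *\<^sub>R x = a *\<^sub>R x + b *\<^sub>R x" by (simp add: r algebra_simps)
  show "a *\<^sub>R b *\<^sub>R x = (a * b) *\<^sub>R x" by (simp add: r mult.assoc)
  show "1 *\<^sub>R x = x" by (simp add: r)
qed (rule sgn_l2_def dist_l2_def uniformity_l2_def open_l2_def)+

end

lemmas cl_simps = cl_add' cl_scaleR' cl_minus'

lemma fn_add: "AE t in lborel. fn (x + y) t = fn x t + fn y t"
  unfolding plus_l2_def by (intro fn_cl L2_add fn_L2)
lemma fn_cscale: "AE t in lborel. fn (cscale \<alpha> x) t = \<alpha> * fn x t"
  unfolding cscale_def by (intro fn_cl L2_scale fn_L2)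
lemma fn_conjl: "AE t in lborel. fn (conjl x) t = cnj (fn x t)"
  unfolding conjl_def by (intro fn_cl L2_cnj fn_L2)

lemma cl_cscale: "u \<in> L2_functions \<Longrightarrow> cscale \<alpha> (cl u) = cl (\<lambda>t. \<alpha> * u t)"
  unfolding cscale_def using fn_cl[of u] by (subst cl_eq_iff) (auto intro!: L2_scale)
lemma cl_conjl: "u \<in> L2_functions \<Longrightarrow> conjl (cl u) = cl (\<lambda>t. cnj (u t))"
  unfolding conjl_def using fn_cl[of u] by (subst cl_eq_iff) (auto intro!: L2_cnj)

lemma bil_cl:
  assumes "u \<in> L2_functions" "v \<in> L2_functions"
  shows "bil (cl u) (cl v) = (\<integral>t. u t * v t \<partial>lborel)"
proof -
  have [measurable]: "u \<in> borel_measurable borel" "v \<in> borel_measurable borel" using assms by auto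
  show ?thesis
    unfolding bil_def using fn_cl[OF assms(1)] fn_cl[OF assms(2)] by (intro integral_cong_AE) auto
qed

lemma bil_commute: "bil x y = bil y x"
  unfolding bil_def by (simp add: mult.commute)

lemma bil_add_left: "bil (x + y) z = bil x z + bil y z"
proof -
  have "bil (x + y) z = (\<integral>t. fn x t * fn z t + fn y t * fn z t \<partial>lborel)"
    unfolding bil_def using fn_add[of x y]
    by (intro integral_cong_AE) (auto simp: algebra_simps)
  then show ?thesis by (simp add: bil_def)
qed

lemma bil_cscale_left: "bil (cscale \<alpha> x) z = \<alpha> * bil x z"
proof -
  have "bil (cscale \<alpha> x) z = (\<integral>t. \<alpha> * (fn x t * fn z t) \<partial>lborel)"
    unfolding bil_def using fn_cscale[of \<alpha> x] by (intro integral_cong_AE) auto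
  then show ?thesis by (simp add: bil_def)
qed

lemma scaleR_cscale: "r *\<^sub>R x = cscale (of_real r) x"
  unfolding scaleR_l2_def cscale_def ..

lemma bil_add_right: "bil z (x + y) = bil z x + bil z y"
  and bil_cscale_right: "bil z (cscale \<alpha> x) = \<alpha> * bil z x"
  using bil_add_left bil_cscale_left bil_commute by metis+

lemma bil_conjl_self': "bil x (conjl x) = of_real (\<integral>t. (cmod (fn x t))\<^sup>2 \<partial>lborel)"
proof -
  have "bil x (conjl x) = (\<integral>t. complex_of_real ((cmod (fn x t))\<^sup>2) \<partial>lborel)"
    unfolding bil_def using fn_conjl[of x] by (intro integral_cong_AE) (auto simp: complex_mult_cnj cmod_power2)
  also have "\<dots> = of_real (\<integral>t. (cmod (fn x t))\<^sup>2 \<partial>lborel)" by (rule integral_complex_of_real)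
  finally show ?thesis .
qed

lemma conjl_cscale: "conjl (cscale \<alpha> x) = cscale (cnj \<alpha>) (conjl x)"
  and conjl_conjl [simp]: "conjl (conjl x) = x"
proof -
  obtain u where u: "u \<in> L2_functions" "x = cl u" using cl_cases[of x] by metis
  note r = cl_conjl cl_simps cl_cscale L2_cnj L2_scale u
  show "conjl (cscale \<alpha> x) = cscale (cnj \<alpha>) (conjl x)"
    "conjl (conjl x) = x" by (simp_all add: r)
qed

lemma bil_conjl_conjl: "bil (conjl x) (conjl y) = cnj (bil x y)"
proof -
  have "bil (conjl x) (conjl y) = (\<integral>t. cnj (fn x t * fn y t) \<partial>lborel)"
    unfolding bil_def using fn_conjl[of x] fn_conjl[of y] by (intro integral_cong_AE) auto
  also have "\<dots> = cnj (bil x y)"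
    unfolding bil_def by (rule integral_bounded_linear[OF bounded_linear_cnj fn_integrable(1)])
  finally show ?thesis .
qed

instantiation l2 :: real_inner
begin

text \<open>The type class is real, so only the real part is kept; the imaginary part is recovered
  by replacing \<open>y\<close> with its multiple by \<open>\<i>\<close>.\<close>

definition inner_l2_def: "inner x y = Re (bil x (conjl y))"

instance
proof
  fix x y z :: l2 and r :: real
  show "inner x y = inner y x"
    unfolding inner_l2_def using bil_conjl_conjl[of y "conjl x"] by (simp add: bil_commute)
  show "inner (x + y) z = inner x z + inner y z" by (simp add: inner_l2_def bil_add_left)
  show "inner (r *\<^sub>R x) y = r * inner x y" by (simp add: inner_l2_def scaleR_cscale bil_cscale_left)
  show "0 \<le> inner x x" by (simp add: inner_l2_def bil_conjl_self' Bochner_Integration.integral_nonneg)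
  show "norm x = sqrt (inner x x)"
    by (simp add: inner_l2_def bil_conjl_self' norm_l2_def)
  show "inner x x = 0 \<longleftrightarrow> x = 0"
  proof
    assume "inner x x = 0"
    then have "(\<integral>t. (cmod (fn x t))\<^sup>2 \<partial>lborel) = 0"
      by (simp add: inner_l2_def bil_conjl_self')
    then have "AE t in lborel. (cmod (fn x t))\<^sup>2 = 0"
      by (subst (asm) integral_nonneg_eq_0_iff_AE) auto
    then have "cl (fn x) = cl (\<lambda>t. 0)" by (subst cl_eq_iff) auto
    then show "x = 0" by (simp add: zero_l2_def)
  next
    assume "x = 0"
    have "bil 0 (conjl 0) = 0" using bil_cscale_left[of 0 0 "conjl 0"] bil_add_left[of 0 0 "conjl 0"] by simp
    then show "inner x x = 0" by (simp add: \<open>x = 0\<close> inner_l2_def)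
  qed
qed

end

lemma norm_l2_sq: "(norm x)\<^sup>2 = (\<integral>t. (cmod (fn x t))\<^sup>2 \<partial>lborel)" for x :: l2
  by (simp add: norm_l2_def Bochner_Integration.integral_nonneg)

lemma bil_conjl_self: "bil x (conjl x) = of_real ((norm x)\<^sup>2)"
  by (simp add: bil_conjl_self' norm_l2_sq)

lemma norm_cl:
  assumes "u \<in> L2_functions"
  shows "(norm (cl u))\<^sup>2 = (\<integral>t. (cmod (u t))\<^sup>2 \<partial>lborel)"
proof -
  have [measurable]: "u \<in> borel_measurable borel" using assms by auto
  show ?thesis unfolding norm_l2_sq using fn_cl[OF assms] by (intro integral_cong_AE) auto
qed

lemma norm_cscale: "norm (cscale \<alpha> x) = cmod \<alpha> * norm x" for x :: l2
proof -
  have "(norm (cscale \<alpha> x))\<^sup>2 = (\<integral>t. (cmod \<alpha>)\<^sup>2 * (cmod (fn x t))\<^sup>2 \<partial>lborel)"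
    unfolding norm_l2_sq using fn_cscale[of \<alpha> x]
    by (intro integral_cong_AE) (auto simp: norm_mult power_mult_distrib)
  then have "(norm (cscale \<alpha> x))\<^sup>2 = (cmod \<alpha> * norm x)\<^sup>2" by (simp add: norm_l2_sq power_mult_distrib)
  then show ?thesis by (subst (asm) power2_eq_iff_nonneg) auto
qed

lemma norm_conjl [simp]: "norm (conjl x) = norm x" for x :: l2
proof -
  have "(norm (conjl x))\<^sup>2 = (norm x)\<^sup>2"
    unfolding norm_l2_sq using fn_conjl[of x] by (intro integral_cong_AE) auto
  then show ?thesis by simp
qed

lemma cmod_bil_le: "cmod (bil x y) \<le> norm x * norm y"
proof (cases "bil x y = 0")
  case False
  \<comment> \<open>A unimodular factor that makes the pairing real and nonnegative, so that the
    real Cauchy-Schwarz inequality applies.\<close>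
  define \<alpha> where "\<alpha> = cnj (bil x y) / of_real (cmod (bil x y))"
  have "bil (cscale \<alpha> x) y = of_real (cmod (bil x y))"
    using False by (simp add: bil_cscale_left \<alpha>_def complex_norm_square[symmetric] power2_eq_square field_simps)
  then have "inner (cscale \<alpha> x) (conjl y) = cmod (bil x y)" by (simp add: inner_l2_def)
  moreover have "cmod \<alpha> = 1" using False by (simp add: \<alpha>_def norm_divide)
  ultimately show ?thesis using norm_cauchy_schwarz[of "cscale \<alpha> x" "conjl y"] by (simp add: norm_cscale)
qed simp

lemma bounded_bilinear_bil: "bounded_bilinear bil"
proof
  show "\<exists>K. \<forall>a b. norm (bil a b) \<le> norm a * norm b * K" using cmod_bil_le by (intro exI[of _ 1]) simp
qed (simp_all add: bil_add_left bil_add_right scaleR_cscale bil_cscale_left bil_cscale_right scaleR_conv_of_real)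

section \<open>Completeness of L2 and a density criterion\<close>

lemma integrable_inv_sq: "integrable lborel (\<lambda>t::real. 1 / (1 + t\<^sup>2))"
  using integrable_inverse_1_plus_square
  by (simp add: set_integrable_def einterval_def inverse_eq_divide)

lemma integrable_inv_sq_sq: "integrable lborel (\<lambda>t::real. (1 / (1 + t\<^sup>2))\<^sup>2)"
proof (rule Bochner_Integration.integrable_bound[OF integrable_inv_sq])
  show "AE t in lborel. norm ((1 / (1 + t\<^sup>2))\<^sup>2) \<le> norm (1 / (1 + t\<^sup>2 :: real))"
  proof (intro AE_I2)
    fix t :: real
    have "1 \<le> 1 + t\<^sup>2" by simp
    then have "(1 / (1 + t\<^sup>2)) * (1 / (1 + t\<^sup>2)) \<le> (1 / (1 + t\<^sup>2)) * 1"
      by (intro mult_left_mono) (auto simp: add_pos_nonneg)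
    then show "norm ((1 / (1 + t\<^sup>2))\<^sup>2) \<le> norm (1 / (1 + t\<^sup>2))" by (simp add: power2_eq_square abs_mult)
  qed
qed simp

text \<open>Riesz-Fischer: against the weight \<open>1 / (1 + t\<^sup>2)\<close> a rapidly converging sequence is absolutely
  summable in the mean, hence almost everywhere convergent.\<close>

lemma l2_rapid_limit:
  fixes X :: "nat \<Rightarrow> l2"
  assumes "\<And>k m. k \<le> m \<Longrightarrow> norm (X m - X k) < (1/2) ^ k"
  shows "\<exists>L. \<forall>k. norm (L - X k) \<le> (1/2) ^ k"
proof -
  define v where "v k = fn (X k)" for k
  define a where "a k t = cmod (v (Suc k) t - v k t)" for k t
  have vL: "v k \<in> L2_functions" for k by (simp add: v_def)
  have [measurable]: "v k \<in> borel_measurable borel" for k by (simp add: v_def)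
  have dL: "(\<lambda>t. v m t - v k t) \<in> L2_functions" for m k by (intro L2_diff vL)
  have nrm: "(\<integral>t. (cmod (v m t - v k t))\<^sup>2 \<partial>lborel) \<le> ((1/2) ^ k)\<^sup>2" if "k \<le> m" for m k
  proof -
    have "X m - X k = cl (\<lambda>t. v m t - v k t)" by (simp add: v_def minus_l2_def)
    then have "(\<integral>t. (cmod (v m t - v k t))\<^sup>2 \<partial>lborel) = (norm (X m - X k))\<^sup>2" by (simp add: norm_cl dL)
    also have "\<dots> \<le> ((1/2) ^ k)\<^sup>2" using assms[OF that] by (intro power_mono) auto
    finally show ?thesis .
  qed
  define w where "w t = 1 / (1 + t\<^sup>2)" for t :: real
  define W where "W = (\<integral>t. (w t)\<^sup>2 \<partial>lborel)"
  have wint: "integrable lborel (\<lambda>t. (w t)\<^sup>2)" using integrable_inv_sq_sq by (simp add: w_def)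
  have [measurable]: "w \<in> borel_measurable borel" unfolding w_def by measurable
  have wpos: "w t > 0" for t unfolding w_def by (simp add: add_pos_nonneg)
  have aint: "integrable lborel (\<lambda>t. (a k t)\<^sup>2)" for k using dL by (simp add: a_def L2_functions_iff)
  have [measurable]: "a k \<in> borel_measurable borel" for k unfolding a_def by measurable
  have a0: "0 \<le> a k t" for k t by (simp add: a_def)
  \<comment> \<open>The weights balance the two terms: the squared norm of the k-th increment is at
    most \<open>(1/4)^k\<close>, so both terms integrate to a multiple of \<open>(1/2)^k\<close>,
    which is summable.\<close>
  have amgm: "a k t * w t \<le> 2 ^ k * (a k t)\<^sup>2 + (1/2) ^ k * (w t)\<^sup>2" for k t
  proof -
    have "0 \<le> (2 ^ k * a k t - w t)\<^sup>2" "0 \<le> (2 ^ k * a k t) * w t" using a0 wpos[of t] by (auto intro: less_imp_le)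
    then have "(2 ^ k * a k t) * w t \<le> (2 ^ k * a k t)\<^sup>2 + (w t)\<^sup>2" unfolding power2_diff by linarith
    then have "(1/2) ^ k * ((2 ^ k * a k t) * w t) \<le> (1/2) ^ k * ((2 ^ k * a k t)\<^sup>2 + (w t)\<^sup>2)"
      by (rule mult_left_mono) simp
    moreover have "(1/2::real) ^ k * 2 ^ k = 1" by (simp add: power_mult_distrib[symmetric])
    ultimately show ?thesis by (simp add: power2_eq_square algebra_simps power_one_over)
  qed
  have "(\<integral>\<^sup>+t. ennreal (a k t * w t) \<partial>lborel) \<le> ennreal ((1/2) ^ k * (1 + W))" for k
  proof -
    have "(\<integral>\<^sup>+t. ennreal (a k t * w t) \<partial>lborel) \<le> (\<integral>\<^sup>+t. ennreal (2 ^ k * (a k t)\<^sup>2 + (1/2) ^ k * (w t)\<^sup>2) \<partial>lborel)"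
      by (intro nn_integral_mono ennreal_leI amgm)
    also have "\<dots> = ennreal (\<integral>t. 2 ^ k * (a k t)\<^sup>2 + (1/2) ^ k * (w t)\<^sup>2 \<partial>lborel)"
      using aint wint by (intro nn_integral_eq_integral) auto
    also have "(\<integral>t. 2 ^ k * (a k t)\<^sup>2 + (1/2) ^ k * (w t)\<^sup>2 \<partial>lborel) = 2 ^ k * (\<integral>t. (a k t)\<^sup>2 \<partial>lborel) + (1/2) ^ k * W"
      using aint wint by (simp add: W_def)
    also have "ennreal (2 ^ k * (\<integral>t. (a k t)\<^sup>2 \<partial>lborel) + (1/2) ^ k * W) \<le> ennreal ((1/2) ^ k * (1 + W))"
    proof (intro ennreal_leI)
      have "2 ^ k * (\<integral>t. (a k t)\<^sup>2 \<partial>lborel) \<le> 2 ^ k * ((1/2) ^ k)\<^sup>2"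
        using nrm[of k "Suc k"] by (intro mult_left_mono) (auto simp: a_def)
      also have "\<dots> = (1/2) ^ k" by (simp add: power2_eq_square power_one_over)
      finally show "2 ^ k * (\<integral>t. (a k t)\<^sup>2 \<partial>lborel) + (1/2) ^ k * W \<le> (1/2) ^ k * (1 + W)"
        by (simp add: algebra_simps)
    qed
    finally show ?thesis .
  qed
  then have "(\<Sum>k. \<integral>\<^sup>+t. ennreal (a k t * w t) \<partial>lborel) \<le> (\<Sum>k. ennreal ((1/2) ^ k * (1 + W)))"
    by (intro suminf_le) auto
  also have "\<dots> = ennreal (\<Sum>k. (1/2) ^ k * (1 + W))"
    by (intro suminf_ennreal2 summable_mult2) (auto simp: W_def Bochner_Integration.integral_nonneg intro!: add_nonneg_nonneg)
  also have "\<dots> < \<infinity>" by simp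
  finally have "(\<integral>\<^sup>+t. (\<Sum>k. ennreal (a k t * w t)) \<partial>lborel) \<noteq> \<infinity>"
    by (subst nn_integral_suminf) auto
  then have "AE t in lborel. (\<Sum>k. ennreal (a k t * w t)) \<noteq> \<infinity>"
    by (intro nn_integral_PInf_AE) auto
  then have conv: "AE t in lborel. convergent (\<lambda>k. v k t)"
  proof eventually_elim
    case (elim t)
    then have "summable (\<lambda>k. a k t * w t)"
      using a0 wpos by (intro summable_suminf_not_top) (simp_all add: zero_le_mult_iff less_imp_le)
    then have "summable (\<lambda>k. cmod (v (Suc k) t - v k t))"
      using summable_mult2[of "\<lambda>k. a k t * w t" "1 / w t"] wpos[of t]
      unfolding a_def[symmetric] by (simp add: less_imp_neq[symmetric])
    then have "summable (\<lambda>k. v (Suc k) t - v k t)" by (rule summable_norm_cancel)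
    moreover have "(\<Sum>i<n. v (Suc i) t - v i t) = v n t - v 0 t" for n by (induction n) auto
    ultimately have "convergent (\<lambda>n. v n t - v 0 t)" by (simp add: summable_iff_convergent)
    from convergent_add[OF this convergent_const[of "v 0 t"]] show "convergent (\<lambda>k. v k t)" by simp
  qed
  define u where "u t = lim (\<lambda>k. v k t)" for t
  have [measurable]: "u \<in> borel_measurable borel" unfolding u_def by measurable
  \<comment> \<open>Fatou's lemma in \<open>m\<close> carries the estimate for the increments to the
    pointwise limit \<open>u\<close>.\<close>
  have bound: "(\<integral>\<^sup>+t. ennreal ((cmod (u t - v k t))\<^sup>2) \<partial>lborel) \<le> ennreal (((1/2) ^ k)\<^sup>2)" for k
  proof -
    have "(\<integral>\<^sup>+t. ennreal ((cmod (u t - v k t))\<^sup>2) \<partial>lborel)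
        = (\<integral>\<^sup>+t. liminf (\<lambda>m. ennreal ((cmod (v m t - v k t))\<^sup>2)) \<partial>lborel)"
    proof (rule nn_integral_cong_AE)
      show "AE t in lborel. ennreal ((cmod (u t - v k t))\<^sup>2) = liminf (\<lambda>m. ennreal ((cmod (v m t - v k t))\<^sup>2))"
        using conv
      proof eventually_elim
        case (elim t)
        then have "(\<lambda>m. v m t) \<longlonglongrightarrow> u t" unfolding u_def by (simp add: convergent_LIMSEQ_iff)
        then have "(\<lambda>m. ennreal ((cmod (v m t - v k t))\<^sup>2)) \<longlonglongrightarrow> ennreal ((cmod (u t - v k t))\<^sup>2)"
          by (intro tendsto_intros)
        then show ?case by (intro lim_imp_Liminf[symmetric]) auto
      qed
    qed
    also have "\<dots> \<le> liminf (\<lambda>m. \<integral>\<^sup>+t. ennreal ((cmod (v m t - v k t))\<^sup>2) \<partial>lborel)"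
      by (rule nn_integral_liminf) measurable
    also have "\<dots> \<le> liminf (\<lambda>m. ennreal (((1/2) ^ k)\<^sup>2))"
    proof (rule Liminf_mono, rule eventually_sequentiallyI[of k])
      fix m assume "k \<le> m"
      have "(\<integral>\<^sup>+t. ennreal ((cmod (v m t - v k t))\<^sup>2) \<partial>lborel) = ennreal (\<integral>t. (cmod (v m t - v k t))\<^sup>2 \<partial>lborel)"
        using dL[of m k] by (intro nn_integral_eq_integral) (auto simp: L2_functions_iff)
      then show "(\<integral>\<^sup>+t. ennreal ((cmod (v m t - v k t))\<^sup>2) \<partial>lborel) \<le> ennreal (((1/2) ^ k)\<^sup>2)"
        using nrm[OF \<open>k \<le> m\<close>] by (simp add: ennreal_leI)
    qed
    finally show ?thesis by (simp add: Liminf_const)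
  qed
  have dint: "integrable lborel (\<lambda>t. (cmod (u t - v k t))\<^sup>2)" for k
    by (rule integrableI_nonneg) (use bound[of k] in \<open>auto simp: less_top[symmetric] top_unique intro: le_less_trans\<close>)
  then have duL: "(\<lambda>t. u t - v k t) \<in> L2_functions" for k by (simp add: L2_functions_iff)
  have uL: "u \<in> L2_functions" using L2_add[OF duL[of 0] vL[of 0]] by simp
  have "norm (cl u - X k) \<le> (1/2) ^ k" for k
  proof -
    have "cl u - X k = cl (\<lambda>t. u t - v k t)" using cl_minus'[OF uL vL[of k]] by (simp add: v_def)
    then have "(norm (cl u - X k))\<^sup>2 = (\<integral>t. (cmod (u t - v k t))\<^sup>2 \<partial>lborel)" by (simp add: norm_cl duL)
    also have "\<dots> \<le> ((1/2) ^ k)\<^sup>2"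
      using bound[of k] dint[of k] by (subst (asm) nn_integral_eq_integral) auto
    finally show ?thesis by (rule power2_le_imp_le) simp
  qed
  then show ?thesis by blast
qed

instance l2 :: complete_space
proof
  fix X :: "nat \<Rightarrow> l2" assume X: "Cauchy X"
  have "\<exists>M. \<forall>m\<ge>M. \<forall>n\<ge>M. norm (X m - X n) < (1/2) ^ k" for k :: nat
    using CauchyD[OF X, of "(1/2) ^ k"] by simp
  then obtain M where M: "\<And>k m n. m \<ge> M k \<Longrightarrow> n \<ge> M k \<Longrightarrow> norm (X m - X n) < (1/2) ^ k" by metis
  \<comment> \<open>The partial sums are monotone and dominate \<open>M\<close>, so
    \<open>X \<circ> r\<close> is rapidly Cauchy.\<close>
  define r where "r k = (\<Sum>i\<le>k. M i)" for k
  have rM: "M k \<le> r k" for k unfolding r_def by (rule member_le_sum) auto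
  have rmono: "r k \<le> r m" if "k \<le> m" for k m unfolding r_def using that by (intro sum_mono2) auto
  obtain L where L: "\<And>k. norm (L - X (r k)) \<le> (1/2) ^ k"
    using l2_rapid_limit[of "X \<circ> r"] M rM rmono by (metis comp_apply order_trans)
  have "X \<longlonglongrightarrow> L"
  proof (rule LIMSEQ_I)
    fix e :: real assume "0 < e"
    then obtain k where k: "(1/2) ^ k < e / 2" using real_arch_pow_inv[of "e / 2" "1/2"] by auto
    have "norm (X n - L) < e" if "n \<ge> M k" for n
    proof -
      have "norm (X n - L) \<le> norm (X n - X (r k)) + norm (X (r k) - L)" by (metis norm_diff_triangle_le order_refl)
      then show ?thesis using M[OF that rM[of k]] L[of k] k by (simp add: norm_minus_commute)
    qed
    then show "\<exists>no. \<forall>n\<ge>no. norm (X n - L) < e" by blast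
  qed
  then show "convergent X" by (rule convergentI)
qed

text \<open>The projection argument: a minimising sequence for the distance from \<open>u\<close> to
  \<open>S\<close> is Cauchy, its limit \<open>v\<close> lies in the closure, and
  \<open>u - v\<close> is orthogonal to \<open>S\<close>, hence zero.\<close>

lemma dense_if_orthogonal_trivial:
  fixes S :: "'a::{real_inner, complete_space} set"
  assumes S: "subspace S" and orth: "\<And>x. (\<And>s. s \<in> S \<Longrightarrow> inner x s = 0) \<Longrightarrow> x = 0"
  shows "closure S = UNIV"
proof -
  have "u \<in> closure S" for u
  proof -
    define d where "d = Inf ((\<lambda>s. (norm (u - s))\<^sup>2) ` S)"
    have S0: "0 \<in> S" using S by (rule subspace_0)
    have dle: "d \<le> (norm (u - s))\<^sup>2" if "s \<in> S" for s
      unfolding d_def using that by (intro cInf_lower bdd_belowI[of _ 0]) auto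
    have "\<exists>s\<in>S. (norm (u - s))\<^sup>2 < d + 1 / real (Suc n)" for n
    proof -
      have "Inf ((\<lambda>s. (norm (u - s))\<^sup>2) ` S) < d + 1 / real (Suc n)" unfolding d_def[symmetric] by simp
      from cInf_lessD[OF _ this] S0 show ?thesis by auto
    qed
    then obtain s where s: "\<And>n. s n \<in> S" "\<And>n. (norm (u - s n))\<^sup>2 < d + 1 / real (Suc n)" by metis
    have dist_s: "(norm (s n - s m))\<^sup>2 \<le> 2 / real (Suc n) + 2 / real (Suc m)" for n m
    proof -
      have mid: "(1/2) *\<^sub>R (s n + s m) \<in> S" using S s(1) by (simp add: subspace_add subspace_scale)
      \<comment> \<open>The parallelogram law; the midpoint lies in \<open>S\<close>, so its
        distance to \<open>u\<close> is at least the infimum.\<close>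
      have "(norm (s n - s m))\<^sup>2 + 4 * (norm (u - (1/2) *\<^sub>R (s n + s m)))\<^sup>2 = 2 * (norm (u - s n))\<^sup>2 + 2 * (norm (u - s m))\<^sup>2"
        by (simp add: power2_norm_eq_inner inner_diff_left inner_diff_right inner_add_left inner_add_right inner_commute algebra_simps)
      then show ?thesis using dle[OF mid] s(2)[of n] s(2)[of m] by simp
    qed
    have "Cauchy s"
    proof (rule CauchyI)
      fix e :: real assume e: "0 < e"
      obtain N where N: "4 / e\<^sup>2 < real N" using reals_Archimedean2 by blast
      have "norm (s m - s n) < e" if "m \<ge> N" "n \<ge> N" for m n
      proof -
        have "1 / real (Suc k) < e\<^sup>2 / 4" if "k \<ge> N" for k
        proof -
          have "4 / e\<^sup>2 < real (Suc k)" using N that by simp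
          then show ?thesis using e by (simp add: field_simps)
        qed
        from this[OF that(1)] this[OF that(2)] have "(norm (s m - s n))\<^sup>2 < e\<^sup>2" using dist_s[of m n] by simp
        then show ?thesis using e by (intro power2_less_imp_less[of _ e]) auto
      qed
      then show "\<exists>M. \<forall>m\<ge>M. \<forall>n\<ge>M. norm (s m - s n) < e" by blast
    qed
    then obtain v where v: "s \<longlonglongrightarrow> v" using Cauchy_convergent convergent_def by blast
    have v_cl: "v \<in> closure S" unfolding closure_sequential using s(1) v by blast
    have lim: "(\<lambda>n. (norm (u - s n))\<^sup>2) \<longlonglongrightarrow> (norm (u - v))\<^sup>2" by (intro tendsto_intros v)
    have "(\<lambda>n. d + 1 / real (Suc n)) \<longlonglongrightarrow> d + 0" by (intro tendsto_intros LIMSEQ_Suc[OF lim_1_over_n])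
    then have uv: "(norm (u - v))\<^sup>2 \<le> d" 
      using s(2) by (intro LIMSEQ_le[OF lim]) (auto intro: less_imp_le)
    have "inner (u - v) h = 0" if h: "h \<in> S" for h
    proof -
      have ge: "(norm (u - v))\<^sup>2 \<le> (norm (u - v - r *\<^sub>R h))\<^sup>2" for r
      proof -
        have "(\<lambda>n. (norm (u - (s n + r *\<^sub>R h)))\<^sup>2) \<longlonglongrightarrow> (norm (u - (v + r *\<^sub>R h)))\<^sup>2" by (intro tendsto_intros v)
        moreover have "d \<le> (norm (u - (s n + r *\<^sub>R h)))\<^sup>2" for n
          using S s(1) h by (intro dle) (simp add: subspace_add subspace_scale)
        ultimately have d_le: "d \<le> (norm (u - (v + r *\<^sub>R h)))\<^sup>2" by (intro LIMSEQ_le_const) auto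
        have eq: "u - v - r *\<^sub>R h = u - (v + r *\<^sub>R h)" by simp
        show ?thesis unfolding eq using uv d_le by linarith
      qed
      have "2 * r * inner (u - v) h \<le> r\<^sup>2 * (norm h)\<^sup>2" for r
      proof -
        have "(norm (u - v - r *\<^sub>R h))\<^sup>2 = (norm (u - v))\<^sup>2 - 2 * r * inner (u - v) h + r\<^sup>2 * (norm h)\<^sup>2"
          unfolding power2_norm_eq_inner inner_diff_left[of "u - v" "r *\<^sub>R h"] inner_diff_right[of _ "u - v" "r *\<^sub>R h"]
          by (simp add: inner_commute power2_eq_square algebra_simps)
        then show ?thesis using ge[of r] by simp
      qed
      \<comment> \<open>This value of \<open>r\<close> minimises the quadratic, and the inequality
        then forces twice a square to be at most that square.\<close>
      from this[of "inner (u - v) h / (norm h)\<^sup>2"] show ?thesis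
        by (cases "h = 0") (auto simp: power2_eq_square field_simps mult_le_0_iff)
    qed
    then have "u - v = 0" by (rule orth)
    then show ?thesis using v_cl by simp
  qed
  then show ?thesis by blast
qed

text \<open>Closure of \<open>S\<close> under complex scalars lets real orthogonality to
  \<open>s\<close> and to its multiple by \<open>\<i>\<close> give complex orthogonality.\<close>

lemma l2_dense:
  fixes S :: "l2 set"
  assumes "0 \<in> S" "\<And>x y. x \<in> S \<Longrightarrow> y \<in> S \<Longrightarrow> x + y \<in> S" "\<And>\<alpha> x. x \<in> S \<Longrightarrow> cscale \<alpha> x \<in> S"
    and orth: "\<And>x. (\<And>s. s \<in> S \<Longrightarrow> bil x (conjl s) = 0) \<Longrightarrow> x = 0"
  shows "closure S = UNIV"
proof (rule dense_if_orthogonal_trivial)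
  show "subspace S" using assms(1-3) by (auto simp: subspace_def scaleR_cscale)
  fix x assume 0: "\<And>s. s \<in> S \<Longrightarrow> inner x s = 0"
  have "bil x (conjl s) = 0" if s: "s \<in> S" for s
  proof (rule complex_eqI)
    show "Re (bil x (conjl s)) = Re 0" using 0[OF s] by (simp add: inner_l2_def)
    show "Im (bil x (conjl s)) = Im 0" using 0[OF assms(3)[OF s, of "\<i>"]]
      by (simp add: inner_l2_def conjl_cscale bil_cscale_right)
  qed
  then show "x = 0" by (rule orth)
qed

lemma cscale_simps:
  "cscale \<alpha> (x + y) = cscale \<alpha> x + cscale \<alpha> y" "cscale (\<alpha> + \<beta>) x = cscale \<alpha> x + cscale \<beta> x"
  "cscale (\<alpha> * \<beta>) x = cscale \<alpha> (cscale \<beta> x)" "cscale 1 x = x" "cscale (-1) x = - x"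
proof -
  obtain u v where u: "u \<in> L2_functions" "x = cl u" and v: "v \<in> L2_functions" "y = cl v"
    using cl_cases[of x] cl_cases[of y] by metis
  note r = cl_simps cl_cscale L2_add L2_scale u v
  show "cscale \<alpha> (x + y) = cscale \<alpha> x + cscale \<alpha> y" "cscale (\<alpha> + \<beta>) x = cscale \<alpha> x + cscale \<beta> x"
    "cscale (\<alpha> * \<beta>) x = cscale \<alpha> (cscale \<beta> x)" "cscale 1 x = x" "cscale (-1) x = - x"
    by (simp_all add: r algebra_simps cl_uminus' del: mult_minus1)
qed

subsection \<open>The concrete Hilbert space\<close>

text \<open>The dictionary between the space with explicit carrier and the type \<open>l2\<close>;
  the later statements about \<open>L2_space\<close> are proved on the type and transported by
  \<open>Rep_l2\<close>.\<close>

lemma L2_space_Rep: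
  "vcarrier L2_space = range Rep_l2"
  "vzero L2_space = Rep_l2 0"
  "vadd L2_space (Rep_l2 x) (Rep_l2 y) = Rep_l2 (x + y)"
  "vscale L2_space \<alpha> (Rep_l2 x) = Rep_l2 (cscale \<alpha> x)"
  "vnorm L2_space (Rep_l2 x) = norm x"
  "vinner L2_space (Rep_l2 x) (Rep_l2 y) = bil x (conjl y)"
proof -
  show "vcarrier L2_space = range Rep_l2"
    unfolding L2_space_def using type_definition.Rep_range[OF type_definition_l2] by simp
  show "vzero L2_space = Rep_l2 0" by (simp add: L2_space_def zero_l2_def Rep_cl)
  show "vadd L2_space (Rep_l2 x) (Rep_l2 y) = Rep_l2 (x + y)"
    by (simp add: L2_space_def plus_l2_def Rep_cl L2_add flip: fn_def)
  show "vscale L2_space \<alpha> (Rep_l2 x) = Rep_l2 (cscale \<alpha> x)"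
    by (simp add: L2_space_def cscale_def Rep_cl L2_scale flip: fn_def)
  show "vnorm L2_space (Rep_l2 x) = norm x" by (simp add: L2_space_def norm_l2_def flip: fn_def)
  have "vinner L2_space (Rep_l2 x) (Rep_l2 y) = (\<integral>t. fn x t * cnj (fn y t) \<partial>lborel)"
    by (simp add: L2_space_def flip: fn_def)
  also have "\<dots> = bil x (conjl y)"
    unfolding bil_def using fn_conjl[of y] by (intro integral_cong_AE) auto
  finally show "vinner L2_space (Rep_l2 x) (Rep_l2 y) = bil x (conjl y)" .
qed

lemma complex_normed_space_L2: "complex_normed_space L2_space"
proof -
  have 0: "Rep_l2 x = Rep_l2 0 \<longleftrightarrow> x = 0" for x by (simp add: Rep_l2_inject)
  show ?thesis
    unfolding complex_normed_space_def L2_space_Rep(1)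
    by (auto simp: L2_space_Rep cscale_simps add_ac norm_cscale 0 norm_triangle_ineq)
qed

lemma vdist_L2 [simp]: "vdist L2_space (Rep_l2 x) (Rep_l2 y) = dist x y"
  by (simp add: vdist_def L2_space_Rep cscale_simps dist_norm)

lemma complex_hilbert_space_L2: "complex_hilbert_space L2_space"
proof -
  interpret cnspace L2_space by unfold_locales (rule complex_normed_space_L2)
  have "M.mcomplete"
    unfolding M.mcomplete_def
  proof (intro allI impI)
    fix \<sigma> :: "nat \<Rightarrow> _" assume \<sigma>: "M.MCauchy \<sigma>"
    then have "range \<sigma> \<subseteq> range Rep_l2" unfolding M.MCauchy_def by (simp add: L2_space_Rep(1))
    then have "\<forall>n. \<exists>x. \<sigma> n = Rep_l2 x" by auto
    then obtain X where X: "\<sigma> = (\<lambda>n. Rep_l2 (X n))" by metis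
    have "Cauchy X"
    proof (rule metric_CauchyI)
      fix e :: real assume "0 < e"
      then show "\<exists>M. \<forall>m\<ge>M. \<forall>n\<ge>M. dist (X m) (X n) < e"
        using \<sigma> unfolding M.MCauchy_def X by simp
    qed
    then obtain L where L: "X \<longlonglongrightarrow> L" using Cauchy_convergent convergent_def by blast
    have "limitin M.mtopology \<sigma> (Rep_l2 L) sequentially"
      unfolding M.limitin_metric X using tendstoD[OF L] by (simp add: L2_space_Rep(1))
    then show "\<exists>x. limitin M.mtopology \<sigma> x sequentially" by blast
  qed
  then have "complex_banach_space L2_space"
    by (simp add: complex_banach_space_def complex_normed_space_L2)
  have herm: "bil y (conjl x) = cnj (bil x (conjl y))" for x y
    by (metis bil_commute bil_conjl_conjl conjl_conjl)
  show ?thesis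
    unfolding complex_hilbert_space_def L2_space_Rep(1)
    by (intro conjI \<open>complex_banach_space L2_space\<close>)
      (auto simp: L2_space_Rep bil_add_left bil_cscale_left bil_conjl_self intro: herm)
qed

section \<open>The Fourier transform on the real line\<close>

definition ft :: "(real \<Rightarrow> complex) \<Rightarrow> real \<Rightarrow> complex" where
  "ft u \<xi> = (\<integral>t. u t * cis (- 2 * pi * \<xi> * t) \<partial>lborel)"

lemma borel_measurable_cis [measurable (raw)]:
  "f \<in> borel_measurable M \<Longrightarrow> (\<lambda>x. cis (f x)) \<in> borel_measurable M"
  by (rule borel_measurable_continuous_on[OF continuous_on_cis[OF continuous_on_id]])

lemma tendsto_cis: "(f \<longlongrightarrow> a) F \<Longrightarrow> ((\<lambda>x. cis (f x)) \<longlongrightarrow> cis a) F"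
  unfolding cis_conv_exp by (intro tendsto_intros)

lemma integrable_mult_cis:
  assumes "integrable lborel u" "f \<in> borel_measurable borel"
  shows "integrable lborel (\<lambda>t. u t * cis (f t))"
  by (rule Bochner_Integration.integrable_bound[OF assms(1)]) (use assms in \<open>auto simp: norm_mult\<close>)

lemma integrable_mult_bounded:
  fixes u m :: "real \<Rightarrow> complex"
  assumes u: "integrable lborel u" and m: "m \<in> borel_measurable borel" and K: "\<And>t. cmod (m t) \<le> K"
  shows "integrable lborel (\<lambda>t. u t * m t)"
proof (rule Bochner_Integration.integrable_bound)
  show "integrable lborel (\<lambda>t. K * cmod (u t))" using u by simp
  show "(\<lambda>t. u t * m t) \<in> borel_measurable lborel" using u m by measurable
  have "cmod (u t * m t) \<le> \<bar>K * cmod (u t)\<bar>" for t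
    using mult_right_mono[OF K[of t], of "cmod (u t)"] by (simp add: norm_mult mult.commute)
  then show "AE t in lborel. norm (u t * m t) \<le> norm (K * cmod (u t))" by simp
qed

lemma ft_integrable [simp]: "integrable lborel u \<Longrightarrow> integrable lborel (\<lambda>t. u t * cis (- 2 * pi * \<xi> * t))"
  by (rule integrable_mult_cis) measurable

lemma cmod_ft_le: "cmod (ft u \<xi>) \<le> (\<integral>t. cmod (u t) \<partial>lborel)"
proof -
  have "cmod (ft u \<xi>) \<le> (\<integral>t. cmod (u t * cis (- 2 * pi * \<xi> * t)) \<partial>lborel)"
    unfolding ft_def by (rule integral_norm_bound)
  then show ?thesis by (simp add: norm_mult)
qed

text \<open>The set where the functions differ is open and null, hence empty.\<close>

lemma AE_eq_isCont:
  fixes f g :: "real \<Rightarrow> complex"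
  assumes "\<And>t. isCont f t" "\<And>t. isCont g t" "AE t in lborel. f t = g t"
  shows "f t = g t"
proof -
  let ?S = "{t. f t \<noteq> g t}"
  have c: "continuous_on UNIV f" "continuous_on UNIV g" using assms(1,2) by (simp_all add: continuous_on_eq_continuous_at)
  then have "open ?S" by (rule open_Collect_neq)
  then have "?S \<in> null_sets lborel" using assms(3) by (simp add: AE_iff_null_sets)
  then have "negligible ?S" by (simp add: negligible_iff_null_sets null_sets_completionI)
  then have "?S = {}" using open_not_negligible \<open>open ?S\<close> by blast
  then show ?thesis by blast
qed

lemma isCont_ft:
  assumes u: "integrable lborel u" shows "isCont (ft u) \<xi>"
  unfolding continuous_at_sequentially
proof safe
  fix X assume X: "X \<longlonglongrightarrow> \<xi>"
  have [measurable]: "u \<in> borel_measurable borel" using borel_measurable_integrable[OF u] by simp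
  show "(ft u \<circ> X) \<longlonglongrightarrow> ft u \<xi>"
    unfolding comp_def ft_def
  proof (rule integral_dominated_convergence[where w = "\<lambda>t. cmod (u t)"])
    show "AE t in lborel. (\<lambda>i. u t * cis (- 2 * pi * X i * t)) \<longlonglongrightarrow> u t * cis (- 2 * pi * \<xi> * t)"
      by (intro AE_I2 tendsto_intros tendsto_cis X)
  qed (use u in \<open>auto simp: norm_mult\<close>)
qed

lemma ft_measurable: "integrable lborel u \<Longrightarrow> ft u \<in> borel_measurable borel"
  by (intro borel_measurable_continuous_onI) (auto simp: continuous_on_eq_continuous_at isCont_ft)

lemma ft_shift:
  assumes "integrable lborel u"
  shows "ft (\<lambda>t. u t * cis (2 * pi * a * t)) \<xi> = ft u (\<xi> - a)"
    and "ft (\<lambda>t. u (t - x)) \<xi> = cis (- 2 * pi * \<xi> * x) * ft u \<xi>"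
    and "ft (\<lambda>t. u (- t)) \<xi> = ft u (- \<xi>)"
    and "ft (\<lambda>t. cnj (u t)) \<xi> = cnj (ft u (- \<xi>))"
proof -
  show "ft (\<lambda>t. u t * cis (2 * pi * a * t)) \<xi> = ft u (\<xi> - a)"
    unfolding ft_def by (simp add: mult.assoc cis_mult algebra_simps)
  have "ft (\<lambda>t. u (t - x)) \<xi> = (\<integral>t. u t * cis (- 2 * pi * \<xi> * (t + x)) \<partial>lborel)"
    unfolding ft_def by (subst lborel_integral_real_affine[where c = 1 and t = x]) (auto simp: add.commute)
  also have "\<dots> = (\<integral>t. cis (- 2 * pi * \<xi> * x) * (u t * cis (- 2 * pi * \<xi> * t)) \<partial>lborel)"
  proof (intro Bochner_Integration.integral_cong refl)
    fix t
    have "cis (- 2 * pi * \<xi> * (t + x)) = cis (- 2 * pi * \<xi> * x) * cis (- 2 * pi * \<xi> * t)"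
      by (simp add: cis_mult algebra_simps)
    then show "u t * cis (- 2 * pi * \<xi> * (t + x)) = cis (- 2 * pi * \<xi> * x) * (u t * cis (- 2 * pi * \<xi> * t))"
      by simp
  qed
  finally show "ft (\<lambda>t. u (t - x)) \<xi> = cis (- 2 * pi * \<xi> * x) * ft u \<xi>" by (simp add: ft_def)
  show "ft (\<lambda>t. u (- t)) \<xi> = ft u (- \<xi>)"
    unfolding ft_def by (subst lborel_integral_real_affine[where c = "-1" and t = 0]) auto
  have "ft (\<lambda>t. cnj (u t)) \<xi> = (\<integral>t. cnj (u t * cis (- 2 * pi * (- \<xi>) * t)) \<partial>lborel)"
    unfolding ft_def by (simp add: cis_cnj)
  also have "\<dots> = cnj (ft u (- \<xi>))"
    unfolding ft_def by (rule integral_bounded_linear[OF bounded_linear_cnj ft_integrable[OF assms]])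
  finally show "ft (\<lambda>t. cnj (u t)) \<xi> = cnj (ft u (- \<xi>))" .
qed

text \<open>The multiplication formula: the transform is symmetric for the bilinear pairing. It
  serves as the definition of the Fourier operator on L2 below.\<close>

lemma ft_fubini:
  assumes u: "integrable lborel u" and v: "integrable lborel v"
  shows "(\<integral>t. ft u t * v t \<partial>lborel) = (\<integral>t. u t * ft v t \<partial>lborel)"
proof -
  have [measurable]: "u \<in> borel_measurable borel" "v \<in> borel_measurable borel"
    using u v by (auto dest: borel_measurable_integrable)
  have "integrable (lborel \<Otimes>\<^sub>M lborel) (case_prod (\<lambda>s t. u s * v t * cis (- 2 * pi * s * t)))"
  proof (rule lborel_pair.Fubini_integrable)
    show "case_prod (\<lambda>s t. u s * v t * cis (- 2 * pi * s * t)) \<in> borel_measurable (lborel \<Otimes>\<^sub>M lborel)" by measurable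
    show "integrable lborel (\<lambda>x. \<integral>y. norm (case (x, y) of (s, t) \<Rightarrow> u s * v t * cis (- 2 * pi * s * t)) \<partial>lborel)"
      using u v by (simp add: norm_mult)
    show "AE x in lborel. integrable lborel (\<lambda>y. case (x, y) of (s, t) \<Rightarrow> u s * v t * cis (- 2 * pi * s * t))"
      using v by (auto intro!: integrable_mult_cis)
  qed
  from lborel_pair.Fubini_integral[OF this]
  have "(\<integral>t. (\<integral>s. u s * v t * cis (- 2 * pi * s * t) \<partial>lborel) \<partial>lborel)
      = (\<integral>s. (\<integral>t. u s * v t * cis (- 2 * pi * s * t) \<partial>lborel) \<partial>lborel)" .
  moreover have "(\<integral>s. u s * v t * cis (- 2 * pi * s * t) \<partial>lborel) = ft u t * v t" for t
    unfolding ft_def integral_mult_left_zero[symmetric]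
    by (intro Bochner_Integration.integral_cong refl) (simp add: mult_ac)
  moreover have "(\<integral>t. u s * v t * cis (- 2 * pi * s * t) \<partial>lborel) = u s * ft v s" for s
    unfolding ft_def integral_mult_right_zero[symmetric] by (simp add: mult_ac)
  ultimately show ?thesis by simp
qed

lemma ft_diff: "integrable lborel u \<Longrightarrow> integrable lborel v \<Longrightarrow> ft (\<lambda>t. u t - v t) \<xi> = ft u \<xi> - ft v \<xi>"
  and ft_add: "integrable lborel u \<Longrightarrow> integrable lborel v \<Longrightarrow> ft (\<lambda>t. u t + v t) \<xi> = ft u \<xi> + ft v \<xi>"
  and ft_scale: "ft (\<lambda>t. \<alpha> * u t) \<xi> = \<alpha> * ft u \<xi>"
proof -
  show "ft (\<lambda>t. \<alpha> * u t) \<xi> = \<alpha> * ft u \<xi>" unfolding ft_def by (simp add: mult.assoc)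
  assume i: "integrable lborel u" "integrable lborel v"
  note i' = ft_integrable[OF i(1), of \<xi>] ft_integrable[OF i(2), of \<xi>]
  show "ft (\<lambda>t. u t - v t) \<xi> = ft u \<xi> - ft v \<xi>"
    unfolding ft_def left_diff_distrib by (rule Bochner_Integration.integral_diff[OF i'])
  show "ft (\<lambda>t. u t + v t) \<xi> = ft u \<xi> + ft v \<xi>"
    unfolding ft_def distrib_right by (rule Bochner_Integration.integral_add[OF i'])
qed

subsection \<open>Uniqueness\<close>

text \<open>The positive and negative parts of \<open>w\<close> have equal mass and equal
  characteristic functions; normalised to probability densities they coincide by Levy's uniqueness
  theorem.\<close>

lemma ft_eq_0_real:
  fixes w :: "real \<Rightarrow> real"
  assumes w: "integrable lborel w" and 0: "\<And>\<xi>. ft (\<lambda>t. of_real (w t)) \<xi> = 0"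
  shows "AE t in lborel. w t = 0"
proof -
  define p where "p t = max 0 (w t)" for t
  define n where "n t = max 0 (- w t)" for t
  have pn: "p t - n t = w t" "p t \<ge> 0" "n t \<ge> 0" for t by (auto simp: p_def n_def)
  have pint: "integrable lborel p" and nint: "integrable lborel n"
    unfolding p_def n_def using w by auto
  have [measurable]: "p \<in> borel_measurable borel" "n \<in> borel_measurable borel"
    using pint nint by (auto dest: borel_measurable_integrable)
  have char_eq: "(\<integral>t. p t *\<^sub>R cis (s * t) \<partial>lborel) = (\<integral>t. n t *\<^sub>R cis (s * t) \<partial>lborel)" for s
  proof -
    have i: "integrable lborel (\<lambda>t. p t *\<^sub>R cis (s * t))" "integrable lborel (\<lambda>t. n t *\<^sub>R cis (s * t))"
      using integrable_mult_cis[of "\<lambda>t. of_real (p t)" "\<lambda>t. s * t"] integrable_mult_cis[of "\<lambda>t. of_real (n t)" "\<lambda>t. s * t"]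
        pint nint by (auto simp: scaleR_conv_of_real)
    have "(\<integral>t. p t *\<^sub>R cis (s * t) \<partial>lborel) - (\<integral>t. n t *\<^sub>R cis (s * t) \<partial>lborel)
        = (\<integral>t. p t *\<^sub>R cis (s * t) - n t *\<^sub>R cis (s * t) \<partial>lborel)" using i by simp
    \<comment> \<open>The probabilistic convention \<open>cis (s * t)\<close> corresponds to the
      frequency \<open>- s / (2 * pi)\<close>.\<close>
    also have "\<dots> = ft (\<lambda>t. of_real (w t)) (- s / (2 * pi))"
      unfolding ft_def by (intro Bochner_Integration.integral_cong refl) (simp add: scaleR_conv_of_real left_diff_distrib pn(1)[symmetric])
    finally show ?thesis using 0 by simp
  qed
  define m where "m = (\<integral>t. p t \<partial>lborel)"
  have mn: "m = (\<integral>t. n t \<partial>lborel)"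
  proof -
    have "complex_of_real m = of_real (\<integral>t. n t \<partial>lborel)"
      using char_eq[of 0] by (simp add: m_def scaleR_conv_of_real)
    then show ?thesis by (simp only: of_real_eq_iff)
  qed
  have m0: "m \<ge> 0" unfolding m_def by (intro Bochner_Integration.integral_nonneg pn)
  show ?thesis
  \<comment> \<open>With zero mass there is nothing to normalise, and both parts vanish almost
    everywhere.\<close>
  proof (cases "m = 0")
    case True
    have "(\<integral>t. p t \<partial>lborel) = 0" "(\<integral>t. n t \<partial>lborel) = 0"
      using True mn by (simp_all add: m_def)
    then have "AE t in lborel. p t = 0" "AE t in lborel. n t = 0"
      using integral_nonneg_eq_0_iff_AE[OF pint] integral_nonneg_eq_0_iff_AE[OF nint] pn by simp_all
    then show ?thesis by eventually_elim (use pn(1) in \<open>metis diff_self\<close>)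
  next
    case False
    then have m: "m > 0" using m0 by simp
    define M :: "(real \<Rightarrow> real) \<Rightarrow> real measure" where "M f = density lborel (\<lambda>t. ennreal (f t / m))" for f
    have rd: "real_distribution (M f)"
      if [measurable]: "f \<in> borel_measurable borel" and f: "integrable lborel f" "\<And>t. f t \<ge> 0" "(\<integral>t. f t \<partial>lborel) = m" for f
    proof -
      have "emeasure (M f) (space (M f)) = (\<integral>\<^sup>+t. ennreal (f t / m) \<partial>lborel)"
        unfolding M_def by (subst emeasure_density) auto
      also have "\<dots> = ennreal (\<integral>t. f t / m \<partial>lborel)" using f m by (intro nn_integral_eq_integral) auto
      also have "\<dots> = 1" using f m by simp
      finally have "prob_space (M f)" by (rule prob_spaceI)
      then show ?thesis
        unfolding real_distribution_def real_distribution_axioms_def by (simp add: M_def)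
    qed
    have ch: "char (M f) s = (\<integral>t. f t *\<^sub>R cis (s * t) \<partial>lborel) / of_real m"
      if [measurable]: "f \<in> borel_measurable borel" and f: "\<And>t. f t \<ge> 0" for f s
    proof -
      have "char (M f) s = (\<integral>t. (f t / m) *\<^sub>R cis (s * t) \<partial>lborel)"
        unfolding char_def M_def using f m by (subst integral_density) (auto simp: cis_conv_exp)
      also have "\<dots> = (\<integral>t. (f t *\<^sub>R cis (s * t)) / of_real m \<partial>lborel)"
        by (intro Bochner_Integration.integral_cong refl) (simp add: scaleR_conv_of_real)
      finally show ?thesis by simp
    qed
    have "M p = M n"
      by (rule Levy_uniqueness[OF rd rd]) (use pint nint pn mn in \<open>auto simp: m_def ch char_eq fun_eq_iff\<close>)
    then have "AE t in lborel. ennreal (p t / m) = ennreal (n t / m)"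
      unfolding M_def by (intro sigma_finite_measure.density_unique[OF sigma_finite_lborel]) auto
    then show ?thesis
    proof eventually_elim
      case (elim t)
      then have "p t / m = n t / m" using pn m by (simp add: ennreal_inj)
      then show ?case using m pn(1)[of t] by simp
    qed
  qed
qed

text \<open>The transform of the conjugate is the reflected conjugate of the transform and vanishes
  too; hence so do the transforms of the real and imaginary parts.\<close>

lemma ft_eq_0:
  assumes w: "integrable lborel w" and 0: "\<And>\<xi>. ft w \<xi> = 0"
  shows "AE t in lborel. w t = 0"
proof -
  have c: "ft (\<lambda>t. cnj (w t)) \<xi> = 0" for \<xi> using ft_shift(4)[OF w] 0 by simp
  have wc: "integrable lborel (\<lambda>t. cnj (w t))" using w by simp
  have "ft (\<lambda>t. of_real (Re (w t))) \<xi> = 0" for \<xi>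
  proof -
    have "of_real (Re (w t)) = (1/2) * (w t + cnj (w t))" for t by (simp add: complex_eq_iff)
    then show ?thesis using w wc by (simp only: ft_scale ft_add 0 c) simp
  qed
  then have r: "AE t in lborel. Re (w t) = 0" using w by (intro ft_eq_0_real) auto
  have "ft (\<lambda>t. of_real (Im (w t))) \<xi> = 0" for \<xi>
  proof -
    have "of_real (Im (w t)) = (1/(2*\<i>)) * (w t - cnj (w t))" for t by (simp add: complex_eq_iff)
    then show ?thesis using w wc by (simp only: ft_scale ft_diff 0 c) simp
  qed
  then have "AE t in lborel. Im (w t) = 0" using w by (intro ft_eq_0_real) auto
  with r show ?thesis by eventually_elim (simp add: complex_eq_iff)
qed

subsection \<open>Differentiation and the Fourier transform\<close>

text \<open>Derivatives as limits along sequences, the form in which dominated convergence can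
  produce them.\<close>

lemma has_vector_derivative_seq_iff:
  fixes f :: "real \<Rightarrow> complex"
  shows "(f has_vector_derivative D) (at x) \<longleftrightarrow>
    (\<forall>h. (\<forall>n::nat. h n \<noteq> 0) \<longrightarrow> h \<longlonglongrightarrow> 0 \<longrightarrow> (\<lambda>n. (f (x + h n) - f x) /\<^sub>R h n) \<longlonglongrightarrow> D)"
proof -
  have eq: "norm (f (x + y) - f x - y *\<^sub>R D) / norm y = norm ((f (x + y) - f x) /\<^sub>R y - D)" if "y \<noteq> 0" for y
  proof -
    have "(f (x + y) - f x) /\<^sub>R y - D = (f (x + y) - f x - y *\<^sub>R D) /\<^sub>R y"
      using that by (simp add: scaleR_diff_right)
    then show ?thesis by (simp add: divide_inverse mult.commute)
  qed
  have "(f has_vector_derivative D) (at x) \<longleftrightarrow> (\<lambda>y. norm (f (x + y) - f x - y *\<^sub>R D) / norm y) \<midarrow>0\<rightarrow> 0"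
    unfolding has_vector_derivative_def has_derivative_at by (simp add: bounded_linear_scaleR_left)
  also have "\<dots> \<longleftrightarrow> (\<forall>h. (\<forall>n::nat. h n \<noteq> 0) \<longrightarrow> h \<longlonglongrightarrow> 0 \<longrightarrow>
      (\<lambda>n. norm (f (x + h n) - f x - h n *\<^sub>R D) / norm (h n)) \<longlonglongrightarrow> 0)"
    unfolding tendsto_at_iff_sequentially comp_def by simp
  also have "\<dots> \<longleftrightarrow> (\<forall>h. (\<forall>n::nat. h n \<noteq> 0) \<longrightarrow> h \<longlonglongrightarrow> 0 \<longrightarrow>
      (\<lambda>n. norm ((f (x + h n) - f x) /\<^sub>R h n - D)) \<longlonglongrightarrow> 0)"
    by (intro all_cong imp_cong refl) (simp add: eq del: real_norm_def)
  also have "\<dots> \<longleftrightarrow> (\<forall>h. (\<forall>n::nat. h n \<noteq> 0) \<longrightarrow> h \<longlonglongrightarrow> 0 \<longrightarrow> (\<lambda>n. (f (x + h n) - f x) /\<^sub>R h n) \<longlonglongrightarrow> D)"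
    unfolding tendsto_norm_zero_iff by (subst LIM_zero_iff) (rule refl)
  finally show ?thesis .
qed

lemma cmod_cis_diff_le: "cmod (cis a - cis b) \<le> \<bar>a - b\<bar>"
proof -
  have "cis a - cis b = cis b * (cis (a - b) - 1)" by (simp add: algebra_simps cis_mult)
  moreover have "cmod (cis y - 1) \<le> \<bar>y\<bar>" for y
    using iexp_approx1[of y 0] by (simp add: cis_conv_exp)
  ultimately show ?thesis by (simp add: norm_mult)
qed

text \<open>Since \<open>cis\<close> is Lipschitz with constant 1, the difference quotients of the
  integrand are dominated by 2 pi |t u(t)|.\<close>

lemma ft_has_derivative:
  assumes u: "integrable lborel u" and tu: "integrable lborel (\<lambda>t. of_real t * u t)"
  shows "(ft u has_vector_derivative ft (\<lambda>t. - 2 * pi * \<i> * of_real t * u t) \<xi>) (at \<xi>)"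
  unfolding has_vector_derivative_seq_iff
proof (intro allI impI)
  fix h :: "nat \<Rightarrow> real" assume h: "\<forall>n. h n \<noteq> 0" "h \<longlonglongrightarrow> 0"
  have [measurable]: "u \<in> borel_measurable borel" using borel_measurable_integrable[OF u] by simp
  define q where "q n t = u t * ((cis (- 2 * pi * (\<xi> + h n) * t) - cis (- 2 * pi * \<xi> * t)) /\<^sub>R h n)" for n t
  have eq: "(ft u (\<xi> + h n) - ft u \<xi>) /\<^sub>R h n = (\<integral>t. q n t \<partial>lborel)" for n
  proof -
    have "q n = (\<lambda>t. inverse (of_real (h n)) * (u t * cis (- 2 * pi * (\<xi> + h n) * t) - u t * cis (- 2 * pi * \<xi> * t)))"
      unfolding q_def by (intro ext) (simp add: scaleR_conv_of_real right_diff_distrib mult_ac)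
    then show ?thesis
      using Bochner_Integration.integral_diff[OF ft_integrable[OF u, of "\<xi> + h n"] ft_integrable[OF u, of \<xi>]]
      by (simp only: integral_mult_right_zero ft_def) (simp add: scaleR_conv_of_real)
  qed
  have "(\<lambda>n. \<integral>t. q n t \<partial>lborel) \<longlonglongrightarrow> (\<integral>t. (- 2 * pi * \<i> * of_real t * u t) * cis (- 2 * pi * \<xi> * t) \<partial>lborel)"
  proof (rule integral_dominated_convergence[where w = "\<lambda>t. 2 * pi * cmod (of_real t * u t)"])
    show "AE t in lborel. (\<lambda>n. q n t) \<longlonglongrightarrow> - 2 * pi * \<i> * of_real t * u t * cis (- 2 * pi * \<xi> * t)"
    proof (intro AE_I2)
      fix t :: real
      have "((\<lambda>y. cis (- 2 * pi * y * t)) has_vector_derivative - 2 * pi * \<i> * of_real t * cis (- 2 * pi * \<xi> * t)) (at \<xi>)"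
        unfolding cis_conv_exp by (rule derivative_eq_intros has_vector_derivative_real_field refl | simp)+
      then have "(\<lambda>n. (cis (- 2 * pi * (\<xi> + h n) * t) - cis (- 2 * pi * \<xi> * t)) /\<^sub>R h n)
          \<longlonglongrightarrow> - 2 * pi * \<i> * of_real t * cis (- 2 * pi * \<xi> * t)"
        using h unfolding has_vector_derivative_seq_iff by blast
      from tendsto_mult_left[OF this, of "u t"]
      show "(\<lambda>n. q n t) \<longlonglongrightarrow> - 2 * pi * \<i> * of_real t * u t * cis (- 2 * pi * \<xi> * t)"
        unfolding q_def by (simp only: mult_ac)
    qed
    show "AE t in lborel. norm (q n t) \<le> 2 * pi * cmod (of_real t * u t)" for n
    proof (intro AE_I2)
      fix t
      have "cmod (cis (- 2 * pi * (\<xi> + h n) * t) - cis (- 2 * pi * \<xi> * t)) \<le> \<bar>2 * pi * h n * t\<bar>"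
        using cmod_cis_diff_le[of "- 2 * pi * (\<xi> + h n) * t" "- 2 * pi * \<xi> * t"] by (simp add: algebra_simps)
      then have "cmod (cis (- 2 * pi * (\<xi> + h n) * t) - cis (- 2 * pi * \<xi> * t)) / \<bar>h n\<bar> \<le> 2 * pi * \<bar>t\<bar>"
        using h(1) by (simp add: divide_simps abs_mult mult_ac)
      from mult_left_mono[OF this norm_ge_zero[of "u t"]]
      have "norm (q n t) \<le> cmod (u t) * (2 * pi * \<bar>t\<bar>)"
        unfolding q_def norm_mult norm_scaleR by (simp only: abs_inverse divide_inverse mult.commute[of "inverse _"])
      then show "norm (q n t) \<le> 2 * pi * cmod (of_real t * u t)" by (simp add: norm_mult mult_ac)
    qed
    show "integrable lborel (\<lambda>t. 2 * pi * cmod (of_real t * u t))" using tu by simp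
  qed (auto simp: q_def)
  then show "(\<lambda>n. (ft u (\<xi> + h n) - ft u \<xi>) /\<^sub>R h n) \<longlonglongrightarrow> ft (\<lambda>t. - 2 * pi * \<i> * of_real t * u t) \<xi>"
    unfolding eq by (simp only: ft_def)
qed

lemma integral_derivative:
  fixes F f :: "real \<Rightarrow> complex"
  assumes "\<And>t. (F has_vector_derivative f t) (at t)" "\<And>t. isCont f t" "integrable lborel f"
    and "(F \<longlongrightarrow> A) at_bot" "(F \<longlongrightarrow> B) at_top"
  shows "(\<integral>t. f t \<partial>lborel) = B - A"
proof -
  have "(LBINT x=-\<infinity>..\<infinity>. f x) = B - A"
    by (rule interval_integral_FTC_integrable[where F = F])
      (use assms in \<open>auto simp: ereal_tendsto_simps set_integrable_def einterval_def\<close>)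
  then show ?thesis
    by (simp add: interval_lebesgue_integral_def set_lebesgue_integral_def einterval_def)
qed

text \<open>Integration by parts: the derivative of \<open>u\<close> times the exponential
  integrates to 0, as the product vanishes at both ends.\<close>

lemma ft_derivative:
  assumes u: "\<And>t. (u has_vector_derivative u' t) (at t)" and u': "\<And>t. isCont u' t"
    and int: "integrable lborel u" "integrable lborel u'"
    and lim: "(u \<longlongrightarrow> 0) at_bot" "(u \<longlongrightarrow> 0) at_top"
  shows "ft u' \<xi> = 2 * pi * \<i> * \<xi> * ft u \<xi>"
proof -
  let ?e = "\<lambda>t. cis (- 2 * pi * \<xi> * t)"
  have e: "(?e has_vector_derivative - 2 * pi * \<i> * of_real \<xi> * ?e t) (at t)" for t
    unfolding cis_conv_exp by (rule derivative_eq_intros has_vector_derivative_real_field refl | simp)+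
  have ec: "isCont ?e t" for t using has_vector_derivative_continuous[OF e] .
  have uc: "isCont u t" for t using has_vector_derivative_continuous[OF u] .
  have "(\<integral>t. u t * (- 2 * pi * \<i> * of_real \<xi> * ?e t) + u' t * ?e t \<partial>lborel) = 0 - 0"
  proof (rule integral_derivative)
    show "((\<lambda>t. u t * ?e t) has_vector_derivative u t * (- 2 * pi * \<i> * of_real \<xi> * ?e t) + u' t * ?e t) (at t)" for t
      by (rule has_vector_derivative_mult[OF u e])
    show "isCont (\<lambda>t. u t * (- 2 * pi * \<i> * of_real \<xi> * ?e t) + u' t * ?e t) t" for t
      by (intro continuous_intros u' ec uc)
    have eq: "u t * (- 2 * pi * \<i> * of_real \<xi> * ?e t) = (- 2 * pi * \<i> * of_real \<xi>) * (u t * ?e t)" for t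
      by (rule mult.left_commute)
    show "integrable lborel (\<lambda>t. u t * (- 2 * pi * \<i> * of_real \<xi> * ?e t) + u' t * ?e t)"
      unfolding eq by (intro Bochner_Integration.integrable_add integrable_mult_right ft_integrable int)
    show "((\<lambda>t. u t * ?e t) \<longlongrightarrow> 0) at_bot" "((\<lambda>t. u t * ?e t) \<longlongrightarrow> 0) at_top"
      using lim[THEN tendsto_norm_zero]
      by (rule_tac [!] tendsto_norm_zero_cancel) (simp_all add: norm_mult)
  qed
  moreover have "(\<integral>t. u t * (- 2 * pi * \<i> * of_real \<xi> * ?e t) + u' t * ?e t \<partial>lborel)
      = (\<integral>t. (- 2 * pi * \<i> * of_real \<xi>) * (u t * ?e t) + u' t * ?e t \<partial>lborel)"
    by (intro Bochner_Integration.integral_cong refl) (simp add: mult_ac)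
  moreover have "\<dots> = (- 2 * pi * \<i> * of_real \<xi>) * ft u \<xi> + ft u' \<xi>"
    unfolding ft_def using ft_integrable[OF int(1), of \<xi>] ft_integrable[OF int(2), of \<xi>]
    by (subst Bochner_Integration.integral_add) (auto intro: integrable_mult_right)
  ultimately show ?thesis by (simp add: algebra_simps)
qed

section \<open>Schwartz functions and Gaussians\<close>

text \<open>A smooth function is carried together with all its derivatives as an explicit sequence;
  by \<open>nth_derivative_chain\<close> the sequence is determined by its first member.\<close>

definition smooth_chain :: "(nat \<Rightarrow> real \<Rightarrow> complex) \<Rightarrow> bool" where
  "smooth_chain d \<longleftrightarrow> (\<forall>n t. (d n has_vector_derivative d (Suc n) t) (at t))"

lemma smooth_chainD: "smooth_chain d \<Longrightarrow> (d n has_vector_derivative d (Suc n) t) (at t)"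
  by (simp add: smooth_chain_def)

lemma smooth_chain_isCont: "smooth_chain d \<Longrightarrow> isCont (d n) t"
  by (rule has_vector_derivative_continuous[OF smooth_chainD])

lemma nth_derivative_chain:
  assumes "smooth_chain d" shows "nth_derivative n (d 0) = d n"
proof (induction n)
  case (Suc n)
  have "nth_derivative (Suc n) (d 0) = (\<lambda>t. vector_derivative (d n) (at t))"
    using Suc by (simp add: nth_derivative_def)
  then show ?case using vector_derivative_at[OF smooth_chainD[OF assms]] by simp
qed (simp add: nth_derivative_def)

lemma schwartz_smooth_chain:
  assumes "f \<in> schwartz_space"
  shows "smooth_chain (\<lambda>n. nth_derivative n f)"
  using assms vector_derivative_works
  by (auto simp: smooth_chain_def schwartz_space_def nth_derivative_def)

lemma nth_derivative_0 [simp]: "nth_derivative 0 f = f"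
  by (simp add: nth_derivative_def)

lemma schwartz_bound:
  assumes "f \<in> schwartz_space"
  obtains B where "\<And>t. \<bar>t\<bar> ^ m * cmod (nth_derivative n f t) \<le> B"
proof -
  have "bounded (range (\<lambda>t. t ^ m *\<^sub>R nth_derivative n f t))" using assms by (simp add: schwartz_space_def)
  then obtain B where "\<And>t. norm (t ^ m *\<^sub>R nth_derivative n f t) \<le> B" unfolding bounded_iff by auto
  then show ?thesis by (intro that[of B]) (simp add: power_abs)
qed

lemma schwartzI:
  assumes d: "smooth_chain d" and B: "\<And>m n. \<exists>B. \<forall>t. \<bar>t\<bar> ^ m * cmod (d n t) \<le> B"
  shows "d 0 \<in> schwartz_space"
  unfolding schwartz_space_def mem_Collect_eq nth_derivative_chain[OF d]
proof (intro conjI allI)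
  show "d n differentiable at t" for n t
    using smooth_chainD[OF d] by (auto intro: differentiableI_vector)
  show "bounded (range (\<lambda>t. t ^ m *\<^sub>R d n t))" for m n
    using B[of m n] by (auto simp: bounded_iff power_abs)
qed

lemma power_le_exp:
  fixes x :: real assumes "x \<ge> 0" shows "x ^ k \<le> fact k * exp x"
proof -
  have "(\<Sum>n\<in>{k}. x ^ n /\<^sub>R fact n) \<le> (\<Sum>n. x ^ n /\<^sub>R fact n)"
    using assms by (intro sum_le_suminf summable_exp_generic) auto
  then show ?thesis by (simp add: exp_def field_simps)
qed

text \<open>The general complex Gaussian: for positive real part of \<open>z\<close> it covers the
  modulated, the chirped and the dilated Gaussians that occur as windows.\<close>

definition gexp :: "complex \<Rightarrow> complex \<Rightarrow> real \<Rightarrow> complex" where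
  "gexp z w t = exp (- z * (of_real t)\<^sup>2 + w * of_real t)"

lemma gexp_decay:
  assumes z: "Re z > 0" shows "\<exists>B. \<forall>t. \<bar>t\<bar> ^ m * cmod (gexp z w t) \<le> B"
proof -
  \<comment> \<open>\<open>K\<close> is the maximum of the quadratic
    \<open>(\<bar>Re w\<bar> + 1) * x - Re z * x^2\<close>; the extra 1 leaves a factor
    \<open>exp (- \<bar>t\<bar>)\<close> that absorbs the power of \<open>t\<close>.\<close>
  define K where "K = (\<bar>Re w\<bar> + 1)\<^sup>2 / (4 * Re z)"
  have "\<bar>t\<bar> ^ m * cmod (gexp z w t) \<le> fact m * exp K" for t
  proof -
    have quad: "y * x - r * x\<^sup>2 \<le> y\<^sup>2 / (4 * r)" if "r > 0" for x y r :: real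
    proof -
      have "0 \<le> (2 * r * x - y)\<^sup>2" by simp
      then show ?thesis using that by (simp add: power2_eq_square field_simps)
    qed
    from quad[OF z, of "\<bar>Re w\<bar> + 1" "\<bar>t\<bar>"]
    have "(\<bar>Re w\<bar> + 1) * \<bar>t\<bar> - Re z * t\<^sup>2 \<le> K" unfolding K_def by simp
    moreover have "Re w * t \<le> \<bar>Re w\<bar> * \<bar>t\<bar>" by (metis abs_ge_self abs_mult)
    ultimately have le: "- Re z * t\<^sup>2 + Re w * t \<le> K - \<bar>t\<bar>" by (simp add: algebra_simps)
    have "cmod (gexp z w t) = exp (- Re z * t\<^sup>2 + Re w * t)" by (simp add: gexp_def power2_eq_square)
    also have "\<dots> \<le> exp (K - \<bar>t\<bar>)" using le by simp
    finally have "\<bar>t\<bar> ^ m * cmod (gexp z w t) \<le> (fact m * exp \<bar>t\<bar>) * exp (K - \<bar>t\<bar>)"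
      using power_le_exp[of "\<bar>t\<bar>" m] by (intro mult_mono) auto
    then show ?thesis by (simp add: exp_add[symmetric] mult.assoc)
  qed
  then show ?thesis by blast
qed

lemma gexp_poly_decay:
  assumes z: "Re z > 0" shows "\<exists>B. \<forall>t. \<bar>t\<bar> ^ m * cmod (poly p (of_real t) * gexp z w t) \<le> B"
proof (induction p arbitrary: m)
  case (pCons c p)
  obtain B where B: "\<And>t. \<bar>t\<bar> ^ Suc m * cmod (poly p (of_real t) * gexp z w t) \<le> B" using pCons.IH by blast
  obtain A where A: "\<And>t. \<bar>t\<bar> ^ m * cmod (gexp z w t) \<le> A" using gexp_decay[OF z] by blast
  have "\<bar>t\<bar> ^ m * cmod (poly (pCons c p) (of_real t) * gexp z w t) \<le> cmod c * A + B" for t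
  proof -
    have "\<bar>t\<bar> ^ m * cmod (poly (pCons c p) (of_real t) * gexp z w t)
        = \<bar>t\<bar> ^ m * cmod (c * gexp z w t + of_real t * (poly p (of_real t) * gexp z w t))"
      by (simp add: algebra_simps)
    also have "\<dots> \<le> \<bar>t\<bar> ^ m * (cmod c * cmod (gexp z w t) + \<bar>t\<bar> * cmod (poly p (of_real t) * gexp z w t))"
      by (intro mult_left_mono norm_triangle_le) (auto simp: norm_mult)
    also have "\<dots> = cmod c * (\<bar>t\<bar> ^ m * cmod (gexp z w t)) + \<bar>t\<bar> ^ Suc m * cmod (poly p (of_real t) * gexp z w t)"
      by (simp add: algebra_simps)
    also have "\<dots> \<le> cmod c * A + B" by (intro add_mono mult_left_mono A B) auto
    finally show ?thesis .
  qed
  then show ?case by blast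
qed (auto intro: exI[of _ 0])

lemma gexp_schwartz:
  assumes z: "Re z > 0" shows "gexp z w \<in> schwartz_space"
proof -
  \<comment> \<open>\<open>q n\<close> is the polynomial factor of the n-th derivative; the
    recursion is the product rule with the logarithmic derivative \<open>w - 2 * z * t\<close> of
    the Gaussian.\<close>
  define q where "q = rec_nat (1 :: complex poly) (\<lambda>_ r. pderiv r + r * [:w, - 2 * z:])"
  have q: "q 0 = 1" "q (Suc n) = pderiv (q n) + q n * [:w, - 2 * z:]" for n by (simp_all add: q_def)
  define d where "d n t = poly (q n) (of_real t) * gexp z w t" for n t
  have dn: "d n = (\<lambda>t. poly (q n) (of_real t) * exp (- z * (of_real t)\<^sup>2 + w * of_real t))" for n
    by (simp add: d_def gexp_def fun_eq_iff)
  have "smooth_chain d"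
    unfolding smooth_chain_def
  proof (intro allI)
    fix n t
    have "((\<lambda>\<zeta>. poly (q n) \<zeta> * exp (- z * \<zeta>\<^sup>2 + w * \<zeta>)) has_field_derivative
        poly (q (Suc n)) (of_real t) * exp (- z * (of_real t)\<^sup>2 + w * of_real t)) (at (of_real t))"
      by (rule derivative_eq_intros poly_DERIV refl | simp)+ (simp add: q algebra_simps)
    from has_vector_derivative_real_field[OF this]
    show "(d n has_vector_derivative d (Suc n) t) (at t)" unfolding dn .
  qed
  then have "d 0 \<in> schwartz_space"
    by (rule schwartzI) (use gexp_poly_decay[OF z] in \<open>simp add: d_def\<close>)
  moreover have "d 0 = gexp z w" by (auto simp: d_def q)
  ultimately show ?thesis by simp
qed

subsection \<open>Twice differentiable functions with decay\<close>

text \<open>Two derivatives are what integrability of the short-time Fourier transform in the frequency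
  variable needs; unlike the Schwartz space, this class requires no control of higher derivatives.\<close>

definition C2_chain :: "(real \<Rightarrow> complex) \<Rightarrow> (real \<Rightarrow> complex) \<Rightarrow> (real \<Rightarrow> complex) \<Rightarrow> real \<Rightarrow> bool" where
  "C2_chain u u1 u2 C \<longleftrightarrow> (\<forall>t. (u has_vector_derivative u1 t) (at t)) \<and>
     (\<forall>t. (u1 has_vector_derivative u2 t) (at t)) \<and> (\<forall>t. isCont u2 t) \<and>
     (\<forall>t. (1 + t\<^sup>2)\<^sup>2 * cmod (u t) \<le> C \<and> (1 + t\<^sup>2)\<^sup>2 * cmod (u1 t) \<le> C \<and> (1 + t\<^sup>2)\<^sup>2 * cmod (u2 t) \<le> C)"

definition C2_decay :: "(real \<Rightarrow> complex) set" where
  "C2_decay = {u. \<exists>u1 u2 C. C2_chain u u1 u2 C}"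

lemma schwartz_C2_decay:
  assumes f: "f \<in> schwartz_space" shows "f \<in> C2_decay"
proof -
  have B: "\<exists>B. \<forall>t. (1 + t\<^sup>2)\<^sup>2 * cmod (nth_derivative n f t) \<le> B" for n
  proof -
    obtain A0 A2 A4 where A: "\<And>t. \<bar>t\<bar> ^ 0 * cmod (nth_derivative n f t) \<le> A0"
      "\<And>t. \<bar>t\<bar> ^ 2 * cmod (nth_derivative n f t) \<le> A2" "\<And>t. \<bar>t\<bar> ^ 4 * cmod (nth_derivative n f t) \<le> A4"
      using schwartz_bound[OF f, of 0 n] schwartz_bound[OF f, of 2 n] schwartz_bound[OF f, of 4 n] by metis
    have "(1 + t\<^sup>2)\<^sup>2 * cmod (nth_derivative n f t) \<le> A0 + 2 * A2 + A4" for t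
    proof -
      have "(1 + t\<^sup>2)\<^sup>2 = 1 + 2 * \<bar>t\<bar>\<^sup>2 + \<bar>t\<bar> ^ 4" by (simp add: power2_eq_square power4_eq_xxxx algebra_simps)
      then show ?thesis using A(1)[of t] A(2)[of t] A(3)[of t] by (simp add: algebra_simps)
    qed
    then show ?thesis by blast
  qed
  obtain B0 B1 B2 where B': "\<And>t. (1 + t\<^sup>2)\<^sup>2 * cmod (nth_derivative 0 f t) \<le> B0"
    "\<And>t. (1 + t\<^sup>2)\<^sup>2 * cmod (nth_derivative (Suc 0) f t) \<le> B1" "\<And>t. (1 + t\<^sup>2)\<^sup>2 * cmod (nth_derivative (Suc (Suc 0)) f t) \<le> B2"
    using B[of 0] B[of "Suc 0"] B[of "Suc (Suc 0)"] by blast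
  have "C2_chain (nth_derivative 0 f) (nth_derivative (Suc 0) f) (nth_derivative (Suc (Suc 0)) f) (max B0 (max B1 B2))"
    unfolding C2_chain_def
    using smooth_chainD[OF schwartz_smooth_chain[OF f]] smooth_chain_isCont[OF schwartz_smooth_chain[OF f]] B'
    by (auto simp del: nth_derivative_0 simp: le_max_iff_disj)
  then show ?thesis unfolding C2_decay_def by auto
qed

lemma bound_C2:
  fixes x :: real assumes "(1 + t\<^sup>2)\<^sup>2 * x \<le> C" "x \<ge> 0"
  shows "x \<le> C * (1 / (1 + t\<^sup>2))" "x \<le> C * (1 / (1 + t\<^sup>2))\<^sup>2" "x \<le> C" "C \<ge> 0"
proof -
  have p: "1 + t\<^sup>2 \<ge> 1" by simp
  then have p1: "(1 + t\<^sup>2)\<^sup>2 \<ge> 1 + t\<^sup>2" by (rule self_le_power) simp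
  have "1 * x \<le> (1 + t\<^sup>2)\<^sup>2 * x" using p p1 assms(2) by (intro mult_right_mono) auto
  then show "x \<le> C" using assms(1) by simp
  then show "C \<ge> 0" using assms(2) by simp
  have "(1 + t\<^sup>2) * x \<le> C" using mult_right_mono[OF p1 assms(2)] assms(1) by linarith
  then have "x * (1 + t\<^sup>2) \<le> C" by (simp only: mult.commute)
  then have "x \<le> C / (1 + t\<^sup>2)" by (rule mult_imp_le_div_pos[OF less_le_trans[OF zero_less_one p]])
  then show "x \<le> C * (1 / (1 + t\<^sup>2))" by (simp only: times_divide_eq_right mult_1_right)
  have "0 < (1 + t\<^sup>2)\<^sup>2" by (rule zero_less_power[OF less_le_trans[OF zero_less_one p]])
  then show "x \<le> C * (1 / (1 + t\<^sup>2))\<^sup>2"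
    using assms(1) pos_le_divide_eq[of "(1 + t\<^sup>2)\<^sup>2" x C] by (simp add: mult.commute power_divide)
qed

lemma C2_chain_props:
  assumes "C2_chain u u1 u2 C"
  shows "u \<in> borel_measurable borel" "u1 \<in> borel_measurable borel" "u2 \<in> borel_measurable borel"
    "integrable lborel u" "integrable lborel u1" "integrable lborel u2"
    "cmod (u t) \<le> C" "u \<in> L2_functions" "(u \<longlongrightarrow> 0) at_bot" "(u \<longlongrightarrow> 0) at_top" "(u1 \<longlongrightarrow> 0) at_bot" "(u1 \<longlongrightarrow> 0) at_top"
    "isCont u t" "isCont u1 t"
proof -
  note c = assms[unfolded C2_chain_def]
  have d: "\<And>t. (u has_vector_derivative u1 t) (at t)" "\<And>t. (u1 has_vector_derivative u2 t) (at t)" using c by blast+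
  have cont: "\<And>t. isCont u t" "\<And>t. isCont u1 t" "\<And>t. isCont u2 t"
    using d[THEN has_vector_derivative_continuous] c by blast+
  then show "isCont u t" "isCont u1 t" by blast+
  have m: "f \<in> borel_measurable borel" if "\<And>t. isCont f t" for f :: "real \<Rightarrow> complex"
    using that by (intro borel_measurable_continuous_onI) (simp add: continuous_on_eq_continuous_at)
  show meas: "u \<in> borel_measurable borel" "u1 \<in> borel_measurable borel" "u2 \<in> borel_measurable borel"
    using m cont by blast+
  have int: "integrable lborel f" if "f \<in> borel_measurable borel" "\<And>t. (1 + t\<^sup>2)\<^sup>2 * cmod (f t) \<le> C" for f
  proof (rule Bochner_Integration.integrable_bound)
    show "integrable lborel (\<lambda>t. C * (1 / (1 + t\<^sup>2)))" by (intro integrable_mult_right integrable_inv_sq)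
    show "AE t in lborel. norm (f t) \<le> norm (C * (1 / (1 + t\<^sup>2)))"
      using bound_C2(1)[OF that(2) norm_ge_zero] by (intro AE_I2) (metis abs_ge_self order_trans real_norm_def)
  qed (use that in simp)
  show "integrable lborel u" "integrable lborel u1" "integrable lborel u2" using int meas c by blast+
  have bd: "cmod (u t) \<le> C" for t using c bound_C2(3)[OF _ norm_ge_zero] by blast
  then show "cmod (u t) \<le> C" .
  show "u \<in> L2_functions" by (rule L2_I1_bounded[OF \<open>integrable lborel u\<close> bd])
  have lim: "((\<lambda>t::real. C * (1 / (1 + t\<^sup>2))) \<longlongrightarrow> 0) at_bot" "((\<lambda>t::real. C * (1 / (1 + t\<^sup>2))) \<longlongrightarrow> 0) at_top"
    by (rule tendsto_mult_right_zero, rule tendsto_divide_0[OF tendsto_const], rule filterlim_at_top_imp_at_infinity,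
        rule filterlim_tendsto_add_at_top[OF tendsto_const],
        rule filterlim_pow_at_bot_even filterlim_pow_at_top, simp, simp add: filterlim_ident, simp?)+
  have "(f \<longlongrightarrow> 0) F" if "\<And>t. (1 + t\<^sup>2)\<^sup>2 * cmod (f t) \<le> C" "((\<lambda>t::real. C * (1 / (1 + t\<^sup>2))) \<longlongrightarrow> 0) F"
    for f :: "real \<Rightarrow> complex" and F
    by (rule Lim_null_comparison[OF _ that(2)]) (use bound_C2(1)[OF that(1) norm_ge_zero] in simp)
  then show "(u \<longlongrightarrow> 0) at_bot" "(u \<longlongrightarrow> 0) at_top" "(u1 \<longlongrightarrow> 0) at_bot" "(u1 \<longlongrightarrow> 0) at_top"
    using c lim by blast+
qed

lemma C2_decayE:
  assumes "u \<in> C2_decay" obtains u1 u2 C where "C2_chain u u1 u2 C"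
  using assms by (auto simp: C2_decay_def)

lemma C2_decay_props:
  assumes "u \<in> C2_decay"
  shows "u \<in> borel_measurable borel" "integrable lborel u" "u \<in> L2_functions" "\<exists>C. \<forall>t. cmod (u t) \<le> C"
    "isCont u t"
  using C2_decayE[OF assms] C2_chain_props by metis+

lemma C2_decay_add:
  assumes "u \<in> C2_decay" "v \<in> C2_decay"
  shows "(\<lambda>t. u t + v t) \<in> C2_decay"
proof -
  obtain u1 u2 C where u: "C2_chain u u1 u2 C" by (rule C2_decayE[OF assms(1)])
  obtain v1 v2 D where v: "C2_chain v v1 v2 D" by (rule C2_decayE[OF assms(2)])
  have le: "(1 + t\<^sup>2)\<^sup>2 * cmod (x + y) \<le> C + D" if "(1 + t\<^sup>2)\<^sup>2 * cmod x \<le> C" "(1 + t\<^sup>2)\<^sup>2 * cmod y \<le> D" for t x y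
    using that mult_left_mono[OF norm_triangle_ineq[of x y], of "(1 + t\<^sup>2)\<^sup>2"] by (simp add: algebra_simps)
  have "C2_chain (\<lambda>t. u t + v t) (\<lambda>t. u1 t + v1 t) (\<lambda>t. u2 t + v2 t) (C + D)"
    using u v unfolding C2_chain_def by (auto intro!: has_vector_derivative_add continuous_intros le)
  then show ?thesis unfolding C2_decay_def by blast
qed

lemma C2_decay_scale:
  assumes "u \<in> C2_decay" shows "(\<lambda>t. \<alpha> * u t) \<in> C2_decay"
proof -
  obtain u1 u2 C where u: "C2_chain u u1 u2 C" by (rule C2_decayE[OF assms(1)])
  have le: "(1 + t\<^sup>2)\<^sup>2 * cmod (\<alpha> * x) \<le> cmod \<alpha> * C" if "(1 + t\<^sup>2)\<^sup>2 * cmod x \<le> C" for t x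
    using mult_left_mono[OF that, of "cmod \<alpha>"] by (simp add: norm_mult mult_ac)
  have "C2_chain (\<lambda>t. \<alpha> * u t) (\<lambda>t. \<alpha> * u1 t) (\<lambda>t. \<alpha> * u2 t) (cmod \<alpha> * C)"
    using u unfolding C2_chain_def by (auto intro!: has_vector_derivative_mult_right continuous_intros le)
  then show ?thesis unfolding C2_decay_def by blast
qed

text \<open>Two derivatives bring down the factor (2 pi \<xi>)^2, which is at least \<xi>^2 in
  absolute value.\<close>

lemma ft_C2_bound:
  assumes "\<And>t. (u has_vector_derivative u1 t) (at t)" "\<And>t. (u1 has_vector_derivative u2 t) (at t)" "\<And>t. isCont u2 t"
    and "integrable lborel u" "integrable lborel u1" "integrable lborel u2"
    and "(u \<longlongrightarrow> 0) at_bot" "(u \<longlongrightarrow> 0) at_top" "(u1 \<longlongrightarrow> 0) at_bot" "(u1 \<longlongrightarrow> 0) at_top"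
  shows "(1 + \<xi>\<^sup>2) * cmod (ft u \<xi>) \<le> (\<integral>t. cmod (u t) + cmod (u2 t) \<partial>lborel)"
proof -
  have u1c: "isCont u1 t" for t using assms(2) by (rule has_vector_derivative_continuous)
  have "ft u1 \<xi> = 2 * pi * \<i> * \<xi> * ft u \<xi>" by (rule ft_derivative) (use assms u1c in auto)
  moreover have "ft u2 \<xi> = 2 * pi * \<i> * \<xi> * ft u1 \<xi>" by (rule ft_derivative) (use assms in auto)
  ultimately have "cmod (ft u2 \<xi>) = (2 * pi)\<^sup>2 * (\<xi>\<^sup>2 * cmod (ft u \<xi>))"
    by (simp add: norm_mult power2_eq_square abs_mult_self_eq mult_ac)
  moreover have "1 * (\<xi>\<^sup>2 * cmod (ft u \<xi>)) \<le> (2 * pi)\<^sup>2 * (\<xi>\<^sup>2 * cmod (ft u \<xi>))"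
    using one_le_power[of "2 * pi" 2] pi_gt3 by (intro mult_right_mono) simp_all
  ultimately have "\<xi>\<^sup>2 * cmod (ft u \<xi>) \<le> cmod (ft u2 \<xi>)" by simp
  then have "(1 + \<xi>\<^sup>2) * cmod (ft u \<xi>) \<le> (\<integral>t. cmod (u t) \<partial>lborel) + (\<integral>t. cmod (u2 t) \<partial>lborel)"
    using cmod_ft_le[of u \<xi>] cmod_ft_le[of u2 \<xi>] by (simp add: algebra_simps)
  then show ?thesis using assms by simp
qed

lemma integrable_if_inv_sq_bound:
  fixes f :: "real \<Rightarrow> complex"
  assumes "f \<in> borel_measurable borel" "\<And>t. (1 + t\<^sup>2) * cmod (f t) \<le> C"
  shows "integrable lborel f"
proof (rule Bochner_Integration.integrable_bound)
  show "integrable lborel (\<lambda>t. C * (1 / (1 + t\<^sup>2)))" by (intro integrable_mult_right integrable_inv_sq)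
  have "cmod (f t) \<le> C * (1 / (1 + t\<^sup>2))" for t
  proof -
    have "0 < 1 + t\<^sup>2" by (simp add: add_pos_nonneg)
    then show ?thesis using assms(2)[of t] by (simp add: field_simps)
  qed
  then show "AE t in lborel. norm (f t) \<le> norm (C * (1 / (1 + t\<^sup>2)))"
    by (intro AE_I2) (metis abs_ge_self order_trans real_norm_def)
qed (use assms in simp)

lemma ft_C2_integrable:
  assumes "u \<in> C2_decay" shows "integrable lborel (ft u)"
proof -
  obtain u1 u2 C where u: "C2_chain u u1 u2 C" by (rule C2_decayE[OF assms])
  note p = C2_chain_props[OF u]
  show ?thesis
  proof (rule integrable_if_inv_sq_bound[OF ft_measurable[OF p(4)]])
    show "(1 + t\<^sup>2) * cmod (ft u t) \<le> (\<integral>t. cmod (u t) + cmod (u2 t) \<partial>lborel)" for t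
      by (rule ft_C2_bound[of u u1 u2]) (use u p in \<open>auto simp: C2_chain_def\<close>)
  qed
qed

section \<open>The Gaussian, inversion and the unitary Fourier operator\<close>

text \<open>The exponent is normalised so that the unmodulated Gaussian is its own transform; the
  modulation makes pairings with the family values of a Fourier transform.\<close>

definition gauss :: "real \<Rightarrow> real \<Rightarrow> complex" where
  "gauss \<omega> t = of_real (exp (- pi * t\<^sup>2)) * cis (- 2 * pi * \<omega> * t)"

lemma gauss_gexp: "gauss \<omega> = gexp (of_real pi) (of_real (- 2 * pi * \<omega>) * \<i>)"
  unfolding gauss_def gexp_def cis_conv_exp exp_add by (simp add: exp_of_real[symmetric] mult_ac fun_eq_iff)

lemma gauss_schwartz: "gauss \<omega> \<in> schwartz_space"
  unfolding gauss_gexp by (rule gexp_schwartz) simp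

lemmas gauss_C2 = schwartz_C2_decay[OF gauss_schwartz]
lemmas gauss_props = C2_decay_props[OF gauss_C2]

text \<open>The characteristic function of the standard normal distribution, rescaled by
  \<open>sqrt (2 * pi)\<close>.\<close>

lemma ft_gauss_0: "ft (gauss 0) \<xi> = gauss 0 \<xi>"
proof -
  have "char std_normal_distribution (- sqrt (2 * pi) * \<xi>) = complex_of_real (exp (- pi * \<xi>\<^sup>2))"
    unfolding char_std_normal_distribution by (simp add: power_mult_distrib)
  moreover have "char std_normal_distribution (- sqrt (2 * pi) * \<xi>)
      = (\<integral>x. std_normal_density x *\<^sub>R cis (- sqrt (2 * pi) * \<xi> * x) \<partial>lborel)"
    unfolding char_def by (subst integral_density) (auto simp: cis_conv_exp)
  moreover have "\<dots> = sqrt (2 * pi) *\<^sub>R (\<integral>t. std_normal_density (sqrt (2 * pi) * t) *\<^sub>R cis (- sqrt (2 * pi) * \<xi> * (sqrt (2 * pi) * t)) \<partial>lborel)"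
    by (subst lborel_integral_real_affine[where c = "sqrt (2 * pi)" and t = 0]) auto
  moreover have "\<dots> = (\<integral>t. sqrt (2 * pi) *\<^sub>R (std_normal_density (sqrt (2 * pi) * t) *\<^sub>R cis (- sqrt (2 * pi) * \<xi> * (sqrt (2 * pi) * t))) \<partial>lborel)"
    by (rule integral_scaleR_right[symmetric])
  moreover have "\<dots> = ft (gauss 0) \<xi>"
    unfolding ft_def
  proof (intro Bochner_Integration.integral_cong refl)
    fix t
    have "- sqrt (2 * pi) * \<xi> * (sqrt (2 * pi) * t) = - (sqrt (2 * pi) * sqrt (2 * pi)) * \<xi> * t"
      by (simp only: mult_ac minus_mult_left[symmetric])
    then have a: "- sqrt (2 * pi) * \<xi> * (sqrt (2 * pi) * t) = - 2 * pi * \<xi> * t" by simp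
    have b: "sqrt (2 * pi) * std_normal_density (sqrt (2 * pi) * t) = exp (- pi * t\<^sup>2)"
      by (simp add: std_normal_density_def power_mult_distrib)
    show "sqrt (2 * pi) *\<^sub>R (std_normal_density (sqrt (2 * pi) * t) *\<^sub>R cis (- sqrt (2 * pi) * \<xi> * (sqrt (2 * pi) * t)))
        = gauss 0 t * cis (- 2 * pi * \<xi> * t)"
      unfolding a scaleR_scaleR b by (simp add: gauss_def scaleR_conv_of_real)
  qed
  ultimately show ?thesis by (simp add: gauss_def)
qed

lemma ft_gauss: "ft (gauss \<omega>) \<xi> = gauss 0 (\<xi> + \<omega>)"
proof -
  have "gauss \<omega> = (\<lambda>t. gauss 0 t * cis (2 * pi * (- \<omega>) * t))" by (simp add: gauss_def fun_eq_iff)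
  then show ?thesis using ft_shift(1)[OF gauss_props(2), of 0 "- \<omega>" \<xi>] by (simp add: ft_gauss_0)
qed

lemma ft_ft_gauss: "ft (ft (gauss \<omega>)) t = gauss \<omega> (- t)"
proof -
  have "ft (gauss \<omega>) = (\<lambda>\<xi>. gauss 0 (\<xi> - (- \<omega>)))" by (simp add: ft_gauss fun_eq_iff)
  then have "ft (ft (gauss \<omega>)) t = ft (\<lambda>\<xi>. gauss 0 (\<xi> - (- \<omega>))) t" by simp
  also have "\<dots> = cis (- 2 * pi * t * (- \<omega>)) * ft (gauss 0) t" by (rule ft_shift(2)[OF gauss_props(2)])
  finally show ?thesis by (simp add: ft_gauss_0 gauss_def mult_ac)
qed

lemma gauss_nonzero: "gauss \<omega> t \<noteq> 0"
  by (simp add: gauss_def)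

text \<open>The pairings are the values of the transform of \<open>w t * gauss 0 t\<close>; this
  product is therefore null, and the Gaussian has no zeros.\<close>

lemma AE_0_if_gauss_orthogonal:
  assumes w: "integrable lborel (\<lambda>t. w t * gauss 0 t)"
    and 0: "\<And>\<omega>. (\<integral>t. w t * gauss \<omega> t \<partial>lborel) = 0"
  shows "AE t in lborel. w t = 0"
proof -
  have "ft (\<lambda>t. w t * gauss 0 t) \<omega> = 0" for \<omega>
    using 0[of \<omega>] by (simp add: ft_def gauss_def mult_ac)
  from ft_eq_0[OF w this] show ?thesis by eventually_elim (simp add: gauss_nonzero)
qed

lemma l2_eq_0_if_gauss_orthogonal:
  assumes "\<And>\<omega>. bil x (cl (gauss \<omega>)) = 0" shows "x = 0"
proof -
  have "AE t in lborel. fn x t = 0"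
  proof (rule AE_0_if_gauss_orthogonal)
    show "integrable lborel (\<lambda>t. fn x t * gauss 0 t)" by (rule L2_mult_integrable[OF fn_L2 gauss_props(3)])
    show "(\<integral>t. fn x t * gauss \<omega> t \<partial>lborel) = 0" for \<omega>
      using assms[of \<omega>] bil_cl[OF fn_L2[of x] gauss_props(3)[of \<omega>]] by simp
  qed
  then have "cl (fn x) = cl (\<lambda>t. 0)" by (subst cl_eq_iff) auto
  then show ?thesis by (simp add: zero_l2_def)
qed

text \<open>Inversion: by Fubini \<open>u\<close> and its double transform have the same pairing with every modulated
  Gaussian.\<close>

lemma ft_inversion:
  assumes u: "integrable lborel u" and fu: "integrable lborel (ft u)"
  shows "AE t in lborel. ft (ft u) (- t) = u t"
proof -
  let ?v = "\<lambda>t. ft (ft u) (- t)"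
  have [measurable]: "?v \<in> borel_measurable borel" using ft_measurable[OF fu] by measurable
  have vg: "integrable lborel (\<lambda>t. ?v t * gauss \<omega> t)" for \<omega>
    using integrable_mult_bounded[OF gauss_props(2), of ?v "\<integral>t. cmod (ft u t) \<partial>lborel" \<omega>] cmod_ft_le[of "ft u"]
    by (simp add: mult.commute)
  have ug: "integrable lborel (\<lambda>t. u t * gauss \<omega> t)" for \<omega>
    using integrable_mult_bounded[OF u gauss_props(1)] gauss_props(4)[of \<omega>] by blast
  have "AE t in lborel. ?v t - u t = 0"
  proof (rule AE_0_if_gauss_orthogonal)
    show "integrable lborel (\<lambda>t. (?v t - u t) * gauss 0 t)"
      using vg ug by (simp add: left_diff_distrib)
    fix \<omega>
    have "(\<integral>t. ?v t * gauss \<omega> t \<partial>lborel) = (\<integral>t. ft (ft u) t * gauss (- \<omega>) t \<partial>lborel)"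
      by (subst lborel_integral_real_affine[where c = "-1" and t = 0]) (auto simp: gauss_def)
    also have "\<dots> = (\<integral>t. ft u t * ft (gauss (- \<omega>)) t \<partial>lborel)" by (rule ft_fubini[OF fu gauss_props(2)])
    also have "\<dots> = (\<integral>t. u t * ft (ft (gauss (- \<omega>))) t \<partial>lborel)"
      by (rule ft_fubini[OF u ft_C2_integrable[OF gauss_C2]])
    also have "\<dots> = (\<integral>t. u t * gauss \<omega> t \<partial>lborel)"
      by (simp add: ft_ft_gauss) (simp add: gauss_def)
    finally show "(\<integral>t. (?v t - u t) * gauss \<omega> t \<partial>lborel) = 0"
      using vg ug by (simp add: left_diff_distrib)
  qed
  then show ?thesis by simp
qed

subsection \<open>The Fourier operator\<close>

lemma ft_inversion_C2:
  assumes u: "u \<in> C2_decay" shows "ft (ft u) (- t) = u t"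
proof -
  note p = C2_decay_props[OF u]
  note fu = ft_C2_integrable[OF u]
  show ?thesis
  proof (rule AE_eq_isCont)
    show "isCont (\<lambda>t. ft (ft u) (- t)) t" for t
      by (rule isCont_o2[OF _ isCont_ft[OF fu]]) simp
    show "isCont u t" for t by (rule p(5))
    show "AE t in lborel. ft (ft u) (- t) = u t" by (rule ft_inversion[OF p(2) fu])
  qed
qed


text \<open>Integrability of \<open>k\<close> and \<open>ft k\<close> is what inversion asks for;
  \<open>ft k\<close> is then square-integrable, being bounded and integrable.\<close>

definition ftest :: "(real \<Rightarrow> complex) \<Rightarrow> bool" where
  "ftest k \<longleftrightarrow> integrable lborel k \<and> k \<in> L2_functions \<and> integrable lborel (ft k)"

lemma ftest_ft_L2: "ftest k \<Longrightarrow> ft k \<in> L2_functions"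
  unfolding ftest_def by (blast intro: L2_I1_bounded cmod_ft_le)

lemma ftest_C2: "k \<in> C2_decay \<Longrightarrow> ftest k"
  unfolding ftest_def using C2_decay_props ft_C2_integrable by blast

lemma ftest_cnj: assumes k: "ftest k" shows "ftest (\<lambda>t. cnj (k t))"
proof -
  have ki: "integrable lborel k" "integrable lborel (ft k)" using k by (auto simp: ftest_def)
  have "ft (\<lambda>t. cnj (k t)) = (\<lambda>\<xi>. cnj (ft k (- \<xi>)))" using ft_shift(4)[OF ki(1)] by (simp add: fun_eq_iff)
  moreover have "integrable lborel (\<lambda>\<xi>. ft k (- \<xi>))"
    using lborel_integrable_real_affine[OF ki(2), of "-1" 0] by simp
  ultimately show ?thesis using k L2_cnj by (simp add: ftest_def)
qed

text \<open>Plancherel's identity: the multiplication formula moves one transform onto the transform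
  of the conjugate, and inversion undoes the two.\<close>

lemma ft_isometry:
  assumes f: "ftest f" shows "norm (cl (ft f)) = norm (cl f)"
proof -
  have fi: "integrable lborel f" "f \<in> L2_functions" "integrable lborel (ft f)" using f by (auto simp: ftest_def)
  let ?g = "\<lambda>t. cnj (f t)"
  have g: "integrable lborel ?g" "integrable lborel (ft ?g)" using ftest_cnj[OF f] by (auto simp: ftest_def)
  have gm: "integrable lborel (\<lambda>\<xi>. ft ?g (- \<xi>))" using lborel_integrable_real_affine[OF g(2), of "-1" 0] by simp
  have "complex_of_real ((norm (cl (ft f)))\<^sup>2) = (\<integral>\<xi>. ft f \<xi> * cnj (ft f \<xi>) \<partial>lborel)"
    using bil_conjl_self[of "cl (ft f)"] ftest_ft_L2[OF f] by (simp add: cl_conjl bil_cl L2_cnj)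
  also have "\<dots> = (\<integral>\<xi>. ft f \<xi> * ft ?g (- \<xi>) \<partial>lborel)" by (simp add: ft_shift(4)[OF fi(1)])
  also have "\<dots> = (\<integral>t. f t * ft (\<lambda>\<xi>. ft ?g (- \<xi>)) t \<partial>lborel)" by (rule ft_fubini[OF fi(1) gm])
  also have "\<dots> = (\<integral>t. f t * cnj (f t) \<partial>lborel)"
  proof (rule integral_cong_AE)
    have m [measurable]: "f \<in> borel_measurable borel" "ft (\<lambda>\<xi>. ft ?g (- \<xi>)) \<in> borel_measurable borel"
      using fi(1) ft_measurable[OF gm] by (auto dest: borel_measurable_integrable)
    show "(\<lambda>t. f t * ft (\<lambda>\<xi>. ft ?g (- \<xi>)) t) \<in> borel_measurable lborel" "(\<lambda>t. f t * cnj (f t)) \<in> borel_measurable lborel"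
      by measurable
    show "AE t in lborel. f t * ft (\<lambda>\<xi>. ft ?g (- \<xi>)) t = f t * cnj (f t)"
      using ft_inversion[OF g] by eventually_elim (simp add: ft_shift(3)[OF g(2)])
  qed
  also have "\<dots> = complex_of_real ((norm (cl f))\<^sup>2)"
    using bil_conjl_self[of "cl f"] fi(2) by (simp add: cl_conjl bil_cl L2_cnj)
  finally show ?thesis by (simp only: of_real_eq_iff) simp
qed

text \<open>The class contains all modulated Gaussians, so nothing but 0 is orthogonal to
  it.\<close>

lemma dense_C2: "closure (cl ` C2_decay) = UNIV"
proof (rule l2_dense)
  have z: "(\<lambda>t. 0 * gauss 0 t) \<in> C2_decay" by (rule C2_decay_scale[OF gauss_C2])
  then show "0 \<in> cl ` C2_decay" by (auto simp: zero_l2_def)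
  show "x + y \<in> cl ` C2_decay" if "x \<in> cl ` C2_decay" "y \<in> cl ` C2_decay" for x y
    using that C2_decay_add C2_decay_props(3) by (auto simp: cl_add')
  show "cscale \<alpha> x \<in> cl ` C2_decay" if "x \<in> cl ` C2_decay" for \<alpha> x
    using that C2_decay_scale C2_decay_props(3) by (auto simp: cl_cscale)
  fix x assume 0: "\<And>s. s \<in> cl ` C2_decay \<Longrightarrow> bil x (conjl s) = 0"
  show "x = 0"
  proof (rule l2_eq_0_if_gauss_orthogonal)
    fix \<omega>
    have "(\<lambda>t. cnj (gauss (- \<omega>) t)) = gauss \<omega>" by (simp add: gauss_def cis_cnj fun_eq_iff)
    then have "conjl (cl (gauss (- \<omega>))) = cl (gauss \<omega>)" by (simp add: cl_conjl gauss_props)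
    then show "bil x (cl (gauss \<omega>)) = 0" using 0[of "cl (gauss (- \<omega>))"] gauss_C2 by auto
  qed
qed

text \<open>The L2 operator is defined weakly, by the multiplication formula against test functions;
  the Gaussians among them make the solution unique.\<close>

definition fourier :: "l2 \<Rightarrow> l2" where
  "fourier x = (THE w. \<forall>k. ftest k \<longrightarrow> bil w (cl k) = bil x (cl (ft k)))"

lemma fourier_unique:
  assumes "\<And>\<omega>. bil w (cl (gauss \<omega>)) = bil w' (cl (gauss \<omega>))" shows "w = w'"
proof -
  have "w - w' = 0"
  proof (rule l2_eq_0_if_gauss_orthogonal)
    fix \<omega>
    show "bil (w - w') (cl (gauss \<omega>)) = 0"
      using assms[of \<omega>] by (simp add: bounded_bilinear.diff_left[OF bounded_bilinear_bil])
  qed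
  then show ?thesis by simp
qed

text \<open>By isometry the transforms of an approximating sequence from the dense class are Cauchy;
  the limit inherits the norm, and the formula by continuity of \<open>bil\<close>.\<close>

lemma fourier_exists:
  "\<exists>w. norm w = norm x \<and> (\<forall>k. ftest k \<longrightarrow> bil w (cl k) = bil x (cl (ft k)))"
proof -
  have "x \<in> closure (cl ` C2_decay)" by (simp add: dense_C2)
  then obtain X where X: "\<And>n. X n \<in> cl ` C2_decay" "X \<longlonglongrightarrow> x" unfolding closure_sequential by blast
  from X(1) have "\<forall>n. \<exists>k. k \<in> C2_decay \<and> X n = cl k" by blast
  from choice[OF this] obtain g where g': "\<forall>n. g n \<in> C2_decay \<and> X n = cl (g n)" by (rule exE)
  have g: "\<And>n. g n \<in> C2_decay" "X = (\<lambda>n. cl (g n))" using g' by (simp_all add: fun_eq_iff)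
  have gt: "ftest (g n)" for n by (rule ftest_C2[OF g(1)])
  have gi: "integrable lborel (g n)" "g n \<in> L2_functions" for n using gt by (auto simp: ftest_def)
  have iso: "norm (cl (ft (g n)) - cl (ft (g m))) = norm (X n - X m)" for n m
  proof -
    have "(\<lambda>t. g n t + (-1) * g m t) \<in> C2_decay" by (rule C2_decay_add[OF g(1) C2_decay_scale[OF g(1)]])
    then have d: "ftest (\<lambda>t. g n t - g m t)" by (intro ftest_C2) simp
    have "cl (ft (g n)) - cl (ft (g m)) = cl (ft (\<lambda>t. g n t - g m t))"
    proof -
      have "ft (\<lambda>t. g n t - g m t) = (\<lambda>t. ft (g n) t - ft (g m) t)"
        by (rule ext, rule ft_diff[OF gi(1) gi(1)])
      then show ?thesis by (simp add: cl_minus' ftest_ft_L2[OF gt])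
    qed
    then show ?thesis by (simp add: ft_isometry[OF d] g(2) cl_minus' gi)
  qed
  have "Cauchy (\<lambda>n. cl (ft (g n)))"
    using LIMSEQ_imp_Cauchy[OF X(2)] unfolding Cauchy_def dist_norm iso .
  then obtain w where w: "(\<lambda>n. cl (ft (g n))) \<longlonglongrightarrow> w" using Cauchy_convergent convergent_def by blast
  have "bil w (cl k) = bil x (cl (ft k))" if k: "ftest k" for k
  proof -
    have kk: "integrable lborel k" "k \<in> L2_functions" using k by (auto simp: ftest_def)
    have "bil (cl (ft (g n))) (cl k) = bil (X n) (cl (ft k))" for n
      using ft_fubini[OF gi(1) kk(1)] by (simp add: g(2) bil_cl ftest_ft_L2 gt k kk gi)
    then have "(\<lambda>n. bil (X n) (cl (ft k))) \<longlonglongrightarrow> bil w (cl k)"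
      using bounded_bilinear.tendsto[OF bounded_bilinear_bil w tendsto_const[of "cl k"]] by simp
    moreover have "(\<lambda>n. bil (X n) (cl (ft k))) \<longlonglongrightarrow> bil x (cl (ft k))"
      by (intro bounded_bilinear.tendsto[OF bounded_bilinear_bil] X tendsto_const)
    ultimately show ?thesis by (rule LIMSEQ_unique)
  qed
  moreover have "norm w = norm x"
  proof (rule LIMSEQ_unique[OF tendsto_norm[OF w]])
    have "norm (cl (ft (g n))) = norm (X n)" for n by (simp add: ft_isometry[OF gt] g(2))
    then show "(\<lambda>n. norm (cl (ft (g n)))) \<longlonglongrightarrow> norm x" using tendsto_norm[OF X(2)] by simp
  qed
  ultimately show ?thesis by blast
qed

lemma fourier_eqI:
  assumes "\<And>\<omega>. bil w (cl (gauss \<omega>)) = bil x (cl (ft (gauss \<omega>)))"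
  shows "fourier x = w"
proof -
  obtain v where v: "\<And>k. ftest k \<Longrightarrow> bil v (cl k) = bil x (cl (ft k))" using fourier_exists by blast
  have "fourier x = v"
    unfolding fourier_def
  proof (rule the_equality)
    fix w' assume "\<forall>k. ftest k \<longrightarrow> bil w' (cl k) = bil x (cl (ft k))"
    then show "w' = v" using v ftest_C2[OF gauss_C2] by (intro fourier_unique) simp
  qed (use v in blast)
  moreover have "v = w" using v ftest_C2[OF gauss_C2] assms by (intro fourier_unique) simp
  ultimately show ?thesis by simp
qed

lemma bil_fourier_test: "ftest k \<Longrightarrow> bil (fourier x) (cl k) = bil x (cl (ft k))"
  and norm_fourier [simp]: "norm (fourier x) = norm x"
proof -
  obtain v where v: "norm v = norm x" "\<And>k. ftest k \<Longrightarrow> bil v (cl k) = bil x (cl (ft k))" using fourier_exists by blast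
  have "fourier x = v" using v(2) ftest_C2[OF gauss_C2] by (intro fourier_eqI) simp
  then show "ftest k \<Longrightarrow> bil (fourier x) (cl k) = bil x (cl (ft k))" "norm (fourier x) = norm x"
    using v by simp_all
qed

lemma fourier_add: "fourier (x + y) = fourier x + fourier y"
  and fourier_cscale: "fourier (cscale \<alpha> x) = cscale \<alpha> (fourier x)"
  by (rule fourier_eqI; simp add: bil_add_left bil_cscale_left bil_fourier_test ftest_C2 gauss_C2)+

text \<open>Square integrability of \<open>ft u\<close> is part of the conclusion: testing with
  Gaussians shows that \<open>ft u\<close> agrees almost everywhere with a representative of
  \<open>fourier (cl u)\<close>.\<close>

lemma fourier_cl:
  assumes u: "u \<in> L2_functions" "integrable lborel u"
  shows "ft u \<in> L2_functions" "fourier (cl u) = cl (ft u)"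
proof -
  let ?w = "fn (fourier (cl u))"
  have [measurable]: "ft u \<in> borel_measurable borel" by (rule ft_measurable[OF u(2)])
  have fg: "integrable lborel (\<lambda>t. ft u t * gauss \<omega> t)" for \<omega>
    using integrable_mult_bounded[OF gauss_props(2), of "ft u" "\<integral>t. cmod (u t) \<partial>lborel" \<omega>] cmod_ft_le[of u]
    by (simp add: mult.commute)
  have wg: "integrable lborel (\<lambda>t. ?w t * gauss \<omega> t)" for \<omega> by (rule L2_mult_integrable[OF fn_L2 gauss_props(3)])
  have AE: "AE t in lborel. ?w t - ft u t = 0"
  proof (rule AE_0_if_gauss_orthogonal)
    show "integrable lborel (\<lambda>t. (?w t - ft u t) * gauss 0 t)" using fg wg by (simp add: left_diff_distrib)
    fix \<omega>
    have t: "ftest (gauss \<omega>)" by (rule ftest_C2[OF gauss_C2])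
    have "(\<integral>t. ?w t * gauss \<omega> t \<partial>lborel) = (\<integral>t. u t * ft (gauss \<omega>) t \<partial>lborel)"
      using bil_fourier_test[OF t, of "cl u"] bil_cl[OF fn_L2 gauss_props(3), of "fourier (cl u)" \<omega>]
        bil_cl[OF u(1) ftest_ft_L2[OF t]] by simp
    also have "\<dots> = (\<integral>t. ft u t * gauss \<omega> t \<partial>lborel)" by (rule ft_fubini[OF u(2) gauss_props(2), symmetric])
    finally show "(\<integral>t. (?w t - ft u t) * gauss \<omega> t \<partial>lborel) = 0" using fg wg by (simp add: left_diff_distrib)
  qed
  then have AE': "AE t in lborel. ft u t = ?w t" by eventually_elim simp
  have "integrable lborel (\<lambda>t. (cmod (ft u t))\<^sup>2)"
    using AE' by (subst integrable_cong_AE[where g = "\<lambda>t. (cmod (?w t))\<^sup>2"]) auto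
  then show L: "ft u \<in> L2_functions" by (simp add: L2_functions_iff)
  have "cl (ft u) = cl ?w" using AE' L by (subst cl_eq_iff) auto
  then show "fourier (cl u) = cl (ft u)" by simp
qed

text \<open>Both sides are continuous in \<open>y\<close>, and on the dense class the identity is
  the defining property of \<open>fourier\<close>.\<close>

lemma bil_fourier: "bil (fourier x) y = bil x (fourier y)"
proof -
  have "y \<in> closure (cl ` C2_decay)" by (simp add: dense_C2)
  then obtain Y where Y: "\<And>n. Y n \<in> cl ` C2_decay" "Y \<longlonglongrightarrow> y" unfolding closure_sequential by blast
  have eq: "bil (fourier x) (Y n) = bil x (fourier (Y n))" for n
  proof -
    obtain k where k: "k \<in> C2_decay" "Y n = cl k" using Y(1)[of n] by blast
    show ?thesis using bil_fourier_test[OF ftest_C2[OF k(1)]] fourier_cl(2)[OF C2_decay_props(3,2)[OF k(1)]] k(2) by simp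
  qed
  have "fourier (Y n) - fourier y = fourier (Y n - y)" for n
    using fourier_add[of "Y n - y" y] by simp
  then have "norm (fourier (Y n) - fourier y) = norm (Y n - y)" for n by simp
  then have "(\<lambda>n. fourier (Y n)) \<longlonglongrightarrow> fourier y" using Y(2) by (simp add: tendsto_iff dist_norm)
  then have "(\<lambda>n. bil x (fourier (Y n))) \<longlonglongrightarrow> bil x (fourier y)"
    by (intro bounded_bilinear.tendsto[OF bounded_bilinear_bil] tendsto_const)
  moreover have "(\<lambda>n. bil (fourier x) (Y n)) \<longlonglongrightarrow> bil (fourier x) y"
    by (intro bounded_bilinear.tendsto[OF bounded_bilinear_bil] tendsto_const Y)
  ultimately show ?thesis unfolding eq by (intro LIMSEQ_unique)
qed

section \<open>Products of Schwartz functions and continuity of tempered distributions\<close>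

definition leibniz :: "(nat \<Rightarrow> real \<Rightarrow> complex) \<Rightarrow> (nat \<Rightarrow> real \<Rightarrow> complex) \<Rightarrow> nat \<Rightarrow> real \<Rightarrow> complex" where
  "leibniz a b n t = (\<Sum>k\<le>n. of_nat (n choose k) * (a k t * b (n - k) t))"

lemma leibniz_0: "leibniz a b 0 = (\<lambda>t. a 0 t * b 0 t)"
  by (simp add: leibniz_def fun_eq_iff)

text \<open>Pascal's rule, stated for an abstract double sequence so that differentiating the
  Leibniz sum becomes an index shift.\<close>

lemma leibniz_Suc:
  fixes x :: "nat \<Rightarrow> nat \<Rightarrow> complex"
  shows "(\<Sum>k\<le>n. of_nat (n choose k) * (x k (Suc (n - k)) + x (Suc k) (n - k)))
    = (\<Sum>k\<le>Suc n. of_nat (Suc n choose k) * x k (Suc n - k))"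
proof -
  define y where "y k = x k (Suc n - k)" for k
  have "(\<Sum>k\<le>Suc n. of_nat (Suc n choose k) * y k)
      = y 0 + (\<Sum>k\<le>n. of_nat (Suc n choose Suc k) * y (Suc k))"
    by (subst sum.atMost_Suc_shift) simp
  also have "\<dots> = y 0 + (\<Sum>k\<le>n. of_nat (n choose Suc k) * y (Suc k)) + (\<Sum>k\<le>n. of_nat (n choose k) * y (Suc k))"
    by (simp add: sum.distrib algebra_simps)
  also have "y 0 + (\<Sum>k\<le>n. of_nat (n choose Suc k) * y (Suc k)) = (\<Sum>k\<le>Suc n. of_nat (n choose k) * y k)"
    by (subst sum.atMost_Suc_shift) simp
  also have "\<dots> = (\<Sum>k\<le>n. of_nat (n choose k) * y k)" by simp
  finally have "(\<Sum>k\<le>Suc n. of_nat (Suc n choose k) * y k)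
      = (\<Sum>k\<le>n. of_nat (n choose k) * (y k + y (Suc k)))" by (simp add: sum.distrib algebra_simps)
  also have "\<dots> = (\<Sum>k\<le>n. of_nat (n choose k) * (x k (Suc (n - k)) + x (Suc k) (n - k)))"
    by (intro sum.cong refl) (simp add: y_def Suc_diff_le)
  finally show ?thesis by (simp add: y_def)
qed

lemma smooth_chain_leibniz:
  assumes a: "smooth_chain a" and b: "smooth_chain b" shows "smooth_chain (leibniz a b)"
  unfolding smooth_chain_def
proof (intro allI)
  fix n t
  have "((\<lambda>t. \<Sum>k\<le>n. of_nat (n choose k) * (a k t * b (n - k) t)) has_vector_derivative
     (\<Sum>k\<le>n. of_nat (n choose k) * (a k t * b (Suc (n - k)) t + a (Suc k) t * b (n - k) t))) (at t)"
    by (intro has_vector_derivative_sum has_vector_derivative_mult_right has_vector_derivative_mult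
        smooth_chainD[OF a] smooth_chainD[OF b])
  then show "(leibniz a b n has_vector_derivative leibniz a b (Suc n) t) (at t)"
    using leibniz_Suc[of n "\<lambda>k l. a k t * b l t"] by (simp add: leibniz_def[abs_def] del: sum.atMost_Suc)
qed

definition schwartz_chain :: "(nat \<Rightarrow> real \<Rightarrow> complex) \<Rightarrow> bool" where
  "schwartz_chain d \<longleftrightarrow> smooth_chain d \<and> (\<forall>m n. \<exists>B. \<forall>t. \<bar>t\<bar> ^ m * cmod (d n t) \<le> B)"

text \<open>Multipliers of the Schwartz space with a fixed growth rate for all derivatives. The
  weight \<open>1 + t^2\<close> also turns the locally uniform convergence of modulations and
  translates into convergence in a norm.\<close>

definition slow_chain :: "(nat \<Rightarrow> real \<Rightarrow> complex) \<Rightarrow> bool" where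
  "slow_chain b \<longleftrightarrow> smooth_chain b \<and> (\<forall>n. \<exists>K. \<forall>t. cmod (b n t) \<le> K * (1 + t\<^sup>2))"

lemma schwartz_chain_space: "schwartz_chain d \<Longrightarrow> d 0 \<in> schwartz_space"
  unfolding schwartz_chain_def by (elim conjE, rule schwartzI) blast+

lemma schwartz_chain_nth: "f \<in> schwartz_space \<Longrightarrow> schwartz_chain (\<lambda>n. nth_derivative n f)"
  unfolding schwartz_chain_def using schwartz_smooth_chain schwartz_bound by metis

lemma schwartz_chain_bound:
  assumes "schwartz_chain d" obtains B where "B \<ge> 0" "\<And>t. \<bar>t\<bar> ^ m * (1 + t\<^sup>2) * cmod (d n t) \<le> B"
proof -
  obtain B1 B2 where B: "\<And>t. \<bar>t\<bar> ^ m * cmod (d n t) \<le> B1" "\<And>t. \<bar>t\<bar> ^ (m + 2) * cmod (d n t) \<le> B2"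
    using assms unfolding schwartz_chain_def by metis
  have "\<bar>t\<bar> ^ m * (1 + t\<^sup>2) * cmod (d n t) \<le> B1 + B2" for t
    using B[of t] unfolding power_add power2_abs by (simp add: algebra_simps)
  moreover have "0 \<le> B1 + B2" using calculation[of 0] order_trans[OF _ calculation[of 0]] by simp
  ultimately show ?thesis using that by blast
qed

text \<open>The constant \<open>A\<close> depends on \<open>a\<close> only; this uniformity is what
  makes a distribution continuous in the multiplier \<open>b\<close>.\<close>

lemma leibniz_bound:
  assumes a: "schwartz_chain a"
  shows "\<exists>A\<ge>0. \<forall>b \<delta>. (\<forall>j\<le>n. \<forall>t. cmod (b j t) \<le> \<delta> * (1 + t\<^sup>2)) \<longrightarrow>
    (\<forall>t. \<bar>t\<bar> ^ m * cmod (leibniz a b n t) \<le> A * \<delta>)"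
proof -
  have "\<forall>k. \<exists>B. B \<ge> 0 \<and> (\<forall>t. \<bar>t\<bar> ^ m * (1 + t\<^sup>2) * cmod (a k t) \<le> B)"
    using schwartz_chain_bound[OF a] by metis
  then obtain B where B: "\<And>k. B k \<ge> 0" "\<And>k t. \<bar>t\<bar> ^ m * (1 + t\<^sup>2) * cmod (a k t) \<le> B k" by metis
  define A where "A = (\<Sum>k\<le>n. real (n choose k) * B k)"
  have "\<bar>t\<bar> ^ m * cmod (leibniz a b n t) \<le> A * \<delta>"
    if b: "\<forall>j\<le>n. \<forall>t. cmod (b j t) \<le> \<delta> * (1 + t\<^sup>2)" for b \<delta> t
  proof -
    have "0 \<le> \<delta> * (1 + 0\<^sup>2)" using b[rule_format, of 0 0] norm_ge_zero order_trans by blast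
    then have d0: "0 \<le> \<delta>" by simp
    have "\<bar>t\<bar> ^ m * cmod (leibniz a b n t) \<le> \<bar>t\<bar> ^ m * (\<Sum>k\<le>n. cmod (of_nat (n choose k) * (a k t * b (n - k) t)))"
      unfolding leibniz_def by (intro mult_left_mono norm_sum) simp
    also have "\<dots> = (\<Sum>k\<le>n. real (n choose k) * (\<bar>t\<bar> ^ m * cmod (a k t) * cmod (b (n - k) t)))"
      by (simp add: sum_distrib_left norm_mult mult_ac)
    also have "\<dots> \<le> (\<Sum>k\<le>n. real (n choose k) * (B k * \<delta>))"
    proof (intro sum_mono mult_left_mono)
      fix k
      have "\<bar>t\<bar> ^ m * cmod (a k t) * cmod (b (n - k) t) \<le> \<bar>t\<bar> ^ m * cmod (a k t) * (\<delta> * (1 + t\<^sup>2))"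
        using b by (intro mult_left_mono) auto
      also have "\<dots> = (\<bar>t\<bar> ^ m * (1 + t\<^sup>2) * cmod (a k t)) * \<delta>" by (simp add: mult_ac)
      also have "\<dots> \<le> B k * \<delta>" by (intro mult_right_mono B d0)
      finally show "\<bar>t\<bar> ^ m * cmod (a k t) * cmod (b (n - k) t) \<le> B k * \<delta>" .
    qed auto
    finally show ?thesis by (simp add: A_def sum_distrib_right mult.assoc)
  qed
  moreover have "A \<ge> 0" unfolding A_def using B by (intro sum_nonneg) auto
  ultimately show ?thesis by blast
qed

lemma schwartz_leibniz:
  assumes a: "schwartz_chain a" and b: "slow_chain b" shows "schwartz_chain (leibniz a b)"
  unfolding schwartz_chain_def
proof (intro conjI allI)
  show "smooth_chain (leibniz a b)" using assms by (auto simp: schwartz_chain_def slow_chain_def smooth_chain_leibniz)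
  fix m n
  have "\<forall>j. \<exists>K. \<forall>t. cmod (b j t) \<le> K * (1 + t\<^sup>2)" using b by (simp add: slow_chain_def)
  then obtain K where K: "\<And>j t. cmod (b j t) \<le> K j * (1 + t\<^sup>2)" by metis
  define \<delta> where "\<delta> = (\<Sum>j\<le>n. \<bar>K j\<bar>)"
  have "\<forall>j\<le>n. \<forall>t. cmod (b j t) \<le> \<delta> * (1 + t\<^sup>2)"
  proof (intro allI impI)
    fix j t assume "j \<le> n"
    then have "\<bar>K j\<bar> \<le> \<delta>" unfolding \<delta>_def by (intro member_le_sum) auto
    then have "K j * (1 + t\<^sup>2) \<le> \<delta> * (1 + t\<^sup>2)" by (intro mult_right_mono) auto
    then show "cmod (b j t) \<le> \<delta> * (1 + t\<^sup>2)" using K[of j t] by linarith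
  qed
  then show "\<exists>B. \<forall>t. \<bar>t\<bar> ^ m * cmod (leibniz a b n t) \<le> B"
    using leibniz_bound[OF a, of n m] by blast
qed

lemma schwartz_chain_slow: "schwartz_chain d \<Longrightarrow> slow_chain d"
proof -
  assume d: "schwartz_chain d"
  have "\<exists>K. \<forall>t. cmod (d n t) \<le> K * (1 + t\<^sup>2)" for n
  proof -
    obtain B where B: "B \<ge> 0" "\<And>t. \<bar>t\<bar> ^ 0 * (1 + t\<^sup>2) * cmod (d n t) \<le> B" by (rule schwartz_chain_bound[OF d, of 0 n]) blast
    have "cmod (d n t) \<le> B * (1 + t\<^sup>2)" for t
    proof -
      have "1 * cmod (d n t) \<le> (1 + t\<^sup>2) * cmod (d n t)" by (intro mult_right_mono) auto
      moreover have "B * 1 \<le> B * (1 + t\<^sup>2)" using B(1) by (intro mult_left_mono) auto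
      ultimately show ?thesis using B(2)[of t] by simp
    qed
    then show ?thesis by blast
  qed
  then show ?thesis using d by (auto simp: slow_chain_def schwartz_chain_def)
qed

lemma schwartz_mult_slow:
  assumes "\<phi> \<in> schwartz_space" "slow_chain b" shows "(\<lambda>t. \<phi> t * b 0 t) \<in> schwartz_space"
  using schwartz_chain_space[OF schwartz_leibniz[OF schwartz_chain_nth[OF assms(1)] assms(2)]]
  by (simp add: leibniz_0)

lemma schwartz_mult: "\<phi> \<in> schwartz_space \<Longrightarrow> \<psi> \<in> schwartz_space \<Longrightarrow> (\<lambda>t. \<phi> t * \<psi> t) \<in> schwartz_space"
  using schwartz_mult_slow[OF _ schwartz_chain_slow[OF schwartz_chain_nth], of \<phi> \<psi>] by simp

lemma slow_chain_lincomb: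
  assumes "slow_chain b" "slow_chain c" shows "slow_chain (\<lambda>n t. b n t + \<alpha> * c n t)"
  unfolding slow_chain_def
proof (intro conjI allI)
  show "smooth_chain (\<lambda>n t. b n t + \<alpha> * c n t)"
    using assms unfolding slow_chain_def smooth_chain_def
    by (auto intro!: has_vector_derivative_add has_vector_derivative_mult_right)
  fix n
  obtain K L where "\<And>t. cmod (b n t) \<le> K * (1 + t\<^sup>2)" "\<And>t. cmod (c n t) \<le> L * (1 + t\<^sup>2)"
    using assms unfolding slow_chain_def by blast
  then have "cmod (b n t + \<alpha> * c n t) \<le> (K + cmod \<alpha> * L) * (1 + t\<^sup>2)" for t
    using norm_triangle_ineq[of "b n t" "\<alpha> * c n t"] mult_left_mono[of "cmod (c n t)" "L * (1 + t\<^sup>2)" "cmod \<alpha>"]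
    by (simp add: norm_mult distrib_right mult.assoc) (smt (verit))
  then show "\<exists>K. \<forall>t. cmod (b n t + \<alpha> * c n t) \<le> K * (1 + t\<^sup>2)" by blast
qed

lemma schwartz_cnj: "\<phi> \<in> schwartz_space \<Longrightarrow> (\<lambda>t. cnj (\<phi> t)) \<in> schwartz_space"
proof -
  assume \<phi>: "\<phi> \<in> schwartz_space"
  have "schwartz_chain (\<lambda>n t. cnj (nth_derivative n \<phi> t))"
    using schwartz_chain_nth[OF \<phi>] unfolding schwartz_chain_def smooth_chain_def
    by (auto intro!: has_vector_derivative_cnj)
  from schwartz_chain_space[OF this] show ?thesis by simp
qed

lemma power_add_le: fixes x y :: real assumes "x \<ge> 0" "y \<ge> 0" shows "(x + y) ^ m \<le> 2 ^ m * (x ^ m + y ^ m)"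
proof -
  have "(x + y) ^ m \<le> (2 * max x y) ^ m" using assms by (intro power_mono) auto
  also have "\<dots> = 2 ^ m * max x y ^ m" by (rule power_mult_distrib)
  also have "max x y ^ m \<le> x ^ m + y ^ m" using assms by (auto simp: max_def)
  finally show ?thesis by simp
qed

lemma schwartz_translate_bound:
  assumes d: "schwartz_chain d"
  obtains B where "\<And>y t. \<bar>t - y\<bar> \<le> c \<Longrightarrow> \<bar>t\<bar> ^ m * cmod (d n y) \<le> B"
proof -
  obtain B1 B2 where B: "\<And>t. \<bar>t\<bar> ^ m * cmod (d n t) \<le> B1" "\<And>t. \<bar>t\<bar> ^ 0 * cmod (d n t) \<le> B2"
    using d unfolding schwartz_chain_def by metis
  have "\<bar>t\<bar> ^ m * cmod (d n y) \<le> 2 ^ m * (B1 + \<bar>c\<bar> ^ m * B2)" if "\<bar>t - y\<bar> \<le> c" for y t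
  proof -
    have "\<bar>t\<bar> ^ m \<le> (\<bar>y\<bar> + \<bar>c\<bar>) ^ m" using that by (intro power_mono) auto
    also have "\<dots> \<le> 2 ^ m * (\<bar>y\<bar> ^ m + \<bar>c\<bar> ^ m)" by (rule power_add_le) auto
    finally have "\<bar>t\<bar> ^ m * cmod (d n y) \<le> 2 ^ m * (\<bar>y\<bar> ^ m + \<bar>c\<bar> ^ m) * cmod (d n y)" by (rule mult_right_mono) simp
    also have "\<dots> = 2 ^ m * (\<bar>y\<bar> ^ m * cmod (d n y) + \<bar>c\<bar> ^ m * cmod (d n y))" by (simp add: algebra_simps)
    also have "\<dots> \<le> 2 ^ m * (B1 + \<bar>c\<bar> ^ m * B2)"
      using B(1)[of y] B(2)[of y] by (intro mult_left_mono add_mono) auto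
    finally show ?thesis .
  qed
  then show ?thesis using that by blast
qed

lemma schwartz_chain_translate:
  assumes d: "schwartz_chain d" shows "schwartz_chain (\<lambda>n t. d n (t - x))"
  unfolding schwartz_chain_def
proof (intro conjI allI)
  show "smooth_chain (\<lambda>n t. d n (t - x))"
    unfolding smooth_chain_def
  proof (intro allI)
    fix n t
    have "(d n has_vector_derivative d (Suc n) (t - x)) (at (t - x))"
      using d by (simp add: schwartz_chain_def smooth_chainD)
    from vector_diff_chain_at[of "\<lambda>t. t - x" 1 t "d n", unfolded comp_def, OF _ this]
    show "((\<lambda>t. d n (t - x)) has_vector_derivative d (Suc n) (t - x)) (at t)"
      by (simp add: has_vector_derivative_diff_const)
  qed
  show "\<exists>B. \<forall>t. \<bar>t\<bar> ^ m * cmod (d n (t - x)) \<le> B" for m n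
  proof -
    obtain B where B: "\<And>y t. \<bar>t - y\<bar> \<le> \<bar>x\<bar> \<Longrightarrow> \<bar>t\<bar> ^ m * cmod (d n y) \<le> B"
      using schwartz_translate_bound[OF d] by blast
    then show ?thesis by (intro exI[of _ B]) simp
  qed
qed

lemma schwartz_translate: "\<phi> \<in> schwartz_space \<Longrightarrow> (\<lambda>t. \<phi> (t - x)) \<in> schwartz_space"
  using schwartz_chain_space[OF schwartz_chain_translate[OF schwartz_chain_nth]] by simp

lemma slow_chain_translate:
  assumes d: "smooth_chain d" "\<And>n t. cmod (d n t) \<le> M n" shows "slow_chain (\<lambda>n t. d n (t - x))"
  unfolding slow_chain_def
proof (intro conjI allI)
  show "smooth_chain (\<lambda>n t. d n (t - x))"
    unfolding smooth_chain_def
  proof (intro allI)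
    fix n t
    from vector_diff_chain_at[of "\<lambda>t. t - x" 1 t "d n", unfolded comp_def, OF _ smooth_chainD[OF d(1)]]
    show "((\<lambda>t. d n (t - x)) has_vector_derivative d (Suc n) (t - x)) (at t)"
      by (simp add: has_vector_derivative_diff_const)
  qed
  fix n
  have "cmod (d n (t - x)) \<le> \<bar>M n\<bar> * (1 + t\<^sup>2)" for t
  proof -
    have "\<bar>M n\<bar> * 1 \<le> \<bar>M n\<bar> * (1 + t\<^sup>2)" by (intro mult_left_mono) auto
    then show ?thesis using d(2)[of n "t - x"] by simp
  qed
  then show "\<exists>K. \<forall>t. cmod (d n (t - x)) \<le> K * (1 + t\<^sup>2)" by blast
qed

definition mod_chain :: "real \<Rightarrow> nat \<Rightarrow> real \<Rightarrow> complex" where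
  "mod_chain \<omega> n t = (- 2 * pi * \<i> * of_real \<omega>) ^ n * cis (- 2 * pi * \<omega> * t)"

lemma has_vector_derivative_cis_mod:
  "((\<lambda>t. cis (- 2 * pi * \<omega> * t)) has_vector_derivative - 2 * pi * \<i> * of_real \<omega> * cis (- 2 * pi * \<omega> * t)) (at t)"
  unfolding cis_conv_exp by (rule derivative_eq_intros has_vector_derivative_real_field refl | simp)+

lemma mod_chain_slow: "slow_chain (mod_chain \<omega>)"
  unfolding slow_chain_def
proof (intro conjI allI)
  show "smooth_chain (mod_chain \<omega>)"
    unfolding smooth_chain_def
  proof (intro allI)
    fix n t
    from has_vector_derivative_mult_right[OF has_vector_derivative_cis_mod, of "(- 2 * pi * \<i> * of_real \<omega>) ^ n" \<omega> t]
    show "(mod_chain \<omega> n has_vector_derivative mod_chain \<omega> (Suc n) t) (at t)"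
      by (simp add: mod_chain_def[abs_def] mult_ac)
  qed
  fix n
  let ?M = "(2 * pi * \<bar>\<omega>\<bar>) ^ n"
  have "cmod (mod_chain \<omega> n t) \<le> ?M * (1 + t\<^sup>2)" for t
  proof -
    have "?M * 1 \<le> ?M * (1 + t\<^sup>2)" by (intro mult_left_mono) auto
    then show ?thesis by (simp add: mod_chain_def norm_mult norm_power)
  qed
  then show "\<exists>K. \<forall>t. cmod (mod_chain \<omega> n t) \<le> K * (1 + t\<^sup>2)" by blast
qed

lemma schwartz_modulate: "\<phi> \<in> schwartz_space \<Longrightarrow> (\<lambda>t. \<phi> t * cis (- 2 * pi * \<omega> * t)) \<in> schwartz_space"
  using schwartz_mult_slow[OF _ mod_chain_slow[of \<omega>], of \<phi>] by (simp add: mod_chain_def)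

subsection \<open>Tempered distributions\<close>

lemma temperedD:
  assumes "f \<in> tempered_distributions"
  shows "\<phi> \<in> schwartz_space \<Longrightarrow> \<psi> \<in> schwartz_space \<Longrightarrow> f (\<lambda>t. \<phi> t + \<psi> t) = f \<phi> + f \<psi>"
    and "\<phi> \<in> schwartz_space \<Longrightarrow> f (\<lambda>t. \<alpha> * \<phi> t) = \<alpha> * f \<phi>"
    and "\<phi> \<notin> schwartz_space \<Longrightarrow> f \<phi> = 0"
  using assms by (simp_all add: tempered_distributions_def)

lemma tempered_bound:
  assumes f: "f \<in> tempered_distributions"
  obtains C N where "C \<ge> 0" "\<And>d \<delta>. schwartz_chain d \<Longrightarrow> (\<And>m n t. m \<le> N \<Longrightarrow> n \<le> N \<Longrightarrow> \<bar>t\<bar> ^ m * cmod (d n t) \<le> \<delta>)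
    \<Longrightarrow> cmod (f (d 0)) \<le> C * \<delta>"
proof -
  obtain C N where C: "\<And>\<phi>. \<phi> \<in> schwartz_space \<Longrightarrow> cmod (f \<phi>) \<le> C * (\<Sum>m\<le>N. \<Sum>n\<le>N. schwartz_seminorm m n \<phi>)"
    using f unfolding tempered_distributions_def by blast
  \<comment> \<open>The double sum has \<open>Suc N * Suc N\<close> terms, each at most
    \<open>\<delta>\<close>.\<close>
  have "cmod (f (d 0)) \<le> (\<bar>C\<bar> * (real (Suc N) * real (Suc N))) * \<delta>"
    if d: "schwartz_chain d" and le: "\<And>m n t. m \<le> N \<Longrightarrow> n \<le> N \<Longrightarrow> \<bar>t\<bar> ^ m * cmod (d n t) \<le> \<delta>" for d \<delta>
  proof -
    have sd: "nth_derivative n (d 0) = d n" for n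
      using d by (intro nth_derivative_chain) (simp add: schwartz_chain_def)
    have s: "0 \<le> schwartz_seminorm m n (d 0) \<and> schwartz_seminorm m n (d 0) \<le> \<delta>" if "m \<le> N" "n \<le> N" for m n
    proof
      have b: "cmod (t ^ m *\<^sub>R d n t) \<le> \<delta>" for t using le[OF that, of t] by (simp add: power_abs)
      show "schwartz_seminorm m n (d 0) \<le> \<delta>"
        unfolding schwartz_seminorm_def sd by (rule cSUP_least) (use b in auto)
      have "cmod (0 ^ m *\<^sub>R d n 0) \<le> schwartz_seminorm m n (d 0)"
        unfolding schwartz_seminorm_def sd by (rule cSUP_upper) (use b in \<open>auto intro!: bdd_aboveI[of _ \<delta>]\<close>)
      then show "0 \<le> schwartz_seminorm m n (d 0)" using norm_ge_zero order_trans by blast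
    qed
    let ?S = "\<Sum>m\<le>N. \<Sum>n\<le>N. schwartz_seminorm m n (d 0)"
    have "?S \<le> (\<Sum>m\<le>N. \<Sum>n\<le>N. \<delta>)" using s by (intro sum_mono) auto
    then have S: "?S \<le> real (Suc N) * real (Suc N) * \<delta>" by (simp add: mult.assoc)
    have "0 \<le> ?S" using s by (intro sum_nonneg) auto
    then have "C * ?S \<le> \<bar>C\<bar> * ?S" by (intro mult_right_mono) auto
    also have "\<dots> \<le> \<bar>C\<bar> * (real (Suc N) * real (Suc N) * \<delta>)" using S by (intro mult_left_mono) auto
    finally show ?thesis using C[OF schwartz_chain_space[OF d]] by (simp add: mult.assoc)
  qed
  then show ?thesis by (intro that[of "\<bar>C\<bar> * (real (Suc N) * real (Suc N))" N]) auto
qed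

text \<open>With the Schwartz factor \<open>\<phi>\<close> fixed, \<open>f\<close> becomes
  continuous in the multiplier for the weighted norm of finitely many derivatives;
  \<open>tempered_isCont\<close> and \<open>tempered_FTC\<close> rest on this estimate.\<close>

lemma tempered_mult_bound:
  assumes f: "f \<in> tempered_distributions" and \<phi>: "\<phi> \<in> schwartz_space"
  obtains C N where "C \<ge> 0" "\<And>b \<delta>. slow_chain b \<Longrightarrow> (\<And>n t. n \<le> N \<Longrightarrow> cmod (b n t) \<le> \<delta> * (1 + t\<^sup>2))
    \<Longrightarrow> cmod (f (\<lambda>t. \<phi> t * b 0 t)) \<le> C * \<delta>"
proof -
  obtain C N where C: "C \<ge> 0" "\<And>d \<delta>. schwartz_chain d \<Longrightarrow> (\<And>m n t. m \<le> N \<Longrightarrow> n \<le> N \<Longrightarrow> \<bar>t\<bar> ^ m * cmod (d n t) \<le> \<delta>)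
    \<Longrightarrow> cmod (f (d 0)) \<le> C * \<delta>" by (rule tempered_bound[OF f]) blast
  let ?a = "\<lambda>n. nth_derivative n \<phi>"
  note a = schwartz_chain_nth[OF \<phi>]
  have "\<forall>m n. \<exists>A\<ge>0. \<forall>b \<delta>. (\<forall>j\<le>n. \<forall>t. cmod (b j t) \<le> \<delta> * (1 + t\<^sup>2)) \<longrightarrow>
    (\<forall>t. \<bar>t\<bar> ^ m * cmod (leibniz ?a b n t) \<le> A * \<delta>)" using leibniz_bound[OF a] by blast
  then obtain A where A: "\<And>m n. A m n \<ge> 0" "\<And>m n b \<delta> t. \<forall>j\<le>n. \<forall>t. cmod (b j t) \<le> \<delta> * (1 + t\<^sup>2)
     \<Longrightarrow> \<bar>t\<bar> ^ m * cmod (leibniz ?a b n t) \<le> A m n * \<delta>" by metis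
  define K where "K = (\<Sum>m\<le>N. \<Sum>n\<le>N. A m n)"
  have AK: "A m n \<le> K" if "m \<le> N" "n \<le> N" for m n
  proof -
    have "A m n \<le> (\<Sum>n\<le>N. A m n)" using that A(1) by (intro member_le_sum) auto
    also have "\<dots> \<le> K" unfolding K_def using that A(1) by (intro member_le_sum[where f = "\<lambda>m. \<Sum>n\<le>N. A m n"] sum_nonneg) auto
    finally show ?thesis .
  qed
  have "cmod (f (\<lambda>t. \<phi> t * b 0 t)) \<le> (C * K) * \<delta>"
    if b: "slow_chain b" and le: "\<And>n t. n \<le> N \<Longrightarrow> cmod (b n t) \<le> \<delta> * (1 + t\<^sup>2)" for b \<delta>
  proof -
    have "0 \<le> \<delta> * (1 + 0\<^sup>2)" using le[of 0 0] norm_ge_zero order_trans by blast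
    then have d0: "0 \<le> \<delta>" by simp
    have "cmod (f (leibniz ?a b 0)) \<le> C * (K * \<delta>)"
    proof (rule C(2)[OF schwartz_leibniz[OF a b]])
      fix m n t assume mn: "m \<le> N" "n \<le> N"
      have "\<bar>t\<bar> ^ m * cmod (leibniz ?a b n t) \<le> A m n * \<delta>" using le mn by (intro A(2)) auto
      also have "\<dots> \<le> K * \<delta>" using AK[OF mn] d0 by (rule mult_right_mono)
      finally show "\<bar>t\<bar> ^ m * cmod (leibniz ?a b n t) \<le> K * \<delta>" .
    qed
    then show ?thesis by (simp add: leibniz_0 mult.assoc)
  qed
  moreover have "K \<ge> 0" unfolding K_def using A(1) by (intro sum_nonneg) auto
  ultimately show ?thesis using C(1) by (intro that[of "C * K" N]) auto
qed

lemma tempered_lincomb: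
  assumes f: "f \<in> tempered_distributions" and \<phi>: "\<phi> \<in> schwartz_space" and b: "slow_chain b" and c: "slow_chain c"
  shows "f (\<lambda>t. \<phi> t * (b 0 t + \<alpha> * c 0 t)) = f (\<lambda>t. \<phi> t * b 0 t) + \<alpha> * f (\<lambda>t. \<phi> t * c 0 t)"
proof -
  note sb = schwartz_mult_slow[OF \<phi> b] and sc = schwartz_mult_slow[OF \<phi> c]
  have "slow_chain (\<lambda>n t. 0)"
    by (auto simp: slow_chain_def smooth_chain_def intro!: exI[of _ 0])
  from schwartz_mult_slow[OF \<phi> slow_chain_lincomb[OF this c, of \<alpha>]]
  have "(\<lambda>t. \<alpha> * (\<phi> t * c 0 t)) \<in> schwartz_space" by (simp add: mult_ac)
  from temperedD(1)[OF f sb this] show ?thesis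
    by (simp add: temperedD(2)[OF f sc] distrib_left mult_ac)
qed

lemma uniform_upto:
  assumes "\<And>n. \<exists>d>0. \<forall>s'. \<bar>s' - s\<bar> < d \<longrightarrow> Q n s'"
  shows "\<exists>d>0. \<forall>s'. \<bar>s' - s\<bar> < d \<longrightarrow> (\<forall>n\<le>N::nat. Q n (s'::real))"
proof -
  obtain d where d: "\<And>n. d n > 0" "\<And>n s'. \<bar>s' - s\<bar> < d n \<Longrightarrow> Q n s'" using assms by metis
  have "0 < Min (d ` {..N})" using d(1) by (subst Min_gr_iff) auto
  moreover have "Min (d ` {..N}) \<le> d n" if "n \<le> N" for n using that by (intro Min_le) auto
  ultimately show ?thesis using d(2) by (intro exI[of _ "Min (d ` {..N})"]) (auto intro: less_le_trans)
qed

lemma slow_chain_zero: "slow_chain (\<lambda>n t. 0)"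
  by (auto simp: slow_chain_def smooth_chain_def intro!: exI[of _ 0])

lemma slow_chain_scale: "slow_chain b \<Longrightarrow> slow_chain (\<lambda>n t. \<alpha> * b n t)"
  using slow_chain_lincomb[OF slow_chain_zero, of b \<alpha>] by simp

lemma tempered_diff:
  assumes f: "f \<in> tempered_distributions" and \<phi>: "\<phi> \<in> schwartz_space" and b: "slow_chain b" and c: "slow_chain c"
  shows "f (\<lambda>t. \<phi> t * b 0 t) - f (\<lambda>t. \<phi> t * c 0 t) = f (\<lambda>t. \<phi> t * (b 0 t + (-1) * c 0 t))"
  using tempered_lincomb[OF assms, of "-1"] by simp

lemma tempered_isCont:
  fixes P :: "real \<Rightarrow> nat \<Rightarrow> real \<Rightarrow> complex"
  assumes f: "f \<in> tempered_distributions" and \<phi>: "\<phi> \<in> schwartz_space"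
    and P: "\<And>s. slow_chain (P s)"
    and Pcont: "\<And>n \<epsilon>. \<epsilon> > 0 \<Longrightarrow> \<exists>d>0. \<forall>s'. \<bar>s' - s\<bar> < d \<longrightarrow> (\<forall>t. cmod (P s' n t - P s n t) \<le> \<epsilon> * (1 + t\<^sup>2))"
  shows "isCont (\<lambda>s. f (\<lambda>t. \<phi> t * P s 0 t)) s"
proof -
  obtain C N where C: "C \<ge> 0" "\<And>b \<delta>. slow_chain b \<Longrightarrow> (\<And>n t. n \<le> N \<Longrightarrow> cmod (b n t) \<le> \<delta> * (1 + t\<^sup>2))
    \<Longrightarrow> cmod (f (\<lambda>t. \<phi> t * b 0 t)) \<le> C * \<delta>" by (rule tempered_mult_bound[OF f \<phi>]) blast
  let ?p = "\<lambda>s. f (\<lambda>t. \<phi> t * P s 0 t)"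
  have Pcont': "\<exists>d>0. \<forall>s'. \<bar>s' - s\<bar> < d \<longrightarrow> (\<forall>n\<le>N. \<forall>t. cmod (P s' n t - P s n t) \<le> \<epsilon> * (1 + t\<^sup>2))"
    if e: "\<epsilon> > 0" for \<epsilon>
    by (rule uniform_upto, rule Pcont, rule e)
  show ?thesis
    unfolding continuous_at_eps_delta dist_norm
  proof (intro allI impI)
    fix e :: real assume e: "e > 0"
    \<comment> \<open>The denominator is positive also for \<open>C = 0\<close>, and
      \<open>C\<close> times the quotient stays strictly below \<open>e\<close>.\<close>
    have e': "e / (2 * (C + 1)) > 0" using e C(1) by simp
    from Pcont'[OF this] obtain d where d: "d > 0"
      "\<And>s' n t. \<bar>s' - s\<bar> < d \<Longrightarrow> n \<le> N \<Longrightarrow> cmod (P s' n t - P s n t) \<le> e / (2 * (C + 1)) * (1 + t\<^sup>2)" by blast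
    have "cmod (?p s' - ?p s) < e" if "\<bar>s' - s\<bar> < d" for s'
    proof -
      have "cmod (?p s' - ?p s) \<le> C * (e / (2 * (C + 1)))"
        unfolding tempered_diff[OF f \<phi> P P] by (rule C(2)[OF slow_chain_lincomb[OF P P]]) (use d(2)[OF that] in simp)
      also have "\<dots> < e"
        using e C(1) by (simp add: field_simps) (intro add_nonneg_pos mult_nonneg_nonneg mult_pos_pos; simp)
      finally show ?thesis .
    qed
    then show "\<exists>d>0. \<forall>x'. norm (x' - s) < d \<longrightarrow> cmod (?p x' - ?p s) < e" using d(1) by auto
  qed
qed

text \<open>The primitive \<open>s \<mapsto> f (\<phi> B\<^sub>s)\<close> is differentiated instead of interchanging \<open>f\<close> with an integral
  valued in the Schwartz space.\<close>

lemma tempered_FTC: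
  fixes B P :: "real \<Rightarrow> nat \<Rightarrow> real \<Rightarrow> complex"
  assumes f: "f \<in> tempered_distributions" and \<phi>: "\<phi> \<in> schwartz_space"
    and B: "\<And>s. slow_chain (B s)" and P: "\<And>s. slow_chain (P s)" and L: "slow_chain L"
    and deriv: "\<And>n t s. ((\<lambda>s. B s n t) has_vector_derivative P s n t) (at s)"
    and Pcont: "\<And>n s \<epsilon>. \<epsilon> > 0 \<Longrightarrow> \<exists>d>0. \<forall>s'. \<bar>s' - s\<bar> < d \<longrightarrow> (\<forall>t. cmod (P s' n t - P s n t) \<le> \<epsilon> * (1 + t\<^sup>2))"
    and top: "\<And>n \<epsilon>. \<epsilon> > 0 \<Longrightarrow> \<forall>\<^sub>F s in at_top. \<forall>t. cmod (B s n t - L n t) \<le> \<epsilon> * (1 + t\<^sup>2)"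
    and bot: "\<And>n \<epsilon>. \<epsilon> > 0 \<Longrightarrow> \<forall>\<^sub>F s in at_bot. \<forall>t. cmod (B s n t) \<le> \<epsilon> * (1 + t\<^sup>2)"
    and int: "integrable lborel (\<lambda>s. f (\<lambda>t. \<phi> t * P s 0 t))"
  shows "(\<integral>s. f (\<lambda>t. \<phi> t * P s 0 t) \<partial>lborel) = f (\<lambda>t. \<phi> t * L 0 t)"
proof -
  obtain C N where C: "C \<ge> 0" "\<And>b \<delta>. slow_chain b \<Longrightarrow> (\<And>n t. n \<le> N \<Longrightarrow> cmod (b n t) \<le> \<delta> * (1 + t\<^sup>2))
    \<Longrightarrow> cmod (f (\<lambda>t. \<phi> t * b 0 t)) \<le> C * \<delta>" by (rule tempered_mult_bound[OF f \<phi>]) blast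
  let ?G = "\<lambda>s. f (\<lambda>t. \<phi> t * B s 0 t)" and ?p = "\<lambda>s. f (\<lambda>t. \<phi> t * P s 0 t)"
  have pc: "isCont ?p s" for s by (rule tempered_isCont[OF f \<phi> P Pcont])
  note diff = tempered_diff[OF f \<phi>]
  have Pcont': "\<exists>d>0. \<forall>s'. \<bar>s' - s\<bar> < d \<longrightarrow> (\<forall>n\<le>N. \<forall>t. cmod (P s' n t - P s n t) \<le> \<epsilon> * (1 + t\<^sup>2))"
    if e: "\<epsilon> > 0" for s \<epsilon>
    by (rule uniform_upto, rule Pcont, rule e)
  \<comment> \<open>The derivative is known for each \<open>t\<close> separately; the mean value
    inequality with \<open>Pcont\<close> makes the linearisation error uniform in \<open>t\<close>
    relative to the weight.\<close>
  have lin: "cmod (B s' n t - B s n t - (s' - s) *\<^sub>R P s n t) \<le> \<bar>s' - s\<bar> * (\<epsilon> * (1 + t\<^sup>2))"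
    if "\<And>\<sigma>. \<bar>\<sigma> - s\<bar> \<le> \<bar>s' - s\<bar> \<Longrightarrow> cmod (P \<sigma> n t - P s n t) \<le> \<epsilon> * (1 + t\<^sup>2)" for s s' n t \<epsilon>
  proof -
    have "norm (B s' n t - B s n t - (s' - s) *\<^sub>R P s n t) \<le> norm (s' - s) * (\<epsilon> * (1 + t\<^sup>2))"
    proof (rule vector_differentiable_bound_linearization[where S = "closed_segment s s'" and f = "\<lambda>s. B s n t" and f' = "\<lambda>s. P s n t"])
      fix \<sigma> assume "\<sigma> \<in> closed_segment s s'"
      then have "\<bar>\<sigma> - s\<bar> \<le> \<bar>s' - s\<bar>" by (auto simp: closed_segment_eq_real_ivl split: if_splits)
      then show "norm (P \<sigma> n t - P s n t) \<le> \<epsilon> * (1 + t\<^sup>2)" by (rule that)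
    qed (auto intro: has_vector_derivative_at_within deriv)
    then show ?thesis by simp
  qed
  have G: "(?G has_vector_derivative ?p s) (at s)" for s
    unfolding has_vector_derivative_def has_derivative_at_alt
  proof (intro conjI allI impI)
    show "bounded_linear (\<lambda>x. x *\<^sub>R ?p s)" by (rule bounded_linear_scaleR_left)
    fix e :: real assume e: "e > 0"
    define \<epsilon> where "\<epsilon> = e / (C + 1)"
    have \<epsilon>: "\<epsilon> > 0" "C * \<epsilon> \<le> e" using e C(1) by (auto simp: \<epsilon>_def field_simps)
    from Pcont'[OF \<epsilon>(1)] obtain d where d: "d > 0"
      "\<And>s' n t. \<bar>s' - s\<bar> < d \<Longrightarrow> n \<le> N \<Longrightarrow> cmod (P s' n t - P s n t) \<le> \<epsilon> * (1 + t\<^sup>2)" by blast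
    have "cmod (?G y - ?G s - (y - s) *\<^sub>R ?p s) \<le> e * \<bar>y - s\<bar>" if y: "\<bar>y - s\<bar> < d" for y
    proof -
      let ?b = "\<lambda>n t. B y n t + (-1) * B s n t"
      let ?c = "\<lambda>n t. ?b n t + (- of_real (y - s)) * P s n t"
      have b: "slow_chain ?b" by (rule slow_chain_lincomb[OF B B])
      have "f (\<lambda>t. \<phi> t * ?c 0 t) = ?G y - ?G s - (y - s) *\<^sub>R ?p s"
        unfolding tempered_lincomb[OF f \<phi> b P] tempered_lincomb[OF f \<phi> B B]
        by (simp add: scaleR_conv_of_real algebra_simps)
      moreover have "cmod (f (\<lambda>t. \<phi> t * ?c 0 t)) \<le> C * (\<bar>y - s\<bar> * \<epsilon>)"
      proof (rule C(2)[OF slow_chain_lincomb[OF b P]])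
        fix n t assume n: "n \<le> N"
        have "cmod (B y n t - B s n t - (y - s) *\<^sub>R P s n t) \<le> \<bar>y - s\<bar> * (\<epsilon> * (1 + t\<^sup>2))"
          by (rule lin) (use d(2) n y in auto)
        moreover have "?c n t = B y n t - B s n t - (y - s) *\<^sub>R P s n t"
          by (simp add: scaleR_conv_of_real algebra_simps)
        ultimately show "cmod (?c n t) \<le> \<bar>y - s\<bar> * \<epsilon> * (1 + t\<^sup>2)" by (simp only: mult.assoc)
      qed
      moreover have "C * (\<bar>y - s\<bar> * \<epsilon>) \<le> e * \<bar>y - s\<bar>"
        using mult_right_mono[OF \<epsilon>(2), of "\<bar>y - s\<bar>"] by (simp add: mult_ac)
      ultimately show ?thesis by simp
    qed
    then show "\<exists>d>0. \<forall>y. norm (y - s) < d \<longrightarrow> norm (?G y - ?G s - (y - s) *\<^sub>R ?p s) \<le> e * norm (y - s)"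
      using d(1) by auto
  qed
  \<comment> \<open>Only the first \<open>N\<close> derivatives enter the bound for
    \<open>f\<close>, so finitely many weighted limits suffice.\<close>
  have lim0: "((\<lambda>s. f (\<lambda>t. \<phi> t * b s 0 t)) \<longlongrightarrow> 0) F"
    if b: "\<And>s. slow_chain (b s)" and ev: "\<And>n \<epsilon>. \<epsilon> > 0 \<Longrightarrow> \<forall>\<^sub>F s in F. \<forall>t. cmod (b s n t) \<le> \<epsilon> * (1 + t\<^sup>2)"
    for b :: "real \<Rightarrow> nat \<Rightarrow> real \<Rightarrow> complex" and F
  proof (rule tendstoI)
    fix e :: real assume e: "e > 0"
    have e': "e / (2 * (C + 1)) > 0" using e C(1) by simp
    have "\<forall>\<^sub>F s in F. \<forall>n\<in>{..N}. \<forall>t. cmod (b s n t) \<le> e / (2 * (C + 1)) * (1 + t\<^sup>2)"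
      by (intro eventually_ball_finite) (use ev[OF e'] in auto)
    then show "\<forall>\<^sub>F s in F. dist (f (\<lambda>t. \<phi> t * b s 0 t)) 0 < e"
    proof eventually_elim
      case (elim s)
      then have "cmod (f (\<lambda>t. \<phi> t * b s 0 t)) \<le> C * (e / (2 * (C + 1)))" by (intro C(2)[OF b]) auto
      also have "\<dots> < e"
        using e C(1) by (simp add: field_simps) (intro add_nonneg_pos mult_nonneg_nonneg mult_pos_pos; simp)
      finally show ?case by simp
    qed
  qed
  have "(\<integral>s. ?p s \<partial>lborel) = f (\<lambda>t. \<phi> t * L 0 t) - 0"
  proof (rule integral_derivative[OF G pc int])
    show "(?G \<longlongrightarrow> 0) at_bot" by (rule lim0[OF B bot])
    have "((\<lambda>s. f (\<lambda>t. \<phi> t * (B s 0 t + (-1) * L 0 t))) \<longlongrightarrow> 0) at_top"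
      by (rule lim0[OF slow_chain_lincomb[OF B L]]) (use top in simp)
    then have "((\<lambda>s. ?G s - f (\<lambda>t. \<phi> t * L 0 t)) \<longlongrightarrow> 0) at_top" unfolding diff[OF B L] .
    then show "(?G \<longlongrightarrow> f (\<lambda>t. \<phi> t * L 0 t)) at_top" by (rule LIM_zero_cancel)
  qed
  then show ?thesis by simp
qed

section \<open>Interchanging a tempered distribution with an integral\<close>

definition prim :: "(real \<Rightarrow> 'a::euclidean_space) \<Rightarrow> real \<Rightarrow> 'a" where
  "prim k y = (\<integral>t. indicator {..y} t *\<^sub>R k t \<partial>lborel)"

lemma integrable_prim:
  fixes k :: "real \<Rightarrow> 'a::euclidean_space"
  assumes "integrable lborel k" shows "integrable lborel (\<lambda>t. indicator {..y} t *\<^sub>R k t)"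
  using integrable_mult_indicator[OF _ assms, of "{..y}"] by simp

lemma prim_bound:
  fixes k :: "real \<Rightarrow> 'a::euclidean_space"
  assumes "integrable lborel k" shows "norm (prim k y) \<le> prim (\<lambda>t. norm (k t)) y"
proof -
  have "norm (prim k y) \<le> (\<integral>t. norm (indicator {..y} t *\<^sub>R k t) \<partial>lborel)"
    unfolding prim_def by (rule integral_norm_bound)
  then show ?thesis by (simp add: prim_def)
qed

lemma prim_limits:
  fixes k :: "real \<Rightarrow> 'a::euclidean_space"
  assumes k: "integrable lborel k"
  shows "(prim k \<longlongrightarrow> (\<integral>t. k t \<partial>lborel)) at_top" "(prim k \<longlongrightarrow> 0) at_bot"
proof -
  have m [measurable]: "k \<in> borel_measurable borel" using borel_measurable_integrable[OF k] by simp
  have "((\<lambda>y. \<integral>t. indicator {..y} t *\<^sub>R k t \<partial>lborel) \<longlongrightarrow> (\<integral>t. k t \<partial>lborel)) at_top"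
    by (rule tendsto_integral_at_top[OF _ k]) simp
  then show "(prim k \<longlongrightarrow> (\<integral>t. k t \<partial>lborel)) at_top" by (simp add: prim_def[abs_def])
  have "((\<lambda>y. \<integral>t. indicator {..- y} t *\<^sub>R k t \<partial>lborel) \<longlongrightarrow> (\<integral>t. (0::'a) \<partial>(lborel :: real measure))) at_top"
  proof (rule integral_dominated_convergence_at_top[where w = "\<lambda>t. norm (k t)"])
    show "\<forall>\<^sub>F i in at_top. AE x in lborel. norm (indicator {..- i} x *\<^sub>R k x) \<le> norm (k x)"
      by (intro always_eventually allI AE_I2) (auto simp: indicator_def)
    show "AE x in lborel. ((\<lambda>i. indicator {..- i} x *\<^sub>R k x) \<longlongrightarrow> 0) at_top"
    proof (intro AE_I2 tendsto_eventually)
      fix x :: real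
      show "\<forall>\<^sub>F i in at_top. indicator {..- i} x *\<^sub>R k x = 0"
        using eventually_gt_at_top[of "- x"] by eventually_elim (auto simp: indicator_def)
    qed
  qed (use k in auto)
  then show "(prim k \<longlongrightarrow> 0) at_bot" unfolding filterlim_at_bot_mirror by (simp add: prim_def[abs_def])
qed

lemma prim_deriv:
  fixes k :: "real \<Rightarrow> complex"
  assumes k: "integrable lborel k" and c: "\<And>t. isCont k t"
  shows "(prim k has_vector_derivative k y) (at y)"
proof -
  have "((\<lambda>u. LBINT t=y-1..u. k t) has_vector_derivative k y) (at y within {y-1..y+1})"
    using c by (intro interval_integral_FTC2) (auto intro: continuous_at_imp_continuous_on)
  then have "((\<lambda>u. LBINT t=y-1..u. k t) has_vector_derivative k y) (at y)"
    by (simp add: at_within_Icc_at)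
  then have d: "((\<lambda>u. prim k (y-1) + (LBINT t=y-1..u. k t)) has_vector_derivative k y) (at y)"
    by (rule has_vector_derivative_add[OF has_vector_derivative_const, simplified])
  show ?thesis
  proof (rule has_vector_derivative_transform_within_open[OF d, of "{y-1<..<y+1}"])
    fix u assume u: "u \<in> {y-1<..<y+1}"
    have i: "integrable lborel (\<lambda>t. indicator {y-1<..u} t *\<^sub>R k t)"
      using integrable_mult_indicator[OF _ k, of "{y-1<..u}"] by simp
    have "(LBINT t=y-1..u. k t) = (\<integral>t. indicator {y-1<..u} t *\<^sub>R k t \<partial>lborel)"
      using u by (simp add: interval_integral_Ioc set_lebesgue_integral_def)
    then have "prim k (y-1) + (LBINT t=y-1..u. k t)
        = (\<integral>t. indicator {..y-1} t *\<^sub>R k t + indicator {y-1<..u} t *\<^sub>R k t \<partial>lborel)"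
      using i integrable_prim[OF k] by (simp add: prim_def)
    also have "\<dots> = prim k u"
      unfolding prim_def using u by (intro Bochner_Integration.integral_cong refl) (auto simp: indicator_def)
    finally show "prim k (y-1) + (LBINT t=y-1..u. k t) = prim k u" .
  qed auto
qed

section \<open>The interchange with an integral over modulations\<close>

lemma abs_le_one_plus_sq: "\<bar>t\<bar> \<le> 1 + (t::real)\<^sup>2"
proof -
  have "0 \<le> (\<bar>t\<bar> - 1)\<^sup>2" "0 \<le> \<bar>t\<bar>" by auto
  then show ?thesis unfolding power2_diff by simp
qed

text \<open>The n-th member is the transform of the n-th moment of \<open>q\<close>, and each
  derivative multiplies by one more power of the frequency. It is applied to a function and to its
  truncations alike.\<close>

lemma moment_chain_slow:
  assumes q: "\<And>n. integrable lborel (\<lambda>\<omega>. of_real \<omega> ^ n * q \<omega>)"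
  shows "slow_chain (\<lambda>n t. \<integral>\<omega>. q \<omega> * mod_chain \<omega> n t \<partial>lborel)"
proof -
  let ?q = "\<lambda>n \<omega>. (- 2 * pi * \<i> * of_real \<omega>) ^ n * q \<omega>"
  have eq: "(\<integral>\<omega>. q \<omega> * mod_chain \<omega> n t \<partial>lborel) = ft (?q n) t" for n t
    unfolding ft_def mod_chain_def by (intro Bochner_Integration.integral_cong refl) (simp add: mult_ac)
  have qi: "integrable lborel (?q n)" for n
  proof -
    have "?q n = (\<lambda>\<omega>. (- 2 * pi * \<i>) ^ n * (of_real \<omega> ^ n * q \<omega>))"
      unfolding power_mult_distrib[of "- 2 * pi * \<i>"] by (simp only: mult.assoc)
    then show ?thesis using q[of n] by simp
  qed
  show ?thesis
    unfolding slow_chain_def smooth_chain_def eq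
  proof (intro conjI allI)
    fix n t
    have "integrable lborel (\<lambda>\<omega>. (1 / (- 2 * pi * \<i>)) * ?q (Suc n) \<omega>)" by (intro integrable_mult_right qi)
    then have "integrable lborel (\<lambda>\<omega>. of_real \<omega> * ?q n \<omega>)" by (simp add: mult_ac)
    from ft_has_derivative[OF qi this, of t]
    show "(ft (?q n) has_vector_derivative ft (?q (Suc n)) t) (at t)" by (simp add: mult_ac)
  next
    fix n
    let ?K = "\<integral>\<omega>. cmod (?q n \<omega>) \<partial>lborel"
    have "cmod (ft (?q n) t) \<le> ?K * (1 + t\<^sup>2)" for t
    proof -
      have "?K * 1 \<le> ?K * (1 + t\<^sup>2)" by (intro mult_left_mono Bochner_Integration.integral_nonneg) auto
      then show ?thesis using cmod_ft_le[of "?q n" t] by simp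
    qed
    then show "\<exists>K. \<forall>t. cmod (ft (?q n) t) \<le> K * (1 + t\<^sup>2)" by blast
  qed
qed

text \<open>Exponentials of nearby frequencies differ by up to a multiple of |s' - s| |t|, which is
  unbounded in \<open>t\<close>; the weight absorbs the factor |t|.\<close>

lemma mod_chain_uniform_cont:
  assumes \<psi>: "\<And>s. isCont \<psi> s" and e: "\<epsilon> > 0"
  shows "\<exists>d>0. \<forall>s'. \<bar>s' - s\<bar> < d \<longrightarrow> (\<forall>t. cmod (\<psi> s' * mod_chain s' n t - \<psi> s * mod_chain s n t) \<le> \<epsilon> * (1 + t\<^sup>2))"
proof -
  let ?Q = "\<lambda>s. \<psi> s * (- 2 * pi * \<i> * of_real s) ^ n"
  have "isCont ?Q s" by (intro continuous_intros \<psi>)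
  then obtain d1 where d1: "d1 > 0" "\<And>s'. \<bar>s' - s\<bar> < d1 \<Longrightarrow> cmod (?Q s' - ?Q s) < \<epsilon> / 2"
    unfolding continuous_at_eps_delta dist_norm real_norm_def using half_gt_zero[OF e] by blast
  define K where "K = cmod (?Q s) * (2 * pi) + 1"
  have K: "K > 0" unfolding K_def by (intro add_nonneg_pos mult_nonneg_nonneg) auto
  have "cmod (\<psi> s' * mod_chain s' n t - \<psi> s * mod_chain s n t) \<le> \<epsilon> * (1 + t\<^sup>2)"
    if s': "\<bar>s' - s\<bar> < min d1 (\<epsilon> / (2 * K))" for s' t
  proof -
    have "\<psi> s' * mod_chain s' n t - \<psi> s * mod_chain s n t
        = (?Q s' - ?Q s) * cis (- 2 * pi * s' * t) + ?Q s * (cis (- 2 * pi * s' * t) - cis (- 2 * pi * s * t))"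
      by (simp add: mod_chain_def algebra_simps)
    then have "cmod (\<psi> s' * mod_chain s' n t - \<psi> s * mod_chain s n t)
        \<le> cmod (?Q s' - ?Q s) * 1 + cmod (?Q s) * cmod (cis (- 2 * pi * s' * t) - cis (- 2 * pi * s * t))"
      by (metis (no_types, lifting) norm_cis norm_mult norm_triangle_ineq)
    also have "\<dots> \<le> \<epsilon> / 2 * 1 + cmod (?Q s) * \<bar>(- 2 * pi * s' * t) - (- 2 * pi * s * t)\<bar>"
      using d1(2)[of s'] s' by (intro add_mono mult_left_mono cmod_cis_diff_le) auto
    also have "\<bar>(- 2 * pi * s' * t) - (- 2 * pi * s * t)\<bar> = 2 * pi * (\<bar>s' - s\<bar> * \<bar>t\<bar>)"
    proof -
      have "(- 2 * pi * s' * t) - (- 2 * pi * s * t) = - (2 * pi * ((s' - s) * t))" by (simp add: algebra_simps)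
      then show ?thesis by (simp only: abs_minus_cancel abs_mult) simp
    qed
    also have "cmod (?Q s) * (2 * pi * (\<bar>s' - s\<bar> * \<bar>t\<bar>)) = (K - 1) * (\<bar>s' - s\<bar> * \<bar>t\<bar>)" by (simp add: K_def)
    also have "\<dots> \<le> K * (\<bar>s' - s\<bar> * \<bar>t\<bar>)" by (intro mult_right_mono) auto
    also have "\<dots> \<le> K * (\<epsilon> / (2 * K) * (1 + t\<^sup>2))"
      using s' K abs_le_one_plus_sq[of t] e by (intro mult_left_mono mult_mono) auto
    also have "\<dots> = \<epsilon> / 2 * (1 + t\<^sup>2)" using K by simp
    also have "\<epsilon> / 2 * 1 + \<epsilon> / 2 * (1 + t\<^sup>2) \<le> \<epsilon> * (1 + t\<^sup>2)"
      using e by (simp add: algebra_simps)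
    finally show ?thesis by simp
  qed
  moreover have "min d1 (\<epsilon> / (2 * K)) > 0" using d1(1) e K by simp
  ultimately show ?thesis by blast
qed

lemma tempered_isCont_mod:
  assumes f: "f \<in> tempered_distributions" and \<phi>: "\<phi> \<in> schwartz_space"
  shows "isCont (\<lambda>\<omega>. f (\<lambda>t. \<phi> t * cis (- 2 * pi * \<omega> * t))) \<omega>"
proof -
  have "isCont (\<lambda>s. f (\<lambda>t. \<phi> t * mod_chain s 0 t)) \<omega>"
    by (rule tempered_isCont[OF f \<phi> mod_chain_slow]) (use mod_chain_uniform_cont[of "\<lambda>_. 1"] in simp)
  then show ?thesis by (simp add: mod_chain_def)
qed

text \<open>The primitive is the transform of \<open>\<psi>\<close> cut off at frequency
  \<open>s\<close>. It tends to \<open>ft \<psi>\<close> together with all derivatives because all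
  moments of \<open>\<psi>\<close> are integrable.\<close>

lemma tempered_fourier_interchange:
  assumes f: "f \<in> tempered_distributions" and \<phi>: "\<phi> \<in> schwartz_space"
    and \<psi>: "\<And>n. integrable lborel (\<lambda>\<omega>. of_real \<omega> ^ n * \<psi> \<omega>)" and \<psi>c: "\<And>\<omega>. isCont \<psi> \<omega>"
    and int: "integrable lborel (\<lambda>\<omega>. \<psi> \<omega> * f (\<lambda>t. \<phi> t * cis (- 2 * pi * \<omega> * t)))"
  shows "(\<integral>\<omega>. \<psi> \<omega> * f (\<lambda>t. \<phi> t * cis (- 2 * pi * \<omega> * t)) \<partial>lborel) = f (\<lambda>t. \<phi> t * ft \<psi> t)"
proof -
  define k where "k n t \<omega> = \<psi> \<omega> * mod_chain \<omega> n t" for n t \<omega>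
  \<comment> \<open>The modulus of \<open>k n t\<close> does not depend on \<open>t\<close>, so tail
    estimates for \<open>r n\<close> are uniform in \<open>t\<close>.\<close>
  define r where "r n \<omega> = cmod (of_real ((2 * pi) ^ n) * (of_real \<omega> ^ n * \<psi> \<omega>))" for n \<omega>
  have rint: "integrable lborel (r n)" for n
    unfolding r_def by (intro integrable_norm integrable_mult_right \<psi>)
  have kr: "cmod (k n t \<omega>) = r n \<omega>" for n t \<omega>
    by (simp add: k_def r_def mod_chain_def norm_mult norm_power power_mult_distrib)
  have kc: "isCont (k n t) \<omega>" for n t \<omega>
  proof -
    have "isCont (\<lambda>\<omega>. cis (- 2 * pi * \<omega> * t)) \<omega>" for \<omega>
      unfolding cis_conv_exp by (intro continuous_intros)
    then show ?thesis unfolding k_def mod_chain_def by (intro continuous_intros \<psi>c) simp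
  qed
  have kint: "integrable lborel (k n t)" for n t
  proof (rule Bochner_Integration.integrable_bound[OF rint[of n]])
    show "k n t \<in> borel_measurable lborel"
      using borel_measurable_continuous_onI[of "k n t"] kc by (simp add: continuous_on_eq_continuous_at)
  qed (use kr in \<open>simp add: r_def\<close>)
  have rn: "(\<lambda>\<omega>. norm (k n t \<omega>)) = r n" for n t using kr by (simp add: fun_eq_iff)
  let ?B = "\<lambda>s n t. prim (k n t) s" and ?P = "\<lambda>s n t. k n t s" and ?L = "\<lambda>n t. \<integral>\<omega>. k n t \<omega> \<partial>lborel"
  have scale: "f (\<lambda>t. \<phi> t * ?P s 0 t) = \<psi> s * f (\<lambda>t. \<phi> t * cis (- 2 * pi * s * t))" for s
    using temperedD(2)[OF f schwartz_modulate[OF \<phi>], of "\<psi> s" s] by (simp add: k_def mod_chain_def mult_ac)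
  have "(\<integral>s. f (\<lambda>t. \<phi> t * ?P s 0 t) \<partial>lborel) = f (\<lambda>t. \<phi> t * ?L 0 t)"
  proof (rule tempered_FTC[OF f \<phi>, where B = ?B])
    show "slow_chain (?B s)" for s
    proof -
      have "integrable lborel (\<lambda>\<omega>. of_real \<omega> ^ n * (indicator {..s} \<omega> * \<psi> \<omega>))" for n
        using integrable_prim[OF \<psi>[of n], of s] by (simp add: scaleR_conv_of_real mult_ac of_real_indicator)
      from moment_chain_slow[OF this] show ?thesis
        by (simp add: prim_def[abs_def] k_def scaleR_conv_of_real mult_ac of_real_indicator)
    qed
    show "slow_chain (?P s)" for s unfolding k_def by (rule slow_chain_scale[OF mod_chain_slow])
    show "slow_chain ?L" unfolding k_def by (rule moment_chain_slow[OF \<psi>])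
    show "((\<lambda>s. ?B s n t) has_vector_derivative ?P s n t) (at s)" for n t s by (rule prim_deriv[OF kint kc])
    show "\<exists>d>0. \<forall>s'. \<bar>s' - s\<bar> < d \<longrightarrow> (\<forall>t. cmod (?P s' n t - ?P s n t) \<le> \<epsilon> * (1 + t\<^sup>2))" if "\<epsilon> > 0" for n s \<epsilon>
      unfolding k_def by (rule mod_chain_uniform_cont[OF \<psi>c that])
    have w: "x \<le> \<epsilon> * (1 + t\<^sup>2)" if "x < \<epsilon>" "\<epsilon> > 0" for x \<epsilon> t :: real
    proof -
      have "\<epsilon> * 1 \<le> \<epsilon> * (1 + t\<^sup>2)" using that(2) by (intro mult_left_mono) auto
      then show ?thesis using that(1) by simp
    qed
    show "\<forall>\<^sub>F s in at_top. \<forall>t. cmod (?B s n t - ?L n t) \<le> \<epsilon> * (1 + t\<^sup>2)" if e: "\<epsilon> > 0" for n \<epsilon>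
    proof -
      have "\<forall>\<^sub>F s in at_top. dist (prim (r n) s) (\<integral>\<omega>. r n \<omega> \<partial>lborel) < \<epsilon>"
        by (rule tendstoD[OF prim_limits(1)[OF rint] e])
      then show ?thesis
      proof eventually_elim
        case (elim s)
        have "cmod (?B s n t - ?L n t) < \<epsilon>" for t
        proof -
          have "?L n t - ?B s n t = (\<integral>\<omega>. k n t \<omega> - indicator {..s} \<omega> *\<^sub>R k n t \<omega> \<partial>lborel)"
            unfolding prim_def using kint integrable_prim[OF kint] by simp
          also have "cmod \<dots> \<le> (\<integral>\<omega>. cmod (k n t \<omega> - indicator {..s} \<omega> *\<^sub>R k n t \<omega>) \<partial>lborel)"
            by (rule integral_norm_bound)
          also have "\<dots> = (\<integral>\<omega>. r n \<omega> - indicator {..s} \<omega> *\<^sub>R r n \<omega> \<partial>lborel)"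
            by (intro Bochner_Integration.integral_cong refl) (simp add: indicator_def kr)
          also have "\<dots> = (\<integral>\<omega>. r n \<omega> \<partial>lborel) - prim (r n) s"
            unfolding prim_def using rint integrable_prim[OF rint] by simp
          finally show ?thesis using elim by (simp add: dist_real_def norm_minus_commute abs_if split: if_splits)
        qed
        then show ?case using w[OF _ e] by blast
      qed
    qed
    show "\<forall>\<^sub>F s in at_bot. \<forall>t. cmod (?B s n t) \<le> \<epsilon> * (1 + t\<^sup>2)" if e: "\<epsilon> > 0" for n \<epsilon>
    proof -
      have "\<forall>\<^sub>F s in at_bot. dist (prim (r n) s) 0 < \<epsilon>" by (rule tendstoD[OF prim_limits(2)[OF rint] e])
      then show ?thesis
      proof eventually_elim
        case (elim s)
        have "cmod (?B s n t) < \<epsilon>" for t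
          using prim_bound[OF kint, of n t s] elim unfolding rn by simp
        then show ?case using w[OF _ e] by blast
      qed
    qed
    show "integrable lborel (\<lambda>s. f (\<lambda>t. \<phi> t * ?P s 0 t))" unfolding scale by (rule int)
  qed
  moreover have "?L 0 t = ft \<psi> t" for t by (simp add: k_def mod_chain_def ft_def mult_ac)
  ultimately show ?thesis unfolding scale by simp
qed

text \<open>Where \<open>t - s\<close> is still below the threshold \<open>Y\<close>,
  \<open>t\<close> is so far out that the weight alone makes the right-hand side at least
  \<open>M\<close>.\<close>

lemma weighted_translate_limit:
  fixes r :: "real \<Rightarrow> complex"
  assumes M: "\<And>y. cmod (r y) \<le> M" and lim: "(r \<longlongrightarrow> 0) at_top" and e: "\<epsilon> > 0"
  shows "\<forall>\<^sub>F s in at_bot. \<forall>t. cmod (r (t - s)) \<le> \<epsilon> * (1 + t\<^sup>2)"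
proof -
  obtain Y where Y: "\<And>y. y \<ge> Y \<Longrightarrow> cmod (r y) < \<epsilon>"
    using tendstoD[OF lim e] unfolding eventually_at_top_linorder by auto
  have M0: "M \<ge> 0" using M[of 0] norm_ge_zero order_trans by blast
  have "\<forall>\<^sub>F s in at_bot. s \<le> - \<bar>Y\<bar> - (M / \<epsilon> + 1)" by (rule eventually_le_at_bot)
  then show ?thesis
  proof eventually_elim
    case (elim s)
    show ?case
    proof
      fix t
      show "cmod (r (t - s)) \<le> \<epsilon> * (1 + t\<^sup>2)"
      proof (cases "t - s \<ge> Y")
        case True
        have "\<epsilon> * 1 \<le> \<epsilon> * (1 + t\<^sup>2)" using e by (intro mult_left_mono) auto
        then show ?thesis using Y[OF True] by simp
      next
        case False
        have "M / \<epsilon> \<ge> 0" using M0 e by simp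
        then have t: "\<bar>t\<bar> \<ge> M / \<epsilon> + 1" using False elim by linarith
        then have "M / \<epsilon> \<le> 1 + t\<^sup>2" using abs_le_one_plus_sq[of t] by linarith
        then have "M \<le> \<epsilon> * (1 + t\<^sup>2)" using e by (simp add: field_simps)
        then show ?thesis using M[of "t - s"] by linarith
      qed
    qed
  qed
qed

text \<open>The factor 3 comes from linearising at \<open>a\<close>: the derivative varies by at
  most \<open>2 * M\<close>, and the linear part contributes another \<open>M\<close>.\<close>

lemma lipschitz_if_bounded_derivative:
  fixes F F' :: "real \<Rightarrow> complex"
  assumes "\<And>y. (F has_vector_derivative F' y) (at y)" and "\<And>y. y \<in> closed_segment a b \<Longrightarrow> cmod (F' y) \<le> M"
  shows "cmod (F b - F a) \<le> 3 * M * \<bar>b - a\<bar>"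
proof -
  have "cmod (F b - F a - (b - a) *\<^sub>R F' a) \<le> norm (b - a) * (2 * M)"
  proof (rule vector_differentiable_bound_linearization[where S = "closed_segment a b"])
    fix y assume y: "y \<in> closed_segment a b"
    show "(F has_vector_derivative F' y) (at y within closed_segment a b)"
      by (rule has_vector_derivative_at_within[OF assms(1)])
    have "cmod (F' y - F' a) \<le> cmod (F' y) + cmod (F' a)" by (rule norm_triangle_ineq4)
    then show "cmod (F' y - F' a) \<le> 2 * M" using assms(2)[OF y] assms(2)[of a] by simp
  qed auto
  moreover have "cmod ((b - a) *\<^sub>R F' a) \<le> M * \<bar>b - a\<bar>"
    using mult_right_mono[OF assms(2)[of a], of "\<bar>b - a\<bar>"] by (simp add: mult.commute)
  moreover have "cmod (F b - F a) \<le> cmod (F b - F a - (b - a) *\<^sub>R F' a) + cmod ((b - a) *\<^sub>R F' a)"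
    using norm_triangle_ineq[of "F b - F a - (b - a) *\<^sub>R F' a" "(b - a) *\<^sub>R F' a"] by simp
  ultimately show ?thesis by (simp add: mult_ac)
qed

lemma translate_uniform_cont:
  assumes k: "k \<in> schwartz_space" and e: "\<epsilon> > 0"
  shows "\<exists>e>0. \<forall>s'. \<bar>s' - s\<bar> < e \<longrightarrow>
    (\<forall>t. cmod (nth_derivative n k (t - s') - nth_derivative n k (t - s)) \<le> \<epsilon> * (1 + t\<^sup>2))"
proof -
  have d: "schwartz_chain (\<lambda>n. nth_derivative n k)" "smooth_chain (\<lambda>n. nth_derivative n k)"
    using schwartz_chain_nth[OF k] by (auto simp: schwartz_chain_def)
  have "\<forall>n. \<exists>M. \<forall>t. cmod (nth_derivative n k t) \<le> M"
    using d(1) unfolding schwartz_chain_def by (metis mult_1 power_0)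
  then obtain M where M: "\<And>n t. cmod (nth_derivative n k t) \<le> M n" by metis
  define B where "B = 3 * \<bar>M (Suc n)\<bar> + 1"
  have "cmod (nth_derivative n k (t - s') - nth_derivative n k (t - s)) \<le> \<epsilon> * (1 + t\<^sup>2)" if s': "\<bar>s' - s\<bar> < \<epsilon> / B" for s' t
  proof -
    have "cmod (nth_derivative n k (t - s') - nth_derivative n k (t - s)) \<le> 3 * \<bar>M (Suc n)\<bar> * \<bar>(t - s') - (t - s)\<bar>"
      by (rule lipschitz_if_bounded_derivative[OF smooth_chainD[OF d(2)]])
        (use M in \<open>auto intro: order_trans[OF _ abs_ge_self]\<close>)
    also have "\<dots> = 3 * \<bar>M (Suc n)\<bar> * \<bar>s' - s\<bar>" by (simp add: abs_minus_commute)
    also have "\<dots> \<le> B * (\<epsilon> / B)" using s' by (intro mult_mono) (auto simp: B_def)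
    also have "\<dots> = \<epsilon> * 1" by (simp add: B_def add_nonneg_eq_0_iff)
    also have "\<dots> \<le> \<epsilon> * (1 + t\<^sup>2)" using e by (intro mult_left_mono) auto
    finally show ?thesis .
  qed
  moreover have "\<epsilon> / B > 0" using e by (simp add: B_def add_nonneg_pos)
  ultimately show ?thesis by blast
  qed

lemma tempered_isCont_translate_mult:
  assumes f: "f \<in> tempered_distributions" and \<phi>: "\<phi> \<in> schwartz_space" and k: "k \<in> schwartz_space"
  shows "isCont (\<lambda>x. f (\<lambda>t. \<phi> t * k (t - x))) x"
proof -
  have "isCont (\<lambda>x. f (\<lambda>t. \<phi> t * nth_derivative 0 k (t - x))) x"
    by (rule tempered_isCont[OF f \<phi> schwartz_chain_slow[OF schwartz_chain_translate[OF schwartz_chain_nth[OF k]]]])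
      (rule translate_uniform_cont[OF k])
  then show ?thesis by simp
qed

text \<open>The integral of \<open>k (t - x)\<close> over all \<open>x\<close> is the same constant
  for every \<open>t\<close>, so the superposition of translates acts as a constant
  multiplier.\<close>

lemma tempered_translate_interchange:
  assumes f: "f \<in> tempered_distributions" and \<phi>: "\<phi> \<in> schwartz_space" and k: "k \<in> schwartz_space"
    and int: "integrable lborel (\<lambda>x. f (\<lambda>t. \<phi> t * k (t - x)))"
  shows "(\<integral>x. f (\<lambda>t. \<phi> t * k (t - x)) \<partial>lborel) = (\<integral>t. k t \<partial>lborel) * f \<phi>"
proof -
  define c where "c = (\<integral>t. k t \<partial>lborel)"
  let ?d = "\<lambda>n. nth_derivative n k"
  have d: "schwartz_chain ?d" "smooth_chain ?d" using schwartz_chain_nth[OF k] by (auto simp: schwartz_chain_def)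
  have kC: "k \<in> C2_decay" by (rule schwartz_C2_decay[OF k])
  note kp = C2_decay_props[OF kC]
  have "\<forall>n. \<exists>M. \<forall>t. cmod (?d n t) \<le> M"
    using d(1) unfolding schwartz_chain_def by (metis mult_1 power_0)
  then obtain M where M: "\<And>n t. cmod (?d n t) \<le> M n" by metis
  \<comment> \<open>\<open>K 0 (t - s)\<close> is the integral of \<open>k (t - x)\<close> over
    \<open>x\<close> below \<open>s\<close>, that is, of \<open>k\<close> beyond
    \<open>t - s\<close>; the later members are its derivatives in \<open>t\<close>.\<close>
  define K where "K n = (case n of 0 \<Rightarrow> (\<lambda>y. c - prim k y) | Suc m \<Rightarrow> (\<lambda>y. - ?d m y))" for n
  have K0: "K 0 = (\<lambda>y. c - prim k y)" and KS: "K (Suc m) = (\<lambda>y. - ?d m y)" for m by (simp_all add: K_def)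
  have Kd: "(K n has_vector_derivative - ?d n y) (at y)" for n y
  proof (cases n)
    case 0
    have "((\<lambda>y. c - prim k y) has_vector_derivative 0 - k y) (at y)"
      by (intro has_vector_derivative_diff has_vector_derivative_const prim_deriv kp)
    then show ?thesis unfolding 0 K0 by simp
  next
    case (Suc m)
    show ?thesis unfolding Suc KS by (intro has_vector_derivative_minus smooth_chainD[OF d(2)])
  qed
  have Ks: "smooth_chain K" unfolding smooth_chain_def using Kd by (simp add: KS)
  define KM where "KM n = (case n of 0 \<Rightarrow> cmod c + (\<integral>t. cmod (k t) \<partial>lborel) | Suc m \<Rightarrow> M m)" for n
  have KM: "cmod (K n y) \<le> KM n" for n y
  proof (cases n)
    case 0
    have "prim (\<lambda>t. cmod (k t)) y \<le> (\<integral>t. cmod (k t) \<partial>lborel)"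
      unfolding prim_def using kp(2) integrable_prim[OF integrable_norm[OF kp(2)]]
      by (intro integral_mono) (auto simp: indicator_def)
    then have "cmod (prim k y) \<le> (\<integral>t. cmod (k t) \<partial>lborel)" using prim_bound[OF kp(2), of y] by linarith
    then show ?thesis using norm_triangle_ineq4[of c "prim k y"] by (simp add: 0 K0 KM_def)
  qed (use M in \<open>simp add: KM_def KS\<close>)
  \<comment> \<open>The constant \<open>c\<close> with its vanishing derivatives, the limit of the
    primitive as \<open>s\<close> tends to infinity.\<close>
  define L :: "nat \<Rightarrow> real \<Rightarrow> complex" where "L n t = (if n = 0 then c else 0)" for n t
  have d0: "(?d n \<longlongrightarrow> 0) at_bot" "(?d n \<longlongrightarrow> 0) at_top" for n
  proof -
    have "schwartz_chain (\<lambda>m. ?d (n + m))" using d(1) by (simp add: schwartz_chain_def smooth_chain_def)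
    from schwartz_chain_space[OF this] have "?d n \<in> schwartz_space" by simp
    then obtain u1 u2 C where "C2_chain (?d n) u1 u2 C" using C2_decayE[OF schwartz_C2_decay] by metis
    from C2_chain_props(9,10)[OF this] show "(?d n \<longlongrightarrow> 0) at_bot" "(?d n \<longlongrightarrow> 0) at_top" .
  qed
  have Kbot: "((\<lambda>y. K n y - L n 0) \<longlongrightarrow> 0) at_bot" and Ktop: "(K n \<longlongrightarrow> 0) at_top" for n
  proof -
    have "((\<lambda>y. - prim k y) \<longlongrightarrow> 0) at_bot" using tendsto_minus[OF prim_limits(2)[OF kp(2)]] by simp
    moreover have "((\<lambda>y. c - prim k y) \<longlongrightarrow> c - c) at_top"
      unfolding c_def by (intro tendsto_intros prim_limits[OF kp(2)])
    moreover have "((\<lambda>y. - ?d m y) \<longlongrightarrow> 0) at_bot" "((\<lambda>y. - ?d m y) \<longlongrightarrow> 0) at_top" for m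
      using tendsto_minus[OF d0(1)] tendsto_minus[OF d0(2)] by simp_all
    ultimately show "((\<lambda>y. K n y - L n 0) \<longlongrightarrow> 0) at_bot" "(K n \<longlongrightarrow> 0) at_top"
      by (cases n; simp add: K0 KS L_def)+
  qed
  have "(\<integral>s. f (\<lambda>t. \<phi> t * ?d 0 (t - s)) \<partial>lborel) = f (\<lambda>t. \<phi> t * L 0 t)"
  proof (rule tempered_FTC[OF f \<phi>, where P = "\<lambda>s n t. ?d n (t - s)"])
    show "slow_chain (\<lambda>n t. K n (t - s))" for s by (rule slow_chain_translate[OF Ks KM])
    show "slow_chain (\<lambda>n t. ?d n (t - s))" for s by (rule slow_chain_translate[OF d(2) M])
    have Ln: "L (Suc n) = (\<lambda>t. 0)" "L n = (\<lambda>t. L n 0)" for n by (simp_all add: L_def fun_eq_iff)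
    have "smooth_chain L" unfolding smooth_chain_def Ln(1) by (subst Ln(2)) simp
    moreover have "\<forall>t. cmod (L n t) \<le> cmod c * (1 + t\<^sup>2)" for n
      using mult_left_mono[of 1 "1 + _\<^sup>2" "cmod c"] by (simp add: L_def)
    ultimately show "slow_chain L" unfolding slow_chain_def by blast
    show "((\<lambda>s. K n (t - s)) has_vector_derivative ?d n (t - s)) (at s)" for n t s
    proof -
      have "((\<lambda>s. t - s) has_vector_derivative - 1) (at s)"
        by (rule has_vector_derivative_diff[OF has_vector_derivative_const has_vector_derivative_id, simplified])
      from vector_diff_chain_at[OF this Kd[of n "t - s"]] show ?thesis by (simp add: comp_def)
    qed
    show "\<exists>e>0. \<forall>s'. \<bar>s' - s\<bar> < e \<longrightarrow> (\<forall>t. cmod (?d n (t - s') - ?d n (t - s)) \<le> \<epsilon> * (1 + t\<^sup>2))"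
      if "\<epsilon> > 0" for n s \<epsilon>
      by (rule translate_uniform_cont[OF k that])
    show "\<forall>\<^sub>F s in at_bot. \<forall>t. cmod (K n (t - s)) \<le> \<epsilon> * (1 + t\<^sup>2)" if "\<epsilon> > 0" for n \<epsilon>
      by (rule weighted_translate_limit[OF KM Ktop that])
    show "\<forall>\<^sub>F s in at_top. \<forall>t. cmod (K n (t - s) - L n t) \<le> \<epsilon> * (1 + t\<^sup>2)" if e: "\<epsilon> > 0" for n \<epsilon>
    proof -
      \<comment> \<open>Reflecting both \<open>t\<close> and \<open>s\<close> reduces the limit at
        plus infinity to the one at minus infinity.\<close>
      let ?r = "\<lambda>y. K n (- y) - L n 0"
      have "cmod (?r y) \<le> KM n + cmod (L n 0)" for y
        using norm_triangle_ineq4[of "K n (- y)" "L n 0"] KM[of n "- y"] by linarith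
      moreover have "(?r \<longlongrightarrow> 0) at_top" using Kbot[of n] unfolding filterlim_at_bot_mirror by simp
      ultimately have "\<forall>\<^sub>F s in at_bot. \<forall>t. cmod (?r (t - s)) \<le> \<epsilon> * (1 + t\<^sup>2)"
        by (rule weighted_translate_limit[OF _ _ e])
      then have "\<forall>\<^sub>F s in at_top. \<forall>t. cmod (?r (t - (- s))) \<le> \<epsilon> * (1 + t\<^sup>2)"
        unfolding at_bot_mirror eventually_filtermap .
      then show ?thesis
      proof eventually_elim
        case (elim s)
        show ?case
        proof
          fix t show "cmod (K n (t - s) - L n t) \<le> \<epsilon> * (1 + t\<^sup>2)"
            using elim[rule_format, of "- t"] by (simp add: L_def)
        qed
      qed
    qed
    show "integrable lborel (\<lambda>s. f (\<lambda>t. \<phi> t * ?d 0 (t - s)))" using int by simp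
  qed
  then show ?thesis using temperedD(2)[OF f \<phi>, of c] by (simp add: L_def c_def mult.commute)
qed

section \<open>The synthesis formula for distributions in the Feichtinger algebra\<close>

text \<open>Here the Schwartz factor itself moves while the modulation is fixed, so continuity comes
  from a local Lipschitz estimate in every seminorm.\<close>

lemma tempered_isCont_translate:
  assumes f: "f \<in> tempered_distributions" and \<phi>: "\<phi> \<in> schwartz_space"
  shows "isCont (\<lambda>x. f (\<lambda>t. \<phi> (t - x) * cis (- 2 * pi * \<omega> * t))) x"
proof -
  let ?a = "\<lambda>n. nth_derivative n \<phi>" and ?b = "mod_chain \<omega>"
  have a: "schwartz_chain ?a" "smooth_chain ?a" using schwartz_chain_nth[OF \<phi>] by (auto simp: schwartz_chain_def)
  define D where "D x' n t = ?a n (t - x') + (-1) * ?a n (t - x)" for x' n t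
  have E: "\<exists>E\<ge>0. \<forall>x'. \<bar>x' - x\<bar> \<le> 1 \<longrightarrow> (\<forall>t. \<bar>t\<bar> ^ m * cmod (D x' n t) \<le> E * \<bar>x' - x\<bar>)" for m n
  proof -
    obtain B where B: "\<And>y t. \<bar>t - y\<bar> \<le> \<bar>x\<bar> + 1 \<Longrightarrow> \<bar>t\<bar> ^ m * cmod (?a (Suc n) y) \<le> B"
      using schwartz_translate_bound[OF a(1)] by blast
    have "\<bar>t\<bar> ^ m * cmod (D x' n t) \<le> 3 * \<bar>B\<bar> * \<bar>x' - x\<bar>" if x': "\<bar>x' - x\<bar> \<le> 1" for x' t
    proof -
      \<comment> \<open>\<open>t\<close> is fixed, so the power of |t| is a constant factor and the
        mean value bound is applied in \<open>y\<close> only.\<close>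
      let ?T = "of_real (\<bar>t\<bar> ^ m) :: complex"
      have T: "cmod ?T = \<bar>t\<bar> ^ m" by (simp only: norm_of_real) (simp add: power_abs)
      have "cmod (?T * ?a n (t - x') - ?T * ?a n (t - x)) \<le> 3 * \<bar>B\<bar> * \<bar>(t - x') - (t - x)\<bar>"
      proof (rule lipschitz_if_bounded_derivative)
        show "((\<lambda>y. ?T * ?a n y) has_vector_derivative ?T * ?a (Suc n) y) (at y)" for y
          by (intro has_vector_derivative_mult_right smooth_chainD[OF a(2)])
        fix y assume "y \<in> closed_segment (t - x) (t - x')"
        then have "\<bar>t - y\<bar> \<le> \<bar>x\<bar> + 1" using x' by (auto simp: closed_segment_eq_real_ivl split: if_splits)
        from B[OF this] show "cmod (?T * ?a (Suc n) y) \<le> \<bar>B\<bar>"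
          unfolding norm_mult T by linarith
      qed
      moreover have "?T * ?a n (t - x') - ?T * ?a n (t - x) = ?T * D x' n t" by (simp add: D_def algebra_simps)
      moreover have "\<bar>(t - x') - (t - x)\<bar> = \<bar>x' - x\<bar>" by simp
      ultimately show ?thesis by (simp only: norm_mult T)
    qed
    then show ?thesis by (intro exI[of _ "3 * \<bar>B\<bar>"]) auto
  qed
  have "\<forall>m n. \<exists>E\<ge>0. \<forall>x'. \<bar>x' - x\<bar> \<le> 1 \<longrightarrow> (\<forall>t. \<bar>t\<bar> ^ m * cmod (D x' n t) \<le> E * \<bar>x' - x\<bar>)" using E by blast
  then obtain E where E0: "\<And>m n. E m n \<ge> 0"
    and E: "\<And>m n x' t. \<bar>x' - x\<bar> \<le> 1 \<Longrightarrow> \<bar>t\<bar> ^ m * cmod (D x' n t) \<le> E m n * \<bar>x' - x\<bar>" by metis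
  have D: "schwartz_chain (D x')" if "\<bar>x' - x\<bar> \<le> 1" for x'
    unfolding schwartz_chain_def
  proof (intro conjI allI)
    show "smooth_chain (D x')"
      using slow_chain_lincomb[OF schwartz_chain_slow[OF schwartz_chain_translate[OF a(1), of x']]
          schwartz_chain_slow[OF schwartz_chain_translate[OF a(1), of x]], of "-1"]
      unfolding slow_chain_def D_def by blast
    show "\<exists>B. \<forall>t. \<bar>t\<bar> ^ m * cmod (D x' n t) \<le> B" for m n using E[OF that] by blast
  qed
  obtain C N where C: "C \<ge> 0" "\<And>d \<delta>. schwartz_chain d \<Longrightarrow> (\<And>m n t. m \<le> N \<Longrightarrow> n \<le> N \<Longrightarrow> \<bar>t\<bar> ^ m * cmod (d n t) \<le> \<delta>)
    \<Longrightarrow> cmod (f (d 0)) \<le> C * \<delta>" by (rule tempered_bound[OF f]) blast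
  define G where "G m n = (\<Sum>k\<le>n. real (n choose k) * (E m k * (2 * pi * \<bar>\<omega>\<bar>) ^ (n - k)))" for m n
  have G0: "G m n \<ge> 0" for m n unfolding G_def using E0 by (intro sum_nonneg) auto
  define K where "K = (\<Sum>m\<le>N. \<Sum>n\<le>N. G m n)"
  have GK: "G m n \<le> K" if "m \<le> N" "n \<le> N" for m n
  proof -
    have "G m n \<le> (\<Sum>n\<le>N. G m n)" using that G0 by (intro member_le_sum) auto
    also have "\<dots> \<le> K" unfolding K_def using that G0 by (intro member_le_sum[where f = "\<lambda>m. \<Sum>n\<le>N. G m n"] sum_nonneg) auto
    finally show ?thesis .
  qed
  have K0: "K \<ge> 0" unfolding K_def using G0 by (intro sum_nonneg) auto
  let ?F = "\<lambda>x. f (\<lambda>t. \<phi> (t - x) * cis (- 2 * pi * \<omega> * t))"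
  have lip: "cmod (?F x' - ?F x) \<le> C * K * \<bar>x' - x\<bar>" if x': "\<bar>x' - x\<bar> \<le> 1" for x'
  proof -
    have "cmod (f (leibniz (D x') ?b 0)) \<le> C * (K * \<bar>x' - x\<bar>)"
    proof (rule C(2)[OF schwartz_leibniz[OF D[OF x'] mod_chain_slow]])
      fix m n t assume mn: "m \<le> N" "n \<le> N"
      have "\<bar>t\<bar> ^ m * cmod (leibniz (D x') ?b n t)
          \<le> \<bar>t\<bar> ^ m * (\<Sum>k\<le>n. cmod (of_nat (n choose k) * (D x' k t * ?b (n - k) t)))"
        unfolding leibniz_def by (intro mult_left_mono norm_sum) simp
      also have "\<dots> = (\<Sum>k\<le>n. real (n choose k) * ((\<bar>t\<bar> ^ m * cmod (D x' k t)) * (2 * pi * \<bar>\<omega>\<bar>) ^ (n - k)))"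
        by (simp add: sum_distrib_left norm_mult norm_power mod_chain_def mult_ac)
      also have "\<dots> \<le> (\<Sum>k\<le>n. real (n choose k) * ((E m k * \<bar>x' - x\<bar>) * (2 * pi * \<bar>\<omega>\<bar>) ^ (n - k)))"
        by (intro sum_mono mult_left_mono mult_right_mono E[OF x']) auto
      also have "\<dots> = G m n * \<bar>x' - x\<bar>" by (simp add: G_def sum_distrib_left sum_distrib_right mult_ac)
      also have "\<dots> \<le> K * \<bar>x' - x\<bar>" by (intro mult_right_mono GK mn) simp
      finally show "\<bar>t\<bar> ^ m * cmod (leibniz (D x') ?b n t) \<le> K * \<bar>x' - x\<bar>" .
    qed
    moreover have "f (leibniz (D x') ?b 0) = ?F x' - ?F x"
    proof -
      let ?e = "\<lambda>t. cis (- 2 * pi * \<omega> * t)"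
      have s: "(\<lambda>t. \<phi> (t - y) * ?e t) \<in> schwartz_space" for y
        by (intro schwartz_modulate schwartz_translate \<phi>)
      have s': "(\<lambda>t. (-1) * (\<phi> (t - x) * ?e t)) \<in> schwartz_space"
        using schwartz_mult_slow[OF s[of x] slow_chain_scale[OF mod_chain_slow[of 0], of "-1"]]
        by (simp add: mod_chain_def)
      have "leibniz (D x') ?b 0 = (\<lambda>t. \<phi> (t - x') * ?e t + (-1) * (\<phi> (t - x) * ?e t))"
        by (simp add: leibniz_0 D_def mod_chain_def algebra_simps)
      then show ?thesis using temperedD(1)[OF f s s'] temperedD(2)[OF f s, of "-1" x] by simp
    qed
    ultimately show ?thesis by (simp add: mult.assoc)
  qed
  show ?thesis
    unfolding continuous_at_eps_delta dist_norm
  proof (intro allI impI)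
    fix e :: real assume e: "e > 0"
    have CK: "C * K + 1 > 0" using C(1) K0 by (simp add: add_nonneg_pos)
    have "cmod (?F x' - ?F x) < e" if "\<bar>x' - x\<bar> < min 1 (e / (C * K + 1))" for x'
    proof -
      have "cmod (?F x' - ?F x) \<le> C * K * \<bar>x' - x\<bar>" using that by (intro lip) auto
      also have "\<dots> \<le> (C * K + 1) * \<bar>x' - x\<bar>" by (intro mult_right_mono) auto
      also have "\<dots> < (C * K + 1) * (e / (C * K + 1))" using that CK by (intro mult_strict_left_mono) auto
      also have "\<dots> = e" using CK by simp
      finally show ?thesis .
    qed
    moreover have "min 1 (e / (C * K + 1)) > 0" using e CK by simp
    ultimately show "\<exists>d>0. \<forall>x'. norm (x' - x) < d \<longrightarrow> cmod (?F x' - ?F x) < e"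
      unfolding real_norm_def by blast
  qed
qed

text \<open>Rounding the first variable down to a multiple of \<open>1 / Suc n\<close> leaves
  countably many measurable slices; continuity in the first variable makes these approximations
  converge pointwise.\<close>

lemma separately_continuous_measurable:
  fixes V :: "real \<Rightarrow> real \<Rightarrow> complex"
  assumes cx: "\<And>x \<omega>. isCont (\<lambda>x. V x \<omega>) x" and c\<omega>: "\<And>x \<omega>. isCont (V x) \<omega>"
  shows "(\<lambda>p. V (fst p) (snd p)) \<in> borel_measurable (borel \<Otimes>\<^sub>M borel)"
proof (rule borel_measurable_LIMSEQ_metric)
  let ?x = "\<lambda>n x. of_int \<lfloor>real (Suc n) * x\<rfloor> / real (Suc n)"
  fix n
  have V: "V x \<in> borel_measurable borel" for x
    using c\<omega> by (intro borel_measurable_continuous_onI) (simp add: continuous_on_eq_continuous_at)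
  show "(\<lambda>p. V (?x n (fst p)) (snd p)) \<in> borel_measurable (borel \<Otimes>\<^sub>M borel)"
  proof (rule measurable_compose_countable[where f = "\<lambda>i p. V (of_int i / real (Suc n)) (snd p)" and g = "\<lambda>p. \<lfloor>real (Suc n) * fst p\<rfloor>"])
    show "(\<lambda>p. V (of_int i / real (Suc n)) (snd p)) \<in> borel_measurable (borel \<Otimes>\<^sub>M borel)" for i
      by (rule measurable_compose[OF measurable_snd V])
  qed measurable
next
  let ?x = "\<lambda>n x. of_int \<lfloor>real (Suc n) * x\<rfloor> / real (Suc n)"
  fix p :: "real \<times> real"
  have "(\<lambda>n. ?x n (fst p)) \<longlonglongrightarrow> fst p"
  proof (rule LIMSEQ_I)
    fix e :: real assume "e > 0"
    then obtain N where N: "inverse (real (Suc N)) < e" using reals_Archimedean by blast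
    have "norm (?x n (fst p) - fst p) < e" if "n \<ge> N" for n
    proof -
      have *: "(z / r - y) * r = z - r * y" if "r \<noteq> 0" for z r y :: real
        using that by (simp add: field_simps)
      have "\<bar>of_int \<lfloor>real (Suc n) * fst p\<rfloor> - real (Suc n) * fst p\<bar> \<le> 1" by linarith
      moreover have "(?x n (fst p) - fst p) * real (Suc n) = of_int \<lfloor>real (Suc n) * fst p\<rfloor> - real (Suc n) * fst p"
        by (rule *) simp
      ultimately have "\<bar>(?x n (fst p) - fst p) * real (Suc n)\<bar> \<le> 1" by (simp only:)
      then have "\<bar>?x n (fst p) - fst p\<bar> * real (Suc n) \<le> 1" by (simp only: abs_mult abs_of_nat)
      then have "\<bar>?x n (fst p) - fst p\<bar> \<le> inverse (real (Suc n))" by (simp add: field_simps del: of_nat_Suc)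
      also have "\<dots> \<le> inverse (real (Suc N))" using that by (intro le_imp_inverse_le) auto
      finally show ?thesis using N by simp
    qed
    then show "\<exists>no. \<forall>n\<ge>no. norm (?x n (fst p) - fst p) < e" by blast
  qed
  then show "(\<lambda>n. V (?x n (fst p)) (snd p)) \<longlonglongrightarrow> V (fst p) (snd p)"
    by (rule isCont_tendsto_compose[OF cx])
qed

lemma stft_window: "(\<lambda>t. cnj (g (t - x)) * cis (- 2 * pi * \<omega> * t)) \<in> schwartz_space"
  if "g \<in> schwartz_space"
  by (intro schwartz_modulate schwartz_cnj schwartz_translate that)

lemma stft_measurable:
  assumes "f \<in> tempered_distributions" "g \<in> schwartz_space"
  shows "(\<lambda>p. stft g f (fst p) (snd p)) \<in> borel_measurable (borel \<Otimes>\<^sub>M borel)"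
proof (rule separately_continuous_measurable)
  show "isCont (\<lambda>x. stft g f x \<omega>) x" for x \<omega>
    unfolding stft_def using tempered_isCont_translate[OF assms(1) schwartz_cnj[OF assms(2)]] .
  show "isCont (stft g f x) \<omega>" for x \<omega>
    unfolding stft_def[abs_def]
    by (rule tempered_isCont_mod[OF assms(1) schwartz_cnj[OF schwartz_translate[OF assms(2)]]])
qed

lemma stft_L1_pair:
  assumes "f \<in> tempered_distributions" "g \<in> schwartz_space"
  shows "stft_L1 g f = (\<integral>\<^sup>+p. ennreal (cmod (stft g f (fst p) (snd p))) \<partial>(lborel \<Otimes>\<^sub>M lborel))"
  unfolding stft_L1_def using stft_measurable[OF assms]
  by (subst lborel.nn_integral_fst[symmetric]) simp_all

text \<open>Up to a constant the moment is the transform of the n-th derivative, which is again a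
  Schwartz function.\<close>

lemma ft_schwartz_moments:
  assumes \<theta>: "\<theta> \<in> schwartz_space" shows "integrable lborel (\<lambda>\<omega>. of_real \<omega> ^ n * ft \<theta> \<omega>)"
proof -
  have d: "schwartz_chain (\<lambda>n. nth_derivative n \<theta>)" by (rule schwartz_chain_nth[OF \<theta>])
  have dn: "nth_derivative n \<theta> \<in> C2_decay" for n
  proof -
    have "schwartz_chain (\<lambda>m. nth_derivative (n + m) \<theta>)" using d by (simp add: schwartz_chain_def smooth_chain_def)
    from schwartz_C2_decay[OF schwartz_chain_space[OF this]] show ?thesis by simp
  qed
  have "ft (nth_derivative n \<theta>) \<xi> = (2 * pi * \<i> * \<xi>) ^ n * ft \<theta> \<xi>" for \<xi>
  proof (induction n)
    case (Suc n)
    obtain u1 u2 C where c: "C2_chain (nth_derivative n \<theta>) u1 u2 C" using C2_decayE[OF dn] by metis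
    have "ft (nth_derivative (Suc n) \<theta>) \<xi> = 2 * pi * \<i> * \<xi> * ft (nth_derivative n \<theta>) \<xi>"
    proof (rule ft_derivative)
      show "(nth_derivative n \<theta> has_vector_derivative nth_derivative (Suc n) \<theta> t) (at t)" for t
        using d by (simp add: schwartz_chain_def smooth_chain_def)
      show "isCont (nth_derivative (Suc n) \<theta>) t" for t by (rule C2_decay_props(5)[OF dn])
    qed (use C2_decay_props(2)[OF dn] C2_chain_props(9,10)[OF c] in auto)
    then show ?case using Suc by simp
  qed simp
  then have "(\<lambda>\<omega>. of_real \<omega> ^ n * ft \<theta> \<omega>) = (\<lambda>\<omega>. (1 / (2 * pi * \<i>) ^ n) * ft (nth_derivative n \<theta>) \<omega>)"
    by (simp add: fun_eq_iff power_mult_distrib)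
  then show ?thesis using ft_C2_integrable[OF dn[of n]] by simp
qed

text \<open>The formal adjoint of the short-time Fourier transform with window \<open>g\<close>: a
  superposition of its time-frequency shifts with coefficients \<open>V\<close>.\<close>

definition synth :: "(real \<Rightarrow> complex) \<Rightarrow> (real \<Rightarrow> real \<Rightarrow> complex) \<Rightarrow> real \<Rightarrow> complex" where
  "synth g V t = (\<integral>p. V (fst p) (snd p) * (g (t - fst p) * cis (2 * pi * snd p * t)) \<partial>(lborel \<Otimes>\<^sub>M lborel))"

interpretation lborel_pair_lborel: pair_sigma_finite "lborel \<Otimes>\<^sub>M lborel :: (real \<times> real) measure" "lborel :: real measure"
  ..

text \<open>The integrand is dominated by |V(x,s)| |g(t - x)|, integrable in all three variables.
  The sup and L1 bounds together place the synthesis in L2; the last part is Fubini against a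
  bounded function.\<close>

lemma synth_props:
  fixes V :: "real \<Rightarrow> real \<Rightarrow> complex"
  assumes V: "integrable (lborel \<Otimes>\<^sub>M lborel) (\<lambda>p. V (fst p) (snd p))"
    and g: "g \<in> borel_measurable borel" "integrable lborel g" "\<And>t. cmod (g t) \<le> M"
  defines "N \<equiv> \<integral>p. cmod (V (fst p) (snd p)) \<partial>(lborel \<Otimes>\<^sub>M lborel)"
  shows "cmod (synth g V t) \<le> M * N" "integrable lborel (synth g V)"
    "(\<integral>t. cmod (synth g V t) \<partial>lborel) \<le> N * (\<integral>t. cmod (g t) \<partial>lborel)"
    "\<phi> \<in> borel_measurable borel \<Longrightarrow> (\<And>t. cmod (\<phi> t) \<le> K) \<Longrightarrow>
      (\<integral>t. synth g V t * \<phi> t \<partial>lborel) = (\<integral>p. V (fst p) (snd p) * (\<integral>t. g (t - fst p) * cis (2 * pi * snd p * t) * \<phi> t \<partial>lborel) \<partial>(lborel \<Otimes>\<^sub>M lborel))"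
proof -
  have [measurable]: "(\<lambda>p. V (fst p) (snd p)) \<in> borel_measurable (borel \<Otimes>\<^sub>M borel)" "g \<in> borel_measurable borel"
    using V g by (auto dest: borel_measurable_integrable)
  let ?H = "\<lambda>p t. V (fst p) (snd p) * (g (t - fst p) * cis (2 * pi * snd p * t))"
  have gs: "integrable lborel (\<lambda>t. cmod (g (t - x)))" "(\<integral>t. cmod (g (t - x)) \<partial>lborel) = (\<integral>t. cmod (g t) \<partial>lborel)" for x
    using lborel_integrable_real_affine[OF integrable_norm[OF g(2)], of 1 "- x"]
      lborel_integral_real_affine[of 1 "\<lambda>t. cmod (g t)" "- x"] by simp_all
  have Hm: "case_prod (\<lambda>p t. ?H p t * \<phi> t) \<in> borel_measurable ((lborel \<Otimes>\<^sub>M lborel) \<Otimes>\<^sub>M lborel)"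
    if "\<phi> \<in> borel_measurable borel" for \<phi>
    using that by measurable
  have Hi: "integrable ((lborel \<Otimes>\<^sub>M lborel) \<Otimes>\<^sub>M lborel) (case_prod (\<lambda>p t. ?H p t * \<phi> t))"
    if \<phi> [measurable]: "\<phi> \<in> borel_measurable borel" and K: "\<And>t. cmod (\<phi> t) \<le> K" for \<phi> K
  proof -
    have le: "cmod (?H p t * \<phi> t) \<le> cmod (V (fst p) (snd p)) * (\<bar>K\<bar> * cmod (g (t - fst p)))" for p t
    proof -
      have "cmod (\<phi> t) \<le> \<bar>K\<bar>" using K[of t] by linarith
      from mult_left_mono[OF this, of "cmod (V (fst p) (snd p)) * cmod (g (t - fst p))"]
      show ?thesis by (simp add: norm_mult mult_ac)
    qed
    show ?thesis
    proof (rule Bochner_Integration.integrable_bound)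
      show "integrable ((lborel \<Otimes>\<^sub>M lborel) \<Otimes>\<^sub>M lborel) (case_prod (\<lambda>p t. cmod (V (fst p) (snd p)) * (\<bar>K\<bar> * cmod (g (t - fst p)))))"
      proof (rule lborel_pair_lborel.Fubini_integrable)
        show "integrable (lborel \<Otimes>\<^sub>M lborel) (\<lambda>p. \<integral>t. norm (case (p, t) of (p, t) \<Rightarrow> cmod (V (fst p) (snd p)) * (\<bar>K\<bar> * cmod (g (t - fst p)))) \<partial>lborel)"
          using V by (simp add: abs_mult gs)
        show "AE p in lborel \<Otimes>\<^sub>M lborel. integrable lborel (\<lambda>t. case (p, t) of (p, t) \<Rightarrow> cmod (V (fst p) (snd p)) * (\<bar>K\<bar> * cmod (g (t - fst p))))"
          by (simp add: gs)
      qed measurable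
      show "AE x in (lborel \<Otimes>\<^sub>M lborel) \<Otimes>\<^sub>M lborel. norm (case_prod (\<lambda>p t. ?H p t * \<phi> t) x)
          \<le> norm (case_prod (\<lambda>p t. cmod (V (fst p) (snd p)) * (\<bar>K\<bar> * cmod (g (t - fst p)))) x)"
        using le by (intro AE_I2) (auto simp: case_prod_beta intro: order_trans[OF le abs_ge_self])
    qed (rule Hm[OF \<phi>])
  qed
  have Hi1: "integrable ((lborel \<Otimes>\<^sub>M lborel) \<Otimes>\<^sub>M lborel) (case_prod ?H)" using Hi[of "\<lambda>_. 1" 1] by simp
  show "cmod (synth g V t) \<le> M * N"
  proof -
    have M0: "0 \<le> M" using g(3)[of 0] norm_ge_zero order_trans by blast
    have "cmod (synth g V t) \<le> (\<integral>p. cmod (?H p t) \<partial>(lborel \<Otimes>\<^sub>M lborel))"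
      unfolding synth_def by (rule integral_norm_bound)
    also have "\<dots> \<le> (\<integral>p. M * cmod (V (fst p) (snd p)) \<partial>(lborel \<Otimes>\<^sub>M lborel))"
    proof (rule integral_mono_AE')
      show "AE p in lborel \<Otimes>\<^sub>M lborel. cmod (?H p t) \<le> M * cmod (V (fst p) (snd p))"
        using g(3) by (intro AE_I2) (auto simp: norm_mult mult.commute[of M] intro!: mult_left_mono)
      show "AE p in lborel \<Otimes>\<^sub>M lborel. 0 \<le> M * cmod (V (fst p) (snd p))" using M0 by simp
    qed (use V in simp)
    finally show ?thesis by (simp add: N_def)
  qed
  from lborel_pair_lborel.integrable_snd[OF Hi1]
  show "integrable lborel (synth g V)" unfolding synth_def .
  have Hn: "integrable ((lborel \<Otimes>\<^sub>M lborel) \<Otimes>\<^sub>M lborel) (case_prod (\<lambda>p t. cmod (?H p t)))"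
    using integrable_norm[OF Hi1] by (simp add: case_prod_unfold)
  have "(\<integral>t. cmod (synth g V t) \<partial>lborel) \<le> (\<integral>t. (\<integral>p. cmod (?H p t) \<partial>(lborel \<Otimes>\<^sub>M lborel)) \<partial>lborel)"
    unfolding synth_def
    using lborel_pair_lborel.integrable_snd[OF Hi1] lborel_pair_lborel.integrable_snd[OF Hn]
    by (intro integral_mono integral_norm_bound integrable_norm)
  also have "\<dots> = (\<integral>p. (\<integral>t. cmod (?H p t) \<partial>lborel) \<partial>(lborel \<Otimes>\<^sub>M lborel))"
    by (rule lborel_pair_lborel.Fubini_integral[OF Hn])
  also have "\<dots> = N * (\<integral>t. cmod (g t) \<partial>lborel)"
    using V by (simp add: norm_mult gs N_def)
  finally show "(\<integral>t. cmod (synth g V t) \<partial>lborel) \<le> N * (\<integral>t. cmod (g t) \<partial>lborel)" .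
  assume \<phi>: "\<phi> \<in> borel_measurable borel" "\<And>t. cmod (\<phi> t) \<le> K"
  have "(\<integral>t. synth g V t * \<phi> t \<partial>lborel) = (\<integral>t. (\<integral>p. ?H p t * \<phi> t \<partial>(lborel \<Otimes>\<^sub>M lborel)) \<partial>lborel)"
    unfolding synth_def by simp
  also have "\<dots> = (\<integral>p. (\<integral>t. ?H p t * \<phi> t \<partial>lborel) \<partial>(lborel \<Otimes>\<^sub>M lborel))"
    by (rule lborel_pair_lborel.Fubini_integral[OF Hi[OF \<phi>]])
  also have "\<dots> = (\<integral>p. V (fst p) (snd p) * (\<integral>t. g (t - fst p) * cis (2 * pi * snd p * t) * \<phi> t \<partial>lborel) \<partial>(lborel \<Otimes>\<^sub>M lborel))"
    by (simp add: mult.assoc)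
  finally show "(\<integral>t. synth g V t * \<phi> t \<partial>lborel) = (\<integral>p. V (fst p) (snd p) * (\<integral>t. g (t - fst p) * cis (2 * pi * snd p * t) * \<phi> t \<partial>lborel) \<partial>(lborel \<Otimes>\<^sub>M lborel))" .
qed

lemma stft_integrable:
  assumes f: "f \<in> tempered_distributions" and g: "g \<in> schwartz_space" and fin: "stft_L1 g f < \<infinity>"
  shows "integrable (lborel \<Otimes>\<^sub>M lborel) (\<lambda>p. stft g f (fst p) (snd p))"
    and "(\<integral>p. cmod (stft g f (fst p) (snd p)) \<partial>(lborel \<Otimes>\<^sub>M lborel)) = enn2real (stft_L1 g f)"
proof -
  have m: "(\<lambda>p. stft g f (fst p) (snd p)) \<in> borel_measurable (lborel \<Otimes>\<^sub>M lborel)"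
    using stft_measurable[OF f g] by simp
  show "integrable (lborel \<Otimes>\<^sub>M lborel) (\<lambda>p. stft g f (fst p) (snd p))"
    by (rule integrableI_bounded[OF m]) (use fin in \<open>simp add: stft_L1_pair[OF f g]\<close>)
  show "(\<integral>p. cmod (stft g f (fst p) (snd p)) \<partial>(lborel \<Otimes>\<^sub>M lborel)) = enn2real (stft_L1 g f)"
    unfolding stft_L1_pair[OF f g] using m by (intro integral_eq_nn_integral) auto
qed

text \<open>For fixed \<open>x\<close> the frequency integral recovers
  \<open>g (t - x) * \<phi> t\<close> by inversion, under \<open>f\<close> and next to the
  conjugated window; what remains is \<open>f\<close> applied to \<open>\<phi>\<close> times a
  translate of |g|^2, integrated over \<open>x\<close>.\<close>

theorem S0_synthesis:
  assumes f: "f \<in> tempered_distributions" and g: "g \<in> schwartz_space" and fin: "stft_L1 g f < \<infinity>"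
    and \<phi>: "\<phi> \<in> schwartz_space"
  shows "(\<integral>t. g t * cnj (g t) \<partial>lborel) * f \<phi> = (\<integral>t. synth g (stft g f) t * \<phi> t \<partial>lborel)"
proof -
  let ?V = "stft g f"
  note Vi = stft_integrable(1)[OF f g fin]
  have gp: "g \<in> borel_measurable borel" "integrable lborel g" "\<exists>M. \<forall>t. cmod (g t) \<le> M"
    using C2_decay_props[OF schwartz_C2_decay[OF g]] by blast+
  have \<phi>p: "\<phi> \<in> borel_measurable borel" "\<exists>K. \<forall>t. cmod (\<phi> t) \<le> K"
    using C2_decay_props[OF schwartz_C2_decay[OF \<phi>]] by blast+
  obtain M where M: "\<And>t. cmod (g t) \<le> M" using gp(3) by blast
  obtain K where K: "\<And>t. cmod (\<phi> t) \<le> K" using \<phi>p(2) by blast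
  define k where "k t = g t * cnj (g t)" for t
  have kS: "k \<in> schwartz_space" unfolding k_def by (intro schwartz_mult g schwartz_cnj)
  define \<theta> where "\<theta> x t = g (t - x) * \<phi> t" for x t
  have \<theta>S: "\<theta> x \<in> schwartz_space" for x unfolding \<theta>_def by (intro schwartz_mult schwartz_translate g \<phi>)
  note \<theta>p = C2_decay_props[OF schwartz_C2_decay[OF \<theta>S]]
  define W where "W p = (\<integral>t. g (t - fst p) * cis (2 * pi * snd p * t) * \<phi> t \<partial>lborel)" for p :: "real \<times> real"
  have W: "W (x, s) = ft (\<theta> x) (- s)" for x s
    unfolding W_def ft_def \<theta>_def by (intro Bochner_Integration.integral_cong refl) (simp add: mult_ac)
  have fub: "(\<integral>t. synth g ?V t * \<phi> t \<partial>lborel) = (\<integral>p. ?V (fst p) (snd p) * W p \<partial>(lborel \<Otimes>\<^sub>M lborel))"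
    unfolding W_def by (rule synth_props(4)[OF Vi gp(1,2) M \<phi>p(1) K])
  have VW: "integrable (lborel \<Otimes>\<^sub>M lborel) (\<lambda>p. ?V (fst p) (snd p) * W p)"
  proof -
    have [measurable]: "g \<in> borel_measurable borel" "\<phi> \<in> borel_measurable borel" by fact+
    have Wm: "W \<in> borel_measurable (lborel \<Otimes>\<^sub>M lborel)"
      unfolding W_def[abs_def] by measurable
    have WK: "cmod (W p) \<le> \<bar>K\<bar> * (\<integral>t. cmod (g t) \<partial>lborel)" for p
    proof -
      have gs: "integrable lborel (\<lambda>t. cmod (g (t - x)))" "(\<integral>t. cmod (g (t - x)) \<partial>lborel) = (\<integral>t. cmod (g t) \<partial>lborel)" for x
        using lborel_integrable_real_affine[OF integrable_norm[OF gp(2)], of 1 "- x"]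
          lborel_integral_real_affine[of 1 "\<lambda>t. cmod (g t)" "- x"] by simp_all
      have "cmod (W p) \<le> (\<integral>t. cmod (g (t - fst p) * cis (2 * pi * snd p * t) * \<phi> t) \<partial>lborel)"
        unfolding W_def by (rule integral_norm_bound)
      also have "\<dots> \<le> (\<integral>t. \<bar>K\<bar> * cmod (g (t - fst p)) \<partial>lborel)"
      proof (rule integral_mono_AE')
        have "cmod (\<phi> t) \<le> \<bar>K\<bar>" for t using K[of t] by linarith
        then show "AE t in lborel. cmod (g (t - fst p) * cis (2 * pi * snd p * t) * \<phi> t) \<le> \<bar>K\<bar> * cmod (g (t - fst p))"
          by (intro AE_I2) (auto simp: norm_mult mult.commute[of "\<bar>K\<bar>"] intro!: mult_left_mono)
      qed (simp_all add: gs)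
      finally show ?thesis by (simp add: gs)
    qed
    show ?thesis
    proof (rule Bochner_Integration.integrable_bound)
      show "integrable (lborel \<Otimes>\<^sub>M lborel) (\<lambda>p. (\<bar>K\<bar> * (\<integral>t. cmod (g t) \<partial>lborel)) * cmod (?V (fst p) (snd p)))"
        by (intro integrable_mult_right integrable_norm Vi)
      show "AE p in lborel \<Otimes>\<^sub>M lborel. norm (?V (fst p) (snd p) * W p) \<le> norm ((\<bar>K\<bar> * (\<integral>t. cmod (g t) \<partial>lborel)) * cmod (?V (fst p) (snd p)))"
      proof (intro AE_I2)
        fix p
        have "norm (?V (fst p) (snd p) * W p) \<le> cmod (?V (fst p) (snd p)) * (\<bar>K\<bar> * (\<integral>t. cmod (g t) \<partial>lborel))"
          unfolding norm_mult by (rule mult_left_mono[OF WK norm_ge_zero])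
        then show "norm (?V (fst p) (snd p) * W p) \<le> norm ((\<bar>K\<bar> * (\<integral>t. cmod (g t) \<partial>lborel)) * cmod (?V (fst p) (snd p)))"
          unfolding real_norm_def mult.commute[of "cmod _"] by linarith
      qed
    qed (use Wm Vi in measurable)
  qed
  define A where "A x = f (\<lambda>t. \<phi> t * k (t - x))" for x
  have key: "(\<integral>s. ?V x s * W (x, s) \<partial>lborel) = A x" if Vx: "integrable lborel (\<lambda>s. ?V x s * W (x, s))" for x
  proof -
    let ?\<phi> = "\<lambda>t. cnj (g (t - x))" and ?\<psi> = "\<lambda>s. ft (\<theta> x) (- s)"
    have "(\<integral>s. ?\<psi> s * f (\<lambda>t. ?\<phi> t * cis (- 2 * pi * s * t)) \<partial>lborel) = f (\<lambda>t. ?\<phi> t * ft ?\<psi> t)"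
    proof (rule tempered_fourier_interchange[OF f])
      show "?\<phi> \<in> schwartz_space" by (intro schwartz_cnj schwartz_translate g)
      show "integrable lborel (\<lambda>s. of_real s ^ n * ?\<psi> s)" for n
      proof -
        have "integrable lborel (\<lambda>s. (-1) ^ n * (of_real (- s) ^ n * ft (\<theta> x) (- s)))"
          using lborel_integrable_real_affine[OF ft_schwartz_moments[OF \<theta>S[of x], of n], of "-1" 0]
          by (intro integrable_mult_right) simp
        \<comment> \<open>The two sign changes cancel, so the moments of the reflected transform are
          those of the transform up to reflection.\<close>
        moreover have "(-1) ^ n * (of_real (- s) ^ n * z) = of_real s ^ n * (z :: complex)" for s z
        proof -
          have "(-1) ^ n * (of_real (- s) ^ n * z) = ((-1) * of_real (- s)) ^ n * z"
            by (simp only: power_mult_distrib mult.assoc)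
          then show ?thesis by simp
        qed
        ultimately show ?thesis by (simp only:)
      qed
      show "isCont ?\<psi> s" for s
        by (rule isCont_o2[OF _ isCont_ft[OF \<theta>p(2)]]) simp
      show "integrable lborel (\<lambda>s. ?\<psi> s * f (\<lambda>t. ?\<phi> t * cis (- 2 * pi * s * t)))"
        using Vx by (simp add: W stft_def mult.commute)
    qed
    moreover have "ft ?\<psi> t = \<theta> x t" for t
      using ft_shift(3)[OF ft_C2_integrable[OF schwartz_C2_decay[OF \<theta>S[of x]]], of t]
        ft_inversion_C2[OF schwartz_C2_decay[OF \<theta>S[of x]], of t] by simp
    ultimately show ?thesis by (simp add: W stft_def A_def k_def \<theta>_def mult_ac)
  qed
  have VW': "integrable (lborel \<Otimes>\<^sub>M lborel) (case_prod (\<lambda>x s. ?V x s * W (x, s)))"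
    using VW by (simp add: case_prod_unfold)
  \<comment> \<open>Fubini gives integrability in the frequency only for almost every
    \<open>x\<close>, so \<open>key\<close> identifies the inner integral with \<open>A x\<close>
    outside a null set.\<close>
  have AE: "AE x in lborel. (\<integral>s. ?V x s * W (x, s) \<partial>lborel) = A x"
    using lborel_pair.AE_integrable_fst[OF VW'] by eventually_elim (rule key)
  have "isCont A x" for x
    unfolding A_def[abs_def] by (rule tempered_isCont_translate_mult[OF f \<phi> kS])
  then have Am: "A \<in> borel_measurable borel"
    by (intro borel_measurable_continuous_onI) (simp add: continuous_on_eq_continuous_at)
  have "(\<integral>x. A x \<partial>lborel) = (\<integral>t. k t \<partial>lborel) * f \<phi>"
    unfolding A_def
  proof (rule tempered_translate_interchange[OF f \<phi> kS])
    have "integrable lborel (\<lambda>x. \<integral>s. ?V x s * W (x, s) \<partial>lborel)" by (rule lborel_pair.integrable_fst[OF VW'])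
    then have "integrable lborel A"
      by (rule Bochner_Integration.integrable_cong_AE_imp) (use Am AE in auto)
    then show "integrable lborel (\<lambda>x. f (\<lambda>t. \<phi> t * k (t - x)))" unfolding A_def .
  qed
  moreover have "(\<integral>p. ?V (fst p) (snd p) * W p \<partial>(lborel \<Otimes>\<^sub>M lborel)) = (\<integral>x. (\<integral>s. ?V x s * W (x, s) \<partial>lborel) \<partial>lborel)"
    using lborel_pair.integral_fst[OF VW'] by (simp add: case_prod_unfold)
  moreover have "\<dots> = (\<integral>x. A x \<partial>lborel)"
    using Am AE lborel_pair.integrable_fst[OF VW'] by (intro integral_cong_AE) (auto dest: borel_measurable_integrable)
  ultimately show ?thesis unfolding fub k_def by simp
qed

section \<open>The short-time Fourier transform of square-integrable functions\<close>

text \<open>\<open>win\<close>, \<open>stfl\<close> and \<open>s0\<close> are the counterparts on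
  \<open>l2\<close> of the window and of \<open>stft\<close> and \<open>stft_L1\<close>, with a
  point of the plane as one argument; \<open>stft_sdist\<close> links them.\<close>

definition win :: "(real \<Rightarrow> complex) \<Rightarrow> real \<times> real \<Rightarrow> real \<Rightarrow> complex" where
  "win g p t = cnj (g (t - fst p)) * cis (- 2 * pi * snd p * t)"

definition stfl :: "(real \<Rightarrow> complex) \<Rightarrow> l2 \<Rightarrow> real \<times> real \<Rightarrow> complex" where
  "stfl g x p = bil x (cl (win g p))"

definition s0 :: "(real \<Rightarrow> complex) \<Rightarrow> l2 \<Rightarrow> ennreal" where
  "s0 g x = (\<integral>\<^sup>+p. ennreal (cmod (stfl g x p)) \<partial>(lborel \<Otimes>\<^sub>M lborel))"

lemma win_props:
  assumes "g \<in> C2_decay"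
  shows "win g p \<in> L2_functions" "win g p \<in> borel_measurable borel" "integrable lborel (win g p)" "\<exists>K. \<forall>t. cmod (win g p t) \<le> K"
proof -
  note gp = C2_decay_props[OF assms]
  obtain M where M: "\<And>t. cmod (g t) \<le> M" using gp(4) by blast
  have [measurable]: "g \<in> borel_measurable borel" by fact
  show m: "win g p \<in> borel_measurable borel" unfolding win_def[abs_def] by measurable
  have "integrable lborel (\<lambda>t. cnj (g (t - fst p)))"
    using lborel_integrable_real_affine[OF gp(2), of 1 "- fst p"] by simp
  then show i: "integrable lborel (win g p)" unfolding win_def[abs_def] by (rule integrable_mult_cis) measurable
  have b: "cmod (win g p t) \<le> M" for t using M by (simp add: win_def norm_mult)
  then show "\<exists>K. \<forall>t. cmod (win g p t) \<le> K" by blast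
  show "win g p \<in> L2_functions" by (rule L2_I1_bounded[OF i b])
qed

lemma stfl_integral: "g \<in> C2_decay \<Longrightarrow> stfl g x p = (\<integral>t. fn x t * win g p t \<partial>lborel)"
  unfolding stfl_def using bil_cl[OF fn_L2 win_props(1), of g x p] by simp

lemma stfl_measurable: "g \<in> C2_decay \<Longrightarrow> stfl g x \<in> borel_measurable (lborel \<Otimes>\<^sub>M lborel)"
proof -
  assume g: "g \<in> C2_decay"
  have [measurable]: "g \<in> borel_measurable borel" by (rule C2_decay_props(1)[OF g])
  have "stfl g x = (\<lambda>p. \<integral>t. fn x t * (cnj (g (t - fst p)) * cis (- 2 * pi * snd p * t)) \<partial>lborel)"
    using stfl_integral[OF g] by (simp add: win_def fun_eq_iff)
  then show ?thesis by simp measurable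
qed

lemma stfl_linear:
  "stfl g (x + y) p = stfl g x p + stfl g y p" "stfl g (cscale \<alpha> x) p = \<alpha> * stfl g x p"
  "stfl g (x - y) p = stfl g x p - stfl g y p"
  by (simp_all add: stfl_def bil_add_left bil_cscale_left bounded_bilinear.diff_left[OF bounded_bilinear_bil])

lemma s0_add: "g \<in> C2_decay \<Longrightarrow> s0 g (x + y) \<le> s0 g x + s0 g y"
  unfolding s0_def stfl_linear using stfl_measurable[of g]
  by (subst nn_integral_add[symmetric]) (auto intro!: nn_integral_mono simp: ennreal_plus[symmetric] norm_triangle_ineq simp del: ennreal_plus)

lemma s0_scale: "g \<in> C2_decay \<Longrightarrow> s0 g (cscale \<alpha> x) = ennreal (cmod \<alpha>) * s0 g x"
  unfolding s0_def stfl_linear using stfl_measurable[of g]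
  by (simp add: norm_mult ennreal_mult nn_integral_cmult)

subsection \<open>Embedding into the tempered distributions\<close>

definition sdist :: "l2 \<Rightarrow> (real \<Rightarrow> complex) \<Rightarrow> complex" where
  "sdist x \<phi> = (if \<phi> \<in> schwartz_space then bil x (cl \<phi>) else 0)"

lemma schwartz_L2: "\<phi> \<in> schwartz_space \<Longrightarrow> \<phi> \<in> L2_functions"
  by (rule C2_decay_props(3)[OF schwartz_C2_decay])

lemma schwartz_seminorm_upper:
  assumes "\<phi> \<in> schwartz_space" shows "\<bar>t\<bar> ^ m * cmod (nth_derivative n \<phi> t) \<le> schwartz_seminorm m n \<phi>"
proof -
  obtain B where B: "\<And>t. \<bar>t\<bar> ^ m * cmod (nth_derivative n \<phi> t) \<le> B" using schwartz_bound[OF assms] by blast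
  have "cmod (t ^ m *\<^sub>R nth_derivative n \<phi> t) \<le> schwartz_seminorm m n \<phi>"
    unfolding schwartz_seminorm_def by (rule cSUP_upper) (use B in \<open>auto intro!: bdd_aboveI[of _ B] simp: power_abs\<close>)
  then show ?thesis by (simp add: power_abs)
qed

lemma schwartz_add: "\<phi> \<in> schwartz_space \<Longrightarrow> \<psi> \<in> schwartz_space \<Longrightarrow> (\<lambda>t. \<phi> t + \<psi> t) \<in> schwartz_space"
  and schwartz_scale: "\<phi> \<in> schwartz_space \<Longrightarrow> (\<lambda>t. \<alpha> * \<phi> t) \<in> schwartz_space"
proof -
  have lc: "(\<lambda>t. a t + \<beta> * b t) \<in> schwartz_space" if a: "a \<in> schwartz_space" and b: "b \<in> schwartz_space" for a b \<beta>
  proof -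
    let ?d = "\<lambda>n t. nth_derivative n a t + \<beta> * nth_derivative n b t"
    note ca = schwartz_chain_nth[OF a] and cb = schwartz_chain_nth[OF b]
    have "schwartz_chain ?d"
      unfolding schwartz_chain_def
    proof (intro conjI allI)
      show "smooth_chain ?d"
        using slow_chain_lincomb[OF schwartz_chain_slow[OF ca] schwartz_chain_slow[OF cb], of \<beta>] by (simp add: slow_chain_def)
      fix m n
      obtain A B where "\<And>t. \<bar>t\<bar> ^ m * cmod (nth_derivative n a t) \<le> A" "\<And>t. \<bar>t\<bar> ^ m * cmod (nth_derivative n b t) \<le> B"
        using schwartz_bound[OF a] schwartz_bound[OF b] by metis
      then have "\<bar>t\<bar> ^ m * cmod (?d n t) \<le> A + cmod \<beta> * B" for t
      proof -
        have "\<bar>t\<bar> ^ m * cmod (?d n t) \<le> \<bar>t\<bar> ^ m * (cmod (nth_derivative n a t) + cmod \<beta> * cmod (nth_derivative n b t))"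
          by (intro mult_left_mono norm_triangle_le) (auto simp: norm_mult)
        also have "\<dots> = \<bar>t\<bar> ^ m * cmod (nth_derivative n a t) + cmod \<beta> * (\<bar>t\<bar> ^ m * cmod (nth_derivative n b t))"
          by (simp add: algebra_simps)
        also have "\<dots> \<le> A + cmod \<beta> * B" by (intro add_mono mult_left_mono norm_ge_zero) fact+
        finally show ?thesis .
      qed
      then show "\<exists>B. \<forall>t. \<bar>t\<bar> ^ m * cmod (?d n t) \<le> B" by blast
    qed
    from schwartz_chain_space[OF this] show ?thesis by simp
  qed
  show "\<phi> \<in> schwartz_space \<Longrightarrow> \<psi> \<in> schwartz_space \<Longrightarrow> (\<lambda>t. \<phi> t + \<psi> t) \<in> schwartz_space"
    using lc[of \<phi> \<psi> 1] by simp
  show "\<phi> \<in> schwartz_space \<Longrightarrow> (\<lambda>t. \<alpha> * \<phi> t) \<in> schwartz_space"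
    using lc[of \<phi> \<phi> "\<alpha> - 1"] by (simp add: algebra_simps)
qed

text \<open>The seminorms (0,0) and (2,0) bound |\<phi>(t)| by a multiple of 1 / (1 + t^2), hence
  also its L2 norm; this is where the order 2 comes from.\<close>

lemma sdist_tempered: "sdist x \<in> tempered_distributions"
  unfolding tempered_distributions_def mem_Collect_eq
proof (intro conjI)
  show "\<forall>\<phi>\<in>schwartz_space. \<forall>\<psi>\<in>schwartz_space. sdist x (\<lambda>t. \<phi> t + \<psi> t) = sdist x \<phi> + sdist x \<psi>"
    by (auto simp: sdist_def schwartz_add cl_add'[symmetric] schwartz_L2 bil_add_right)
  show "\<forall>\<alpha>. \<forall>\<phi>\<in>schwartz_space. sdist x (\<lambda>t. \<alpha> * \<phi> t) = \<alpha> * sdist x \<phi>"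
    by (auto simp: sdist_def schwartz_scale cl_cscale[symmetric] schwartz_L2 bil_cscale_right)
  \<comment> \<open>The L2 norm of the dominating function 1 / (1 + t^2).\<close>
  define W where "W = sqrt (\<integral>t. (1 / (1 + t\<^sup>2))\<^sup>2 \<partial>(lborel :: real measure))"
  have "cmod (sdist x \<phi>) \<le> (norm x * W) * (\<Sum>m\<le>2. \<Sum>n\<le>2. schwartz_seminorm m n \<phi>)" if \<phi>: "\<phi> \<in> schwartz_space" for \<phi>
  proof -
    let ?S = "\<Sum>m\<le>2. \<Sum>n\<le>2. schwartz_seminorm m n \<phi>"
    have pos: "0 \<le> schwartz_seminorm m n \<phi>" for m n
      using order_trans[OF _ schwartz_seminorm_upper[OF \<phi>, of 0 m n]] by simp
    have s: "schwartz_seminorm 0 0 \<phi> + schwartz_seminorm 2 0 \<phi> \<le> ?S"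
      using pos by (simp add: numeral_2_eq_2 add_nonneg_nonneg)
    have pt: "cmod (\<phi> t) \<le> ?S * (1 / (1 + t\<^sup>2))" for t
    proof -
      have p: "0 < 1 + t\<^sup>2" by (simp add: add_pos_nonneg)
      have "(1 + t\<^sup>2) * cmod (\<phi> t) \<le> ?S"
        using schwartz_seminorm_upper[OF \<phi>, of t 0 0] schwartz_seminorm_upper[OF \<phi>, of t 2 0] s
        by (simp add: algebra_simps)
      then have "cmod (\<phi> t) * (1 + t\<^sup>2) \<le> ?S" by (simp only: mult.commute)
      then have "cmod (\<phi> t) \<le> ?S / (1 + t\<^sup>2)" by (rule mult_imp_le_div_pos[OF p])
      then show ?thesis by (simp only: times_divide_eq_right mult_1_right)
    qed
    have S0: "0 \<le> ?S" using pos by (intro sum_nonneg) auto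
    have "(norm (cl \<phi>))\<^sup>2 = (\<integral>t. (cmod (\<phi> t))\<^sup>2 \<partial>lborel)" by (rule norm_cl[OF schwartz_L2[OF \<phi>]])
    also have "\<dots> \<le> (\<integral>t. ?S\<^sup>2 * (1 / (1 + t\<^sup>2))\<^sup>2 \<partial>lborel)"
    proof (rule integral_mono)
      show "integrable lborel (\<lambda>t. (cmod (\<phi> t))\<^sup>2)" using schwartz_L2[OF \<phi>] by (simp add: L2_functions_iff)
      show "integrable lborel (\<lambda>t. ?S\<^sup>2 * (1 / (1 + t\<^sup>2))\<^sup>2)" by (rule integrable_mult_right[OF integrable_inv_sq_sq])
      show "(cmod (\<phi> t))\<^sup>2 \<le> ?S\<^sup>2 * (1 / (1 + t\<^sup>2))\<^sup>2" for t
        unfolding power_mult_distrib[symmetric] by (intro power_mono pt) simp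
    qed
    also have "\<dots> = (?S * W)\<^sup>2"
      by (simp add: W_def power_mult_distrib Bochner_Integration.integral_nonneg)
    finally have "norm (cl \<phi>) \<le> ?S * W"
      by (rule power2_le_imp_le) (simp add: S0 W_def Bochner_Integration.integral_nonneg)
    then have "norm x * norm (cl \<phi>) \<le> norm x * (?S * W)" by (rule mult_left_mono) simp
    then show ?thesis using cmod_bil_le[of x "cl \<phi>"] \<phi> by (simp add: sdist_def mult_ac)
  qed
  then show "\<exists>C N. \<forall>\<phi>\<in>schwartz_space. cmod (sdist x \<phi>) \<le> C * (\<Sum>m\<le>N. \<Sum>n\<le>N. schwartz_seminorm m n \<phi>)" by blast
  show "\<forall>\<phi>. \<phi> \<notin> schwartz_space \<longrightarrow> sdist x \<phi> = 0" by (simp add: sdist_def)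
qed

lemma stft_sdist: "g \<in> schwartz_space \<Longrightarrow> stft g (sdist x) y \<omega> = stfl g x (y, \<omega>)"
  using stft_window[of g y \<omega>] by (simp add: stft_def sdist_def stfl_def win_def[abs_def])

lemma stft_L1_sdist: "g \<in> schwartz_space \<Longrightarrow> stft_L1 g (sdist x) = s0 g x"
  by (simp add: stft_L1_pair[OF sdist_tempered] s0_def stft_sdist)

lemma sdist_inj: "sdist x = sdist y \<Longrightarrow> x = y"
proof (rule fourier_unique)
  fix \<omega> assume "sdist x = sdist y"
  from fun_cong[OF this, of "gauss \<omega>"] show "bil x (cl (gauss \<omega>)) = bil y (cl (gauss \<omega>))"
    by (simp add: sdist_def gauss_schwartz)
qed

lemma sdist_linear: "sdist (x + y) = (\<lambda>\<phi>. sdist x \<phi> + sdist y \<phi>)" "sdist (cscale \<alpha> x) = (\<lambda>\<phi>. \<alpha> * sdist x \<phi>)"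
  "sdist 0 = (\<lambda>\<phi>. 0)"
  using bounded_bilinear.zero_left[OF bounded_bilinear_bil]
  by (auto simp: sdist_def fun_eq_iff bil_add_left bil_cscale_left)

lemma window_norm_nonzero:
  assumes g: "g \<in> schwartz_space" "g \<noteq> (\<lambda>t. 0)"
  shows "(\<integral>t. g t * cnj (g t) \<partial>lborel) \<noteq> 0"
proof
  assume 0: "(\<integral>t. g t * cnj (g t) \<partial>lborel) = 0"
  have "bil (cl g) (conjl (cl g)) = 0"
    using 0 schwartz_L2[OF g(1)] by (simp add: cl_conjl bil_cl L2_cnj)
  then have "cl g = 0" by (simp add: bil_conjl_self)
  then have AE: "AE t in lborel. g t = 0" using schwartz_L2[OF g(1)] by (simp add: zero_l2_def cl_eq_iff)
  have "g t = 0" for t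
    by (rule AE_eq_isCont[OF C2_decay_props(5)[OF schwartz_C2_decay[OF g(1)]] _ AE]) simp
  then show False using g(2) by auto
qed

text \<open>The synthesis divided by its constant is a bounded integrable function that represents
  \<open>f\<close>. The last clause extends reconstruction to all L2 test functions, as needed for
  windows outside the Schwartz space.\<close>

lemma S0_representation:
  assumes g: "g \<in> schwartz_space" "g \<noteq> (\<lambda>t. 0)"
  shows "\<exists>K\<ge>0. \<forall>f. f \<in> tempered_distributions \<longrightarrow> stft_L1 g f < \<infinity> \<longrightarrow>
    (\<exists>x. f = sdist x \<and> norm x \<le> K * enn2real (stft_L1 g f) \<and>
      (\<forall>\<phi>. \<phi> \<in> L2_functions \<longrightarrow> (\<integral>t. g t * cnj (g t) \<partial>lborel) * bil x (cl \<phi>) = (\<integral>t. synth g (stft g f) t * \<phi> t \<partial>lborel)))"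
proof -
  define c where "c = (\<integral>t. g t * cnj (g t) \<partial>lborel)"
  have c0: "c \<noteq> 0" unfolding c_def by (rule window_norm_nonzero[OF g])
  note gp = C2_decay_props[OF schwartz_C2_decay[OF g(1)]]
  obtain M where M: "\<And>t. cmod (g t) \<le> M" using gp(4) by blast
  have M0: "M \<ge> 0" using M[of 0] norm_ge_zero order_trans by blast
  define I where "I = (\<integral>t. cmod (g t) \<partial>lborel)"
  have I0: "I \<ge> 0" unfolding I_def by (rule Bochner_Integration.integral_nonneg) simp
  \<comment> \<open>The synthesis has sup norm at most \<open>M * N\<close> and L1 norm at most
    \<open>N * I\<close>; the squared L2 norm is at most their product.\<close>
  define K where "K = sqrt (M * I) / cmod c"
  have "\<exists>x. f = sdist x \<and> norm x \<le> K * enn2real (stft_L1 g f) \<and>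
      (\<forall>\<phi>. \<phi> \<in> L2_functions \<longrightarrow> c * bil x (cl \<phi>) = (\<integral>t. synth g (stft g f) t * \<phi> t \<partial>lborel))"
    if f: "f \<in> tempered_distributions" and fin: "stft_L1 g f < \<infinity>" for f
  proof -
    define N where "N = enn2real (stft_L1 g f)"
    note V = stft_integrable[OF f g(1) fin]
    let ?u = "synth g (stft g f)"
    have N: "(\<integral>p. cmod (stft g f (fst p) (snd p)) \<partial>(lborel \<Otimes>\<^sub>M lborel)) = N" using V(2) by (simp add: N_def)
    note sp = synth_props[OF V(1) gp(1,2) M, unfolded N]
    have ub: "cmod (?u t) \<le> M * N" for t by (rule sp(1))
    have uL: "?u \<in> L2_functions" by (rule L2_I1_bounded[OF sp(2) ub])
    have uM: "?u \<in> borel_measurable borel" using uL by (rule L2_measurable)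
    define x where "x = cl (\<lambda>t. (1 / c) * ?u t)"
    have x: "c * bil x (cl \<phi>) = (\<integral>t. ?u t * \<phi> t \<partial>lborel)" if "\<phi> \<in> L2_functions" for \<phi>
      using bil_cl[OF L2_scale[OF uL, of "1 / c"] that] c0 by (simp add: x_def)
    have "f \<phi> = sdist x \<phi>" for \<phi>
    proof (cases "\<phi> \<in> schwartz_space")
      case True
      have "c * f \<phi> = c * bil x (cl \<phi>)"
        using S0_synthesis[OF f g(1) fin True] x[OF schwartz_L2[OF True]] by (simp add: c_def)
      then show ?thesis using c0 True by (simp add: sdist_def)
    qed (use temperedD(3)[OF f] in \<open>simp add: sdist_def\<close>)
    moreover have "norm x \<le> K * N"
    proof (rule power2_le_imp_le)
      have "(norm x)\<^sup>2 = (\<integral>t. (1 / cmod c)\<^sup>2 * (cmod (?u t))\<^sup>2 \<partial>lborel)"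
        unfolding x_def using norm_cl[OF L2_scale[OF uL, of "1 / c"]]
        by (simp add: norm_mult norm_divide power_mult_distrib power_divide)
      also have "\<dots> \<le> (\<integral>t. (1 / cmod c)\<^sup>2 * (M * N * cmod (?u t)) \<partial>lborel)"
      proof (rule integral_mono)
        show "integrable lborel (\<lambda>t. (1 / cmod c)\<^sup>2 * (cmod (?u t))\<^sup>2)" using uL by (simp add: L2_functions_iff)
        show "integrable lborel (\<lambda>t. (1 / cmod c)\<^sup>2 * (M * N * cmod (?u t)))" using sp(2) by simp
        show "(1 / cmod c)\<^sup>2 * (cmod (?u t))\<^sup>2 \<le> (1 / cmod c)\<^sup>2 * (M * N * cmod (?u t))" for t
          using mult_right_mono[OF ub[of t] norm_ge_zero[of "?u t"]]
          by (intro mult_left_mono) (auto simp: power2_eq_square)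
      qed
      also have "\<dots> = (1 / cmod c)\<^sup>2 * (M * N * (\<integral>t. cmod (?u t) \<partial>lborel))" by simp
      also have "\<dots> \<le> (1 / cmod c)\<^sup>2 * (M * N * (N * I))"
        using sp(3) M0 by (intro mult_left_mono) (auto simp: I_def N_def)
      also have "\<dots> = (K * N)\<^sup>2"
        using M0 I0 by (simp add: K_def power_mult_distrib power_divide) (simp add: power2_eq_square mult_ac)
      finally show "(norm x)\<^sup>2 \<le> (K * N)\<^sup>2" .
      show "0 \<le> K * N" using M0 I0 by (simp add: K_def N_def)
    qed
    ultimately show ?thesis using x unfolding N_def by blast
  qed
  moreover have "K \<ge> 0" using M0 I0 by (simp add: K_def)
  ultimately show ?thesis unfolding c_def by blast
qed

subsection \<open>Decay of the short-time Fourier transform and change of window\<close>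

lemma nn_integral_pair_affine:
  fixes F :: "real \<times> real \<Rightarrow> ennreal"
  assumes [measurable]: "F \<in> borel_measurable (borel \<Otimes>\<^sub>M borel)" and ab: "a \<noteq> 0" "b \<noteq> 0"
  shows "(\<integral>\<^sup>+p. F p \<partial>(lborel \<Otimes>\<^sub>M lborel)) = ennreal (\<bar>a\<bar> * \<bar>b\<bar>) * (\<integral>\<^sup>+p. F (s + a * fst p, r + b * snd p) \<partial>(lborel \<Otimes>\<^sub>M lborel))"
proof -
  have "(\<integral>\<^sup>+p. F p \<partial>(lborel \<Otimes>\<^sub>M lborel)) = (\<integral>\<^sup>+x. (\<integral>\<^sup>+y. F (x, y) \<partial>lborel) \<partial>lborel)"
    by (rule lborel.nn_integral_fst[symmetric]) simp
  also have "\<dots> = \<bar>a\<bar> * (\<integral>\<^sup>+x. (\<integral>\<^sup>+y. F (s + a * x, y) \<partial>lborel) \<partial>lborel)"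
    by (rule nn_integral_real_affine[OF _ ab(1)]) measurable
  also have "(\<integral>\<^sup>+x. (\<integral>\<^sup>+y. F (s + a * x, y) \<partial>lborel) \<partial>lborel)
      = (\<integral>\<^sup>+x. \<bar>b\<bar> * (\<integral>\<^sup>+y. F (s + a * x, r + b * y) \<partial>lborel) \<partial>lborel)"
    by (intro nn_integral_cong nn_integral_real_affine[OF _ ab(2)]) measurable
  also have "\<dots> = \<bar>b\<bar> * (\<integral>\<^sup>+x. (\<integral>\<^sup>+y. F (s + a * x, r + b * y) \<partial>lborel) \<partial>lborel)"
    by (rule nn_integral_cmult) measurable
  also have "(\<integral>\<^sup>+x. (\<integral>\<^sup>+y. F (s + a * x, r + b * y) \<partial>lborel) \<partial>lborel)
      = (\<integral>\<^sup>+p. F (s + a * fst p, r + b * snd p) \<partial>(lborel \<Otimes>\<^sub>M lborel))"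
    by (subst lborel.nn_integral_fst[symmetric]) simp_all
  finally show ?thesis by (simp add: ennreal_mult mult.assoc)
qed

text \<open>In the non-integrable case the Bochner integral is 0 by convention.\<close>

lemma norm_integral_le_nn_integral:
  fixes f :: "'a \<Rightarrow> complex"
  shows "ennreal (cmod (\<integral>x. f x \<partial>M)) \<le> (\<integral>\<^sup>+x. ennreal (cmod (f x)) \<partial>M)"
  by (cases "integrable M f") (auto simp: integral_norm_bound_ennreal not_integrable_integral_eq)

text \<open>From 1 + a^2 <= 2 (1 + t^2) (1 + (t - a)^2): of the squared weights, one pair is spent
  on decay in the shift \<open>a\<close>, and a factor integrable in \<open>t\<close> is left
  over.\<close>

lemma inv_sq_convolution_bound:
  fixes t a :: real
  shows "(1 / (1 + t\<^sup>2))\<^sup>2 * (1 / (1 + (t - a)\<^sup>2))\<^sup>2 \<le> 2 / (1 + a\<^sup>2) * (1 / (1 + t\<^sup>2))"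
proof -
  define p q r where "p = 1 + t\<^sup>2" and "q = 1 + (t - a)\<^sup>2" and "r = 1 + a\<^sup>2"
  have pq: "p \<ge> 1" "q \<ge> 1" "r > 0" by (auto simp: p_def q_def r_def add_pos_nonneg)
  have "0 \<le> (t + (t - a))\<^sup>2" by simp
  then have "a\<^sup>2 \<le> 2 * t\<^sup>2 + 2 * (t - a)\<^sup>2" by (simp add: power2_eq_square algebra_simps)
  moreover have "0 \<le> t\<^sup>2 * (t - a)\<^sup>2" by simp
  ultimately have r: "r \<le> 2 * (p * q)"
    unfolding p_def q_def r_def distrib_left distrib_right by linarith
  have "p * q \<le> p * q * q" using pq mult_left_mono[of 1 q "p * q"] by simp
  then have "r \<le> 2 * (p * q\<^sup>2)" using r by (simp add: power2_eq_square mult.assoc)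
  then have "1 / (p\<^sup>2 * q\<^sup>2) \<le> 2 / r * (1 / p)"
    using pq by (simp add: divide_simps power2_eq_square mult_ac)
  then show ?thesis by (simp add: p_def q_def r_def power_divide)
qed

text \<open>The integral is the transform at \<open>b\<close> of the product \<open>m\<close> of
  \<open>u\<close> with a shifted conjugate of \<open>h\<close>. Decay in \<open>a\<close> comes
  from the overlap of the factors, decay in \<open>b\<close> from two derivatives of
  \<open>m\<close>.\<close>

lemma cross_ambiguity_bound:
  assumes u: "u \<in> C2_decay" and h: "h \<in> C2_decay"
  shows "\<exists>C\<ge>0. \<forall>a b. cmod (\<integral>t. u t * win h (a, b) t \<partial>lborel) \<le> C * (1 / (1 + a\<^sup>2)) * (1 / (1 + b\<^sup>2))"
proof -
  obtain u1 u2 C where u': "C2_chain u u1 u2 C" by (rule C2_decayE[OF u])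
  obtain h1 h2 D where h': "C2_chain h h1 h2 D" by (rule C2_decayE[OF h])
  note up = C2_chain_props[OF u'] and hp = C2_chain_props[OF h']
  note uc = u'[unfolded C2_chain_def] and hc = h'[unfolded C2_chain_def]
  have CD: "C \<ge> 0" "D \<ge> 0" using uc hc bound_C2(4)[OF _ norm_ge_zero] by blast+
  define J where "J = (\<integral>t. 1 / (1 + t\<^sup>2) \<partial>(lborel :: real measure))"
  have J0: "J \<ge> 0" unfolding J_def by (intro Bochner_Integration.integral_nonneg) simp
  \<comment> \<open>The factor 10 is 5 times 2: \<open>m\<close> is at most \<open>w\<close> and its
    second derivative at most \<open>4 * w\<close>, while \<open>w\<close> contains the 2 of the
    convolution bound.\<close>
  have "cmod (\<integral>t. u t * win h (a, b) t \<partial>lborel) \<le> (10 * C * D * J) * (1 / (1 + a\<^sup>2)) * (1 / (1 + b\<^sup>2))" for a b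
  proof -
    define w where "w t = C * D * (2 / (1 + a\<^sup>2) * (1 / (1 + t\<^sup>2)))" for t :: real
    have wi: "integrable lborel w" unfolding w_def by (intro integrable_mult_right integrable_inv_sq)
    have w0: "w t \<ge> 0" for t using CD by (simp add: w_def)
    have prod: "cmod (x * cnj y) \<le> w t" if "(1 + t\<^sup>2)\<^sup>2 * cmod x \<le> C" "(1 + (t - a)\<^sup>2)\<^sup>2 * cmod y \<le> D" for x y t
    proof -
      have "cmod (x * cnj y) \<le> (C * (1 / (1 + t\<^sup>2))\<^sup>2) * (D * (1 / (1 + (t - a)\<^sup>2))\<^sup>2)"
        unfolding norm_mult complex_mod_cnj using bound_C2(2)[OF that(1)] bound_C2(2)[OF that(2)] CD
        by (intro mult_mono) auto
      also have "\<dots> = C * D * ((1 / (1 + t\<^sup>2))\<^sup>2 * (1 / (1 + (t - a)\<^sup>2))\<^sup>2)" by (simp only: mult_ac)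
      also have "\<dots> \<le> w t" unfolding w_def using CD by (intro mult_left_mono inv_sq_convolution_bound) auto
      finally show ?thesis .
    qed
    let ?k = "\<lambda>t. cnj (h (t - a))" and ?k1 = "\<lambda>t. cnj (h1 (t - a))" and ?k2 = "\<lambda>t. cnj (h2 (t - a))"
    have sh: "((\<lambda>t. F (t - a)) has_vector_derivative F' (t - a)) (at t)" if "\<And>t. (F has_vector_derivative F' t) (at t)"
      for F F' :: "real \<Rightarrow> complex" and t
      using vector_diff_chain_at[of "\<lambda>t. t - a" 1 t F, unfolded comp_def, OF _ that]
      by (simp add: has_vector_derivative_diff_const)
    have kd: "(?k has_vector_derivative ?k1 t) (at t)" "(?k1 has_vector_derivative ?k2 t) (at t)" for t
      using hc by (auto intro!: has_vector_derivative_cnj sh)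
    have ud: "(u has_vector_derivative u1 t) (at t)" "(u1 has_vector_derivative u2 t) (at t)" for t using uc by blast+
    define m where "m t = u t * ?k t" for t
    define m1 where "m1 t = u t * ?k1 t + u1 t * ?k t" for t
    define m2 where "m2 t = (u t * ?k2 t + u1 t * ?k1 t) + (u1 t * ?k1 t + u2 t * ?k t)" for t
    have md: "(m has_vector_derivative m1 t) (at t)" "(m1 has_vector_derivative m2 t) (at t)" for t
      unfolding m_def m1_def m2_def by (intro has_vector_derivative_mult has_vector_derivative_add ud kd)+
    have shc: "isCont (\<lambda>t. F (t - a)) t" if "\<And>t. isCont F t" for F :: "real \<Rightarrow> complex" and t
      by (rule isCont_o2[OF _ that]) simp
    have cont: "isCont u t" "isCont u1 t" "isCont u2 t" "isCont ?k t" "isCont ?k1 t" "isCont ?k2 t" for t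
      using uc hc up(13,14) hp(13,14) by (auto intro!: isCont_cnj shc)
    have m2c: "isCont m2 t" for t unfolding m2_def by (intro continuous_intros cont)
    have m1c: "isCont m1 t" for t unfolding m1_def by (intro continuous_intros cont)
    have mc: "isCont m t" for t unfolding m_def by (intro continuous_intros cont)
    have bm: "cmod (m t) \<le> w t" for t unfolding m_def by (rule prod) (use uc hc in auto)
    have t2: "cmod (x + y) \<le> 2 * w t" if "cmod x \<le> w t" "cmod y \<le> w t" for x y t
      using norm_triangle_ineq[of x y] that by linarith
    have bm1: "cmod (m1 t) \<le> 2 * w t" for t unfolding m1_def by (rule t2; rule prod) (use uc hc in auto)
    have bm2: "cmod (m2 t) \<le> 4 * w t" for t
    proof -
      have "cmod (u t * ?k2 t + u1 t * ?k1 t) \<le> 2 * w t" "cmod (u1 t * ?k1 t + u2 t * ?k t) \<le> 2 * w t"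
        by (rule t2; rule prod; use uc hc in auto)+
      then show ?thesis unfolding m2_def using norm_triangle_ineq[of "u t * ?k2 t + u1 t * ?k1 t" "u1 t * ?k1 t + u2 t * ?k t"] by linarith
    qed
    have int: "integrable lborel F" if "\<And>t. isCont F t" "\<And>t. cmod (F t) \<le> K * w t" for F K
    proof (rule Bochner_Integration.integrable_bound)
      show "integrable lborel (\<lambda>t. K * w t)" using wi by simp
      show "F \<in> borel_measurable lborel"
        using that(1) borel_measurable_continuous_onI[of F] by (simp add: continuous_on_eq_continuous_at)
      show "AE t in lborel. norm (F t) \<le> norm (K * w t)"
        using that(2) by (intro AE_I2) (metis abs_ge_self order_trans real_norm_def)
    qed
    have wlim: "(w \<longlongrightarrow> 0) at_bot" "(w \<longlongrightarrow> 0) at_top"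
    proof -
      have "((\<lambda>t::real. 1 / (1 + t\<^sup>2)) \<longlongrightarrow> 0) at_bot" "((\<lambda>t::real. 1 / (1 + t\<^sup>2)) \<longlongrightarrow> 0) at_top"
        by (rule tendsto_divide_0[OF tendsto_const], rule filterlim_at_top_imp_at_infinity,
            rule filterlim_tendsto_add_at_top[OF tendsto_const],
            rule filterlim_pow_at_bot_even filterlim_pow_at_top, simp, simp add: filterlim_ident, simp?)+
      then show "(w \<longlongrightarrow> 0) at_bot" "(w \<longlongrightarrow> 0) at_top"
        unfolding w_def by - (rule tendsto_mult_right_zero, rule tendsto_mult_right_zero, assumption)+
    qed
    have lim: "(F \<longlongrightarrow> 0) at_bot" "(F \<longlongrightarrow> 0) at_top" if "\<And>t. cmod (F t) \<le> 2 * w t" for F :: "real \<Rightarrow> complex"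
      by (rule Lim_null_comparison[OF _ tendsto_mult_right_zero[OF wlim(1), of 2]], simp add: that,
          rule Lim_null_comparison[OF _ tendsto_mult_right_zero[OF wlim(2), of 2]], simp add: that)
    have bm': "cmod (m t) \<le> 2 * w t" for t using bm[of t] w0[of t] by linarith
    have "(1 + b\<^sup>2) * cmod (ft m b) \<le> (\<integral>t. cmod (m t) + cmod (m2 t) \<partial>lborel)"
      by (rule ft_C2_bound[OF md m2c int[OF mc bm'] int[OF m1c bm1] int[OF m2c bm2] lim[OF bm'] lim[OF bm1]])
    also have "\<dots> \<le> (\<integral>t. 5 * w t \<partial>lborel)"
    proof (rule integral_mono)
      show "integrable lborel (\<lambda>t. cmod (m t) + cmod (m2 t))"
        using int[OF mc bm'] int[OF m2c bm2] by simp
      show "integrable lborel (\<lambda>t. 5 * w t)" using wi by simp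
      show "cmod (m t) + cmod (m2 t) \<le> 5 * w t" for t using bm[of t] bm2[of t] by linarith
    qed
    also have "\<dots> = 5 * (C * D * (2 / (1 + a\<^sup>2) * J))" by (simp only: w_def J_def integral_mult_right_zero)
    also have "\<dots> = (10 * C * D * J) * (1 / (1 + a\<^sup>2))" by simp
    finally have "cmod (ft m b) * (1 + b\<^sup>2) \<le> (10 * C * D * J) * (1 / (1 + a\<^sup>2))" by (simp only: mult.commute)
    then have "cmod (ft m b) \<le> (10 * C * D * J) * (1 / (1 + a\<^sup>2)) / (1 + b\<^sup>2)"
      by (rule mult_imp_le_div_pos[rotated]) (simp add: add_pos_nonneg)
    moreover have "ft m b = (\<integral>t. u t * win h (a, b) t \<partial>lborel)"
      unfolding ft_def m_def win_def by (simp add: mult.assoc)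
    ultimately show ?thesis by simp
  qed
  moreover have "10 * C * D * J \<ge> 0" using CD J0 by simp
  ultimately show ?thesis by blast
qed

lemma cross_ambiguity_L1:
  assumes u: "u \<in> C2_decay" and h: "h \<in> C2_decay"
  shows "(\<integral>\<^sup>+p. ennreal (cmod (\<integral>t. u t * win h p t \<partial>lborel)) \<partial>(lborel \<Otimes>\<^sub>M lborel)) < \<infinity>"
proof -
  obtain C where C: "C \<ge> 0" "\<And>a b. cmod (\<integral>t. u t * win h (a, b) t \<partial>lborel) \<le> C * (1 / (1 + a\<^sup>2)) * (1 / (1 + b\<^sup>2))"
    using cross_ambiguity_bound[OF u h] by blast
  have "(\<integral>\<^sup>+p. ennreal (cmod (\<integral>t. u t * win h p t \<partial>lborel)) \<partial>(lborel \<Otimes>\<^sub>M lborel))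
      \<le> (\<integral>\<^sup>+p. ennreal (C * (1 / (1 + (fst p)\<^sup>2)) * (1 / (1 + (snd p)\<^sup>2))) \<partial>(lborel \<Otimes>\<^sub>M lborel))"
    using C(2) by (intro nn_integral_mono ennreal_leI) (metis prod.collapse)
  also have "\<dots> = (\<integral>\<^sup>+a. (\<integral>\<^sup>+b. ennreal (C * (1 / (1 + a\<^sup>2)) * (1 / (1 + b\<^sup>2))) \<partial>lborel) \<partial>lborel)"
    by (subst lborel.nn_integral_fst[symmetric]) simp_all
  also have "\<dots> = (\<integral>\<^sup>+a. ennreal (C * (1 / (1 + a\<^sup>2)) * (\<integral>b. 1 / (1 + b\<^sup>2) \<partial>lborel)) \<partial>lborel)"
  proof (intro nn_integral_cong)
    fix a :: real
    have "(\<integral>\<^sup>+b. ennreal (C * (1 / (1 + a\<^sup>2)) * (1 / (1 + b\<^sup>2))) \<partial>lborel) = ennreal (\<integral>b. C * (1 / (1 + a\<^sup>2)) * (1 / (1 + b\<^sup>2)) \<partial>lborel)"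
      using C(1) by (intro nn_integral_eq_integral integrable_mult_right integrable_inv_sq) auto
    then show "(\<integral>\<^sup>+b. ennreal (C * (1 / (1 + a\<^sup>2)) * (1 / (1 + b\<^sup>2))) \<partial>lborel) = ennreal (C * (1 / (1 + a\<^sup>2)) * (\<integral>b. 1 / (1 + b\<^sup>2) \<partial>lborel))"
      by (simp only: integral_mult_right_zero)
  qed
  also have "\<dots> = ennreal (\<integral>a. C * (1 / (1 + a\<^sup>2)) * (\<integral>b. 1 / (1 + b\<^sup>2) \<partial>lborel) \<partial>(lborel :: real measure))"
    using C(1) by (intro nn_integral_eq_integral integrable_mult_left integrable_mult_right integrable_inv_sq)
      (auto intro!: mult_nonneg_nonneg Bochner_Integration.integral_nonneg)
  also have "\<dots> < \<infinity>" by simp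
  finally show ?thesis .
qed

lemma C2_decay_s0_finite:
  assumes "u \<in> C2_decay" "g \<in> C2_decay" shows "s0 g (cl u) < \<infinity>"
proof -
  have "stfl g (cl u) p = (\<integral>t. u t * win g p t \<partial>lborel)" for p
    unfolding stfl_def by (rule bil_cl[OF C2_decay_props(3)[OF assms(1)] win_props(1)[OF assms(2)]])
  then show ?thesis unfolding s0_def using cross_ambiguity_L1[OF assms] by simp
qed

text \<open>Inserting the reconstruction of \<open>x\<close> into its transform with window
  \<open>h\<close> bounds the latter by the convolution of |V_g x| with |\<Gamma>|, up to the factor
  \<open>1 / cmod c\<close>. Tonelli and translation invariance give the product of the two L1
  norms.\<close>

theorem window_change:
  assumes g: "g \<in> schwartz_space" "g \<noteq> (\<lambda>t. 0)" and h: "h \<in> C2_decay"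
  shows "\<exists>C\<ge>0. \<forall>x. s0 g x < \<infinity> \<longrightarrow> s0 h x \<le> ennreal C * s0 g x"
proof -
  define c where "c = (\<integral>t. g t * cnj (g t) \<partial>lborel)"
  have c0: "c \<noteq> 0" unfolding c_def by (rule window_norm_nonzero[OF g])
  have gC: "g \<in> C2_decay" by (rule schwartz_C2_decay[OF g(1)])
  note gp = C2_decay_props[OF gC]
  obtain M where M: "\<And>t. cmod (g t) \<le> M" using gp(4) by blast
  define \<Gamma> where "\<Gamma> p = (\<integral>t. g t * win h p t \<partial>lborel)" for p
  have "\<Gamma> = stfl h (cl g)"
    unfolding \<Gamma>_def stfl_def using bil_cl[OF gp(3) win_props(1)[OF h]] by (simp add: fun_eq_iff)
  then have \<Gamma>m [measurable]: "\<Gamma> \<in> borel_measurable (borel \<Otimes>\<^sub>M borel)" using stfl_measurable[OF h, of "cl g"] by simp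
  define G where "G = (\<integral>\<^sup>+p. ennreal (cmod (\<Gamma> p)) \<partial>(lborel \<Otimes>\<^sub>M lborel))"
  have G: "G < \<infinity>" unfolding G_def \<Gamma>_def by (rule cross_ambiguity_L1[OF gC h])
  have "s0 h x \<le> ennreal (1 / cmod c * enn2real G) * s0 g x" if fin: "s0 g x < \<infinity>" for x
  proof -
    define V where "V = stft g (sdist x)"
    have V: "V (fst p) (snd p) = stfl g x p" for p by (simp add: V_def stft_sdist[OF g(1)])
    have fin': "stft_L1 g (sdist x) < \<infinity>" using fin by (simp add: stft_L1_sdist[OF g(1)])
    obtain x' where x': "sdist x = sdist x'"
      "\<And>\<phi>. \<phi> \<in> L2_functions \<Longrightarrow> c * bil x' (cl \<phi>) = (\<integral>t. synth g V t * \<phi> t \<partial>lborel)"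
      using S0_representation[OF g] sdist_tempered[of x] fin' unfolding c_def V_def by blast
    \<comment> \<open>The representation lemma yields some element of \<open>l2\<close>; injectivity
      of \<open>sdist\<close> shows that it is \<open>x\<close>.\<close>
    have xx: "x' = x" using sdist_inj[OF x'(1)] by simp
    note Vi = stft_integrable(1)[OF sdist_tempered g(1) fin', folded V_def]
    have [measurable]: "(\<lambda>p. V (fst p) (snd p)) \<in> borel_measurable (borel \<Otimes>\<^sub>M borel)"
      using Vi by (auto dest: borel_measurable_integrable)
    \<comment> \<open>Covariance: pairing two time-frequency shifts depends, up to a phase, only on
      the difference of the points.\<close>
    have inner: "cmod (\<integral>t. g (t - fst p) * cis (2 * pi * snd p * t) * win h q t \<partial>lborel)
        = cmod (\<Gamma> (fst q - fst p, snd q - snd p))" for p q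
    proof -
      have "(\<integral>t. g (t - fst p) * cis (2 * pi * snd p * t) * win h q t \<partial>lborel)
          = (\<integral>t. g t * cis (2 * pi * snd p * (fst p + t)) * win h q (fst p + t) \<partial>lborel)"
        by (subst lborel_integral_real_affine[where c = 1 and t = "fst p"]) auto
      also have "\<dots> = (\<integral>t. cis (2 * pi * (snd p - snd q) * fst p) * (g t * win h (fst q - fst p, snd q - snd p) t) \<partial>lborel)"
      proof (intro Bochner_Integration.integral_cong refl)
        fix t
        have "cis (2 * pi * snd p * (fst p + t)) * cis (- 2 * pi * snd q * (fst p + t))
            = cis (2 * pi * (snd p - snd q) * fst p) * cis (- 2 * pi * (snd q - snd p) * t)"
          unfolding cis_mult by (intro arg_cong[where f = cis]) (simp add: algebra_simps)
        then show "g t * cis (2 * pi * snd p * (fst p + t)) * win h q (fst p + t)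
            = cis (2 * pi * (snd p - snd q) * fst p) * (g t * win h (fst q - fst p, snd q - snd p) t)"
          by (simp add: win_def algebra_simps)
      qed
      also have "\<dots> = cis (2 * pi * (snd p - snd q) * fst p) * \<Gamma> (fst q - fst p, snd q - snd p)"
        by (simp add: \<Gamma>_def)
      finally show ?thesis by (simp add: norm_mult)
    qed
    have le: "ennreal (cmod (stfl h x q)) \<le> ennreal (1 / cmod c) *
        (\<integral>\<^sup>+p. ennreal (cmod (stfl g x p)) * ennreal (cmod (\<Gamma> (fst q - fst p, snd q - snd p))) \<partial>(lborel \<Otimes>\<^sub>M lborel))" for q
    proof -
      obtain K where K: "\<And>t. cmod (win h q t) \<le> K" using win_props(4)[OF h] by blast
      let ?R = "\<lambda>p. \<integral>t. g (t - fst p) * cis (2 * pi * snd p * t) * win h q t \<partial>lborel"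
      have wm: "win h q \<in> borel_measurable borel" by (rule win_props(2)[OF h])
      have "c * bil x (cl (win h q)) = (\<integral>t. synth g V t * win h q t \<partial>lborel)"
        using x'(2)[OF win_props(1)[OF h]] by (simp add: xx)
      also have "\<dots> = (\<integral>p. V (fst p) (snd p) * ?R p \<partial>(lborel \<Otimes>\<^sub>M lborel))"
        by (rule synth_props(4)[OF Vi gp(1,2) M wm K])
      finally have "cmod c * cmod (stfl h x q) = cmod (\<integral>p. V (fst p) (snd p) * ?R p \<partial>(lborel \<Otimes>\<^sub>M lborel))"
        by (simp add: stfl_def norm_mult[symmetric])
      also have "ennreal \<dots> \<le> (\<integral>\<^sup>+p. ennreal (cmod (V (fst p) (snd p) * ?R p)) \<partial>(lborel \<Otimes>\<^sub>M lborel))"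
        by (rule norm_integral_le_nn_integral)
      also have "\<dots> = (\<integral>\<^sup>+p. ennreal (cmod (stfl g x p)) * ennreal (cmod (\<Gamma> (fst q - fst p, snd q - snd p))) \<partial>(lborel \<Otimes>\<^sub>M lborel))"
        by (simp add: norm_mult inner V ennreal_mult)
      finally have *: "ennreal (cmod c * cmod (stfl h x q)) \<le> \<dots>" .
      have "ennreal (cmod (stfl h x q)) = ennreal (1 / cmod c) * ennreal (cmod c * cmod (stfl h x q))"
        using c0 by (simp add: ennreal_mult[symmetric])
      also have "\<dots> \<le> ennreal (1 / cmod c) * (\<integral>\<^sup>+p. ennreal (cmod (stfl g x p)) * ennreal (cmod (\<Gamma> (fst q - fst p, snd q - snd p))) \<partial>(lborel \<Otimes>\<^sub>M lborel))"
        by (rule mult_left_mono[OF *]) simp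
      finally show ?thesis .
    qed
    have [measurable]: "stfl g x \<in> borel_measurable (borel \<Otimes>\<^sub>M borel)" using stfl_measurable[OF gC, of x] by simp
    interpret PP: pair_sigma_finite "lborel \<Otimes>\<^sub>M lborel :: (real \<times> real) measure" "lborel \<Otimes>\<^sub>M lborel :: (real \<times> real) measure" ..
    have "s0 h x \<le> (\<integral>\<^sup>+q. ennreal (1 / cmod c) *
        (\<integral>\<^sup>+p. ennreal (cmod (stfl g x p)) * ennreal (cmod (\<Gamma> (fst q - fst p, snd q - snd p))) \<partial>(lborel \<Otimes>\<^sub>M lborel)) \<partial>(lborel \<Otimes>\<^sub>M lborel))"
      unfolding s0_def by (intro nn_integral_mono le)
    also have "\<dots> = ennreal (1 / cmod c) * (\<integral>\<^sup>+q.
        (\<integral>\<^sup>+p. ennreal (cmod (stfl g x p)) * ennreal (cmod (\<Gamma> (fst q - fst p, snd q - snd p))) \<partial>(lborel \<Otimes>\<^sub>M lborel)) \<partial>(lborel \<Otimes>\<^sub>M lborel))"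
      by (rule nn_integral_cmult) measurable
    also have "(\<integral>\<^sup>+q. (\<integral>\<^sup>+p. ennreal (cmod (stfl g x p)) * ennreal (cmod (\<Gamma> (fst q - fst p, snd q - snd p))) \<partial>(lborel \<Otimes>\<^sub>M lborel)) \<partial>(lborel \<Otimes>\<^sub>M lborel))
      = (\<integral>\<^sup>+p. (\<integral>\<^sup>+q. ennreal (cmod (stfl g x p)) * ennreal (cmod (\<Gamma> (fst q - fst p, snd q - snd p))) \<partial>(lborel \<Otimes>\<^sub>M lborel)) \<partial>(lborel \<Otimes>\<^sub>M lborel))"
      by (rule PP.Fubini'[symmetric]) measurable
    also have "\<dots> = (\<integral>\<^sup>+p. ennreal (cmod (stfl g x p)) * G \<partial>(lborel \<Otimes>\<^sub>M lborel))"
    proof (intro nn_integral_cong)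
      fix p :: "real \<times> real"
      have "(\<integral>\<^sup>+q. ennreal (cmod (stfl g x p)) * ennreal (cmod (\<Gamma> (fst q - fst p, snd q - snd p))) \<partial>(lborel \<Otimes>\<^sub>M lborel))
          = ennreal (cmod (stfl g x p)) * (\<integral>\<^sup>+q. ennreal (cmod (\<Gamma> (fst q - fst p, snd q - snd p))) \<partial>(lborel \<Otimes>\<^sub>M lborel))"
        by (rule nn_integral_cmult) measurable
      also have "(\<integral>\<^sup>+q. ennreal (cmod (\<Gamma> (fst q - fst p, snd q - snd p))) \<partial>(lborel \<Otimes>\<^sub>M lborel)) = G"
        unfolding G_def using nn_integral_pair_affine[of "\<lambda>q. ennreal (cmod (\<Gamma> q))" 1 1 "- fst p" "- snd p"] by simp
      finally show "(\<integral>\<^sup>+q. ennreal (cmod (stfl g x p)) * ennreal (cmod (\<Gamma> (fst q - fst p, snd q - snd p))) \<partial>(lborel \<Otimes>\<^sub>M lborel))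
          = ennreal (cmod (stfl g x p)) * G" .
    qed
    also have "\<dots> = s0 g x * G" unfolding s0_def by (rule nn_integral_multc) measurable
    also have "ennreal (1 / cmod c) * (s0 g x * G) = ennreal (1 / cmod c * enn2real G) * s0 g x"
    proof -
      have "ennreal (1 / cmod c * enn2real G) = ennreal (1 / cmod c) * ennreal (enn2real G)"
        by (rule ennreal_mult) simp_all
      also have "ennreal (enn2real G) = G" using G by (simp add: less_top)
      finally show ?thesis by (simp only: mult_ac)
    qed
    finally show ?thesis .
  qed
  moreover have "1 / cmod c * enn2real G \<ge> 0" by simp
  ultimately show ?thesis by blast
qed

section \<open>The Banach Gelfand triple of the Feichtinger algebra\<close>

lemma L2_to_S0_dual_off: "f \<notin> vcarrier (S0_space g) \<Longrightarrow> L2_to_S0_dual g U f = 0"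
  by (simp add: L2_to_S0_dual_def)

lemma S0_to_L2_sdist: "S0_to_L2 (sdist x) = Rep_l2 x"
  unfolding S0_to_L2_def
proof (rule the_equality)
  have eq: "(\<integral>t. L2_rep (Rep_l2 y) t * \<phi> t \<partial>lborel) = bil y (cl \<phi>)" if "\<phi> \<in> schwartz_space" for \<phi> y
    using bil_cl[OF fn_L2[of y] schwartz_L2[OF that]] by (simp add: fn_def[symmetric])
  then show "Rep_l2 x \<in> vcarrier L2_space \<and> (\<forall>\<phi>\<in>schwartz_space. sdist x \<phi> = (\<integral>t. L2_rep (Rep_l2 x) t * \<phi> t \<partial>lborel))"
    by (simp add: L2_space_Rep(1) sdist_def)
  fix U assume U: "U \<in> vcarrier L2_space \<and> (\<forall>\<phi>\<in>schwartz_space. sdist x \<phi> = (\<integral>t. L2_rep U t * \<phi> t \<partial>lborel))"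
  then obtain y where y: "U = Rep_l2 y" by (auto simp: L2_space_Rep(1))
  have "y = x"
  proof (rule fourier_unique)
    fix \<omega>
    show "bil y (cl (gauss \<omega>)) = bil x (cl (gauss \<omega>))"
      using U eq[OF gauss_schwartz, of y \<omega>] gauss_schwartz[of \<omega>] by (simp add: y sdist_def)
  qed
  then show "U = Rep_l2 x" by (simp add: y)
qed

locale schwartz_window =
  fixes g :: "real \<Rightarrow> complex"
  assumes gS: "g \<in> schwartz_space" and g0: "g \<noteq> (\<lambda>t. 0)"
begin

lemmas gC = schwartz_C2_decay[OF gS]

definition n0 :: "l2 \<Rightarrow> real" where "n0 x = enn2real (s0 g x)"

lemma s0_n0: "s0 g x < \<infinity> \<Longrightarrow> s0 g x = ennreal (n0 x)"
  by (simp add: n0_def less_top)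

lemma s0_closed [simp]:
  "s0 g x < \<infinity> \<Longrightarrow> s0 g y < \<infinity> \<Longrightarrow> s0 g (x + y) < \<infinity>" "s0 g x < \<infinity> \<Longrightarrow> s0 g (cscale \<alpha> x) < \<infinity>" "s0 g 0 < \<infinity>"
proof -
  show "s0 g x < \<infinity> \<Longrightarrow> s0 g y < \<infinity> \<Longrightarrow> s0 g (x + y) < \<infinity>"
    using s0_add[OF gC, of x y] by (auto simp: less_top[symmetric] top_unique)
  show "s0 g x < \<infinity> \<Longrightarrow> s0 g (cscale \<alpha> x) < \<infinity>"
    by (simp add: s0_scale[OF gC] ennreal_mult_less_top)
  show "s0 g 0 < \<infinity>"
    by (simp add: s0_def stfl_def bounded_bilinear.zero_left[OF bounded_bilinear_bil])
qed

lemma n0_props: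
  "n0 x \<ge> 0" "n0 (cscale \<alpha> x) = cmod \<alpha> * n0 x"
  "s0 g x < \<infinity> \<Longrightarrow> s0 g y < \<infinity> \<Longrightarrow> n0 (x + y) \<le> n0 x + n0 y"
proof -
  show "n0 x \<ge> 0" by (simp add: n0_def)
  show "n0 (cscale \<alpha> x) = cmod \<alpha> * n0 x" by (simp add: n0_def s0_scale[OF gC] enn2real_mult)
  assume xy: "s0 g x < \<infinity>" "s0 g y < \<infinity>"
  have "ennreal (n0 (x + y)) \<le> ennreal (n0 x) + ennreal (n0 y)"
    using s0_add[OF gC, of x y] unfolding s0_n0[OF xy(1)] s0_n0[OF xy(2)] s0_n0[OF s0_closed(1)[OF xy]] .
  then have "ennreal (n0 (x + y)) \<le> ennreal (n0 x + n0 y)" by (simp add: n0_def)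
  then show "n0 (x + y) \<le> n0 x + n0 y" by (subst (asm) ennreal_le_iff) (auto simp: n0_def)
qed

lemma norm_le_n0: obtains K where "K \<ge> 0" "\<And>x. s0 g x < \<infinity> \<Longrightarrow> norm x \<le> K * n0 x"
proof -
  obtain K where K: "K \<ge> 0" "\<And>f. f \<in> tempered_distributions \<Longrightarrow> stft_L1 g f < \<infinity> \<Longrightarrow>
      \<exists>x. f = sdist x \<and> norm x \<le> K * enn2real (stft_L1 g f)"
    using S0_representation[OF gS g0] by blast
  have "norm x \<le> K * n0 x" if x: "s0 g x < \<infinity>" for x
  proof -
    have "stft_L1 g (sdist x) < \<infinity>" using x by (simp add: stft_L1_sdist[OF gS])
    from K(2)[OF sdist_tempered this] obtain y where y: "sdist x = sdist y" "norm y \<le> K * enn2real (stft_L1 g (sdist x))" by blast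
    have "x = y" by (rule sdist_inj[OF y(1)])
    then show ?thesis using y(2) by (simp add: stft_L1_sdist[OF gS] n0_def)
  qed
  then show ?thesis using K(1) that by blast
qed

lemma n0_eq_0: "s0 g x < \<infinity> \<Longrightarrow> n0 x = 0 \<longleftrightarrow> x = 0"
proof
  assume x: "s0 g x < \<infinity>" "n0 x = 0"
  obtain K where "norm x \<le> K * n0 x" using norm_le_n0 x(1) by metis
  then show "x = 0" using x(2) by simp
next
  assume "x = 0"
  then show "n0 x = 0" by (simp add: n0_def s0_def stfl_def bounded_bilinear.zero_left[OF bounded_bilinear_bil])
qed

text \<open>By reconstruction every distribution in the space comes from an element of
  \<open>l2\<close>; from here on the space is handled through this parametrisation.\<close>

lemma S0_carrier: "vcarrier (S0_space g) = sdist ` {x. s0 g x < \<infinity>}"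
proof -
  obtain K where K: "\<And>f. f \<in> tempered_distributions \<Longrightarrow> stft_L1 g f < \<infinity> \<Longrightarrow> \<exists>x. f = sdist x"
    using S0_representation[OF gS g0] by blast
  have "f \<in> sdist ` {x. s0 g x < \<infinity>}" if f: "f \<in> tempered_distributions" "stft_L1 g f < \<infinity>" for f
  proof -
    obtain x where "f = sdist x" using K[OF f] by blast
    then show ?thesis using f(2) by (auto simp: stft_L1_sdist[OF gS])
  qed
  then show ?thesis by (auto simp: S0_space_def sdist_tempered stft_L1_sdist[OF gS])
qed

lemma S0_sdist:
  "vadd (S0_space g) (sdist x) (sdist y) = sdist (x + y)"
  "vzero (S0_space g) = sdist 0"
  "vscale (S0_space g) \<alpha> (sdist x) = sdist (cscale \<alpha> x)"
  "vnorm (S0_space g) (sdist x) = n0 x"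
  by (simp_all add: S0_space_def sdist_linear n0_def stft_L1_sdist[OF gS])

lemma sdist_eq_iff [simp]: "sdist x = sdist y \<longleftrightarrow> x = y"
  using sdist_inj by blast

lemma complex_normed_space_S0: "complex_normed_space (S0_space g)"
  unfolding complex_normed_space_def S0_carrier
  by (intro conjI allI ballI)
    (auto simp: S0_sdist s0_closed cscale_simps add_ac n0_props n0_eq_0 simp del: infinity_ennreal_def)

sublocale S: cnspace "S0_space g"
  by unfold_locales (rule complex_normed_space_S0)

lemma S0_vdist: "s0 g x < \<infinity> \<Longrightarrow> s0 g y < \<infinity> \<Longrightarrow> vdist (S0_space g) (sdist x) (sdist y) = n0 (x - y)"
  by (auto simp: vdist_def S0_sdist S0_carrier cscale_simps)

lemma s0_diff: "s0 g x < \<infinity> \<Longrightarrow> s0 g y < \<infinity> \<Longrightarrow> s0 g (x - y) < \<infinity>"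
  using s0_closed(1)[of x "cscale (-1) y"] s0_closed(2)[of y "-1"] by (simp add: cscale_simps)

text \<open>A Cauchy sequence in the S_0 norm is Cauchy in L2 by \<open>norm_le_n0\<close>; its L2
  limit is also the limit in S_0.\<close>

lemma complex_banach_space_S0: "complex_banach_space (S0_space g)"
proof -
  obtain K where K: "K \<ge> 0" "\<And>x. s0 g x < \<infinity> \<Longrightarrow> norm x \<le> K * n0 x" by (rule norm_le_n0) blast
  have "S.M.mcomplete"
    unfolding S.M.mcomplete_def
  proof (intro allI impI)
    fix \<sigma> :: "nat \<Rightarrow> _" assume \<sigma>: "S.M.MCauchy \<sigma>"
    then have "range \<sigma> \<subseteq> vcarrier (S0_space g)" unfolding S.M.MCauchy_def by (rule conjunct1)
    then have "range \<sigma> \<subseteq> sdist ` {x. s0 g x < \<infinity>}" by (simp only: S0_carrier)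
    then have "\<forall>n. \<exists>x. s0 g x < \<infinity> \<and> \<sigma> n = sdist x" by blast
    from choice[OF this] obtain X where X: "\<forall>n. s0 g (X n) < \<infinity> \<and> \<sigma> n = sdist (X n)" by (rule exE)
    have Xf: "s0 g (X n) < \<infinity>" and Xs: "\<sigma> n = sdist (X n)" for n using X by blast+
    have C: "\<exists>N. \<forall>m\<ge>N. \<forall>n\<ge>N. n0 (X m - X n) < e" if "e > 0" for e
    proof -
      have "\<exists>N. \<forall>m n. N \<le> m \<longrightarrow> N \<le> n \<longrightarrow> vdist (S0_space g) (\<sigma> m) (\<sigma> n) < e"
        using \<sigma> that unfolding S.M.MCauchy_def by (elim conjE allE[of _ e] impE)
      then obtain N where N: "\<forall>m n. N \<le> m \<longrightarrow> N \<le> n \<longrightarrow> vdist (S0_space g) (\<sigma> m) (\<sigma> n) < e" ..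
      then show ?thesis by (auto simp: Xs S0_vdist[OF Xf Xf])
    qed
    have "Cauchy X"
    proof (rule CauchyI)
      fix e :: real assume e: "e > 0"
      then have "e / (K + 1) > 0" using K(1) by simp
      from C[OF this] obtain N where N: "\<And>m n. m \<ge> N \<Longrightarrow> n \<ge> N \<Longrightarrow> n0 (X m - X n) < e / (K + 1)" by blast
      have "norm (X m - X n) < e" if "m \<ge> N" "n \<ge> N" for m n
      proof -
        have "norm (X m - X n) \<le> K * n0 (X m - X n)" by (rule K(2)[OF s0_diff[OF Xf Xf]])
        also have "\<dots> \<le> (K + 1) * n0 (X m - X n)" using n0_props(1) by (intro mult_right_mono) auto
        also have "\<dots> < (K + 1) * (e / (K + 1))" using N[OF that] K(1) by (intro mult_strict_left_mono) auto
        also have "\<dots> = e" using K(1) by simp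
        finally show ?thesis .
      qed
      then show "\<exists>M. \<forall>m\<ge>M. \<forall>n\<ge>M. norm (X m - X n) < e" by blast
    qed
    then obtain x where x: "X \<longlonglongrightarrow> x" using Cauchy_convergent convergent_def by blast
    \<comment> \<open>L2 convergence gives pointwise convergence of the short-time transforms, and
      Fatou's lemma passes the S_0 estimate to the limit.\<close>
    have lim: "s0 g (X n - x) \<le> ennreal e" if N: "\<And>m. m \<ge> N \<Longrightarrow> n0 (X n - X m) \<le> e" for n N e
    proof -
      have "s0 g (X n - x) = (\<integral>\<^sup>+p. liminf (\<lambda>m. ennreal (cmod (stfl g (X n - X m) p))) \<partial>(lborel \<Otimes>\<^sub>M lborel))"
        unfolding s0_def
      proof (intro nn_integral_cong)
        fix p
        have "(\<lambda>m. ennreal (cmod (stfl g (X n - X m) p))) \<longlonglongrightarrow> ennreal (cmod (stfl g (X n - x) p))"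
          unfolding stfl_def
          by (intro tendsto_ennrealI tendsto_norm bounded_bilinear.tendsto[OF bounded_bilinear_bil] tendsto_intros x)
        then show "ennreal (cmod (stfl g (X n - x) p)) = liminf (\<lambda>m. ennreal (cmod (stfl g (X n - X m) p)))"
          by (intro lim_imp_Liminf[symmetric]) auto
      qed
      also have "\<dots> \<le> liminf (\<lambda>m. s0 g (X n - X m))"
        unfolding s0_def using stfl_measurable[OF gC] by (intro nn_integral_liminf) simp
      also have "\<dots> \<le> liminf (\<lambda>m. ennreal e)"
      proof (rule Liminf_mono, rule eventually_sequentiallyI[of N])
        fix m assume "N \<le> m"
        then show "s0 g (X n - X m) \<le> ennreal e"
          using N unfolding s0_n0[OF s0_diff[OF Xf Xf]] by (intro ennreal_leI) auto
      qed
      also have "\<dots> = ennreal e" by (simp add: Liminf_const)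
      finally show ?thesis .
    qed
    obtain N1 where N1: "\<And>m n. m \<ge> N1 \<Longrightarrow> n \<ge> N1 \<Longrightarrow> n0 (X m - X n) < 1" using C[of 1] by auto
    have "s0 g (X N1 - x) \<le> ennreal 1" by (rule lim[of N1]) (use N1 in \<open>auto intro: less_imp_le\<close>)
    then have "s0 g (X N1 - x) < \<infinity>" by (metis ennreal_less_top infinity_ennreal_def le_less_trans)
    from s0_diff[OF Xf[of N1] this] have xf: "s0 g x < \<infinity>" by simp
    have "limitin S.M.mtopology \<sigma> (sdist x) sequentially"
      unfolding S.M.limitin_metric
    proof (intro conjI allI impI)
      show "sdist x \<in> vcarrier (S0_space g)" using xf by (auto simp: S0_carrier)
      fix e :: real assume e: "e > 0"
      obtain N where N: "\<And>m n. m \<ge> N \<Longrightarrow> n \<ge> N \<Longrightarrow> n0 (X m - X n) < e / 2" using C[of "e / 2"] e by auto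
      show "\<forall>\<^sub>F n in sequentially. \<sigma> n \<in> vcarrier (S0_space g) \<and> vdist (S0_space g) (\<sigma> n) (sdist x) < e"
      proof (rule eventually_sequentiallyI[of N])
        fix n assume n: "N \<le> n"
        have "s0 g (X n - x) \<le> ennreal (e / 2)" by (rule lim[of N]) (use N n in \<open>auto intro: less_imp_le\<close>)
        then have "n0 (X n - x) \<le> e / 2"
          using e unfolding s0_n0[OF s0_diff[OF Xf xf]] by (subst (asm) ennreal_le_iff) auto
        then show "\<sigma> n \<in> vcarrier (S0_space g) \<and> vdist (S0_space g) (\<sigma> n) (sdist x) < e"
          using e Xf[of n] by (auto simp: Xs S0_vdist[OF Xf xf] S0_carrier)
      qed
    qed
    then show "\<exists>x. limitin S.M.mtopology \<sigma> x sequentially" by blast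
  qed
  then show ?thesis by (simp add: complex_banach_space_def complex_normed_space_S0)
qed

section \<open>The embedding of L2 into the dual and its weak-star density\<close>

lemma embH_sdist: "s0 g x < \<infinity> \<Longrightarrow> L2_to_S0_dual g (Rep_l2 y) (sdist x) = bil y x"
  by (auto simp: L2_to_S0_dual_def S0_to_L2_sdist S0_carrier bil_def fn_def)

lemma C2_s0_finite: "u \<in> C2_decay \<Longrightarrow> s0 g (cl u) < \<infinity>"
  by (rule C2_decay_s0_finite[OF _ gC])

lemma embH_dual: "L2_to_S0_dual g (Rep_l2 y) \<in> vcarrier (dual_space (S0_space g))"
proof -
  obtain K where K: "K \<ge> 0" "\<And>x. s0 g x < \<infinity> \<Longrightarrow> norm x \<le> K * n0 x" by (rule norm_le_n0) blast
  have "cmod (bil y x) \<le> (norm y * K) * n0 x" if "s0 g x < \<infinity>" for x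
    using cmod_bil_le[of y x] mult_left_mono[OF K(2)[OF that] norm_ge_zero[of y]] by (simp add: mult.assoc)
  then have 3: "\<exists>C. \<forall>f\<in>vcarrier (S0_space g). cmod (L2_to_S0_dual g (Rep_l2 y) f) \<le> C * vnorm (S0_space g) f"
    by (intro exI[of _ "norm y * K"]) (auto simp: S0_carrier S0_sdist embH_sdist simp del: infinity_ennreal_def)
  have 1: "L2_to_S0_dual g (Rep_l2 y) (vadd (S0_space g) f h) = L2_to_S0_dual g (Rep_l2 y) f + L2_to_S0_dual g (Rep_l2 y) h"
    if "f \<in> vcarrier (S0_space g)" "h \<in> vcarrier (S0_space g)" for f h
    using that by (auto simp: S0_carrier S0_sdist embH_sdist bil_add_right simp del: infinity_ennreal_def)
  have 2: "L2_to_S0_dual g (Rep_l2 y) (vscale (S0_space g) \<alpha> f) = \<alpha> * L2_to_S0_dual g (Rep_l2 y) f"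
    if "f \<in> vcarrier (S0_space g)" for f \<alpha>
    using that by (auto simp: S0_carrier S0_sdist embH_sdist bil_cscale_right simp del: infinity_ennreal_def)
  show ?thesis unfolding dual_carrier using 1 2 3 L2_to_S0_dual_off by blast
qed

text \<open>Linear algebra behind weak-star density: if no \<open>k\<close> separates \<open>x\<^sub>0\<close> from the finite set \<open>F\<close>, then \<open>x\<^sub>0\<close> is
  in the span of \<open>F\<close>, expressed here through all linear functionals.\<close>

definition s0_functional :: "(l2 \<Rightarrow> complex) \<Rightarrow> bool" where
  "s0_functional \<psi> \<longleftrightarrow> (\<forall>x y. s0 g x < \<infinity> \<longrightarrow> s0 g y < \<infinity> \<longrightarrow> \<psi> (x + y) = \<psi> x + \<psi> y) \<and>
     (\<forall>\<alpha> x. s0 g x < \<infinity> \<longrightarrow> \<psi> (cscale \<alpha> x) = \<alpha> * \<psi> x)"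

text \<open>Elimination by induction on \<open>F\<close>: the new point \<open>x1\<close> is either
  dependent on \<open>F\<close>, and can be ignored, or it has a dual element \<open>k1\<close>,
  with which \<open>x0\<close> is reduced modulo \<open>x1\<close>.\<close>

lemma separation_or_span:
  assumes "finite F" "\<And>x. x \<in> F \<Longrightarrow> s0 g x < \<infinity>" "s0 g x0 < \<infinity>"
  shows "(\<exists>k. (\<forall>x\<in>F. bil k x = 0) \<and> bil k x0 = 1) \<or> (\<forall>\<psi>. s0_functional \<psi> \<longrightarrow> (\<forall>x\<in>F. \<psi> x = 0) \<longrightarrow> \<psi> x0 = 0)"
  using assms
proof (induction F arbitrary: x0 rule: finite_induct)
  case empty
  show ?case
  proof (cases "x0 = 0")
    case True
    have "\<psi> 0 = 0" if "s0_functional \<psi>" for \<psi>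
    proof -
      have "\<psi> (0 + 0) = \<psi> 0 + \<psi> 0" using that s0_closed(3) unfolding s0_functional_def by blast
      then show ?thesis by simp
    qed
    then show ?thesis using True by blast
  next
    case False
    let ?k = "cscale (1 / of_real ((norm x0)\<^sup>2)) (conjl x0)"
    have "bil ?k x0 = 1" using False bil_conjl_self[of x0] by (simp add: bil_cscale_left bil_commute[of "conjl x0" x0])
    then show ?thesis by blast
  qed
next
  case (insert x1 F)
  have F: "\<And>x. x \<in> F \<Longrightarrow> s0 g x < \<infinity>" and x1: "s0 g x1 < \<infinity>" using insert.prems(1) by blast+
  from insert.IH[OF F x1] show ?case
  proof
    assume sp1: "\<forall>\<psi>. s0_functional \<psi> \<longrightarrow> (\<forall>x\<in>F. \<psi> x = 0) \<longrightarrow> \<psi> x1 = 0"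
    have bf: "s0_functional (bil k)" for k by (simp add: s0_functional_def bil_add_right bil_cscale_right)
    from insert.IH[OF F insert.prems(2)] show ?thesis
    proof
      assume "\<exists>k. (\<forall>x\<in>F. bil k x = 0) \<and> bil k x0 = 1"
      then obtain k where k: "\<forall>x\<in>F. bil k x = 0" "bil k x0 = 1" by blast
      have "bil k x1 = 0" using sp1 bf k(1) by blast
      then show ?thesis using k by blast
    next
      assume sp: "\<forall>\<psi>. s0_functional \<psi> \<longrightarrow> (\<forall>x\<in>F. \<psi> x = 0) \<longrightarrow> \<psi> x0 = 0"
      have "\<psi> x0 = 0" if "s0_functional \<psi>" "\<forall>x\<in>insert x1 F. \<psi> x = 0" for \<psi> using sp that by simp
      then show ?thesis by blast
    qed
  next
    assume "\<exists>k. (\<forall>x\<in>F. bil k x = 0) \<and> bil k x1 = 1"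
    then obtain k1 where k1: "\<forall>x\<in>F. bil k1 x = 0" "bil k1 x1 = 1" by blast
    \<comment> \<open>\<open>?y\<close> is \<open>x0\<close> reduced so that \<open>k1\<close>
      vanishes on it. If \<open>k\<close> separates \<open>?y\<close> from \<open>F\<close>,
      subtracting the multiple \<open>bil k x1\<close> of \<open>k1\<close> makes it vanish at
      \<open>x1\<close> and take the value 1 at \<open>x0\<close>.\<close>
    let ?y = "x0 + cscale (- bil k1 x0) x1"
    have y: "s0 g ?y < \<infinity>" by (intro s0_closed insert.prems(2) x1)
    from insert.IH[OF F y] show ?thesis
    proof
      assume "\<exists>k. (\<forall>x\<in>F. bil k x = 0) \<and> bil k ?y = 1"
      then obtain k where k: "\<forall>x\<in>F. bil k x = 0" "bil k ?y = 1" by blast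
      let ?k = "k + cscale (- bil k x1) k1"
      have "\<forall>x\<in>insert x1 F. bil ?k x = 0" using k k1 by (simp add: bil_add_left bil_cscale_left)
      moreover have "bil ?k x0 = 1" using k(2) by (simp add: bil_add_left bil_add_right bil_cscale_left bil_cscale_right mult.commute)
      ultimately show ?thesis by blast
    next
      assume sp: "\<forall>\<psi>. s0_functional \<psi> \<longrightarrow> (\<forall>x\<in>F. \<psi> x = 0) \<longrightarrow> \<psi> ?y = 0"
      have "\<psi> x0 = 0" if \<psi>: "s0_functional \<psi>" and 0: "\<forall>x\<in>insert x1 F. \<psi> x = 0" for \<psi>
      proof -
        have "\<psi> ?y = \<psi> x0 + \<psi> (cscale (- bil k1 x0) x1)"
          using \<psi> insert.prems(2) s0_closed(2)[OF x1] unfolding s0_functional_def by blast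
        also have "\<psi> (cscale (- bil k1 x0) x1) = - bil k1 x0 * \<psi> x1" using \<psi> x1 unfolding s0_functional_def by blast
        finally have "\<psi> ?y = \<psi> x0 - bil k1 x0 * \<psi> x1" by simp
        moreover have "\<psi> ?y = 0" using sp \<psi> 0 by blast
        moreover have "\<psi> x1 = 0" using 0 by blast
        ultimately show ?thesis by simp
      qed
      then show ?thesis by blast
    qed
  qed
qed

text \<open>If some \<open>k\<close> separates the new point, a multiple of it corrects
  \<open>h\<close>. Otherwise the difference of \<open>\<psi>\<close> and \<open>bil h\<close>,
  which vanishes on \<open>F\<close>, vanishes at the new point as well.\<close>

lemma interpolation:
  assumes "finite F" "\<And>x. x \<in> F \<Longrightarrow> s0 g x < \<infinity>" and \<psi>: "s0_functional \<psi>"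
  shows "\<exists>h. \<forall>x\<in>F. bil h x = \<psi> x"
  using assms(1,2)
proof (induction F rule: finite_induct)
  case (insert x1 F)
  then obtain h where h: "\<forall>x\<in>F. bil h x = \<psi> x" by blast
  have F: "\<And>x. x \<in> F \<Longrightarrow> s0 g x < \<infinity>" and x1: "s0 g x1 < \<infinity>" using insert.prems by blast+
  have d: "s0_functional (\<lambda>x. \<psi> x - bil h x)"
    using \<psi> unfolding s0_functional_def by (auto simp: bil_add_right bil_cscale_right algebra_simps)
  from separation_or_span[OF insert.hyps(1) F x1] show ?case
  proof
    assume "\<exists>k. (\<forall>x\<in>F. bil k x = 0) \<and> bil k x1 = 1"
    then obtain k where k: "\<forall>x\<in>F. bil k x = 0" "bil k x1 = 1" by blast
    have "\<forall>x\<in>insert x1 F. bil (h + cscale (\<psi> x1 - bil h x1) k) x = \<psi> x"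
      using h k by (simp add: bil_add_left bil_cscale_left)
    then show ?thesis by blast
  next
    assume sp: "\<forall>\<psi>. s0_functional \<psi> \<longrightarrow> (\<forall>x\<in>F. \<psi> x = 0) \<longrightarrow> \<psi> x1 = 0"
    have "\<psi> x1 - bil h x1 = 0" using sp[rule_format, OF d] h by simp
    then show ?thesis using h by (intro exI[of _ h]) simp
  qed
qed simp

lemma S0_triple_simps: "Bspace (S0_triple g) = S0_space g" "Hspace (S0_triple g) = L2_space"
  "embB (S0_triple g) = S0_to_L2" "embH (S0_triple g) = L2_to_S0_dual g"
  by (simp_all add: S0_triple_def)

theorem banach_gelfand_triple_S0: "banach_gelfand_triple (S0_triple g)"
proof -
  interpret H: cnspace L2_space by unfold_locales (rule complex_normed_space_L2)
  obtain K where K: "K \<ge> 0" "\<And>x. s0 g x < \<infinity> \<Longrightarrow> norm x \<le> K * n0 x" by (rule norm_le_n0) blast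
  have linB: "clinear_between (S0_space g) L2_space S0_to_L2"
    unfolding clinear_between_def S0_carrier L2_space_Rep(1)
    by (auto simp: S0_sdist S0_to_L2_sdist L2_space_Rep)
  have bdB: "vnorm L2_space (S0_to_L2 f) \<le> K * vnorm (S0_space g) f" if "f \<in> vcarrier (S0_space g)" for f
    using that K(2) by (auto simp: S0_carrier S0_sdist S0_to_L2_sdist L2_space_Rep)
  have linH: "clinear_between L2_space (dual_space (S0_space g)) (L2_to_S0_dual g)"
    unfolding clinear_between_def
  proof (intro conjI ballI allI)
    show "L2_to_S0_dual g \<in> vcarrier L2_space \<rightarrow> vcarrier (dual_space (S0_space g))"
      using embH_dual by (auto simp: L2_space_Rep(1))
    fix U V \<alpha> assume "U \<in> vcarrier L2_space"
    then obtain x where x: "U = Rep_l2 x" by (auto simp: L2_space_Rep(1))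
    show "L2_to_S0_dual g (vscale L2_space \<alpha> U) = vscale (dual_space (S0_space g)) \<alpha> (L2_to_S0_dual g U)"
    proof
      fix f show "L2_to_S0_dual g (vscale L2_space \<alpha> U) f = vscale (dual_space (S0_space g)) \<alpha> (L2_to_S0_dual g U) f"
        by (cases "f \<in> vcarrier (S0_space g)")
          (auto simp: S0_carrier x L2_space_Rep embH_sdist bil_cscale_left L2_to_S0_dual_off simp del: infinity_ennreal_def)
    qed
    assume "V \<in> vcarrier L2_space"
    then obtain y where y: "V = Rep_l2 y" by (auto simp: L2_space_Rep(1))
    show "L2_to_S0_dual g (vadd L2_space U V) = vadd (dual_space (S0_space g)) (L2_to_S0_dual g U) (L2_to_S0_dual g V)"
    proof
      fix f show "L2_to_S0_dual g (vadd L2_space U V) f = vadd (dual_space (S0_space g)) (L2_to_S0_dual g U) (L2_to_S0_dual g V) f"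
        by (cases "f \<in> vcarrier (S0_space g)")
          (auto simp: S0_carrier x y L2_space_Rep embH_sdist bil_add_left L2_to_S0_dual_off simp del: infinity_ennreal_def)
    qed
  qed
  have injH: "inj_on (L2_to_S0_dual g) (vcarrier L2_space)"
  proof (rule inj_onI)
    fix U V assume "U \<in> vcarrier L2_space" "V \<in> vcarrier L2_space" and eq: "L2_to_S0_dual g U = L2_to_S0_dual g V"
    then obtain x y where xy: "U = Rep_l2 x" "V = Rep_l2 y" by (auto simp: L2_space_Rep(1))
    have "x = y"
    proof (rule fourier_unique)
      fix \<omega>
      have "s0 g (cl (gauss \<omega>)) < \<infinity>" by (rule C2_s0_finite[OF gauss_C2])
      then show "bil x (cl (gauss \<omega>)) = bil y (cl (gauss \<omega>))"
        using fun_cong[OF eq, of "sdist (cl (gauss \<omega>))"] by (simp add: xy embH_sdist)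
    qed
    then show "U = V" by (simp add: xy)
  qed
  have contH: "continuous_map (norm_topology L2_space) (weak_star_topology (S0_space g)) (L2_to_S0_dual g)"
  proof (rule S.continuous_map_weak_star)
    show "L2_to_S0_dual g \<in> topspace (norm_topology L2_space) \<rightarrow> vcarrier (dual_space (S0_space g))"
      using embH_dual by (auto simp: L2_space_Rep(1))
    fix f assume "f \<in> vcarrier (S0_space g)"
    then obtain x where x: "f = sdist x" "s0 g x < \<infinity>" by (auto simp: S0_carrier)
    \<comment> \<open>Continuity into the weak-star topology is tested at one \<open>f\<close> at a
      time, where the pairing is Lipschitz by Cauchy-Schwarz.\<close>
    have "dist (L2_to_S0_dual g U f) (L2_to_S0_dual g V f) \<le> norm x * vdist L2_space U V"
      if "U \<in> vcarrier L2_space" "V \<in> vcarrier L2_space" for U V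
    proof -
      obtain y z where yz: "U = Rep_l2 y" "V = Rep_l2 z" using \<open>U \<in> _\<close> \<open>V \<in> _\<close> by (auto simp: L2_space_Rep(1))
      have "bil y x - bil z x = bil (y - z) x" by (simp add: bounded_bilinear.diff_left[OF bounded_bilinear_bil])
      then show ?thesis using cmod_bil_le[of "y - z" x] by (simp add: yz x(1) embH_sdist[OF x(2)] dist_norm mult.commute)
    qed
    then have "Lipschitz_continuous_map (metric (vcarrier L2_space, vdist L2_space)) euclidean_metric (\<lambda>U. L2_to_S0_dual g U f)"
      unfolding Lipschitz_continuous_map_def by auto
    from Lipschitz_continuous_imp_continuous_map[OF this]
    show "continuous_map (norm_topology L2_space) euclidean (\<lambda>U. L2_to_S0_dual g U f)"
      by (simp add: norm_topology_def H.M.mtopology_of)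
  qed
  have denseB: "norm_topology L2_space closure_of (S0_to_L2 ` vcarrier (S0_space g)) = vcarrier L2_space"
  proof (rule H.norm_topology_closureI)
    show "S0_to_L2 ` vcarrier (S0_space g) \<subseteq> vcarrier L2_space" by (auto simp: S0_carrier S0_to_L2_sdist L2_space_Rep(1))
    fix U and e :: real assume "U \<in> vcarrier L2_space" and e: "e > 0"
    then obtain x where x: "U = Rep_l2 x" by (auto simp: L2_space_Rep(1))
    have "x \<in> closure (cl ` C2_decay)" by (simp add: dense_C2)
    then obtain u where u: "u \<in> C2_decay" "dist (cl u) x < e" using e unfolding closure_approachable by blast
    have "S0_to_L2 (sdist (cl u)) \<in> S0_to_L2 ` vcarrier (S0_space g)" using C2_s0_finite[OF u(1)] by (auto simp: S0_carrier)
    moreover have "vdist L2_space U (S0_to_L2 (sdist (cl u))) < e" using u(2) by (simp add: x S0_to_L2_sdist dist_commute)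
    ultimately show "\<exists>V\<in>S0_to_L2 ` vcarrier (S0_space g). vdist L2_space U V < e" by blast
  qed
  have denseH: "weak_star_topology (S0_space g) closure_of (L2_to_S0_dual g ` vcarrier L2_space) = vcarrier (dual_space (S0_space g))"
  proof (rule S.weak_star_closure_of)
    show "L2_to_S0_dual g ` vcarrier L2_space \<subseteq> vcarrier (dual_space (S0_space g))"
      using embH_dual by (auto simp: L2_space_Rep(1))
    fix F \<phi> assume F: "finite F" "F \<subseteq> vcarrier (S0_space g)" and \<phi>: "\<phi> \<in> vcarrier (dual_space (S0_space g))"
    let ?F = "inv sdist ` F"
    have inv: "inv sdist (sdist x) = x" for x by (rule inv_f_f) (simp add: inj_def)
    have F': "s0 g x < \<infinity>" if "x \<in> ?F" for x using that F(2) by (auto simp: S0_carrier inv)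
    have "s0_functional (\<lambda>x. \<phi> (sdist x))"
      unfolding s0_functional_def
    proof (intro conjI allI impI)
      fix x assume x: "s0 g x < \<infinity>"
      then have xc: "sdist x \<in> vcarrier (S0_space g)" by (auto simp: S0_carrier)
      show "\<phi> (sdist (cscale \<alpha> x)) = \<alpha> * \<phi> (sdist x)" for \<alpha>
        using \<phi> xc unfolding dual_carrier S0_sdist[symmetric] by blast
      fix y assume "s0 g y < \<infinity>"
      then have yc: "sdist y \<in> vcarrier (S0_space g)" by (auto simp: S0_carrier)
      show "\<phi> (sdist (x + y)) = \<phi> (sdist x) + \<phi> (sdist y)"
        using \<phi> xc yc unfolding dual_carrier S0_sdist[symmetric] by blast
    qed
    from interpolation[OF finite_imageI[OF F(1)] F' this]
    obtain h where h: "\<forall>x\<in>?F. bil h x = \<phi> (sdist x)" by blast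
    have "L2_to_S0_dual g (Rep_l2 h) f = \<phi> f" if f: "f \<in> F" for f
    proof -
      obtain x where x: "f = sdist x" "s0 g x < \<infinity>" using f F(2) by (auto simp: S0_carrier)
      have "x \<in> ?F" using f x(1) inv[of x] by (metis imageI)
      then have "bil h x = \<phi> (sdist x)" using h by (rule bspec[rotated])
      then show ?thesis by (simp only: x(1) embH_sdist[OF x(2)])
    qed
    then show "\<exists>\<psi>\<in>L2_to_S0_dual g ` vcarrier L2_space. \<forall>x\<in>F. \<psi> x = \<phi> x"
      by (intro bexI[of _ "L2_to_S0_dual g (Rep_l2 h)"]) (auto simp: L2_space_Rep(1))
  qed
  have injB: "inj_on S0_to_L2 (vcarrier (S0_space g))"
    by (auto simp: inj_on_def S0_carrier S0_to_L2_sdist Rep_l2_inject)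
  show ?thesis
    unfolding banach_gelfand_triple_def S0_triple_simps
    by (intro conjI complex_banach_space_S0 complex_hilbert_space_L2 linB injB linH injH contH denseB denseH
        clinear_bounded_continuous[OF complex_normed_space_S0 complex_normed_space_L2 linB bdB])
qed

end

section \<open>Unitary operators preserving the Feichtinger algebra\<close>

text \<open>The S_0 bound is asked only for the Gaussian window, where explicit computation is
  possible; \<open>S0_unitary_bound\<close> transfers it to the given window.\<close>

definition S0_unitary :: "(l2 \<Rightarrow> l2) \<Rightarrow> (l2 \<Rightarrow> l2) \<Rightarrow> bool" where
  "S0_unitary T S \<longleftrightarrow> (\<forall>x y. T (x + y) = T x + T y) \<and> (\<forall>\<alpha> x. T (cscale \<alpha> x) = cscale \<alpha> (T x)) \<and>
     (\<forall>x. norm (T x) = norm x) \<and> (\<forall>x. S (T x) = x \<and> T (S x) = x) \<and>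
     (\<exists>C\<ge>0. \<forall>x. s0 (gauss 0) x < \<infinity> \<longrightarrow>
        s0 (gauss 0) (T x) \<le> ennreal C * s0 (gauss 0) x \<and> s0 (gauss 0) (S x) \<le> ennreal C * s0 (gauss 0) x)"

lemma S0_unitaryD:
  assumes "S0_unitary T S"
  shows "T (x + y) = T x + T y" "T (cscale \<alpha> x) = cscale \<alpha> (T x)" "norm (T x) = norm x" "S (T x) = x" "T (S x) = x"
    "S (x + y) = S x + S y" "S (cscale \<alpha> x) = cscale \<alpha> (S x)" "norm (S x) = norm x"
proof -
  note d = assms[unfolded S0_unitary_def]
  show T: "T (x + y) = T x + T y" "T (cscale \<alpha> x) = cscale \<alpha> (T x)" "norm (T x) = norm x" "S (T x) = x" "T (S x) = x"
    for x y \<alpha> using d by blast+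
  show "S (x + y) = S x + S y" by (metis T(1) T(4) T(5))
  show "S (cscale \<alpha> x) = cscale \<alpha> (S x)" by (metis T(2) T(4) T(5))
  show "norm (S x) = norm x" by (metis T(3) T(5))
qed

lemma ennreal_bound_finite: "y \<le> ennreal C * x \<Longrightarrow> x < \<infinity> \<Longrightarrow> y < \<infinity>"
  by (rule le_less_trans, assumption) (simp add: ennreal_mult_less_top)

lemma S0_unitaryI:
  assumes "\<And>x y. T (x + y) = T x + T y" "\<And>\<alpha> x. T (cscale \<alpha> x) = cscale \<alpha> (T x)" "\<And>x. norm (T x) = norm x"
    "\<And>x. S (T x) = x" "\<And>x. T (S x) = x"
    and T: "\<exists>C\<ge>0. \<forall>x. s0 (gauss 0) x < \<infinity> \<longrightarrow> s0 (gauss 0) (T x) \<le> ennreal C * s0 (gauss 0) x"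
    and S: "\<exists>C\<ge>0. \<forall>x. s0 (gauss 0) x < \<infinity> \<longrightarrow> s0 (gauss 0) (S x) \<le> ennreal C * s0 (gauss 0) x"
  shows "S0_unitary T S"
proof -
  obtain C D where C: "C \<ge> 0" "\<And>x. s0 (gauss 0) x < \<infinity> \<Longrightarrow> s0 (gauss 0) (T x) \<le> ennreal C * s0 (gauss 0) x"
    and D: "D \<ge> 0" "\<And>x. s0 (gauss 0) x < \<infinity> \<Longrightarrow> s0 (gauss 0) (S x) \<le> ennreal D * s0 (gauss 0) x"
    using T S by blast
  have mono: "ennreal C * y \<le> ennreal (max C D) * y" "ennreal D * y \<le> ennreal (max C D) * y" for y
    by (intro mult_right_mono ennreal_leI; simp)+
  have "\<exists>C\<ge>0. \<forall>x. s0 (gauss 0) x < \<infinity> \<longrightarrow> s0 (gauss 0) (T x) \<le> ennreal C * s0 (gauss 0) x \<and>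
      s0 (gauss 0) (S x) \<le> ennreal C * s0 (gauss 0) x"
  proof (intro exI[of _ "max C D"] conjI allI impI)
    show "max C D \<ge> 0" using C(1) by simp
    fix x assume x: "s0 (gauss 0) x < \<infinity>"
    show "s0 (gauss 0) (T x) \<le> ennreal (max C D) * s0 (gauss 0) x" by (rule order_trans[OF C(2)[OF x] mono(1)])
    show "s0 (gauss 0) (S x) \<le> ennreal (max C D) * s0 (gauss 0) x" by (rule order_trans[OF D(2)[OF x] mono(2)])
  qed
  then show ?thesis using assms(1-5) unfolding S0_unitary_def by simp
qed

lemma S0_unitary_comp:
  assumes 1: "S0_unitary T S" and 2: "S0_unitary T' S'"
  shows "S0_unitary (T \<circ> T') (S' \<circ> S)"
proof -
  obtain C where C: "C \<ge> 0" "\<And>x. s0 (gauss 0) x < \<infinity> \<Longrightarrow>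
        s0 (gauss 0) (T x) \<le> ennreal C * s0 (gauss 0) x \<and> s0 (gauss 0) (S x) \<le> ennreal C * s0 (gauss 0) x"
    using 1 unfolding S0_unitary_def by blast
  obtain D where D: "D \<ge> 0" "\<And>x. s0 (gauss 0) x < \<infinity> \<Longrightarrow>
        s0 (gauss 0) (T' x) \<le> ennreal D * s0 (gauss 0) x \<and> s0 (gauss 0) (S' x) \<le> ennreal D * s0 (gauss 0) x"
    using 2 unfolding S0_unitary_def by blast
  have "s0 (gauss 0) (T (T' x)) \<le> ennreal (C * D) * s0 (gauss 0) x \<and> s0 (gauss 0) (S' (S x)) \<le> ennreal (C * D) * s0 (gauss 0) x"
    if x: "s0 (gauss 0) x < \<infinity>" for x
  proof
    have "s0 (gauss 0) (T' x) < \<infinity>" using D(2)[OF x] ennreal_bound_finite x by blast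
    then have "s0 (gauss 0) (T (T' x)) \<le> ennreal C * s0 (gauss 0) (T' x)" using C(2) by blast
    also have "\<dots> \<le> ennreal C * (ennreal D * s0 (gauss 0) x)" using D(2)[OF x] by (intro mult_left_mono) auto
    finally show "s0 (gauss 0) (T (T' x)) \<le> ennreal (C * D) * s0 (gauss 0) x"
      using C(1) D(1) by (simp add: ennreal_mult mult.assoc)
    have "s0 (gauss 0) (S x) < \<infinity>" using C(2)[OF x] ennreal_bound_finite x by blast
    then have "s0 (gauss 0) (S' (S x)) \<le> ennreal D * s0 (gauss 0) (S x)" using D(2) by blast
    also have "\<dots> \<le> ennreal D * (ennreal C * s0 (gauss 0) x)" using C(2)[OF x] by (intro mult_left_mono) auto
    finally show "s0 (gauss 0) (S' (S x)) \<le> ennreal (C * D) * s0 (gauss 0) x"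
      using C(1) D(1) by (simp add: ennreal_mult mult_ac)
  qed
  then have "\<exists>C\<ge>0. \<forall>x. s0 (gauss 0) x < \<infinity> \<longrightarrow>
        s0 (gauss 0) ((T \<circ> T') x) \<le> ennreal C * s0 (gauss 0) x \<and> s0 (gauss 0) ((S' \<circ> S) x) \<le> ennreal C * s0 (gauss 0) x"
    using C(1) D(1) by (intro exI[of _ "C * D"]) auto
  then show ?thesis
    using S0_unitaryD[OF 1] S0_unitaryD[OF 2] unfolding S0_unitary_def by simp
qed

section \<open>From the Gaussian to an arbitrary Schwartz window\<close>

lemma gauss_window: "schwartz_window (gauss 0)"
proof
  show "gauss 0 \<in> schwartz_space" by (rule gauss_schwartz)
  show "gauss 0 \<noteq> (\<lambda>t. 0)" using gauss_nonzero[of 0 0] by metis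
qed

context schwartz_window begin

text \<open>Window change from \<open>g\<close> to the Gaussian costs \<open>A\<close>, the operator
  \<open>C\<close>, and the change back \<open>B\<close>.\<close>

lemma S0_unitary_bound:
  assumes "S0_unitary T S"
  obtains C where "C \<ge> 0" "\<And>x. s0 g x < \<infinity> \<Longrightarrow> s0 g (T x) < \<infinity> \<and> s0 g (S x) < \<infinity> \<and> n0 (T x) \<le> C * n0 x \<and> n0 (S x) \<le> C * n0 x"
proof -
  interpret \<gamma>: schwartz_window "gauss 0" by (rule gauss_window)
  obtain A where A: "A \<ge> 0" "\<And>x. s0 g x < \<infinity> \<Longrightarrow> s0 (gauss 0) x \<le> ennreal A * s0 g x"
    using window_change[OF gS g0 gauss_C2] by blast
  obtain B where B: "B \<ge> 0" "\<And>x. s0 (gauss 0) x < \<infinity> \<Longrightarrow> s0 g x \<le> ennreal B * s0 (gauss 0) x"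
    using window_change[OF \<gamma>.gS \<gamma>.g0 gC] by blast
  obtain C where C: "C \<ge> 0" "\<And>x. s0 (gauss 0) x < \<infinity> \<Longrightarrow>
        s0 (gauss 0) (T x) \<le> ennreal C * s0 (gauss 0) x \<and> s0 (gauss 0) (S x) \<le> ennreal C * s0 (gauss 0) x"
    using assms unfolding S0_unitary_def by blast
  have main: "s0 g (R x) < \<infinity> \<and> n0 (R x) \<le> B * C * A * n0 x"
    if R: "\<And>x. s0 (gauss 0) x < \<infinity> \<Longrightarrow> s0 (gauss 0) (R x) \<le> ennreal C * s0 (gauss 0) x" and x: "s0 g x < \<infinity>" for R x
  proof -
    have xf: "s0 (gauss 0) x < \<infinity>" by (rule ennreal_bound_finite[OF A(2)[OF x] x])
    have Rf: "s0 (gauss 0) (R x) < \<infinity>" by (rule ennreal_bound_finite[OF R[OF xf] xf])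
    have f: "s0 g (R x) < \<infinity>" by (rule ennreal_bound_finite[OF B(2)[OF Rf] Rf])
    have "s0 g (R x) \<le> ennreal B * s0 (gauss 0) (R x)" by (rule B(2)[OF Rf])
    also have "\<dots> \<le> ennreal B * (ennreal C * s0 (gauss 0) x)" by (intro mult_left_mono R[OF xf]) simp
    also have "\<dots> \<le> ennreal B * (ennreal C * (ennreal A * s0 g x))" by (intro mult_left_mono A(2)[OF x]) simp_all
    also have "\<dots> = ennreal (B * C * A * n0 x)"
      using A(1) B(1) C(1) n0_props(1) unfolding s0_n0[OF x] by (simp add: ennreal_mult[symmetric] mult.assoc)
    finally have "ennreal (n0 (R x)) \<le> ennreal (B * C * A * n0 x)" unfolding s0_n0[OF f] .
    then have "n0 (R x) \<le> B * C * A * n0 x"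
      using A(1) B(1) C(1) n0_props(1) by (subst (asm) ennreal_le_iff) auto
    with f show ?thesis by blast
  qed
  have "s0 g (T x) < \<infinity> \<and> s0 g (S x) < \<infinity> \<and> n0 (T x) \<le> B * C * A * n0 x \<and> n0 (S x) \<le> B * C * A * n0 x" if "s0 g x < \<infinity>" for x
    using main[of T x] main[of S x] C(2) that by blast
  then show ?thesis using A(1) B(1) C(1) by (intro that[of "B * C * A"]) auto
qed

text \<open>The operator is conjugated by the parametrisation \<open>sdist\<close>; off the range of
  \<open>sdist\<close>, hence off the carrier, its values are arbitrary.\<close>

definition S0_op :: "(l2 \<Rightarrow> l2) \<Rightarrow> ((real \<Rightarrow> complex) \<Rightarrow> complex) \<Rightarrow> (real \<Rightarrow> complex) \<Rightarrow> complex" where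
  "S0_op T f = sdist (T (inv sdist f))"

lemma S0_op_sdist [simp]: "S0_op T (sdist x) = sdist (T x)"
proof -
  have "inv sdist (sdist x) = x" by (rule inv_f_f) (simp add: inj_def)
  then show ?thesis by (simp add: S0_op_def)
qed

lemma S0_op_automorphism:
  assumes T: "S0_unitary T S" shows "bounded_automorphism (S0_space g) (S0_op T) (S0_op S)"
proof -
  obtain C where C: "C \<ge> 0"
    "\<And>x. s0 g x < \<infinity> \<Longrightarrow> s0 g (T x) < \<infinity> \<and> s0 g (S x) < \<infinity> \<and> n0 (T x) \<le> C * n0 x \<and> n0 (S x) \<le> C * n0 x"
    by (rule S0_unitary_bound[OF T]) blast
  have lin: "clinear_between (S0_space g) (S0_space g) (S0_op R)"
    if "\<And>x y. R (x + y) = R x + R y" "\<And>\<alpha> x. R (cscale \<alpha> x) = cscale \<alpha> (R x)" "\<And>x. s0 g x < \<infinity> \<Longrightarrow> s0 g (R x) < \<infinity>" for R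
    unfolding clinear_between_def S0_carrier using that by (auto simp: S0_sdist simp del: infinity_ennreal_def)
  have "clinear_between (S0_space g) (S0_space g) (S0_op T)" "clinear_between (S0_space g) (S0_space g) (S0_op S)"
    by (rule lin; use S0_unitaryD[OF T] C(2) in blast)+
  moreover have "\<forall>f\<in>vcarrier (S0_space g). S0_op S (S0_op T f) = f \<and> S0_op T (S0_op S f) = f"
    unfolding S0_carrier using S0_unitaryD(4,5)[OF T] by auto
  moreover have "\<forall>f\<in>vcarrier (S0_space g). vnorm (S0_space g) (S0_op T f) \<le> C * vnorm (S0_space g) f
      \<and> vnorm (S0_space g) (S0_op S f) \<le> C * vnorm (S0_space g) f"
    unfolding S0_carrier using C(2) by (auto simp: S0_sdist simp del: infinity_ennreal_def)
  ultimately show ?thesis unfolding bounded_automorphism_def by blast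
qed

lemma L2_op_automorphism:
  assumes T: "S0_unitary T S" and F: "\<And>x. F (Rep_l2 x) = Rep_l2 (T x)"
  shows "bounded_automorphism L2_space F (\<lambda>U. Rep_l2 (S (Abs_l2 U)))"
  unfolding bounded_automorphism_def clinear_between_def L2_space_Rep(1)
  by (auto simp: L2_space_Rep F Rep_l2_inverse S0_unitaryD[OF T] intro!: exI[of _ 1])

text \<open>The extension of \<open>T\<close> to the dual is the transpose of the restriction of \<open>A\<close>.\<close>

theorem S0_triple_automorphismI:
  assumes T: "S0_unitary T S" and A: "S0_unitary A A'"
    and transpose: "\<And>x y. bil (T y) x = bil y (A x)" and F: "\<And>x. F (Rep_l2 x) = Rep_l2 (T x)"
  shows "gelfand_triple_automorphism (S0_triple g) F"
proof (rule gelfand_triple_automorphismI[OF banach_gelfand_triple_S0, unfolded S0_triple_simps])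
  show "bounded_automorphism L2_space F (\<lambda>U. Rep_l2 (S (Abs_l2 U)))" by (rule L2_op_automorphism[OF T F])
  show "bounded_automorphism (S0_space g) (S0_op T) (S0_op S)" by (rule S0_op_automorphism[OF T])
  show "bounded_automorphism (S0_space g) (S0_op A) (S0_op A')" by (rule S0_op_automorphism[OF A])
  show "S0_to_L2 (S0_op T f) = F (S0_to_L2 f)" if "f \<in> vcarrier (S0_space g)" for f
    using that by (auto simp: S0_carrier S0_to_L2_sdist F)
  fix h f assume "h \<in> vcarrier L2_space" "f \<in> vcarrier (S0_space g)"
  then obtain y x where yx: "h = Rep_l2 y" "f = sdist x" "s0 g x < \<infinity>" by (auto simp: L2_space_Rep(1) S0_carrier)
  obtain C where "\<And>x. s0 g x < \<infinity> \<Longrightarrow> s0 g (A x) < \<infinity>" using S0_unitary_bound[OF A] by metis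
  then have "s0 g (A x) < \<infinity>" using yx(3) by blast
  then show "L2_to_S0_dual g (F h) f = L2_to_S0_dual g h (S0_op A f)"
    by (simp add: yx F embH_sdist transpose del: infinity_ennreal_def)
qed

end

subsection \<open>Multiplication by chirps\<close>

text \<open>One family contains the three multipliers of the theorem and is closed under inversion,
  by negating both parameters.\<close>

definition chirp :: "real \<Rightarrow> real \<Rightarrow> real \<Rightarrow> complex" where
  "chirp \<alpha> \<beta> t = cis (\<alpha> * t\<^sup>2 + \<beta> * t)"

definition mulc :: "real \<Rightarrow> real \<Rightarrow> l2 \<Rightarrow> l2" where
  "mulc \<alpha> \<beta> x = cl (\<lambda>t. chirp \<alpha> \<beta> t * fn x t)"

lemma chirp_measurable [measurable]: "chirp \<alpha> \<beta> \<in> borel_measurable borel"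
  unfolding chirp_def[abs_def] by measurable

lemma cmod_chirp [simp]: "cmod (chirp \<alpha> \<beta> t) = 1"
  by (simp add: chirp_def)

lemma chirp_L2: "u \<in> L2_functions \<Longrightarrow> (\<lambda>t. chirp \<alpha> \<beta> t * u t) \<in> L2_functions"
  by (rule L2_mult_bounded[where K = 1]) auto

lemma mulc_cl: "u \<in> L2_functions \<Longrightarrow> mulc \<alpha> \<beta> (cl u) = cl (\<lambda>t. chirp \<alpha> \<beta> t * u t)"
  unfolding mulc_def using fn_cl[of u] by (subst cl_eq_iff) (auto intro!: chirp_L2)

lemma mulc_linear: "mulc \<alpha> \<beta> (x + y) = mulc \<alpha> \<beta> x + mulc \<alpha> \<beta> y" "mulc \<alpha> \<beta> (cscale z x) = cscale z (mulc \<alpha> \<beta> x)"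
proof -
  obtain u v where u: "u \<in> L2_functions" "x = cl u" and v: "v \<in> L2_functions" "y = cl v"
    using cl_cases[of x] cl_cases[of y] by metis
  show "mulc \<alpha> \<beta> (x + y) = mulc \<alpha> \<beta> x + mulc \<alpha> \<beta> y" "mulc \<alpha> \<beta> (cscale z x) = cscale z (mulc \<alpha> \<beta> x)"
    by (simp_all only: u v cl_add' cl_cscale mulc_cl chirp_L2 L2_add L2_scale) (simp_all add: algebra_simps)
qed

lemma mulc_inverse: "mulc (- \<alpha>) (- \<beta>) (mulc \<alpha> \<beta> x) = x"
proof -
  obtain u where u: "u \<in> L2_functions" "x = cl u" using cl_cases[of x] by metis
  have "(\<lambda>t. chirp (- \<alpha>) (- \<beta>) t * (chirp \<alpha> \<beta> t * u t)) = u"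
    by (simp add: chirp_def mult.assoc[symmetric] cis_mult)
  then show ?thesis by (simp only: u(2) mulc_cl[OF u(1)] mulc_cl[OF chirp_L2[OF u(1)]])
qed

lemma norm_mulc: "norm (mulc \<alpha> \<beta> x) = norm x"
proof -
  obtain u where u: "u \<in> L2_functions" "x = cl u" using cl_cases[of x] by metis
  have "(norm (mulc \<alpha> \<beta> x))\<^sup>2 = (norm x)\<^sup>2" by (simp add: u mulc_cl norm_cl chirp_L2 norm_mult)
  then show ?thesis by simp
qed

lemma bil_mulc: "bil (mulc \<alpha> \<beta> y) x = bil y (mulc \<alpha> \<beta> x)"
proof -
  obtain u v where u: "u \<in> L2_functions" "x = cl u" and v: "v \<in> L2_functions" "y = cl v"
    using cl_cases[of x] cl_cases[of y] by metis
  show ?thesis by (simp only: u v mulc_cl bil_cl chirp_L2) (simp add: mult_ac)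
qed

lemma nn_integral_pair_shear:
  fixes F :: "real \<times> real \<Rightarrow> ennreal"
  assumes [measurable]: "F \<in> borel_measurable (borel \<Otimes>\<^sub>M borel)"
  shows "(\<integral>\<^sup>+p. F (fst p, snd p + \<kappa> * fst p) \<partial>(lborel \<Otimes>\<^sub>M lborel)) = (\<integral>\<^sup>+p. F p \<partial>(lborel \<Otimes>\<^sub>M lborel))"
proof -
  have "(\<integral>\<^sup>+p. F (fst p, snd p + \<kappa> * fst p) \<partial>(lborel \<Otimes>\<^sub>M lborel)) = (\<integral>\<^sup>+x. (\<integral>\<^sup>+y. F (x, y + \<kappa> * x) \<partial>lborel) \<partial>lborel)"
    by (subst lborel.nn_integral_fst[symmetric]) simp_all
  also have "\<dots> = (\<integral>\<^sup>+x. (\<integral>\<^sup>+y. F (x, y) \<partial>lborel) \<partial>lborel)"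
  proof (rule nn_integral_cong)
    fix x :: real
    show "(\<integral>\<^sup>+y. F (x, y + \<kappa> * x) \<partial>lborel) = (\<integral>\<^sup>+y. F (x, y) \<partial>lborel)"
      using nn_integral_real_affine[of "\<lambda>y. F (x, y)" 1 "\<kappa> * x"] by (simp add: add.commute)
  qed
  also have "\<dots> = (\<integral>\<^sup>+p. F p \<partial>(lborel \<Otimes>\<^sub>M lborel))"
    by (rule lborel.nn_integral_fst) simp
  finally show ?thesis .
qed

text \<open>A chirp moves onto the window, up to a unimodular factor and a shear of the time-frequency plane.\<close>

lemma s0_mulc:
  "s0 (gauss 0) (mulc \<alpha> \<beta> x) = s0 (\<lambda>s. gauss 0 s * chirp (- \<alpha>) (- \<beta>) s) x"
  and chirped_gauss_C2: "(\<lambda>s. gauss 0 s * chirp (- \<alpha>) (- \<beta>) s) \<in> C2_decay"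
proof -
  let ?h = "\<lambda>s. gauss 0 s * chirp (- \<alpha>) (- \<beta>) s"
  have "?h = gexp (of_real pi + \<i> * of_real \<alpha>) (- \<i> * of_real \<beta>)"
  proof
    fix s
    have "gauss 0 s = exp (of_real (- pi * s\<^sup>2))" by (simp add: gauss_def flip: exp_of_real)
    moreover have "chirp (- \<alpha>) (- \<beta>) s = exp (\<i> * of_real (- \<alpha> * s\<^sup>2 + - \<beta> * s))" by (simp add: chirp_def cis_conv_exp)
    ultimately show "?h s = gexp (of_real pi + \<i> * of_real \<alpha>) (- \<i> * of_real \<beta>) s"
      by (simp add: gexp_def exp_add[symmetric] algebra_simps)
  qed
  then show h: "?h \<in> C2_decay" using schwartz_C2_decay[OF gexp_schwartz] by simp
  have eq: "cmod (stfl (gauss 0) (mulc \<alpha> \<beta> x) p) = cmod (stfl ?h x (fst p, snd p + (- \<alpha> / pi) * fst p))" for p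
  proof -
    obtain y \<omega> where p: "p = (y, \<omega>)" by (cases p)
    have "stfl (gauss 0) (mulc \<alpha> \<beta> x) p = bil x (mulc \<alpha> \<beta> (cl (win (gauss 0) p)))"
      unfolding stfl_def by (rule bil_mulc)
    also have "\<dots> = (\<integral>t. fn x t * (chirp \<alpha> \<beta> t * win (gauss 0) p t) \<partial>lborel)"
      using bil_cl[OF fn_L2[of x] chirp_L2[OF win_props(1)[OF gauss_C2]], of \<alpha> \<beta> 0 p]
      by (simp add: mulc_cl win_props(1)[OF gauss_C2])
    also have "\<dots> = (\<integral>t. cis (\<beta> * y - \<alpha> * y\<^sup>2) * (fn x t * win ?h (y, \<omega> + (- \<alpha> / pi) * y) t) \<partial>lborel)"
    proof (intro Bochner_Integration.integral_cong refl)
      fix t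
      \<comment> \<open>Expanding the square about \<open>y\<close>: the cross term is linear in
        \<open>t\<close> and shifts the frequency by \<open>- \<alpha> * y / pi\<close>; what does
        not depend on \<open>t\<close> is the phase in front.\<close>
      have "chirp \<alpha> \<beta> t * cis (- 2 * pi * \<omega> * t)
          = cis (\<beta> * y - \<alpha> * y\<^sup>2) * (cnj (chirp (- \<alpha>) (- \<beta>) (t - y)) * cis (- 2 * pi * (\<omega> + (- \<alpha> / pi) * y) * t))"
        unfolding chirp_def cis_cnj cis_mult
        by (intro arg_cong[where f = cis]) (simp add: power2_eq_square algebra_simps)
      then show "fn x t * (chirp \<alpha> \<beta> t * win (gauss 0) p t)
          = cis (\<beta> * y - \<alpha> * y\<^sup>2) * (fn x t * win ?h (y, \<omega> + (- \<alpha> / pi) * y) t)"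
        by (simp add: win_def p)
    qed
    also have "\<dots> = cis (\<beta> * y - \<alpha> * y\<^sup>2) * stfl ?h x (y, \<omega> + (- \<alpha> / pi) * y)"
      by (simp only: integral_mult_right_zero stfl_integral[OF h])
    finally show ?thesis by (simp add: norm_mult p)
  qed
  show "s0 (gauss 0) (mulc \<alpha> \<beta> x) = s0 ?h x"
    unfolding s0_def eq using stfl_measurable[OF h, of x]
    by (intro nn_integral_pair_shear[of "\<lambda>p. ennreal (cmod (stfl ?h x p))"]) simp
qed

lemma S0_unitary_mulc: "S0_unitary (mulc \<alpha> \<beta>) (mulc (- \<alpha>) (- \<beta>))"
proof -
  interpret \<gamma>: schwartz_window "gauss 0" by (rule gauss_window)
  have bd: "\<exists>C\<ge>0. \<forall>x. s0 (gauss 0) x < \<infinity> \<longrightarrow> s0 (gauss 0) (mulc \<alpha> \<beta> x) \<le> ennreal C * s0 (gauss 0) x" for \<alpha> \<beta>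
    unfolding s0_mulc by (rule window_change[OF \<gamma>.gS \<gamma>.g0 chirped_gauss_C2])
  show ?thesis
    by (rule S0_unitaryI[OF mulc_linear norm_mulc mulc_inverse _ bd bd]) (use mulc_inverse[of "- \<alpha>" "- \<beta>"] in simp)
qed

lemma mult_operator_Rep: "mult_operator (chirp \<alpha> \<beta>) (Rep_l2 x) = Rep_l2 (mulc \<alpha> \<beta> x)"
  by (simp add: mult_operator_def mulc_def Rep_cl chirp_L2 flip: fn_def)

lemma (in schwartz_window) mult_operator_automorphism:
  "gelfand_triple_automorphism (S0_triple g) (mult_operator (chirp \<alpha> \<beta>))"
  by (rule S0_triple_automorphismI[OF S0_unitary_mulc S0_unitary_mulc bil_mulc mult_operator_Rep])

subsection \<open>Dilations\<close>

text \<open>Normalised to be isometric; the absolute value admits negative \<open>b\<close>, in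
  particular the reflection \<open>dil (-1)\<close>.\<close>

definition dil :: "real \<Rightarrow> l2 \<Rightarrow> l2" where
  "dil b x = cl (\<lambda>t. of_real (1 / sqrt \<bar>b\<bar>) * fn x (t / b))"

lemma dil_L2:
  assumes u: "u \<in> L2_functions" and b: "b \<noteq> 0"
  shows "(\<lambda>t. of_real (1 / sqrt \<bar>b\<bar>) * u (t / b)) \<in> L2_functions"
proof (rule L2_scale)
  have [measurable]: "u \<in> borel_measurable borel" using u by (rule L2_measurable)
  have "integrable lborel (\<lambda>t. (cmod (u (0 + (1 / b) * t)))\<^sup>2)"
    using u b by (intro lborel_integrable_real_affine) (auto simp: L2_functions_iff)
  then show "(\<lambda>t. u (t / b)) \<in> L2_functions" by (simp add: L2_functions_iff)
qed

lemma dil_cl: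
  assumes u: "u \<in> L2_functions" and b: "b \<noteq> 0"
  shows "dil b (cl u) = cl (\<lambda>t. of_real (1 / sqrt \<bar>b\<bar>) * u (t / b))"
  unfolding dil_def
proof (subst cl_eq_iff)
  have [measurable]: "u \<in> borel_measurable borel" using u by (rule L2_measurable)
  have "AE t in lborel. fn (cl u) (0 + (1 / b) * t) = u (0 + (1 / b) * t)"
    using b by (intro AE_borel_affine[of _ "\<lambda>t. fn (cl u) t = u t"] fn_cl[OF u]) auto
  then show "AE t in lborel. of_real (1 / sqrt \<bar>b\<bar>) * fn (cl u) (t / b) = of_real (1 / sqrt \<bar>b\<bar>) * u (t / b)" by simp
qed (intro dil_L2 fn_L2 u b)+

lemma dil_linear:
  assumes b: "b \<noteq> 0"
  shows "dil b (x + y) = dil b x + dil b y" "dil b (cscale z x) = cscale z (dil b x)"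
proof -
  obtain u v where u: "u \<in> L2_functions" "x = cl u" and v: "v \<in> L2_functions" "y = cl v"
    using cl_cases[of x] cl_cases[of y] by metis
  note d = dil_cl[OF _ b] dil_L2[OF _ b]
  show "dil b (x + y) = dil b x + dil b y" "dil b (cscale z x) = cscale z (dil b x)"
    by (simp_all only: u v cl_add' cl_cscale d L2_add L2_scale) (simp_all add: algebra_simps)
qed

lemma bil_dil:
  assumes b: "b \<noteq> 0" shows "bil (dil b y) x = bil y (dil (1 / b) x)"
proof -
  obtain u v where u: "u \<in> L2_functions" "x = cl u" and v: "v \<in> L2_functions" "y = cl v"
    using cl_cases[of x] cl_cases[of y] by metis
  have b': "1 / b \<noteq> 0" using b by simp
  have "bil (dil b y) x = (\<integral>t. (of_real (1 / sqrt \<bar>b\<bar>) * v (t / b)) * u t \<partial>lborel)"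
    by (simp only: u v dil_cl[OF _ b] dil_L2[OF _ b] bil_cl)
  also have "\<dots> = \<bar>b\<bar> *\<^sub>R (\<integral>s. (of_real (1 / sqrt \<bar>b\<bar>) * v ((0 + b * s) / b)) * u (0 + b * s) \<partial>lborel)"
    by (rule lborel_integral_real_affine[OF b])
  also have "\<dots> = (\<integral>s. v s * (of_real (1 / sqrt \<bar>1 / b\<bar>) * u (s / (1 / b))) \<partial>lborel)"
  proof -
    have "\<bar>b\<bar> * (1 / sqrt \<bar>b\<bar>) = 1 / sqrt \<bar>1 / b\<bar>"
      using b by (simp add: real_sqrt_divide real_div_sqrt)
    then have "\<bar>b\<bar> *\<^sub>R ((of_real (1 / sqrt \<bar>b\<bar>) * v ((0 + b * s) / b)) * u (0 + b * s)) = v s * (of_real (1 / sqrt \<bar>1 / b\<bar>) * u (s / (1 / b)))" for s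
      using b unfolding scaleR_conv_of_real by (simp only: of_real_mult flip: \<open>_ = 1 / sqrt \<bar>1 / b\<bar>\<close>) (simp add: mult_ac)
    then show ?thesis by (simp only: integral_scaleR_right[symmetric])
  qed
  also have "\<dots> = bil y (dil (1 / b) x)"
    by (simp only: u v dil_cl[OF _ b'] dil_L2[OF _ b'] bil_cl)
  finally show ?thesis .
qed

lemma dil_inverse:
  assumes b: "b \<noteq> 0" shows "dil (1 / b) (dil b x) = x"
proof -
  obtain u where u: "u \<in> L2_functions" "x = cl u" using cl_cases[of x] by metis
  have b': "1 / b \<noteq> 0" using b by simp
  have "complex_of_real (1 / sqrt \<bar>1 / b\<bar>) * (of_real (1 / sqrt \<bar>b\<bar>) * z) = z" for z
  proof -
    have "1 / sqrt \<bar>1 / b\<bar> * (1 / sqrt \<bar>b\<bar>) = 1" using b by (simp add: real_sqrt_divide)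
    then show ?thesis by (simp only: mult.assoc[symmetric] of_real_mult[symmetric]) simp
  qed
  then show ?thesis
    unfolding u(2) dil_cl[OF u(1) b] dil_cl[OF dil_L2[OF u(1) b] b'] using b by simp
qed

lemma norm_dil:
  assumes b: "b \<noteq> 0" shows "norm (dil b x) = norm x"
proof -
  obtain u where u: "u \<in> L2_functions" "x = cl u" using cl_cases[of x] by metis
  have "(norm (dil b x))\<^sup>2 = (\<integral>t. (cmod (of_real (1 / sqrt \<bar>b\<bar>) * u (t / b)))\<^sup>2 \<partial>lborel)"
    unfolding u(2) dil_cl[OF u(1) b] by (rule norm_cl[OF dil_L2[OF u(1) b]])
  also have "\<dots> = (1 / \<bar>b\<bar>) * (\<integral>t. (cmod (u (t / b)))\<^sup>2 \<partial>lborel)"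
    by (simp add: norm_mult norm_divide power_mult_distrib power_divide)
  also have "(\<integral>t. (cmod (u (t / b)))\<^sup>2 \<partial>lborel) = \<bar>b\<bar> * (\<integral>t. (cmod (u t))\<^sup>2 \<partial>lborel)"
    using lborel_integral_real_affine[OF b, of "\<lambda>t. (cmod (u (t / b)))\<^sup>2" 0] b by simp
  finally have "(norm (dil b x))\<^sup>2 = (norm x)\<^sup>2" using b by (simp add: u norm_cl)
  then show ?thesis by simp
qed

text \<open>The dilation moves onto the window as a rescaled Gaussian; the point (y, \<omega>)
  becomes (y / b, b \<omega>), a map of determinant 1, so only the normalisation of
  \<open>dil (1 / b)\<close> remains as a factor.\<close>

lemma s0_dil:
  assumes b: "b \<noteq> 0"
  shows "s0 (gauss 0) (dil b x) = ennreal (1 / sqrt \<bar>1 / b\<bar>) * s0 (\<lambda>s. gauss 0 (b * s)) x"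
    and "(\<lambda>s. gauss 0 (b * s)) \<in> C2_decay"
proof -
  let ?h = "\<lambda>s. gauss 0 (b * s)"
  have "?h = gexp (of_real (pi * b\<^sup>2)) 0"
    by (simp add: gauss_def gexp_def fun_eq_iff exp_of_real[symmetric] power_mult_distrib mult_ac)
  then show h: "?h \<in> C2_decay" using schwartz_C2_decay[OF gexp_schwartz, of "of_real (pi * b\<^sup>2)" 0] b by simp
  have b': "1 / b \<noteq> 0" using b by simp
  have eq: "cmod (stfl (gauss 0) (dil b x) p) = (1 / sqrt \<bar>1 / b\<bar>) * cmod (stfl ?h x (0 + (1 / b) * fst p, 0 + b * snd p))" for p
  proof -
    have w: "win (gauss 0) p \<in> L2_functions" by (rule win_props(1)[OF gauss_C2])
    have "stfl (gauss 0) (dil b x) p = bil x (dil (1 / b) (cl (win (gauss 0) p)))"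
      unfolding stfl_def by (rule bil_dil[OF b])
    also have "\<dots> = (\<integral>t. fn x t * (of_real (1 / sqrt \<bar>1 / b\<bar>) * win (gauss 0) p (t / (1 / b))) \<partial>lborel)"
      unfolding dil_cl[OF w b'] using bil_cl[OF fn_L2[of x] dil_L2[OF w b']] by simp
    also have "\<dots> = (\<integral>t. of_real (1 / sqrt \<bar>1 / b\<bar>) * (fn x t * win ?h (0 + (1 / b) * fst p, 0 + b * snd p) t) \<partial>lborel)"
    proof (intro Bochner_Integration.integral_cong refl)
      fix t
      have "b * (t - (0 + 1 / b * fst p)) = t / (1 / b) - fst p" using b by (simp add: algebra_simps)
      then show "fn x t * (of_real (1 / sqrt \<bar>1 / b\<bar>) * win (gauss 0) p (t / (1 / b)))
          = of_real (1 / sqrt \<bar>1 / b\<bar>) * (fn x t * win ?h (0 + (1 / b) * fst p, 0 + b * snd p) t)"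
        by (simp add: win_def mult_ac)
    qed
    also have "\<dots> = of_real (1 / sqrt \<bar>1 / b\<bar>) * stfl ?h x (0 + (1 / b) * fst p, 0 + b * snd p)"
      by (simp only: integral_mult_right_zero stfl_integral[OF h])
    finally show ?thesis by (simp add: norm_mult norm_divide)
  qed
  have m [measurable]: "stfl ?h x \<in> borel_measurable (borel \<Otimes>\<^sub>M borel)" using stfl_measurable[OF h, of x] by simp
  have "s0 (gauss 0) (dil b x) = (\<integral>\<^sup>+p. ennreal (1 / sqrt \<bar>1 / b\<bar>) * ennreal (cmod (stfl ?h x (0 + (1 / b) * fst p, 0 + b * snd p))) \<partial>(lborel \<Otimes>\<^sub>M lborel))"
    unfolding s0_def eq by (intro nn_integral_cong ennreal_mult) auto
  also have "\<dots> = ennreal (1 / sqrt \<bar>1 / b\<bar>) * (\<integral>\<^sup>+p. ennreal (cmod (stfl ?h x (0 + (1 / b) * fst p, 0 + b * snd p))) \<partial>(lborel \<Otimes>\<^sub>M lborel))"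
    by (rule nn_integral_cmult) measurable
  also have "(\<integral>\<^sup>+p. ennreal (cmod (stfl ?h x (0 + (1 / b) * fst p, 0 + b * snd p))) \<partial>(lborel \<Otimes>\<^sub>M lborel)) = s0 ?h x"
    unfolding s0_def using nn_integral_pair_affine[of "\<lambda>p. ennreal (cmod (stfl ?h x p))" "1 / b" b 0 0] b by simp
  finally show "s0 (gauss 0) (dil b x) = ennreal (1 / sqrt \<bar>1 / b\<bar>) * s0 ?h x" .
qed

lemma S0_unitary_dil:
  assumes b: "b \<noteq> 0" shows "S0_unitary (dil b) (dil (1 / b))"
proof -
  interpret \<gamma>: schwartz_window "gauss 0" by (rule gauss_window)
  have bd: "\<exists>C\<ge>0. \<forall>x. s0 (gauss 0) x < \<infinity> \<longrightarrow> s0 (gauss 0) (dil b x) \<le> ennreal C * s0 (gauss 0) x" if b: "b \<noteq> 0" for b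
  proof -
    obtain C where C: "C \<ge> 0" "\<And>x. s0 (gauss 0) x < \<infinity> \<Longrightarrow> s0 (\<lambda>s. gauss 0 (b * s)) x \<le> ennreal C * s0 (gauss 0) x"
      using window_change[OF \<gamma>.gS \<gamma>.g0 s0_dil(2)[OF b]] by blast
    have "s0 (gauss 0) (dil b x) \<le> ennreal (1 / sqrt \<bar>1 / b\<bar> * C) * s0 (gauss 0) x" if "s0 (gauss 0) x < \<infinity>" for x
    proof -
      have "ennreal (1 / sqrt \<bar>1 / b\<bar> * C) = ennreal (1 / sqrt \<bar>1 / b\<bar>) * ennreal C" using C(1) by (intro ennreal_mult) auto
      then show ?thesis unfolding s0_dil(1)[OF b] using mult_left_mono[OF C(2)[OF that], of "ennreal (1 / sqrt \<bar>1 / b\<bar>)"]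
        by (simp add: mult.assoc)
    qed
    then show ?thesis using C(1) by (intro exI[of _ "1 / sqrt \<bar>1 / b\<bar> * C"]) auto
  qed
  have b': "1 / b \<noteq> 0" using b by simp
  show ?thesis
    by (rule S0_unitaryI[OF dil_linear[OF b] norm_dil[OF b] dil_inverse[OF b] _ bd[OF b] bd[OF b']])
      (use dil_inverse[OF b'] in simp)
qed

subsection \<open>The Fourier transform\<close>

lemma fourier_fourier: "fourier (fourier x) = dil (-1) x"
proof (rule fourier_unique)
  fix \<omega>
  have m: "(-1::real) \<noteq> 0" by simp
  have "fourier (cl (gauss \<omega>)) = cl (ft (gauss \<omega>))" by (rule fourier_cl(2)[OF gauss_props(3,2)])
  moreover have "fourier (cl (ft (gauss \<omega>))) = cl (ft (ft (gauss \<omega>)))"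
    by (rule fourier_cl(2)[OF ftest_ft_L2[OF ftest_C2[OF gauss_C2]] ft_C2_integrable[OF gauss_C2]])
  moreover have "cl (ft (ft (gauss \<omega>))) = dil (-1) (cl (gauss \<omega>))"
    using dil_cl[OF gauss_props(3) m, of \<omega>] by (simp add: ft_ft_gauss[abs_def])
  ultimately show "bil (fourier (fourier x)) (cl (gauss \<omega>)) = bil (dil (-1) x) (cl (gauss \<omega>))"
    using bil_dil[OF m, of x "cl (gauss \<omega>)"] by (simp add: bil_fourier)
qed

text \<open>The Gaussian is its own transform, so the window stays the same and the time-frequency
  plane is rotated by a right angle, which preserves the integral.\<close>

lemma s0_fourier: "s0 (gauss 0) (fourier x) = s0 (gauss 0) x"
proof -
  have eq: "cmod (stfl (gauss 0) (fourier x) (y, \<omega>)) = cmod (stfl (gauss 0) x (- \<omega>, y))" for y \<omega>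
  proof -
    note w = win_props[OF gauss_C2[of 0], of "(y, \<omega>)"]
    have "ft (win (gauss 0) (y, \<omega>)) s = cis (- 2 * pi * \<omega> * y) * win (gauss 0) (- \<omega>, y) s" for s
    proof -
      have "ft (win (gauss 0) (y, \<omega>)) s = ft (\<lambda>t. gauss 0 (t - y)) (s + \<omega>)"
        unfolding ft_def win_def
        by (intro Bochner_Integration.integral_cong refl)
          (simp add: gauss_def mult.assoc cis_mult algebra_simps)
      also have "\<dots> = cis (- 2 * pi * (s + \<omega>) * y) * gauss 0 (s + \<omega>)"
        using ft_shift(2)[OF gauss_props(2), of 0 y "s + \<omega>"] by (simp add: ft_gauss_0)
      also have "\<dots> = cis (- 2 * pi * \<omega> * y) * win (gauss 0) (- \<omega>, y) s"
      proof -
        have "cis (- 2 * pi * (s + \<omega>) * y) = cis (- 2 * pi * \<omega> * y) * cis (- 2 * pi * y * s)"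
          unfolding cis_mult by (intro arg_cong[where f = cis]) (simp add: algebra_simps)
        then show ?thesis by (simp add: win_def gauss_def mult_ac)
      qed
      finally show ?thesis .
    qed
    then have "ft (win (gauss 0) (y, \<omega>)) = (\<lambda>s. cis (- 2 * pi * \<omega> * y) * win (gauss 0) (- \<omega>, y) s)" by blast
    then have "stfl (gauss 0) (fourier x) (y, \<omega>) = cis (- 2 * pi * \<omega> * y) * stfl (gauss 0) x (- \<omega>, y)"
      unfolding stfl_def bil_fourier fourier_cl(2)[OF w(1,3)]
      by (simp only: cl_cscale[OF win_props(1)[OF gauss_C2], symmetric] bil_cscale_right)
    then show ?thesis by (simp add: norm_mult)
  qed
  have m [measurable]: "stfl (gauss 0) x \<in> borel_measurable (borel \<Otimes>\<^sub>M borel)" for x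
    using stfl_measurable[OF gauss_C2, of 0 x] by simp
  have "s0 (gauss 0) (fourier x) = (\<integral>\<^sup>+y. (\<integral>\<^sup>+\<omega>. ennreal (cmod (stfl (gauss 0) x (- \<omega>, y))) \<partial>lborel) \<partial>lborel)"
    unfolding s0_def eq[symmetric] by (rule lborel.nn_integral_fst[symmetric]) simp
  also have "\<dots> = (\<integral>\<^sup>+\<omega>. (\<integral>\<^sup>+y. ennreal (cmod (stfl (gauss 0) x (- \<omega>, y))) \<partial>lborel) \<partial>lborel)"
    by (rule lborel_pair.Fubini') measurable
  also have "\<dots> = (\<integral>\<^sup>+\<omega>. (\<integral>\<^sup>+y. ennreal (cmod (stfl (gauss 0) x (\<omega>, y))) \<partial>lborel) \<partial>lborel)"
    using nn_integral_real_affine[of "\<lambda>\<omega>. \<integral>\<^sup>+y. ennreal (cmod (stfl (gauss 0) x (\<omega>, y))) \<partial>lborel" "-1" 0] by simp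
  also have "\<dots> = s0 (gauss 0) x"
    unfolding s0_def by (rule lborel.nn_integral_fst) simp
  finally show ?thesis .
qed

lemma S0_unitary_fourier: "S0_unitary fourier (\<lambda>x. dil (-1) (fourier x))"
proof -
  have m: "(-1::real) \<noteq> 0" by simp
  have inv: "dil (-1) (dil (-1) x) = x" for x using dil_inverse[OF m, of x] by simp
  \<comment> \<open>The reflection is the square of the Fourier operator and inherits the
    invariance.\<close>
  have "s0 (gauss 0) (dil (-1) x) = s0 (gauss 0) x" for x
    using s0_fourier[of "fourier x"] s0_fourier[of x] by (simp add: fourier_fourier)
  then show ?thesis
    unfolding S0_unitary_def
    by (auto simp: fourier_add fourier_cscale fourier_fourier[symmetric] s0_fourier intro!: exI[of _ 1])
      (simp_all add: fourier_fourier inv)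
qed

section \<open>The special affine Fourier transform\<close>

text \<open>Polarisation gives the real inner product; replacing \<open>y\<close> by its multiple by
  \<open>\<i>\<close> gives the imaginary part.\<close>

lemma isometry_inner:
  assumes "\<And>x y. T (x + y) = T x + T y" "\<And>\<alpha> x. T (cscale \<alpha> x) = cscale \<alpha> (T x)" "\<And>x. norm (T x) = norm (x :: l2)"
  shows "bil (T x) (conjl (T y)) = bil x (conjl y)"
proof -
  have inner: "inner (T x) (T y) = inner x y" for x y
    using dot_norm[of "T x" "T y"] dot_norm[of x y] assms(1,3) by (metis)
  show ?thesis
  proof (rule complex_eqI)
    show "Re (bil (T x) (conjl (T y))) = Re (bil x (conjl y))" using inner[of x y] by (simp add: inner_l2_def)
    show "Im (bil (T x) (conjl (T y))) = Im (bil x (conjl y))"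
      using inner[of x "cscale \<i> y"] by (simp add: inner_l2_def assms(2) conjl_cscale bil_cscale_right)
  qed
qed

context
  fixes a b d p q :: real
  assumes b: "b \<noteq> 0"
begin

definition saft_op :: "l2 \<Rightarrow> l2" where
  "saft_op = mulc (pi * d / b) (2 * pi * (b * q - d * p) / b) \<circ> dil b \<circ> fourier \<circ> mulc (pi * a / b) (2 * pi * p / b)"

text \<open>The factors of \<open>saft_op\<close> in reverse order: chirps and the Fourier operator
  are symmetric for \<open>bil\<close>, and \<open>dil b\<close> becomes
  \<open>dil (1 / b)\<close>.\<close>

definition saft_transpose :: "l2 \<Rightarrow> l2" where
  "saft_transpose = mulc (pi * a / b) (2 * pi * p / b) \<circ> fourier \<circ> dil (1 / b) \<circ> mulc (pi * d / b) (2 * pi * (b * q - d * p) / b)"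

lemma S0_unitary_saft: "\<exists>S. S0_unitary saft_op S" "\<exists>S. S0_unitary saft_transpose S"
proof -
  have b': "1 / b \<noteq> 0" using b by simp
  show "\<exists>S. S0_unitary saft_op S"
    unfolding saft_op_def
    by (rule exI) (rule S0_unitary_comp[OF S0_unitary_comp[OF S0_unitary_comp[OF S0_unitary_mulc S0_unitary_dil[OF b]]
        S0_unitary_fourier] S0_unitary_mulc])
  show "\<exists>S. S0_unitary saft_transpose S"
    unfolding saft_transpose_def
    by (rule exI) (rule S0_unitary_comp[OF S0_unitary_comp[OF S0_unitary_comp[OF S0_unitary_mulc S0_unitary_fourier]
        S0_unitary_dil[OF b']] S0_unitary_mulc])
qed

lemma bil_saft: "bil (saft_op y) x = bil y (saft_transpose x)"
  by (simp add: saft_op_def saft_transpose_def bil_mulc bil_dil[OF b] bil_fourier)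

text \<open>The phase of the kernel splits into a part in \<open>t\<close>, a part in
  \<open>\<omega>\<close> and the cross term, which is the Fourier kernel at frequency
  \<open>\<omega> / b\<close>.\<close>

lemma saft_op_cl:
  assumes u: "u \<in> L2_functions" "integrable lborel u"
  shows "saft_integral a b d p q u \<in> L2_functions" "saft_op (cl u) = cl (saft_integral a b d p q u)"
proof -
  let ?\<rho> = "chirp (pi * a / b) (2 * pi * p / b)" and ?\<eta> = "chirp (pi * d / b) (2 * pi * (b * q - d * p) / b)"
  let ?v = "\<lambda>t. ?\<rho> t * u t"
  have v: "?v \<in> L2_functions" "integrable lborel ?v"
    using chirp_L2[OF u(1)] integrable_mult_bounded[OF u(2) chirp_measurable, of _ _ 1] by (simp_all add: mult.commute)
  note F = fourier_cl[OF v]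
  have eq: "saft_integral a b d p q u = (\<lambda>\<omega>. ?\<eta> \<omega> * (of_real (1 / sqrt \<bar>b\<bar>) * ft ?v (\<omega> / b)))"
  proof
    fix \<omega>
    have "ft ?v (\<omega> / b) * ?\<eta> \<omega> = (\<integral>t. u t * cis (pi / b * (a * t\<^sup>2 + 2 * p * t - 2 * \<omega> * t
                               + 2 * (b * q - d * p) * \<omega> + d * \<omega>\<^sup>2)) \<partial>lborel)"
      unfolding ft_def integral_mult_left_zero[symmetric]
    proof (intro Bochner_Integration.integral_cong refl)
      fix t
      have "?\<rho> t * cis (- 2 * pi * (\<omega> / b) * t) * ?\<eta> \<omega> = cis (pi / b * (a * t\<^sup>2 + 2 * p * t - 2 * \<omega> * t
                               + 2 * (b * q - d * p) * \<omega> + d * \<omega>\<^sup>2))"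
        unfolding chirp_def cis_mult using b by (intro arg_cong[where f = cis]) (simp add: field_simps)
      then show "?\<rho> t * u t * cis (- 2 * pi * (\<omega> / b) * t) * ?\<eta> \<omega> = u t * cis (pi / b * (a * t\<^sup>2 + 2 * p * t - 2 * \<omega> * t
                               + 2 * (b * q - d * p) * \<omega> + d * \<omega>\<^sup>2))"
        by (simp only: mult_ac)
    qed
    then show "saft_integral a b d p q u \<omega> = ?\<eta> \<omega> * (of_real (1 / sqrt \<bar>b\<bar>) * ft ?v (\<omega> / b))"
      unfolding saft_integral_def by (simp add: mult_ac)
  qed
  show "saft_integral a b d p q u \<in> L2_functions" unfolding eq by (rule chirp_L2[OF dil_L2[OF F(1) b]])
  show "saft_op (cl u) = cl (saft_integral a b d p q u)"
    unfolding eq saft_op_def comp_def mulc_cl[OF u(1)] F(2) dil_cl[OF F(1) b] by (rule mulc_cl[OF dil_L2[OF F(1) b]])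
qed

text \<open>\<open>saft\<close> is a definite description. Any operator that fits it agrees with
  \<open>saft_op\<close> on a dense class of integrable functions, and both are continuous
  isometries.\<close>

lemma saft_Rep: "saft a b d p q (Rep_l2 x) = Rep_l2 (saft_op x)"
proof -
  obtain S where S: "S0_unitary saft_op S" using S0_unitary_saft(1) by blast
  note D = S0_unitaryD[OF S]
  \<comment> \<open>\<open>undefined\<close> off the carrier is the value that
    \<open>extensional\<close> prescribes; it makes the described operator unique as a total
    function.\<close>
  define F0 where "F0 = (\<lambda>U. if U \<in> vcarrier L2_space then Rep_l2 (saft_op (Abs_l2 U)) else undefined)"
  have F0: "F0 (Rep_l2 x) = Rep_l2 (saft_op x)" for x by (simp add: F0_def L2_space_Rep(1) Rep_l2_inverse)
  have "saft a b d p q = F0"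
    unfolding saft_def
  proof (rule the_equality)
    have "bij_betw F0 (range Rep_l2) (range Rep_l2)"
    proof (rule bij_betwI)
      show "F0 \<in> range Rep_l2 \<rightarrow> range Rep_l2" by (auto simp: F0)
      show "(\<lambda>U. Rep_l2 (S (Abs_l2 U))) \<in> range Rep_l2 \<rightarrow> range Rep_l2" by auto
      show "Rep_l2 (S (Abs_l2 (F0 U))) = U" if "U \<in> range Rep_l2" for U using that by (auto simp: F0 Rep_l2_inverse D)
      show "F0 (Rep_l2 (S (Abs_l2 U))) = U" if "U \<in> range Rep_l2" for U using that by (auto simp: F0 Rep_l2_inverse D)
    qed
    moreover have "clinear_between L2_space L2_space F0"
      unfolding clinear_between_def L2_space_Rep(1) by (auto simp: L2_space_Rep F0 D)
    moreover have "\<forall>U\<in>vcarrier L2_space. \<forall>V\<in>vcarrier L2_space. vinner L2_space (F0 U) (F0 V) = vinner L2_space U V"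
      unfolding L2_space_Rep(1) using isometry_inner[of saft_op, OF D(1,2,3)] by (auto simp: L2_space_Rep F0)
    ultimately have "unitary_operator L2_space L2_space F0"
      unfolding unitary_operator_def L2_space_Rep(1) by blast
    moreover have "F0 (L2_class u) = L2_class (saft_integral a b d p q u)" if "u \<in> L2_functions" "integrable lborel u" for u
      using F0[of "cl u"] saft_op_cl[OF that] by (simp add: Rep_cl that)
    ultimately show "F0 \<in> extensional (vcarrier L2_space) \<and> unitary_operator L2_space L2_space F0 \<and>
        (\<forall>u\<in>L2_functions. integrable lborel u \<longrightarrow> F0 (L2_class u) = L2_class (saft_integral a b d p q u))"
      by (auto simp: F0_def extensional_def)
  next
    fix F assume F: "F \<in> extensional (vcarrier L2_space) \<and> unitary_operator L2_space L2_space F \<and>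
        (\<forall>u\<in>L2_functions. integrable lborel u \<longrightarrow> F (L2_class u) = L2_class (saft_integral a b d p q u))"
    then have uF: "clinear_between L2_space L2_space F"
      "\<And>U. U \<in> vcarrier L2_space \<Longrightarrow> vinner L2_space (F U) (F U) = vinner L2_space U U"
      unfolding unitary_operator_def by blast+
    define T where "T x = Abs_l2 (F (Rep_l2 x))" for x
    have T: "F (Rep_l2 x) = Rep_l2 (T x)" for x
    proof -
      have "F (Rep_l2 x) \<in> vcarrier L2_space" by (rule clinear_betweenD[OF uF(1)]) (simp add: L2_space_Rep(1))
      then obtain y where "F (Rep_l2 x) = Rep_l2 y" by (auto simp: L2_space_Rep(1))
      then show ?thesis by (simp add: T_def Rep_l2_inverse)
    qed
    have Tadd: "T (x + y) = T x + T y" for x y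
    proof -
      have "F (vadd L2_space (Rep_l2 x) (Rep_l2 y)) = vadd L2_space (F (Rep_l2 x)) (F (Rep_l2 y))"
        using uF(1) unfolding clinear_between_def L2_space_Rep(1) by blast
      then show ?thesis by (simp add: T L2_space_Rep Rep_l2_inject)
    qed
    have Tnorm: "norm (T x) = norm x" for x
    proof -
      have "bil (T x) (conjl (T x)) = bil x (conjl x)" using uF(2)[of "Rep_l2 x"] by (simp add: T L2_space_Rep)
      then have "(norm (T x))\<^sup>2 = (norm x)\<^sup>2" unfolding bil_conjl_self by (simp only: of_real_eq_iff)
      then show ?thesis by simp
    qed
    have Tcl: "T (cl u) = saft_op (cl u)" if u: "u \<in> C2_decay" for u
    proof -
      note up = C2_decay_props(3,2)[OF u]
      have "Rep_l2 (T (cl u)) = L2_class (saft_integral a b d p q u)"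
        using F up T[of "cl u"] by (simp add: Rep_cl)
      also have "\<dots> = Rep_l2 (saft_op (cl u))" using saft_op_cl[OF up] by (simp add: Rep_cl)
      finally show ?thesis by (simp only: Rep_l2_inject)
    qed
    have "T x = saft_op x" for x
    proof -
      have "x \<in> closure (cl ` C2_decay)" by (simp add: dense_C2)
      then obtain X where X: "\<And>n. X n \<in> cl ` C2_decay" "X \<longlonglongrightarrow> x" unfolding closure_sequential by blast
      have lim: "(\<lambda>n. R (X n)) \<longlonglongrightarrow> R x" if R: "\<And>x y. R (x + y) = R x + R y" "\<And>x. norm (R x) = norm x" for R :: "l2 \<Rightarrow> l2"
      proof -
        have "R (X n) - R x = R (X n - x)" for n using R(1)[of "X n - x" x] by simp
        then have "norm (R (X n) - R x) = norm (X n - x)" for n by (simp add: R(2))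
        then show ?thesis using X(2) by (simp add: tendsto_iff dist_norm)
      qed
      have eq: "T (X n) = saft_op (X n)" for n using X(1)[of n] Tcl by auto
      have "(\<lambda>n. saft_op (X n)) \<longlonglongrightarrow> T x" using lim[of T, OF Tadd Tnorm] unfolding eq .
      then show ?thesis using lim[of saft_op, OF D(1,3)] by (rule LIMSEQ_unique)
    qed
    then have on: "F U = F0 U" if "U \<in> vcarrier L2_space" for U
      using that by (auto simp: L2_space_Rep(1) T F0)
    show "F = F0"
    proof
      fix U show "F U = F0 U"
        using on F by (cases "U \<in> vcarrier L2_space") (auto simp: F0_def extensional_def)
    qed
  qed
  then show ?thesis by (simp add: F0)
qed

end

theorem theorem4p10:
  fixes a b c d p q :: real and g :: "real \<Rightarrow> complex"
  assumes "a * d - b * c = 1" and "b \<noteq> 0"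
    and "g \<in> schwartz_space" and "g \<noteq> (\<lambda>t. 0)"
  shows "gelfand_triple_automorphism (S0_triple g) (saft a b d p q)
    \<and> (gelfand_triple_automorphism (S0_triple g) (mult_operator (lambda_chirp a b))
      \<and> gelfand_triple_automorphism (S0_triple g) (mult_operator (rho_chirp a b p))
      \<and> gelfand_triple_automorphism (S0_triple g) (mult_operator (eta_chirp b d p q)))"
proof -
  interpret schwartz_window g by unfold_locales fact+
  obtain S S' where S: "S0_unitary (saft_op a b d p q) S" "S0_unitary (saft_transpose a b d p q) S'"
    using S0_unitary_saft[OF assms(2)] by blast
  have "gelfand_triple_automorphism (S0_triple g) (saft a b d p q)"
    by (rule S0_triple_automorphismI[OF S bil_saft[OF assms(2)] saft_Rep[OF assms(2)]])
  moreover have "lambda_chirp a b = chirp (pi * a / b) 0" "rho_chirp a b p = chirp (pi * a / b) (2 * pi * p / b)"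
    "eta_chirp b d p q = chirp (pi * d / b) (2 * pi * (b * q - d * p) / b)"
    using assms(2) by (auto simp: fun_eq_iff lambda_chirp_def rho_chirp_def eta_chirp_def chirp_def
        intro!: arg_cong[where f = cis]) (simp_all add: field_simps)
  ultimately show ?thesis by (simp add: mult_operator_automorphism)
qed

end
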